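(* Let $d\ge1$, $p\in[1,\infty)$ and $\frac1p+\frac1{p'}=1$. There are constants $c,C>0$, depending only on $d$, $p$ and the wavelet system, such that the following holds. Let $f,g$ be two probability densities in $L_p([0,1]^d)$ and suppose that $M\ge f(x)\vee g(x)\ge m>0$ for almost every $x\in[0,1]^d$, where $f(x)\vee g(x)=\max\{f(x),g(x)\}$. Then $$c\,M^{-1/p'}\,\|f-g\|_{\mathcal B^{-1}_{p,\infty}}\ \le\ W_p(f,g)\ \le\ C\,m^{-1/p'}\,\|f-g\|_{\mathcal B^{-1}_{p,1}}.$$
   Context: $\Omega=[0,1]^d$. $W_p(f,g)$ denotes the $p$-Wasserstein distance between the probability measures $\mu,\nu$ on $\Omega$ with densities $f,g$: $W_p^p(\mu,\nu)=\inf_\pi\int\|x-y\|^p\,d\pi(x,y)$ over couplings $\pi$ of $\mu$ and $\nu$, with $\|\cdot\|$ the Euclidean norm. When $p=1$, $1/p'=0$. Wavelet system. Fix sets $\Phi$ and $\Psi_j$ ($j\ge0$) of functions in $L_2(\Omega)$, of regularity $r>1$, such that, with constants depending only on the system: (i) $\Phi\cup\bigcup_{j\ge0}\Psi_j$ is an orthonormal basis of $L_2(\Omega)$; (ii) all these functions lie in $C^r(\Omega)$, and polynomials of degree at most $r$ on $\Omega$ lie in $\mathrm{span}(\Phi)$; (iii) each $\psi\in\Psi_j$ has the form $\psi(x)=\prod_{i=1}^d\psi_i(x_i)$ with univariate $\psi_i$; (iv) for each $\psi\in\Psi_j$ there is a rectangle $I_\psi\subseteq\Omega$ with $\mathrm{supp}(\psi)\subseteq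 I_\psi$, $\mathrm{diam}(I_\psi)\lesssim 2^{-j}$, and $\|\sum_{\psi\in\Psi_j}\mathbf 1\{x\in I_\psi\}\|_{L_\infty}\lesssim1$; (v) $\|\psi\|_{L_t(\Omega)}\asymp2^{dj(\frac12-\frac1t)}$ for all $\psi\in\Psi_j$ and $t\in[1,\infty]$; (vi) $\|\nabla u\|_{L_t(\Omega)}\lesssim 2^j\|u\|_{L_t(\Omega)}$ for $u\in\mathrm{span}(\Phi\cup\bigcup_{0\le k<j}\Psi_k)$. Consequently $|\Phi|\lesssim1$ and $|\Psi_j|\lesssim2^{dj}$. Besov norm. For a function $h$ put $\alpha=(\int h\phi)_{\phi\in\Phi}$ and $\beta_j=(\int h\psi)_{\psi\in\Psi_j}$; for $s\in\mathbb R$ and $q\in[1,\infty]$, $$\|h\|_{\mathcal B^s_{p,q}}=\|\alpha\|_{\ell_p}+\Big\|\big(2^{js}2^{dj(\frac12-\frac1p)}\|\beta_j\|_{\ell_p}\big)_{j\ge0}\Big\|_{\ell_q}.$$ *)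

theory Defs
  imports "HOL-Probability.Probability"
begin

section \<open>Norms\<close>

text \<open>Real powers on \<open>[0, \<infinity>]\<close>, for exponents \<open>a > 0\<close> (where \<open>\<infinity>\<close> is mapped to \<open>\<infinity>\<close>).\<close>

definition epowr :: "ennreal \<Rightarrow> real \<Rightarrow> ennreal" where
  "epowr x a = (if x = \<infinity> then \<infinity> else ennreal (enn2real x powr a))"

definition eL_norm :: "ennreal \<Rightarrow> 'a measure \<Rightarrow> ('a \<Rightarrow> ennreal) \<Rightarrow> ennreal" where
  "eL_norm t M F =
     (if t = \<infinity> then esssup M F
      else epowr (\<integral>\<^sup>+ x. epowr (F x) (enn2real t) \<partial>M) (1 / enn2real t))"

text \<open>With \<open>M = count_space A\<close> this is the \<open>\<ell>\<^sub>t\<close> norm of a family indexed by \<open>A\<close>.\<close>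

definition L_norm :: "ennreal \<Rightarrow> 'a measure \<Rightarrow> ('a \<Rightarrow> 'b::real_normed_vector) \<Rightarrow> ennreal" where
  "L_norm t M f = eL_norm t M (\<lambda>x. ennreal (norm (f x)))"

definition L_space :: "ennreal \<Rightarrow> 'a measure \<Rightarrow> ('a \<Rightarrow> real) set" where
  "L_space t M = {f \<in> borel_measurable M. L_norm t M f < \<infinity>}"

section \<open>Wasserstein distance\<close>

definition couplings :: "'a measure \<Rightarrow> 'a measure \<Rightarrow> ('a \<times> 'a) measure set" where
  "couplings \<mu> \<nu> =
     {\<pi>. sets \<pi> = sets (\<mu> \<Otimes>\<^sub>M \<nu>) \<and> distr \<pi> \<mu> fst = \<mu> \<and> distr \<pi> \<nu> snd = \<nu>}"

definition wasserstein :: "real \<Rightarrow> 'a::metric_space measure \<Rightarrow> 'a measure \<Rightarrow> ennreal" where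
  "wasserstein p \<mu> \<nu> =
     epowr (INF \<pi>\<in>couplings \<mu> \<nu>. \<integral>\<^sup>+ z. ennreal (dist (fst z) (snd z) powr p) \<partial>\<pi>) (1 / p)"

section \<open>The unit cube and functions on it\<close>

text \<open>The dimension is \<open>CARD('n)\<close>. A function on the cube is represented by a function on the
  whole space, of which only the values on the cube matter.\<close>

abbreviation cube :: "(real ^ 'n) set" where
  "cube \<equiv> cbox 0 1"

abbreviation cube_measure :: "(real ^ 'n) measure" where
  "cube_measure \<equiv> restrict_space lborel cube"

definition prob_density :: "(real ^ 'n \<Rightarrow> real) \<Rightarrow> bool" where
  "prob_density f \<longleftrightarrow>
     f \<in> borel_measurable cube_measure \<and> (AE x in cube_measure. 0 \<le> f x) \<and>
     (\<integral>\<^sup>+ x. ennreal (f x) \<partial>cube_measure) = 1"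

definition density_wasserstein ::
    "real \<Rightarrow> (real ^ 'n \<Rightarrow> real) \<Rightarrow> (real ^ 'n \<Rightarrow> real) \<Rightarrow> ennreal" where
  "density_wasserstein p f g =
     wasserstein p (density cube_measure (\<lambda>x. ennreal (f x)))
                   (density cube_measure (\<lambda>x. ennreal (g x)))"

text \<open>\<open>holder_space k a\<close>: all partial derivatives up to order \<open>k\<close> exist and are continuous on the
  closed cube (one-sided on its boundary), those of order \<open>k\<close> being \<open>a\<close>-Hoelder. For \<open>a = 0\<close> the
  Hoelder condition says only that they are bounded, so that this is the classical \<open>C\<^sup>k\<close>.\<close>

primrec holder_space :: "nat \<Rightarrow> real \<Rightarrow> (real ^ 'n \<Rightarrow> real) set" where
  "holder_space 0 a =
     {u. continuous_on cube u \<and>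
         (\<exists>L. \<forall>x\<in>cube. \<forall>y\<in>cube. \<bar>u x - u y\<bar> \<le> L * dist x y powr a)}"
| "holder_space (Suc k) a =
     {u. \<exists>D. (\<forall>i. D i \<in> holder_space k a) \<and>
             (\<forall>x\<in>cube. (u has_derivative (\<lambda>h. \<Sum>i\<in>UNIV. D i x * h $ i)) (at x within cube))}"

definition C_space :: "real \<Rightarrow> (real ^ 'n \<Rightarrow> real) set" where
  "C_space r = holder_space (nat \<lfloor>r\<rfloor>) (frac r)"

definition gradient :: "(real ^ 'n \<Rightarrow> real) \<Rightarrow> real ^ 'n \<Rightarrow> real ^ 'n" where
  "gradient u x = (\<chi> i. frechet_derivative u (at x within cube) (axis i 1))"

section \<open>Linear combinations and orthonormal bases\<close>

definition fun_span :: "('a \<Rightarrow> real) set \<Rightarrow> ('a \<Rightarrow> real) set" where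
  "fun_span B = {u. \<exists>S c. finite S \<and> S \<subseteq> B \<and> u = (\<lambda>x. \<Sum>\<phi>\<in>S. c \<phi> * \<phi> x)}"

definition polys_deg_le :: "real \<Rightarrow> (real ^ 'n \<Rightarrow> real) set" where
  "polys_deg_le r =
     fun_span {\<lambda>x. \<Prod>i\<in>UNIV. x $ i ^ k i | k. real (\<Sum>i\<in>UNIV. k i) \<le> r}"

definition orthonormal_basis_L2 :: "'a measure \<Rightarrow> ('a \<Rightarrow> real) set \<Rightarrow> bool" where
  "orthonormal_basis_L2 M B \<longleftrightarrow>
     B \<subseteq> L_space 2 M \<and>
     (\<forall>\<phi>\<in>B. \<forall>\<psi>\<in>B. (\<integral>x. \<phi> x * \<psi> x \<partial>M) = (if \<phi> = \<psi> then 1 else 0)) \<and>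
     (\<forall>h\<in>L_space 2 M. \<forall>e>0. \<exists>u\<in>fun_span B. L_norm 2 M (\<lambda>x. h x - u x) < ennreal e)"

section \<open>Wavelet systems and Besov norms\<close>

text \<open>Finiteness of \<open>\<Phi>\<close> and of the \<open>\<Psi> j\<close> is not assumed: it follows from the other conditions.
  In the last two conditions the constants are uniform in the integrability exponent \<open>t\<close>.\<close>

locale wavelet_system =
  fixes r :: real
    and \<Phi> :: "(real ^ 'n \<Rightarrow> real) set"
    and \<Psi> :: "nat \<Rightarrow> (real ^ 'n \<Rightarrow> real) set"
  assumes regularity: "r > 1"
    and orthonormal_basis: "orthonormal_basis_L2 cube_measure (\<Phi> \<union> (\<Union>j. \<Psi> j))"
    and smooth: "\<Phi> \<union> (\<Union>j. \<Psi> j) \<subseteq> C_space r"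
    and polynomials: "\<forall>P\<in>polys_deg_le r. \<exists>u\<in>fun_span \<Phi>. \<forall>x\<in>cube. u x = P x"
    and tensor_product:
      "\<forall>j. \<forall>\<psi>\<in>\<Psi> j. \<exists>\<psi>1 :: 'n \<Rightarrow> real \<Rightarrow> real. \<forall>x\<in>cube. \<psi> x = (\<Prod>i\<in>UNIV. \<psi>1 i (x $ i))"
    and localized:
      "\<exists>(I :: nat \<Rightarrow> (real ^ 'n \<Rightarrow> real) \<Rightarrow> (real ^ 'n) set) K :: real. \<forall>j.
         (\<forall>\<psi>\<in>\<Psi> j. (\<exists>a b. I j \<psi> = cbox a b) \<and> I j \<psi> \<subseteq> cube \<and>
            closure {x \<in> cube. \<psi> x \<noteq> 0} \<subseteq> I j \<psi> \<and>
            diameter (I j \<psi>) \<le> K * 2 powr (- real j)) \<and>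
         eL_norm \<infinity> cube_measure
           (\<lambda>x. \<integral>\<^sup>+ \<psi>. indicator (I j \<psi>) x \<partial>count_space (\<Psi> j)) \<le> ennreal K"
    and normalized:
      "\<exists>c>0. \<exists>C>0. \<forall>j. \<forall>\<psi>\<in>\<Psi> j. \<forall>t\<ge>1.
         (let w = 2 powr (real CARD('n) * real j * (1 / 2 - enn2real (1 / t)))
          in ennreal (c * w) \<le> L_norm t cube_measure \<psi> \<and>
             L_norm t cube_measure \<psi> \<le> ennreal (C * w))"
    and bernstein:
      "\<exists>C>0. \<forall>j. \<forall>u\<in>fun_span (\<Phi> \<union> (\<Union>k<j. \<Psi> k)). \<forall>t\<ge>1.
         L_norm t cube_measure (gradient u) \<le> ennreal (C * 2 ^ j) * L_norm t cube_measure u"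

definition wavelet_coeff :: "(real ^ 'n \<Rightarrow> real) \<Rightarrow> (real ^ 'n \<Rightarrow> real) \<Rightarrow> real" where
  "wavelet_coeff h \<phi> = (\<integral>x. h x * \<phi> x \<partial>cube_measure)"

definition besov_norm ::
    "(real ^ 'n \<Rightarrow> real) set \<Rightarrow> (nat \<Rightarrow> (real ^ 'n \<Rightarrow> real) set) \<Rightarrow>
     real \<Rightarrow> ennreal \<Rightarrow> ennreal \<Rightarrow> (real ^ 'n \<Rightarrow> real) \<Rightarrow> ennreal" where
  "besov_norm \<Phi> \<Psi> s p q h =
     L_norm p (count_space \<Phi>) (wavelet_coeff h) +
     eL_norm q (count_space UNIV)
       (\<lambda>j. ennreal (2 powr (real j * s) *
               2 powr (real CARD('n) * real j * (1 / 2 - enn2real (1 / p)))) *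
            L_norm p (count_space (\<Psi> j)) (wavelet_coeff h))"

end

theory Submission
  imports Defs
begin

text \<open>
  Lower bound: for any coupling \<open>\<pi>\<close>, each coefficient of \<open>f - g\<close> is the integral of \<open>\<psi> x - \<psi> y\<close>, which is
  at most \<open>2\<^sup>j 2\<^bsup>dj/2\<^esup> \<bar>x - y\<bar>\<close> and vanishes unless \<open>x\<close> or \<open>y\<close> lies in the small rectangle of \<open>\<psi>\<close>, a set
  of mass \<open>O(M 2\<^bsup>-dj\<^esup>)\<close>. Testing against \<open>sgn \<beta> \<bar>\<beta>\<bar>\<^bsup>p-1\<^esup>\<close> and using Young's inequality bounds the
  \<open>\<ell>\<^sub>p\<close> norm of each level by the transport cost.

  Upper bound: a function of mean zero supported in a rectangle is a sum of functions with vanishing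
  integrals along lines in one coordinate direction. Adding such a function to a density bounded below
  by \<open>a\<close> is realised by the monotone rearrangement on each line, at cost at most \<open>a\<^bsup>-(1-1/p)\<^esup>\<close> times
  the \<open>L\<^sub>p\<close> norm of its line primitive. Moving in many small steps along the segment from \<open>f\<close> to \<open>g\<close>, with
  dyadic times towards both ends because only \<open>max f g\<close> is bounded below, the costs sum to the Besov
  norm; the truncation error of the wavelet expansion and the two ends of the segment are moved by
  couplings that are cheap in total variation.
\<close>

section \<open>Composing transports\<close>

text \<open>Chaining couplings would normally mean gluing them along a common marginal, hence
  disintegration. It is replaced by steps given by explicit random maps: such a step extends every
  coupling that ends in its source, and costs add by Minkowski's inequality. The line primitives are
  the components of a vector field whose divergence is the function to be added, so the upper bound
  is a discretised continuity equation; using one coordinate at a time makes every velocity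
  one-dimensional. The negative smoothness comes from integrating once across a box of side
  O(2^(-j)). A step of length \<theta> at distance \<theta> from both ends costs a multiple of
  \<theta>^(1/p), which is summable over dyadic \<theta> because p is finite. A truncated expansion
  of g - f, added to f, need not stay nonnegative; this forces the remainder into the endpoints
  before interpolating, and the remainder has to be small in L1 only. In the lower bound Young's
  inequality has the form b^(p-1) t <= t^p + b^p, which includes p = 1 on equal terms.\<close>

definition transport ::
    "real \<Rightarrow> real \<Rightarrow> 'a::metric_space measure \<Rightarrow> 'a measure \<Rightarrow> bool" where
  "transport p w \<mu> \<nu> \<longleftrightarrow>
     (\<exists>\<pi>\<in>couplings \<mu> \<nu>. (\<integral>\<^sup>+ z. ennreal (dist (fst z) (snd z) powr p) \<partial>\<pi>) \<le> ennreal (w powr p))"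

text \<open>Quantifying over all couplings that end in \<open>\<mu>\<close> makes composition
  immediate. The incoming bound \<open>w0\<close> is strictly positive because it becomes a convex
  weight in \<open>minkowski_powr\<close>.\<close>

definition move ::
    "real \<Rightarrow> real \<Rightarrow> 'a::metric_space measure \<Rightarrow> 'a measure \<Rightarrow> bool" where
  "move p w \<mu> \<nu> \<longleftrightarrow>
     (\<forall>\<mu>0 w0. prob_space \<mu>0 \<longrightarrow> (\<lambda>x. x) \<in> borel_measurable \<mu>0 \<longrightarrow> 0 < w0 \<longrightarrow> transport p w0 \<mu>0 \<mu> \<longrightarrow> transport p (w0 + w) \<mu>0 \<nu>)"

lemma move_trans:
  assumes "move p v \<mu> \<nu>" "move p w \<nu> \<rho>" "0 \<le> v"
  shows "move p (v + w) \<mu> \<rho>"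
  using assms unfolding move_def by (metis add.assoc add_pos_nonneg)

lemma transport_mono:
  assumes "transport p v \<mu> \<nu>" "0 \<le> v" "v \<le> w" "0 \<le> p"
  shows "transport p w \<mu> \<nu>"
  using assms unfolding transport_def
  by (meson ennreal_leI order_trans powr_mono2)

lemma move_mono:
  assumes "move p v \<mu> \<nu>" "0 \<le> v" "v \<le> w" "0 \<le> p"
  shows "move p w \<mu> \<nu>"
  using assms unfolding move_def
  by (meson add_left_mono add_nonneg_nonneg less_imp_le transport_mono)

lemma move_refl: "0 \<le> w \<Longrightarrow> 0 \<le> p \<Longrightarrow> move p w \<mu> \<mu>"
  unfolding move_def by (auto intro: transport_mono)

lemma move_chain:
  assumes "\<And>k. k < n \<Longrightarrow> move p (w k) (\<rho> k) (\<rho> (Suc k))" "\<And>k. k < n \<Longrightarrow> 0 \<le> w k" "0 \<le> p"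
  shows "move p (\<Sum>k<n. w k) (\<rho> 0) (\<rho> n)"
  using assms
proof (induction n)
  case 0
  then show ?case by (simp add: move_refl)
next
  case (Suc n)
  have "move p (\<Sum>k<n. w k) (\<rho> 0) (\<rho> n)"
    using Suc by auto
  then have "move p ((\<Sum>k<n. w k) + w n) (\<rho> 0) (\<rho> (Suc n))"
    using Suc.prems by (intro move_trans) (auto intro!: sum_nonneg)
  then show ?case by simp
qed

text \<open>Convexity on the open half-line is extended to zero arguments, where it reduces to
  \<open>t powr p \<le> t\<close> for \<open>t\<close> in \<open>[0, 1]\<close>.\<close>

lemma powr_convex_combination:
  fixes x y l p :: real
  assumes p: "1 \<le> p" and l: "0 \<le> l" "l \<le> 1" and xy: "0 \<le> x" "0 \<le> y"
  shows "(l * x + (1 - l) * y) powr p \<le> l * x powr p + (1 - l) * y powr p"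
proof -
  have scale: "(t * z) powr p \<le> t * z powr p" if "0 \<le> t" "t \<le> 1" "0 \<le> z" for t z :: real
  proof -
    have "t powr p \<le> t powr 1"
      using that p powr_mono'[of 1 p t] by simp
    then show ?thesis
      using that by (simp add: powr_mult mult_right_mono)
  qed
  consider "x = 0" | "y = 0" | "0 < x" "0 < y"
    using xy by linarith
  then show ?thesis
  proof cases
    case 1
    then show ?thesis using scale[of "1 - l" y] l xy p by simp
  next
    case 2
    then show ?thesis using scale[of l x] l xy p by simp
  next
    case 3
    then show ?thesis
      using convex_onD[OF powr_convex[OF p], of "1 - l" x y] l by simp
  qed
qed

text \<open>With \<open>l = a / (a + b)\<close> the sum \<open>u + v\<close> is \<open>a + b\<close>
  times the convex combination of \<open>u / a\<close> and \<open>v / b\<close>, so convexity of the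
  power does the work of Hoelder's inequality. The numbers \<open>a\<close> and \<open>b\<close> are
  upper bounds of the norms and may be enlarged to be positive.\<close>

lemma minkowski_powr:
  fixes u v :: "'a \<Rightarrow> real"
  assumes p: "1 \<le> p" and ab: "0 < a" "0 < b"
    and [measurable]: "u \<in> borel_measurable M" "v \<in> borel_measurable M"
    and nn: "\<And>x. 0 \<le> u x" "\<And>x. 0 \<le> v x"
    and U: "(\<integral>\<^sup>+ x. ennreal (u x powr p) \<partial>M) \<le> ennreal (a powr p)"
    and V: "(\<integral>\<^sup>+ x. ennreal (v x powr p) \<partial>M) \<le> ennreal (b powr p)"
  shows "(\<integral>\<^sup>+ x. ennreal ((u x + v x) powr p) \<partial>M) \<le> ennreal ((a + b) powr p)"
proof -
  define l where "l = a / (a + b)"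
  have l: "0 \<le> l" "0 \<le> 1 - l" "1 - l = b / (a + b)"
    using ab by (auto simp: l_def field_simps)
  then have l1: "l \<le> 1" by simp
  have pt: "(u x + v x) powr p \<le>
      (a + b) powr p * (l * a powr (-p) * u x powr p + (1 - l) * b powr (-p) * v x powr p)" for x
  proof -
    have eq: "u x + v x = (a + b) * (l * (u x / a) + (1 - l) * (v x / b))"
    proof -
      have "(a + b) * l = a" "(a + b) * (1 - l) = b"
        using ab l by (auto simp: l_def)
      then show ?thesis
        using ab by (simp add: distrib_left flip: mult.assoc)
    qed
    have "(l * (u x / a) + (1 - l) * (v x / b)) powr p \<le> l * (u x / a) powr p + (1 - l) * (v x / b) powr p"
      using powr_convex_combination[OF p l(1) l1, of "u x / a" "v x / b"] l nn ab by simp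
    moreover have "(u x / a) powr p = a powr (-p) * u x powr p" "(v x / b) powr p = b powr (-p) * v x powr p"
      using ab nn by (auto simp: powr_divide powr_minus field_simps)
    ultimately have "(l * (u x / a) + (1 - l) * (v x / b)) powr p \<le>
        l * a powr (-p) * u x powr p + (1 - l) * b powr (-p) * v x powr p"
      by (simp add: mult.assoc)
    moreover have "0 \<le> l * (u x / a) + (1 - l) * (v x / b)"
      using l l1 ab nn by simp
    ultimately show ?thesis
      unfolding eq using ab by (subst powr_mult) (auto intro: mult_left_mono)
  qed
  define A where "A = (a + b) powr p * (l * a powr (-p))"
  define B where "B = (a + b) powr p * ((1 - l) * b powr (-p))"
  have AB: "0 \<le> A" "0 \<le> B"
    using l(1,2) unfolding A_def B_def by (metis mult_nonneg_nonneg powr_ge_zero)+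
  have "(u x + v x) powr p \<le> A * u x powr p + B * v x powr p" for x
    using pt[of x] by (simp add: A_def B_def algebra_simps)
  then have "(\<integral>\<^sup>+ x. ennreal ((u x + v x) powr p) \<partial>M) \<le>
     (\<integral>\<^sup>+ x. ennreal A * ennreal (u x powr p) + ennreal B * ennreal (v x powr p) \<partial>M)"
    using AB by (intro nn_integral_mono) (simp flip: ennreal_mult ennreal_plus)
  also have "\<dots> = ennreal A * (\<integral>\<^sup>+ x. ennreal (u x powr p) \<partial>M) + ennreal B * (\<integral>\<^sup>+ x. ennreal (v x powr p) \<partial>M)"
    by (simp add: nn_integral_add nn_integral_cmult)
  also have "\<dots> \<le> ennreal A * ennreal (a powr p) + ennreal B * ennreal (b powr p)"
    using U V by (intro add_mono mult_left_mono) auto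
  also have "\<dots> = ennreal (A * a powr p + B * b powr p)"
    using AB by (simp flip: ennreal_mult ennreal_plus)
  also have "A * a powr p + B * b powr p = (a + b) powr p"
  proof -
    have "a powr (-p) * a powr p = 1" "b powr (-p) * b powr p = 1"
      using ab by (auto simp flip: powr_add)
    then have "A * a powr p = (a + b) powr p * l" "B * b powr p = (a + b) powr p * (1 - l)"
      unfolding A_def B_def by (simp_all add: mult.assoc)
    then show ?thesis by (simp add: algebra_simps)
  qed
  finally show ?thesis .
qed

text \<open>Gluing without disintegration: the step from \<open>\<mu>\<close> to
  \<open>\<nu>\<close> is a map of the current point and of an independent random argument with law
  \<open>P\<close>, so a coupling \<open>\<pi>\<close> ending in \<open>\<mu>\<close> is extended by
  the image of \<open>\<pi> \<Otimes>\<^sub>M P\<close>.\<close>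

lemma move_kernel:
  fixes T :: "'a::{metric_space,second_countable_topology} \<Rightarrow> 'b \<Rightarrow> 'a"
  assumes p: "1 \<le> p" and w: "0 < w"
    and P: "prob_space P" and fin: "finite_measure \<mu>"
    and bor [measurable]: "(\<lambda>x. x) \<in> borel_measurable \<mu>"
    and T [measurable]: "(\<lambda>z. T (fst z) (snd z)) \<in> \<mu> \<Otimes>\<^sub>M P \<rightarrow>\<^sub>M \<nu>"
    and push: "distr (\<mu> \<Otimes>\<^sub>M P) \<nu> (\<lambda>z. T (fst z) (snd z)) = \<nu>"
    and sets_eq [measurable_cong]: "sets \<nu> = sets \<mu>"
    and cost: "(\<integral>\<^sup>+ z. ennreal (dist (fst z) (T (fst z) (snd z)) powr p) \<partial>(\<mu> \<Otimes>\<^sub>M P)) \<le> ennreal (w powr p)"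
  shows "move p w \<mu> \<nu>"
  unfolding move_def
proof (intro allI impI)
  fix \<mu>0 :: "'a measure" and w0 :: real
  assume "prob_space \<mu>0" and [measurable]: "(\<lambda>x. x) \<in> borel_measurable \<mu>0" and w0: "0 < w0" and "transport p w0 \<mu>0 \<mu>"
  then obtain \<pi> where \<pi>: "\<pi> \<in> couplings \<mu>0 \<mu>"
    and c0: "(\<integral>\<^sup>+ z. ennreal (dist (fst z) (snd z) powr p) \<partial>\<pi>) \<le> ennreal (w0 powr p)"
    unfolding transport_def by auto
  interpret P: prob_space P by fact
  interpret \<mu>0: prob_space \<mu>0 by fact
  interpret \<mu>: finite_measure \<mu> by fact
  have sp[measurable_cong]: "sets \<pi> = sets (\<mu>0 \<Otimes>\<^sub>M \<mu>)"
    and d1: "distr \<pi> \<mu>0 fst = \<mu>0" and d2: "distr \<pi> \<mu> snd = \<mu>"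
    using \<pi> by (auto simp: couplings_def)
  interpret \<pi>: prob_space \<pi>
    by (rule prob_space_distrD[of fst _ \<mu>0]) (use d1 \<mu>0.prob_space_axioms in auto)
  interpret \<pi>P: pair_prob_space \<pi> P ..
  show "transport p (w0 + w) \<mu>0 \<nu>"
    unfolding transport_def
  proof (intro bexI)
    let ?\<pi> = "distr (\<pi> \<Otimes>\<^sub>M P) (\<mu>0 \<Otimes>\<^sub>M \<nu>) (\<lambda>z. (fst (fst z), T (snd (fst z)) (snd z)))"
    have bn [measurable]: "(\<lambda>x. x) \<in> borel_measurable \<nu>"
      using bor by (simp add: measurable_cong_sets[OF sets_eq refl])
    have [measurable]: "fst \<in> borel_measurable (\<mu>0 \<Otimes>\<^sub>M \<mu>)" "snd \<in> borel_measurable (\<mu>0 \<Otimes>\<^sub>M \<mu>)"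
      "snd \<in> borel_measurable (\<mu>0 \<Otimes>\<^sub>M \<nu>)" "fst \<in> borel_measurable (\<mu>0 \<Otimes>\<^sub>M \<nu>)" "fst \<in> borel_measurable (\<mu> \<Otimes>\<^sub>M P)"
      using measurable_compose[OF measurable_fst, of "\<lambda>x. x" \<mu>0] measurable_compose[OF measurable_snd, of "\<lambda>x. x" \<mu>]
        measurable_compose[OF measurable_snd, of "\<lambda>x. x" \<nu>] measurable_compose[OF measurable_fst, of "\<lambda>x. x" \<mu>]
      by auto
    have TP [measurable]: "(\<lambda>z. T (fst z) (snd z)) \<in> borel_measurable (\<mu> \<Otimes>\<^sub>M P)"
      using measurable_compose[OF T bn] by simp
    have TP2 [measurable]: "(\<lambda>z. T (snd (fst z)) (snd z)) \<in> borel_measurable (\<pi> \<Otimes>\<^sub>M P)"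
      using measurable_compose[OF _ TP, of "\<lambda>z. (snd (fst z), snd z)" "\<pi> \<Otimes>\<^sub>M P"] by simp
    have [measurable]: "(\<lambda>z. fst (fst z)) \<in> borel_measurable (\<pi> \<Otimes>\<^sub>M P)" "(\<lambda>z. snd (fst z)) \<in> borel_measurable (\<pi> \<Otimes>\<^sub>M P)"
      by measurable
    have [measurable]: "(\<lambda>z. T (snd (fst z)) (snd z)) \<in> \<pi> \<Otimes>\<^sub>M P \<rightarrow>\<^sub>M \<nu>"
      using measurable_compose[OF _ T, of "\<lambda>z. (snd (fst z), snd z)" "\<pi> \<Otimes>\<^sub>M P"] by simp
    have dP: "distr (\<pi> \<Otimes>\<^sub>M P) \<pi> fst = \<pi>"
      by (rule P.distr_pair_fst)
    have "distr ?\<pi> \<mu>0 fst = distr (distr (\<pi> \<Otimes>\<^sub>M P) \<pi> fst) \<mu>0 fst"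
      by (simp add: distr_distr o_def)
    then have 1: "distr ?\<pi> \<mu>0 fst = \<mu>0"
      by (simp add: dP d1)
    \<comment> \<open>The random argument is independent of the old coupling, so the intermediate
      point and the argument have joint law \<open>\<mu> \<Otimes>\<^sub>M P\<close>, the law for
      which \<open>push\<close> and \<open>cost\<close> are stated.\<close>
    have "distr \<pi> \<mu> snd \<Otimes>\<^sub>M distr P P (\<lambda>x. x) = distr (\<pi> \<Otimes>\<^sub>M P) (\<mu> \<Otimes>\<^sub>M P) (\<lambda>(x, y). (snd x, y))"
      by (rule pair_measure_distr) (auto simp: distr_id P.sigma_finite_measure_axioms)
    then have d3: "\<mu> \<Otimes>\<^sub>M P = distr (\<pi> \<Otimes>\<^sub>M P) (\<mu> \<Otimes>\<^sub>M P) (\<lambda>z. (snd (fst z), snd z))"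
      by (simp add: d2 distr_id split_def)
    have "distr ?\<pi> \<nu> snd = distr (distr (\<pi> \<Otimes>\<^sub>M P) (\<mu> \<Otimes>\<^sub>M P) (\<lambda>z. (snd (fst z), snd z))) \<nu> (\<lambda>z. T (fst z) (snd z))"
      by (simp add: distr_distr o_def)
    then have 2: "distr ?\<pi> \<nu> snd = \<nu>"
      by (simp flip: d3 add: push)
    show "?\<pi> \<in> couplings \<mu>0 \<nu>"
      using 1 2 by (simp add: couplings_def)
    show "(\<integral>\<^sup>+ z. ennreal (dist (fst z) (snd z) powr p) \<partial>?\<pi>) \<le> ennreal ((w0 + w) powr p)"
    proof -
      have "(\<integral>\<^sup>+ z. ennreal (dist (fst z) (snd z) powr p) \<partial>?\<pi>) =
          (\<integral>\<^sup>+ z. ennreal (dist (fst (fst z)) (T (snd (fst z)) (snd z)) powr p) \<partial>(\<pi> \<Otimes>\<^sub>M P))"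
        by (subst nn_integral_distr) auto
      also have "\<dots> \<le> (\<integral>\<^sup>+ z. ennreal ((dist (fst (fst z)) (snd (fst z)) +
          dist (snd (fst z)) (T (snd (fst z)) (snd z))) powr p) \<partial>(\<pi> \<Otimes>\<^sub>M P))"
        using p by (intro nn_integral_mono ennreal_leI powr_mono2 dist_triangle) auto
      also have "\<dots> \<le> ennreal ((w0 + w) powr p)"
      proof (rule minkowski_powr[OF p w0 w])
        have "(\<integral>\<^sup>+ z. ennreal (dist (fst (fst z)) (snd (fst z)) powr p) \<partial>(\<pi> \<Otimes>\<^sub>M P)) =
            (\<integral>\<^sup>+ z. ennreal (dist (fst z) (snd z) powr p) \<partial>distr (\<pi> \<Otimes>\<^sub>M P) \<pi> fst)"
          by (subst nn_integral_distr) auto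
        then show "(\<integral>\<^sup>+ z. ennreal (dist (fst (fst z)) (snd (fst z)) powr p) \<partial>(\<pi> \<Otimes>\<^sub>M P)) \<le> ennreal (w0 powr p)"
          by (simp add: dP c0)
        have "(\<integral>\<^sup>+ z. ennreal (dist (snd (fst z)) (T (snd (fst z)) (snd z)) powr p) \<partial>(\<pi> \<Otimes>\<^sub>M P)) =
            (\<integral>\<^sup>+ z. ennreal (dist (fst z) (T (fst z) (snd z)) powr p)
              \<partial>distr (\<pi> \<Otimes>\<^sub>M P) (\<mu> \<Otimes>\<^sub>M P) (\<lambda>z. (snd (fst z), snd z)))"
          by (subst nn_integral_distr) auto
        then show "(\<integral>\<^sup>+ z. ennreal (dist (snd (fst z)) (T (snd (fst z)) (snd z)) powr p) \<partial>(\<pi> \<Otimes>\<^sub>M P)) \<le> ennreal (w powr p)"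
          by (simp flip: d3 add: cost)
      qed auto
      finally show ?thesis .
    qed
  qed
qed

section \<open>Monotone rearrangement on the unit interval\<close>

text \<open>Carried by the whole line, so that its measurable sets are all Borel sets and functions
  need no restriction.\<close>

abbreviation unit_measure :: "real measure" where
  "unit_measure \<equiv> density lborel (indicator {0..1})"

lemma emeasure_unit_measure: "S \<in> sets borel \<Longrightarrow> emeasure unit_measure S = emeasure lborel (S \<inter> {0..1})"
  by (simp add: emeasure_density nn_integral_indicator flip: indicator_inter_arith) (simp add: Int_commute)

interpretation unit: prob_space unit_measure
  by (rule prob_spaceI) (simp add: emeasure_unit_measure)

lemma AE_unit_measure: "AE s in unit_measure. s \<in> {0..1}"
  by (subst AE_density) (auto simp: indicator_def)

lemma AE_unitI: "(\<And>s. s \<in> {0..1} \<Longrightarrow> P s) \<Longrightarrow> AE s in unit_measure. P s"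
  using AE_unit_measure by (rule eventually_mono)

lemma AE_unit_neq_0: "AE s in unit_measure. s \<noteq> 0"
proof -
  have "AE s in lborel. s \<noteq> (0::real)" by (rule AE_lborel_singleton)
  then show ?thesis by (subst AE_density) (auto elim!: eventually_mono)
qed

definition primitive :: "(real \<Rightarrow> real) \<Rightarrow> real \<Rightarrow> real" where
  "primitive u t = (\<integral>s. (if s \<le> t then u s else 0) \<partial>unit_measure)"

text \<open>The quantile transform, inverse of \<open>primitive v\<close> composed with
  \<open>primitive u\<close>: for an increasing continuous primitive the set of \<open>y\<close>
  below the level is an initial segment, and its length is the inverse. Writing both notions as
  integrals over the fixed unit interval gives measurability in additional parameters.\<close>

definition rearrangement :: "(real \<Rightarrow> real) \<Rightarrow> (real \<Rightarrow> real) \<Rightarrow> real \<Rightarrow> real" where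
  "rearrangement u v t = (\<integral>y. (if primitive v y < primitive u t then 1 else 0) \<partial>unit_measure)"

lemma measure_unit_interval:
  assumes "0 \<le> s" "s \<le> t" "t \<le> 1"
  shows "emeasure unit_measure {s..t} = ennreal (t - s)" "emeasure unit_measure {s<..t} = ennreal (t - s)"
    "emeasure unit_measure {s..<t} = ennreal (t - s)"
proof -
  have "{s..t} \<inter> {0..1} = {s..t}" "{s<..t} \<inter> {0..1} = {s<..t}" "{s..<t} \<inter> {0..1} = {s..<t}"
    using assms by auto
  then show "emeasure unit_measure {s..t} = ennreal (t - s)" "emeasure unit_measure {s<..t} = ennreal (t - s)"
    "emeasure unit_measure {s..<t} = ennreal (t - s)"
    using assms by (simp_all add: emeasure_unit_measure)
qed

lemma integrable_unit_measure:
  fixes u :: "real \<Rightarrow> real"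
  assumes [measurable]: "u \<in> borel_measurable borel" and b: "\<And>s. s \<in> {0..1} \<Longrightarrow> \<bar>u s\<bar> \<le> B"
  shows "integrable unit_measure u"
  by (rule unit.integrable_const_bound[of _ B]) (auto intro!: AE_unitI simp: b)

lemma primitive_measurable [measurable]:
  assumes [measurable]: "u \<in> borel_measurable borel"
  shows "primitive u \<in> borel_measurable borel"
proof -
  have "(\<lambda>t. \<integral>s. (if s \<le> t then u s else 0) \<partial>unit_measure) \<in> borel_measurable borel"
    by (rule unit.borel_measurable_lebesgue_integral) measurable
  then show ?thesis by (simp add: primitive_def[abs_def])
qed

lemma rearrangement_measurable [measurable]:
  assumes [measurable]: "u \<in> borel_measurable borel" "v \<in> borel_measurable borel"
  shows "rearrangement u v \<in> borel_measurable borel"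
proof -
  have "(\<lambda>t. \<integral>y. (if primitive v y < primitive u t then 1 else 0 :: real) \<partial>unit_measure) \<in> borel_measurable borel"
    by (rule unit.borel_measurable_lebesgue_integral) measurable
  then show ?thesis by (simp add: rearrangement_def[abs_def])
qed

context
  fixes u :: "real \<Rightarrow> real" and a A :: real
  assumes um [measurable]: "u \<in> borel_measurable borel"
    and ub: "\<And>s. s \<in> {0..1} \<Longrightarrow> a \<le> u s \<and> u s \<le> A" and a: "0 < a"
begin

lemma primitive_diff:
  assumes "0 \<le> s" "s \<le> t" "t \<le> 1"
  shows "ennreal (primitive u t - primitive u s) = (\<integral>\<^sup>+ x. ennreal (u x) * indicator {s<..t} x \<partial>unit_measure)"
    and "a * (t - s) \<le> primitive u t - primitive u s" and "primitive u t - primitive u s \<le> A * (t - s)"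
proof -
  have ab: "\<bar>u x\<bar> \<le> A" if "x \<in> {0..1}" for x
    using ub[OF that] a by auto
  have A: "0 \<le> A" using ub[of 0] a by auto
  have I: "integrable unit_measure (\<lambda>x. if x \<le> t then u x else 0)" for t
    by (rule integrable_unit_measure[where B = A]) (use ab A in auto)
  have eq: "primitive u t - primitive u s = (\<integral>x. u x * indicator {s<..t} x \<partial>unit_measure)"
    unfolding primitive_def using assms
    by (subst Bochner_Integration.integral_diff[symmetric, OF I I])
      (auto intro!: Bochner_Integration.integral_cong split: split_indicator)
  have J: "integrable unit_measure (\<lambda>x. u x * indicator {s<..t} x)"
    by (rule integrable_unit_measure[where B = A]) (use ab A in \<open>auto split: split_indicator\<close>)
  have K: "integrable unit_measure (\<lambda>x. c * indicator {s<..t} x :: real)" for c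
    by (rule integrable_unit_measure[where B = "\<bar>c\<bar>"]) (auto split: split_indicator)
  have M: "(\<integral>x. c * indicator {s<..t} x \<partial>unit_measure) = c * (t - s)" for c :: real
    using measure_unit_interval(2)[OF assms] assms
    by (simp add: measure_def)
  show "ennreal (primitive u t - primitive u s) = (\<integral>\<^sup>+ x. ennreal (u x) * indicator {s<..t} x \<partial>unit_measure)"
    unfolding eq
  proof (subst nn_integral_eq_integral[symmetric, OF J])
    show "AE x in unit_measure. 0 \<le> u x * indicator {s<..t} x"
      using AE_unit_measure
    proof eventually_elim
      case (elim x)
      then show ?case using ub[OF elim] a by (auto simp: indicator_def)
    qed
  qed (auto intro!: nn_integral_cong simp: indicator_def)
  show "a * (t - s) \<le> primitive u t - primitive u s"
    unfolding eq M[symmetric] using ub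
    by (intro integral_mono_AE[OF K J]) (auto intro!: AE_unitI split: split_indicator)
  show "primitive u t - primitive u s \<le> A * (t - s)"
    unfolding eq M[symmetric] using ub
    by (intro integral_mono_AE[OF J K]) (auto intro!: AE_unitI split: split_indicator)
qed

lemma primitive_0: "primitive u 0 = 0"
proof -
  have "AE s in unit_measure. (if s \<le> 0 then u s else 0) = 0"
    using AE_unit_neq_0 AE_unit_measure by eventually_elim auto
  then have "primitive u 0 = (\<integral>s. 0 \<partial>unit_measure)"
    unfolding primitive_def by (intro integral_cong_AE) auto
  then show ?thesis by simp
qed

lemma primitive_less_iff:
  assumes "s \<in> {0..1}" "t \<in> {0..1}"
  shows "primitive u s < primitive u t \<longleftrightarrow> s < t"
proof -
  have "s < t \<Longrightarrow> s \<in> {0..1} \<Longrightarrow> t \<in> {0..1} \<Longrightarrow> primitive u s < primitive u t" for s t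
    using primitive_diff(2)[of s t] mult_pos_pos[OF a, of "t - s"] by auto
  from this[of s t] this[of t s] assms show ?thesis
    by (cases s t rule: linorder_cases) auto
qed

lemma primitive_le_iff:
  "s \<in> {0..1} \<Longrightarrow> t \<in> {0..1} \<Longrightarrow> primitive u s \<le> primitive u t \<longleftrightarrow> s \<le> t"
  using primitive_less_iff[of t s] by (auto simp: not_less[symmetric])

lemma primitive_IVT:
  assumes "0 \<le> y" "y \<le> primitive u 1"
  obtains t where "t \<in> {0..1}" "primitive u t = y"
proof -
  have "A-lipschitz_on {0..1} (primitive u)"
  proof (rule lipschitz_onI)
    show "0 \<le> A" using ub[of 0] a by auto
    fix s t :: real assume st: "s \<in> {0..1}" "t \<in> {0..1}"
    have "\<bar>primitive u t - primitive u s\<bar> \<le> A * \<bar>t - s\<bar>" if "s \<le> t" "s \<in> {0..1}" "t \<in> {0..1}" for s t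
    proof -
      have "0 \<le> a * (t - s)" using a that by simp
      then show ?thesis
        using primitive_diff(2,3)[of s t] that by auto
    qed
    from this[of s t] this[of t s] st show "dist (primitive u s) (primitive u t) \<le> A * dist s t"
      by (cases "s \<le> t") (auto simp: dist_real_def abs_minus_commute)
  qed
  then have "continuous_on {0..1} (primitive u)"
    by (rule lipschitz_on_continuous_on)
  with assms show ?thesis
    using IVT'[of "primitive u" 0 y 1] that by (auto simp: primitive_0)
qed

lemma emeasure_density_unit_atMost:
  assumes "t \<in> {0..1}"
  shows "emeasure (density unit_measure (\<lambda>x. ennreal (u x))) {0..t} = ennreal (primitive u t)"
proof -
  have "AE x in unit_measure. ennreal (u x) * indicator {0..t} x = ennreal (u x) * indicator {0<..t} x"
    using AE_unit_neq_0 by eventually_elim (auto simp: indicator_def)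
  then have "(\<integral>\<^sup>+ x. ennreal (u x) * indicator {0..t} x \<partial>unit_measure) =
      (\<integral>\<^sup>+ x. ennreal (u x) * indicator {0<..t} x \<partial>unit_measure)"
    by (rule nn_integral_cong_AE)
  then show ?thesis
    using assms primitive_diff(1)[of 0 t]
    by (subst emeasure_density) (auto simp: primitive_0)
qed

end

context
  fixes u v :: "real \<Rightarrow> real" and a A :: real
  assumes um [measurable]: "u \<in> borel_measurable borel"
    and vm [measurable]: "v \<in> borel_measurable borel"
    and ub: "\<And>s. s \<in> {0..1} \<Longrightarrow> a \<le> u s \<and> u s \<le> A"
    and vb: "\<And>s. s \<in> {0..1} \<Longrightarrow> a \<le> v s \<and> v s \<le> A" and a: "0 < a"
    and mass: "primitive u 1 = primitive v 1"
begin

lemma primitive_u_range: "t \<in> {0..1} \<Longrightarrow> 0 \<le> primitive u t \<and> primitive u t \<le> primitive u 1"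
  using primitive_le_iff[OF um ub a, of 0 t] primitive_le_iff[OF um ub a, of t 1] primitive_0[OF um ub a] by auto

lemma primitive_v_range: "t \<in> {0..1} \<Longrightarrow> 0 \<le> primitive v t \<and> primitive v t \<le> primitive v 1"
  using primitive_le_iff[OF vm vb a, of 0 t] primitive_le_iff[OF vm vb a, of t 1] primitive_0[OF vm vb a] by auto

lemma rearrangement:
  assumes t: "t \<in> {0..1}"
  shows "rearrangement u v t \<in> {0..1}" "primitive v (rearrangement u v t) = primitive u t"
proof -
  obtain y where y: "y \<in> {0..1}" "primitive v y = primitive u t"
    using primitive_IVT[OF vm vb a, of "primitive u t"] primitive_u_range[OF t] mass by auto
  have "AE s in unit_measure. (if primitive v s < primitive u t then 1 else 0) = (indicator {0..<y} s :: real)"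
    using AE_unit_measure
  proof eventually_elim
    case (elim s)
    then show ?case
      using primitive_less_iff[OF vm vb a elim y(1)] by (auto simp: y(2) indicator_def)
  qed
  then have "rearrangement u v t = (\<integral>s. indicator {0..<y} s \<partial>unit_measure)"
    unfolding rearrangement_def by (intro integral_cong_AE) auto
  also have "\<dots> = y"
    using measure_unit_interval(3)[of 0 y] y by (simp add: measure_def)
  finally show "rearrangement u v t \<in> {0..1}" "primitive v (rearrangement u v t) = primitive u t"
    using y by auto
qed

lemma rearrangement_le_iff:
  assumes "t \<in> {0..1}" "y \<in> {0..1}"
  shows "rearrangement u v t \<le> y \<longleftrightarrow> primitive u t \<le> primitive v y"
  using primitive_le_iff[OF vm vb a rearrangement(1)[OF assms(1)] assms(2)] rearrangement(2)[OF assms(1)] by simp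

lemma le_rearrangement_iff:
  assumes "t \<in> {0..1}" "y \<in> {0..1}"
  shows "y \<le> rearrangement u v t \<longleftrightarrow> primitive v y \<le> primitive u t"
  using primitive_le_iff[OF vm vb a assms(2) rearrangement(1)[OF assms(1)]] rearrangement(2)[OF assms(1)] by simp

lemma finite_borel_density_unit:
  assumes [measurable]: "w \<in> borel_measurable borel" and "\<And>s. s \<in> {0..1} \<Longrightarrow> w s \<le> B"
  shows "finite_borel_measure (density unit_measure (\<lambda>x. ennreal (w x)))"
proof -
  have "(\<integral>\<^sup>+ x. ennreal (w x) \<partial>unit_measure) \<le> (\<integral>\<^sup>+ x. ennreal B \<partial>unit_measure)"
    by (intro nn_integral_mono_AE AE_unitI) (auto intro!: ennreal_leI assms(2))
  also have "\<dots> = ennreal B"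
    using unit.emeasure_space_1 by simp
  finally have "(\<integral>\<^sup>+ x. ennreal (w x) \<partial>unit_measure) < \<infinity>"
    by (simp add: le_less_trans)
  then show ?thesis
    by (intro finite_borel_measure.intro finite_borel_measure_axioms.intro finite_measureI)
      (auto simp: emeasure_density less_top)
qed

lemma AE_density_unit:
  assumes [measurable]: "w \<in> borel_measurable borel"
  shows "AE t in density unit_measure (\<lambda>x. ennreal (w x)). t \<in> {0..1}"
proof -
  have "AE t in unit_measure. 0 < ennreal (w t) \<longrightarrow> t \<in> {0..1}"
    using AE_unit_measure by eventually_elim auto
  then show ?thesis by (subst AE_density) auto
qed

text \<open>Distribution functions are compared. For \<open>z = min y 1\<close> the points with
  image at most \<open>z\<close> form \<open>{0..t}\<close>, where
  \<open>primitive u t = primitive v z\<close>; negative \<open>y\<close> gives null sets on both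
  sides.\<close>

lemma distr_rearrangement:
  "distr (density unit_measure (\<lambda>x. ennreal (u x))) borel (rearrangement u v) =
     density unit_measure (\<lambda>x. ennreal (v x))"
proof -
  let ?U = "density unit_measure (\<lambda>x. ennreal (u x))" and ?V = "density unit_measure (\<lambda>x. ennreal (v x))"
  interpret U: finite_borel_measure ?U
    by (rule finite_borel_density_unit[of _ A]) (use ub in auto)
  interpret V: finite_borel_measure ?V
    by (rule finite_borel_density_unit[of _ A]) (use vb in auto)
  show ?thesis
  proof (rule cdf_unique')
    interpret D: finite_measure "distr ?U borel (rearrangement u v)"
      by (rule U.finite_measure_distr) measurable
    show "finite_borel_measure (distr ?U borel (rearrangement u v))"
      by unfold_locales simp
    show "finite_borel_measure ?V" ..
    show "cdf (distr ?U borel (rearrangement u v)) = cdf ?V"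
    proof
      fix y :: real
      have [measurable]: "rearrangement u v -` {..y} \<in> sets borel"
        using measurable_sets[OF rearrangement_measurable[OF um vm], of "{..y}"] by simp
      have "emeasure ?U (rearrangement u v -` {..y} \<inter> space ?U) = emeasure ?V {..y}"
      proof -
        consider "y < 0" | "0 \<le> y" by linarith
        then show ?thesis
        proof cases
          case 1
          have "AE t in ?U. t \<in> rearrangement u v -` {..y} \<inter> space ?U \<longleftrightarrow> t \<in> {}"
            using AE_density_unit[OF um] by eventually_elim (use 1 rearrangement(1) in force)
          then have A: "emeasure ?U (rearrangement u v -` {..y} \<inter> space ?U) = emeasure ?U {}"
            by (intro emeasure_eq_AE) auto
          have "AE t in ?V. t \<in> {..y} \<longleftrightarrow> t \<in> {}"
            using AE_density_unit[OF vm] by eventually_elim (use 1 in auto)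
          then have "emeasure ?V {..y} = emeasure ?V {}"
            by (intro emeasure_eq_AE) auto
          with A show ?thesis by simp
        next
          case 2
          define z where "z = min y 1"
          have z: "z \<in> {0..1}" using 2 by (auto simp: z_def)
          obtain t where t: "t \<in> {0..1}" "primitive u t = primitive v z"
            using primitive_IVT[OF um ub a, of "primitive v z"] primitive_v_range[OF z] mass by auto
          have "AE s in ?U. s \<in> rearrangement u v -` {..y} \<inter> space ?U \<longleftrightarrow> s \<in> {0..t}"
            using AE_density_unit[OF um]
          proof eventually_elim
            case (elim s)
            have "rearrangement u v s \<le> y \<longleftrightarrow> rearrangement u v s \<le> z"
              using rearrangement(1)[OF elim] by (auto simp: z_def)
            also have "\<dots> \<longleftrightarrow> s \<le> t"
              using rearrangement_le_iff[OF elim z] primitive_le_iff[OF um ub a elim t(1)] t(2) by simp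
            finally show ?case using elim by auto
          qed
          then have "emeasure ?U (rearrangement u v -` {..y} \<inter> space ?U) = emeasure ?U {0..t}"
            by (intro emeasure_eq_AE) auto
          also have "\<dots> = ennreal (primitive v z)"
            using emeasure_density_unit_atMost[OF um ub a t(1)] t(2) by simp
          also have "\<dots> = emeasure ?V {0..z}"
            using emeasure_density_unit_atMost[OF vm vb a z] by simp
          also have "\<dots> = emeasure ?V {..y}"
          proof (rule emeasure_eq_AE)
            show "AE s in ?V. s \<in> {0..z} \<longleftrightarrow> s \<in> {..y}"
              using AE_density_unit[OF vm] by eventually_elim (auto simp: z_def)
          qed auto
          finally show ?thesis .
        qed
      qed
      then show "cdf (distr ?U borel (rearrangement u v)) y = cdf ?V y"
        by (simp add: cdf_def measure_def emeasure_distr)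
    qed
  qed
qed

text \<open>Write \<open>V\<close> for the difference of the primitives. It is at least
  \<open>a\<close> times the displacement on the whole interval between \<open>t\<close> and its
  image, which bounds the displacement power by an integral of
  \<open>\<bar>V\<bar> powr (p - 1)\<close> over that interval. By Fubini each \<open>x\<close> is
  then weighted with the mass transported across it, and this mass is
  \<open>\<bar>V x\<bar>\<close>.\<close>

lemma rearrangement_cost:
  assumes p: "1 \<le> p"
  shows "ennreal (a powr (p - 1)) * (\<integral>\<^sup>+ t. ennreal (u t) * ennreal (\<bar>rearrangement u v t - t\<bar> powr p) \<partial>unit_measure) \<le>
     (\<integral>\<^sup>+ x. ennreal (\<bar>primitive u x - primitive v x\<bar> powr p) \<partial>unit_measure)"
proof -
  define V where "V x = primitive u x - primitive v x" for x
  define T where "T = rearrangement u v"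
  define B where "B t x = (t \<le> x \<and> x \<le> T t \<or> T t \<le> x \<and> x \<le> t)" for t x
  have [measurable]: "T \<in> borel_measurable borel" "V \<in> borel_measurable borel"
    unfolding T_def V_def by measurable
  have pt: "ennreal (a powr (p - 1)) * ennreal (\<bar>T t - t\<bar> powr p) \<le>
      (\<integral>\<^sup>+ x. (if B t x then ennreal (\<bar>V x\<bar> powr (p - 1)) else 0) \<partial>unit_measure)" (is "?l \<le> ?r")
    if t: "t \<in> {0..1}" for t
  proof -
    define w where "w = \<bar>T t - t\<bar>"
    have Tt: "T t \<in> {0..1}" "primitive v (T t) = primitive u t"
      using rearrangement[OF t] by (auto simp: T_def)
    \<comment> \<open>Both primitives grow at rate at least \<open>a\<close>, one from
      \<open>t\<close> to \<open>x\<close> and the other from \<open>x\<close> to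
      \<open>T t\<close>; since \<open>primitive v (T t) = primitive u t\<close>, the two increments
      add up to the gap at \<open>x\<close>.\<close>
    have V: "a * w \<le> \<bar>V x\<bar>" if x: "x \<in> {0..1}" "B t x" for x
    proof -
      consider "t \<le> x" "x \<le> T t" | "T t \<le> x" "x \<le> t"
        using x by (auto simp: B_def)
      then show ?thesis
      proof cases
        case 1
        have "a * (x - t) \<le> primitive u x - primitive u t"
          using 1 x t by (intro primitive_diff(2)[OF um ub a]) auto
        moreover have "a * (T t - x) \<le> primitive v (T t) - primitive v x"
          using 1 x Tt by (intro primitive_diff(2)[OF vm vb a]) auto
        ultimately have "a * (x - t) + a * (T t - x) \<le> V x"
          using Tt(2) by (simp add: V_def)
        then show ?thesis using 1 by (simp add: w_def algebra_simps)
      next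
        case 2
        have "a * (t - x) \<le> primitive u t - primitive u x"
          using 2 x t by (intro primitive_diff(2)[OF um ub a]) auto
        moreover have "a * (x - T t) \<le> primitive v x - primitive v (T t)"
          using 2 x Tt by (intro primitive_diff(2)[OF vm vb a]) auto
        ultimately have "a * (t - x) + a * (x - T t) \<le> - V x"
          using Tt(2) by (simp add: V_def)
        then show ?thesis using 2 by (simp add: w_def algebra_simps)
      qed
    qed
    show ?thesis
    proof (cases "w = 0")
      case True
      then show ?thesis by (simp add: w_def)
    next
      case False
      then have w: "0 < w" by (simp add: w_def)
      let ?I = "{min t (T t)..max t (T t)}"
      \<comment> \<open>One factor \<open>w\<close> is kept as the length of the interval between
        \<open>t\<close> and \<open>T t\<close>; the remaining power \<open>p - 1\<close> is paid by
        the gap.\<close>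
      have "?l = ennreal ((a * w) powr (p - 1)) * ennreal w"
        using a w p powr_add[of w "p - 1" 1]
        by (simp flip: ennreal_mult w_def) (simp add: powr_mult)
      also have "ennreal w = emeasure unit_measure ?I"
        using t Tt by (subst measure_unit_interval(1)) (auto simp: w_def min_def max_def)
      also have "ennreal ((a * w) powr (p - 1)) * \<dots> =
          (\<integral>\<^sup>+ x. ennreal ((a * w) powr (p - 1)) * indicator ?I x \<partial>unit_measure)"
        by (subst nn_integral_cmult_indicator) auto
      also have "\<dots> \<le> ?r"
      proof (rule nn_integral_mono_AE)
        show "AE x in unit_measure. ennreal ((a * w) powr (p - 1)) * indicator ?I x \<le>
            (if B t x then ennreal (\<bar>V x\<bar> powr (p - 1)) else 0)"
          using AE_unit_measure
        proof eventually_elim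
          case (elim x)
          have "x \<in> ?I \<longleftrightarrow> B t x" by (auto simp: B_def min_def max_def)
          then show ?case
            using V[OF elim] a w p by (auto simp: indicator_def intro!: ennreal_leI powr_mono2)
        qed
      qed
      finally show ?thesis .
    qed
  qed
  \<comment> \<open>The mass crossing \<open>x\<close>: it starts between \<open>x\<close> and the
    preimage \<open>s\<close> of \<open>x\<close>, and
    \<open>primitive u s = primitive v x\<close>.\<close>
  have fub: "(\<integral>\<^sup>+ t. ennreal (u t) * (if B t x then 1 else 0) \<partial>unit_measure) = ennreal \<bar>V x\<bar>"
    if x: "x \<in> {0..1}" for x
  proof -
    obtain s where s: "s \<in> {0..1}" "primitive u s = primitive v x"
      using primitive_IVT[OF um ub a, of "primitive v x"] primitive_v_range[OF x] mass by auto
    have B: "B t x \<longleftrightarrow> (s \<le> t \<and> t \<le> x \<or> x \<le> t \<and> t \<le> s)" if t: "t \<in> {0..1}" for t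
      unfolding B_def T_def using rearrangement_le_iff[OF t x] le_rearrangement_iff[OF t x]
        primitive_le_iff[OF um ub a t s(1)] primitive_le_iff[OF um ub a s(1) t] s(2) by auto
    \<comment> \<open>The left endpoint is discarded to match the half-open interval of
      \<open>primitive_diff\<close>.\<close>
    have ne: "AE t in unit_measure. t \<noteq> min s x"
    proof -
      have "AE t in lborel. t \<noteq> min s x" by (rule AE_lborel_singleton)
      then show ?thesis by (subst AE_density) (auto elim!: eventually_mono)
    qed
    have "AE t in unit_measure. ennreal (u t) * (if B t x then 1 else 0) =
        ennreal (u t) * indicator {min s x<..max s x} t"
      using AE_unit_measure ne
      by eventually_elim (auto simp: B indicator_def min_def max_def split: if_splits)
    then have "(\<integral>\<^sup>+ t. ennreal (u t) * (if B t x then 1 else 0) \<partial>unit_measure) =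
        (\<integral>\<^sup>+ t. ennreal (u t) * indicator {min s x<..max s x} t \<partial>unit_measure)"
      by (rule nn_integral_cong_AE)
    also have "\<dots> = ennreal (primitive u (max s x) - primitive u (min s x))"
      using s x by (subst primitive_diff(1)[OF um ub a]) auto
    also have "primitive u (max s x) - primitive u (min s x) = \<bar>primitive u x - primitive u s\<bar>"
      using primitive_le_iff[OF um ub a x s(1)] primitive_le_iff[OF um ub a s(1) x]
      by (auto simp: min_def max_def)
    finally show ?thesis by (simp add: V_def s(2))
  qed
  have [measurable]: "Measurable.pred (borel \<Otimes>\<^sub>M borel) (\<lambda>z. B (fst z) (snd z))"
    "Measurable.pred (borel \<Otimes>\<^sub>M borel) (\<lambda>z. B (snd z) (fst z))"
    "\<And>t. Measurable.pred borel (B t)" "\<And>x. Measurable.pred borel (\<lambda>t. B t x)"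
    unfolding B_def by measurable
  interpret UU: pair_sigma_finite unit_measure unit_measure ..
  have "ennreal (a powr (p - 1)) * (\<integral>\<^sup>+ t. ennreal (u t) * ennreal (\<bar>T t - t\<bar> powr p) \<partial>unit_measure) =
      (\<integral>\<^sup>+ t. ennreal (u t) * (ennreal (a powr (p - 1)) * ennreal (\<bar>T t - t\<bar> powr p)) \<partial>unit_measure)"
    by (subst nn_integral_cmult[symmetric]) (auto simp: mult.left_commute)
  also have "\<dots> \<le> (\<integral>\<^sup>+ t. ennreal (u t) * (\<integral>\<^sup>+ x. (if B t x then ennreal (\<bar>V x\<bar> powr (p - 1)) else 0) \<partial>unit_measure) \<partial>unit_measure)"
    by (intro nn_integral_mono_AE AE_unitI) (auto intro!: mult_left_mono pt)
  also have "\<dots> = (\<integral>\<^sup>+ t. (\<integral>\<^sup>+ x. ennreal (u t) * (if B t x then 1 else 0) * ennreal (\<bar>V x\<bar> powr (p - 1)) \<partial>unit_measure) \<partial>unit_measure)"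
    by (subst nn_integral_cmult[symmetric]) (auto intro!: nn_integral_cong)
  also have "\<dots> = (\<integral>\<^sup>+ x. (\<integral>\<^sup>+ t. ennreal (u t) * (if B t x then 1 else 0) * ennreal (\<bar>V x\<bar> powr (p - 1)) \<partial>unit_measure) \<partial>unit_measure)"
    by (rule UU.Fubini') measurable
  also have "\<dots> = (\<integral>\<^sup>+ x. (\<integral>\<^sup>+ t. ennreal (u t) * (if B t x then 1 else 0) \<partial>unit_measure) * ennreal (\<bar>V x\<bar> powr (p - 1)) \<partial>unit_measure)"
    by (subst nn_integral_multc) auto
  also have "\<dots> = (\<integral>\<^sup>+ x. ennreal \<bar>V x\<bar> * ennreal (\<bar>V x\<bar> powr (p - 1)) \<partial>unit_measure)"
    by (intro nn_integral_cong_AE AE_unitI) (simp add: fub)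
  also have "\<dots> = (\<integral>\<^sup>+ x. ennreal (\<bar>V x\<bar> powr p) \<partial>unit_measure)"
  proof (rule nn_integral_cong)
    fix x show "ennreal \<bar>V x\<bar> * ennreal (\<bar>V x\<bar> powr (p - 1)) = ennreal (\<bar>V x\<bar> powr p)"
      using powr_add[of "\<bar>V x\<bar>" 1 "p - 1"] by (simp flip: ennreal_mult)
  qed
  finally show ?thesis by (simp add: T_def V_def)
qed

end

section \<open>Transport along one coordinate of the cube\<close>

text \<open>Integrates like \<open>cube_measure\<close>, but its measurable sets are all Borel sets
  of the space; the transports are built on this version and carried over to the subspace at the
  end.\<close>

abbreviation cubeM :: "(real ^ 'n) measure" where
  "cubeM \<equiv> density lborel (indicator cube)"

lemma emeasure_unit_cube:
  "S \<in> sets borel \<Longrightarrow> emeasure cubeM S = emeasure lborel (S \<inter> (cube :: (real ^ 'n) set))"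
  by (simp add: emeasure_density nn_integral_indicator flip: indicator_inter_arith) (simp add: Int_commute)

lemma prod_Basis_vec: "(\<Prod>b\<in>(Basis :: (real ^ 'n) set). f b) = (\<Prod>k\<in>UNIV. f (axis k 1))"
proof -
  have "(Basis :: (real ^ 'n) set) = range (\<lambda>k. axis k 1)"
    by (auto simp: Basis_vec_def)
  moreover have "inj (\<lambda>k. axis k 1 :: real ^ 'n)"
    by (auto simp: inj_def axis_eq_axis)
  ultimately show ?thesis
    by (metis (no_types, lifting) prod.reindex_cong)
qed

text \<open>The boundary of the cube is null, so only two open boxes are intersected; truncation of
  \<open>ennreal\<close> at \<open>0\<close> makes the product vanish when the intersection is
  empty.\<close>

lemma emeasure_unit_cube_box:
  "emeasure cubeM (box l u) = (\<Prod>k\<in>UNIV. ennreal (min (u $ k) 1 - max (l $ k) 0))"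
  for l u :: "real ^ 'n"
proof -
  define a b where "a = (\<chi> k. max (l $ k) 0)" and "b = (\<chi> k. min (u $ k) 1)"
  have N: "emeasure lborel (cube - box 0 1 :: (real ^ 'n) set) = 0"
    by (subst emeasure_Diff) (auto simp: emeasure_lborel_cbox_eq emeasure_lborel_box_eq box_subset_cbox)
  have "AE x in lborel. x \<in> box l u \<inter> cube \<longleftrightarrow> x \<in> box l u \<inter> box 0 1"
    using AE_not_in[of "cube - box 0 1 :: (real ^ 'n) set" lborel] N
    by (auto simp: null_sets_def elim!: eventually_mono dest: subsetD[OF box_subset_cbox])
  then have "emeasure lborel (box l u \<inter> cube) = emeasure lborel (box l u \<inter> box 0 1)"
    by (rule emeasure_eq_AE) auto
  also have "box l u \<inter> box 0 1 = box a b"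
    by (auto simp: mem_box_cart a_def b_def)
  also have "emeasure lborel (box a b) = (\<Prod>k\<in>UNIV. ennreal (min (u $ k) 1 - max (l $ k) 0))"
  proof (cases "\<forall>k. a $ k \<le> b $ k")
    case True
    then have "\<forall>c\<in>Basis. a \<bullet> c \<le> b \<bullet> c"
      by (auto simp: Basis_vec_def inner_axis)
    then have "emeasure lborel (box a b) = ennreal (\<Prod>c\<in>Basis. (b - a) \<bullet> c)"
      by (simp add: emeasure_lborel_box_eq)
    also have "\<dots> = ennreal (\<Prod>k\<in>UNIV. b $ k - a $ k)"
      by (simp add: prod_Basis_vec inner_axis)
    also have "\<dots> = (\<Prod>k\<in>UNIV. ennreal (b $ k - a $ k))"
      using True by (subst prod_ennreal) auto
    finally show ?thesis by (simp add: a_def b_def)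
  next
    case False
    then obtain k where k: "b $ k < a $ k" by (auto simp: not_le)
    then have "box a b = {}"
      by (force simp: mem_box_cart dest: less_trans)
    moreover have "ennreal (min (u $ k) 1 - max (l $ k) 0) = 0"
      using k by (intro ennreal_neg) (simp add: a_def b_def)
    ultimately show ?thesis
      by (auto intro!: prod_zero[symmetric])
  qed
  finally show ?thesis
    by (simp add: emeasure_unit_cube)
qed

interpretation ucube: prob_space "cubeM :: (real ^ 'n) measure"
proof (rule prob_spaceI)
  have "\<forall>b\<in>Basis. (1 :: real ^ 'n) \<bullet> b = 1"
    by (auto simp: Basis_vec_def inner_axis)
  then have "emeasure lborel (cube :: (real ^ 'n) set) = 1"
    by (simp add: emeasure_lborel_cbox_eq)
  then show "emeasure cubeM (space cubeM :: (real ^ 'n) set) = 1"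
    by (subst emeasure_unit_cube) auto
qed

lemma AE_cubeI: "(\<And>x. x \<in> cube \<Longrightarrow> P x) \<Longrightarrow> AE x in cubeM. P x"
  by (subst AE_density) (auto simp: indicator_def)

text \<open>An affine formula instead of a case distinction on coordinates, so that joint
  measurability follows from that of the vector operations.\<close>

definition upd :: "'n \<Rightarrow> real \<Rightarrow> real ^ 'n \<Rightarrow> real ^ 'n" where
  "upd i s x = x + (s - x $ i) *\<^sub>R axis i 1"

lemma upd_nth [simp]: "upd i s x $ k = (if k = i then s else x $ k)"
  by (simp add: upd_def axis_def)

lemma upd_upd [simp]: "upd i s (upd i t x) = upd i s x"
  by (simp add: vec_eq_iff)

lemma upd_self [simp]: "upd i (x $ i) x = x"
  by (simp add: vec_eq_iff)

lemma upd_in_cube: "x \<in> cube \<Longrightarrow> s \<in> {0..1} \<Longrightarrow> upd i s x \<in> cube"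
  by (simp add: mem_box_cart)

lemma vec_nth_measurable [measurable (raw)]:
  "f \<in> borel_measurable M \<Longrightarrow> (\<lambda>x. f x $ i) \<in> borel_measurable M" for f :: "'a \<Rightarrow> real ^ 'n"
  using borel_measurable_inner[of f M "\<lambda>_. axis i 1"] by (simp add: inner_axis)

lemma upd_measurable [measurable (raw)]:
  assumes [measurable]: "f \<in> borel_measurable M" "g \<in> borel_measurable M"
  shows "(\<lambda>x. upd i (f x) (g x)) \<in> borel_measurable M"
  unfolding upd_def by measurable

text \<open>Fubini for a single coordinate, phrased as invariance: resampling coordinate
  \<open>i\<close> uniformly preserves the uniform law. This avoids splitting the space into a
  product; boxes suffice as an intersection-stable generator.\<close>

lemma distr_upd:
  "distr (cubeM \<Otimes>\<^sub>M unit_measure) borel (\<lambda>z. upd i (snd z) (fst z)) = cubeM"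
  for i :: "'n::finite"
proof (rule sym, rule measure_eqI_generator_eq)
  let ?E = "range (\<lambda>(a, b). box a b :: (real ^ 'n) set)"
  let ?D = "distr (cubeM \<Otimes>\<^sub>M unit_measure) borel (\<lambda>z. upd i (snd z) (fst z)) :: (real ^ 'n) measure"
  show "Int_stable ?E"
    by (auto simp: Int_stable_def box_Int_box)
  show "?E \<subseteq> Pow UNIV" "sets (cubeM :: (real ^ 'n) measure) = sigma_sets UNIV ?E" "sets ?D = sigma_sets UNIV ?E"
    by (simp_all add: borel_eq_box)
  let ?A = "\<lambda>n::nat. box (- (real n *\<^sub>R One)) (real n *\<^sub>R One) :: (real ^ 'n) set"
  show "range ?A \<subseteq> ?E" "(\<Union>i. ?A i) = UNIV"
    unfolding UN_box_eq_UNIV by auto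
  show "emeasure cubeM (?A i) \<noteq> \<infinity>" for i
    by (simp add: ucube.emeasure_finite)
  fix X assume "X \<in> ?E"
  then obtain l u where X: "X = box l u" by auto
  let ?J = "{l $ i <..< u $ i}"
  \<comment> \<open>Coordinate \<open>i\<close> of the old point is irrelevant, so its side of the
    box is widened to \<open>(-1, 2)\<close>, which contains \<open>[0, 1]\<close>; the event
    becomes a product.\<close>
  have "AE z in cubeM \<Otimes>\<^sub>M unit_measure. z \<in> (\<lambda>z. upd i (snd z) (fst z)) -` X \<longleftrightarrow>
      z \<in> box (upd i (-1) l) (upd i 2 u) \<times> ?J"
  proof -
    have "AE z in distr (cubeM \<Otimes>\<^sub>M unit_measure) cubeM fst. z \<in> cube"
      by (subst unit.distr_pair_fst) (auto intro: AE_cubeI)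
    then have "AE z in cubeM \<Otimes>\<^sub>M unit_measure. fst z \<in> cube"
      by (subst (asm) AE_distr_iff) auto
    then show ?thesis
    proof eventually_elim
      case (elim z)
      then have "-1 < fst z $ i" "fst z $ i < 2"
        using elim by (auto simp: mem_box_cart intro: less_le_trans[of _ 0] le_less_trans[of _ 1])
      then show ?case
        by (cases z) (auto simp: X mem_box_cart)
    qed
  qed
  moreover have "(\<lambda>z. upd i (snd z) (fst z)) -` X \<in> sets (borel \<Otimes>\<^sub>M borel)"
  proof -
    have "(\<lambda>z. upd i (snd z) (fst z)) \<in> borel_measurable (borel \<Otimes>\<^sub>M borel)" by measurable
    from measurable_sets[OF this, of X] show ?thesis by (simp add: X space_pair_measure)
  qed
  ultimately have "emeasure ?D X = emeasure (cubeM \<Otimes>\<^sub>M unit_measure) (box (upd i (-1) l) (upd i 2 u) \<times> ?J)"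
    by (subst emeasure_distr, use X in auto, intro emeasure_eq_AE) (auto simp: X space_pair_measure)
  also have "\<dots> = emeasure cubeM (box (upd i (-1) l) (upd i 2 u)) * emeasure unit_measure ?J"
    by (rule unit.emeasure_pair_measure_Times) auto
  also have "emeasure cubeM (box (upd i (-1) l) (upd i 2 u)) =
      (\<Prod>k\<in>UNIV - {i}. ennreal (min (u $ k) 1 - max (l $ k) 0))"
    unfolding emeasure_unit_cube_box
    by (subst prod.remove[of _ i]) (auto intro!: prod.cong)
  also have "emeasure unit_measure ?J = ennreal (min (u $ i) 1 - max (l $ i) 0)"
  proof -
    have "AE s in lborel. s \<noteq> (0::real) \<and> s \<noteq> 1"
      using AE_lborel_singleton[of 0] AE_lborel_singleton[of 1] by eventually_elim auto
    then have "AE s in lborel. s \<in> ?J \<inter> {0..1} \<longleftrightarrow> s \<in> {max (l $ i) 0 <..< min (u $ i) 1}"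
      by eventually_elim auto
    then have "emeasure lborel (?J \<inter> {0..1}) = emeasure lborel {max (l $ i) 0 <..< min (u $ i) 1}"
      by (rule emeasure_eq_AE) auto
    also have "\<dots> = ennreal (min (u $ i) 1 - max (l $ i) 0)"
    proof -
      have "emeasure lborel {y<..<z} = ennreal (z - y)" for y z :: real
        by (cases "y \<le> z") (simp_all add: ennreal_neg)
      then show ?thesis .
    qed
    finally show ?thesis by (simp add: emeasure_unit_measure)
  qed
  also have "(\<Prod>k\<in>UNIV - {i}. ennreal (min (u $ k) 1 - max (l $ k) 0)) * \<dots> = emeasure cubeM X"
    unfolding X emeasure_unit_cube_box by (subst prod.remove[of UNIV i]) (auto simp: mult.commute)
  finally show "emeasure cubeM X = emeasure ?D X" by simp
qed

lemma nn_integral_upd: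
  assumes [measurable]: "h \<in> borel_measurable borel"
  shows "(\<integral>\<^sup>+ x. h x \<partial>cubeM) =
     (\<integral>\<^sup>+ x. (\<integral>\<^sup>+ s. h (upd i s x) \<partial>unit_measure) \<partial>cubeM)"
proof -
  have "(\<integral>\<^sup>+ x. h x \<partial>cubeM) =
      (\<integral>\<^sup>+ z. h (upd i (snd z) (fst z)) \<partial>(cubeM \<Otimes>\<^sub>M unit_measure))"
    by (subst distr_upd[of i, symmetric], subst nn_integral_distr) auto
  also have "\<dots> = (\<integral>\<^sup>+ x. (\<integral>\<^sup>+ s. h (upd i s x) \<partial>unit_measure) \<partial>cubeM)"
    by (subst unit.nn_integral_fst[symmetric]) auto
  finally show ?thesis .
qed

lemma integral_upd:
  fixes h :: "real ^ 'n \<Rightarrow> real"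
  assumes [measurable]: "h \<in> borel_measurable borel" and b: "\<And>x. x \<in> cube \<Longrightarrow> \<bar>h x\<bar> \<le> B"
  shows "(\<integral>x. h x \<partial>cubeM) =
     (\<integral>x. (\<integral>s. h (upd i s x) \<partial>unit_measure) \<partial>cubeM)"
proof -
  interpret pair_sigma_finite cubeM unit_measure ..
  have "integrable (cubeM :: (real ^ 'n) measure) h"
    by (rule ucube.integrable_const_bound[of _ B]) (auto intro!: AE_cubeI b)
  then have I: "integrable (cubeM \<Otimes>\<^sub>M unit_measure) (\<lambda>z. h (upd i (snd z) (fst z)))"
    by (subst (asm) distr_upd[of i, symmetric], subst (asm) integrable_distr_eq) auto
  have "(\<integral>x. h x \<partial>cubeM) =
      (\<integral>z. h (upd i (snd z) (fst z)) \<partial>(cubeM \<Otimes>\<^sub>M unit_measure))"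
    by (subst distr_upd[of i, symmetric], subst integral_distr) auto
  also have "\<dots> = (\<integral>x. (\<integral>s. h (upd i s x) \<partial>unit_measure) \<partial>cubeM)"
    using I by (subst integral_fst'[symmetric]) auto
  finally show ?thesis .
qed

section \<open>Line primitives and maps depending measurably on the line\<close>

lemma primitive_measurable_param:
  assumes u [measurable]: "(\<lambda>z. u (fst z) (snd z)) \<in> borel_measurable (M \<Otimes>\<^sub>M borel)"
    and f [measurable]: "f \<in> borel_measurable M"
  shows "(\<lambda>x. primitive (u x) (f x)) \<in> borel_measurable M"
proof -
  have [measurable]: "(\<lambda>z. u (fst z) (snd z)) \<in> borel_measurable (M \<Otimes>\<^sub>M unit_measure)"
    using u by (simp cong: measurable_cong_sets)
  have "(\<lambda>x. \<integral>s. (if s \<le> f x then u x s else 0) \<partial>unit_measure) \<in> borel_measurable M"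
    by (rule unit.borel_measurable_lebesgue_integral) measurable
  then show ?thesis by (simp add: primitive_def)
qed

lemma rearrangement_measurable_param:
  assumes u [measurable]: "(\<lambda>z. u (fst z) (snd z)) \<in> borel_measurable (M \<Otimes>\<^sub>M borel)"
    and v [measurable]: "(\<lambda>z. v (fst z) (snd z)) \<in> borel_measurable (M \<Otimes>\<^sub>M borel)"
    and f [measurable]: "f \<in> borel_measurable M"
  shows "(\<lambda>x. rearrangement (u x) (v x) (f x)) \<in> borel_measurable M"
proof -
  have [measurable]: "(\<lambda>x. primitive (u x) (f x)) \<in> borel_measurable M"
    by (rule primitive_measurable_param) measurable
  have [measurable]: "(\<lambda>z. primitive (v (fst z)) (snd z)) \<in> borel_measurable (M \<Otimes>\<^sub>M unit_measure)"
  proof (rule primitive_measurable_param)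
    show "(\<lambda>w. v (fst (fst w)) (snd w)) \<in> borel_measurable ((M \<Otimes>\<^sub>M unit_measure) \<Otimes>\<^sub>M borel)"
      using measurable_compose[OF _ v, of "\<lambda>w. (fst (fst w), snd w)" "(M \<Otimes>\<^sub>M unit_measure) \<Otimes>\<^sub>M borel"] by simp
    show "snd \<in> borel_measurable (M \<Otimes>\<^sub>M unit_measure)"
      using measurable_snd[of M unit_measure] by (simp cong: measurable_cong_sets)
  qed
  have "(\<lambda>x. \<integral>y. (if primitive (v x) y < primitive (u x) (f x) then 1 else 0 :: real) \<partial>unit_measure) \<in> borel_measurable M"
    by (rule unit.borel_measurable_lebesgue_integral) measurable
  then show ?thesis by (simp add: rearrangement_def)
qed

lemma primitive_add:
  assumes [measurable]: "u \<in> borel_measurable borel" "v \<in> borel_measurable borel"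
    and u: "\<And>s. s \<in> {0..1} \<Longrightarrow> \<bar>u s\<bar> \<le> B" and v: "\<And>s. s \<in> {0..1} \<Longrightarrow> \<bar>v s\<bar> \<le> C"
  shows "primitive (\<lambda>s. u s + v s) t = primitive u t + primitive v t"
proof -
  have nn: "0 \<le> B" "0 \<le> C" using u[of 0] v[of 0] by auto
  have "integrable unit_measure (\<lambda>s. if s \<le> t then u s else 0)"
    by (rule integrable_unit_measure[of _ B]) (use u nn in auto)
  moreover have "integrable unit_measure (\<lambda>s. if s \<le> t then v s else 0)"
    by (rule integrable_unit_measure[of _ C]) (use v nn in auto)
  ultimately have "primitive u t + primitive v t = (\<integral>s. (if s \<le> t then u s else 0) + (if s \<le> t then v s else 0) \<partial>unit_measure)"
    unfolding primitive_def by (rule Bochner_Integration.integral_add[symmetric])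
  also have "\<dots> = primitive (\<lambda>s. u s + v s) t"
    unfolding primitive_def by (intro Bochner_Integration.integral_cong) auto
  finally show ?thesis by simp
qed

text \<open>The field with this single component in direction \<open>i\<close> has divergence
  \<open>S\<close>; vanishing line integrals of \<open>S\<close> mean that no flux leaves the
  cube.\<close>

definition line_primitive :: "'n \<Rightarrow> (real ^ 'n \<Rightarrow> real) \<Rightarrow> real ^ 'n \<Rightarrow> real" where
  "line_primitive i S x = primitive (\<lambda>s. S (upd i s x)) (x $ i)"

lemma line_primitive_measurable [measurable]:
  assumes [measurable]: "S \<in> borel_measurable borel"
  shows "line_primitive i S \<in> borel_measurable borel"
  unfolding line_primitive_def[abs_def] by (rule primitive_measurable_param) measurable

definition dens :: "(real ^ 'n \<Rightarrow> real) \<Rightarrow> (real ^ 'n) measure" where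
  "dens \<rho> = density cubeM (\<lambda>x. ennreal (\<rho> x))"

lemma sets_dens [simp, measurable_cong]: "sets (dens \<rho>) = sets borel"
  by (simp add: dens_def)

lemma space_dens [simp]: "space (dens \<rho>) = UNIV"
  by (simp add: dens_def)

lemma finite_measure_dens:
  fixes \<rho> :: "real ^ 'n \<Rightarrow> real"
  assumes [measurable]: "\<rho> \<in> borel_measurable borel" and "\<And>x. x \<in> cube \<Longrightarrow> \<rho> x \<le> A"
  shows "finite_measure (dens \<rho>)"
proof (rule finite_measureI)
  have "(\<integral>\<^sup>+ x. ennreal (\<rho> x) \<partial>cubeM) \<le> (\<integral>\<^sup>+ x. ennreal A \<partial>(cubeM :: (real ^ 'n) measure))"
    by (intro nn_integral_mono_AE AE_cubeI ennreal_leI assms(2))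
  also have "\<dots> = ennreal A"
    by (simp add: ucube.emeasure_space_1[simplified])
  finally have "(\<integral>\<^sup>+ x. ennreal (\<rho> x) \<partial>cubeM) < \<infinity>"
    by (simp add: le_less_trans)
  then show "emeasure (dens \<rho>) (space (dens \<rho>)) \<noteq> \<infinity>"
    by (simp add: dens_def emeasure_density)
qed

text \<open>A kernel that ignores its random argument; \<open>unit_measure\<close> merely fills the
  place of \<open>P\<close>.\<close>

lemma move_map:
  fixes T :: "real ^ 'n \<Rightarrow> real ^ 'n"
  assumes p: "1 \<le> p" and w: "0 < w" and [measurable]: "\<rho> \<in> borel_measurable borel"
    and fin: "finite_measure (dens \<rho>)" and T [measurable]: "T \<in> borel_measurable borel"
    and push: "distr (dens \<rho>) borel T = dens \<sigma>"
    and cost: "(\<integral>\<^sup>+ x. ennreal (\<rho> x) * ennreal (dist x (T x) powr p) \<partial>cubeM) \<le> ennreal (w powr p)"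
  shows "move p w (dens \<rho>) (dens \<sigma>)"
proof (rule move_kernel[OF p w unit.prob_space_axioms fin])
  have fs: "distr (dens \<rho> \<Otimes>\<^sub>M unit_measure) (dens \<rho>) fst = dens \<rho>"
    by (rule unit.distr_pair_fst)
  show "distr (dens \<rho> \<Otimes>\<^sub>M unit_measure) (dens \<sigma>) (\<lambda>z. T (fst z)) = dens \<sigma>"
  proof -
    have "distr (dens \<rho> \<Otimes>\<^sub>M unit_measure) (dens \<sigma>) (\<lambda>z. T (fst z)) =
        distr (distr (dens \<rho> \<Otimes>\<^sub>M unit_measure) (dens \<rho>) fst) borel T"
      by (subst distr_distr) (auto simp: o_def intro!: distr_cong)
    then show ?thesis by (simp add: fs push)
  qed
  have "(\<integral>\<^sup>+ z. ennreal (dist (fst z) (T (fst z)) powr p) \<partial>(dens \<rho> \<Otimes>\<^sub>M unit_measure)) =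
      (\<integral>\<^sup>+ x. ennreal (dist x (T x) powr p) \<partial>distr (dens \<rho> \<Otimes>\<^sub>M unit_measure) (dens \<rho>) fst)"
    by (subst nn_integral_distr) auto
  also have "\<dots> = (\<integral>\<^sup>+ x. ennreal (\<rho> x) * ennreal (dist x (T x) powr p) \<partial>cubeM)"
    unfolding fs by (simp add: dens_def nn_integral_density)
  finally show "(\<integral>\<^sup>+ z. ennreal (dist (fst z) (T (fst z)) powr p) \<partial>(dens \<rho> \<Otimes>\<^sub>M unit_measure)) \<le> ennreal (w powr p)"
    using cost by simp
qed auto

text \<open>Zero line integrals of \<open>S\<close> give both densities the same mass on each line
  in direction \<open>i\<close>, so the lines can be rearranged separately and reassembled by
  \<open>nn_integral_upd\<close>. The factor \<open>a powr (p - 1)\<close> is that of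
  \<open>rearrangement_cost\<close>.\<close>

lemma move_slide:
  fixes \<rho> S :: "real ^ 'n \<Rightarrow> real"
  assumes p: "1 \<le> p" and w: "0 < w" and a: "0 < a"
    and [measurable]: "\<rho> \<in> borel_measurable borel" "S \<in> borel_measurable borel"
    and \<rho>: "\<And>x. x \<in> cube \<Longrightarrow> a \<le> \<rho> x \<and> \<rho> x \<le> A"
    and \<sigma>: "\<And>x. x \<in> cube \<Longrightarrow> a \<le> \<rho> x + S x \<and> \<rho> x + S x \<le> A"
    and mass: "\<And>x. x \<in> cube \<Longrightarrow> primitive (\<lambda>s. S (upd i s x)) 1 = 0"
    and cost: "(\<integral>\<^sup>+ x. ennreal (\<bar>line_primitive i S x\<bar> powr p) \<partial>cubeM) \<le> ennreal (a powr (p - 1) * w powr p)"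
  shows "move p w (dens \<rho>) (dens (\<lambda>x. \<rho> x + S x))"
proof -
  define u where "u x s = \<rho> (upd i s x)" for x s
  define v where "v x s = \<rho> (upd i s x) + S (upd i s x)" for x s
  define T where "T x = upd i (rearrangement (u x) (v x) (x $ i)) x" for x
  have [measurable]: "u x \<in> borel_measurable borel" "v x \<in> borel_measurable borel" for x
    unfolding u_def[abs_def] v_def[abs_def] by measurable
  have Tm [measurable]: "T \<in> borel_measurable borel"
  proof -
    have [measurable]: "(\<lambda>x. rearrangement (u x) (v x) (x $ i)) \<in> borel_measurable borel"
      by (rule rearrangement_measurable_param) (auto simp: u_def v_def)
    show ?thesis unfolding T_def[abs_def] by measurable
  qed
  have ub: "a \<le> u x s \<and> u x s \<le> A" "a \<le> v x s \<and> v x s \<le> A" if "x \<in> cube" "s \<in> {0..1}" for x s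
    using \<rho>[OF upd_in_cube[OF that, of i]] \<sigma>[OF upd_in_cube[OF that, of i]] by (auto simp: u_def v_def)
  have pv: "primitive (v x) t = primitive (u x) t + primitive (\<lambda>s. S (upd i s x)) t" if x: "x \<in> cube" for x t
    unfolding v_def u_def
  proof (rule primitive_add)
    fix s :: real assume s: "s \<in> {0..1}"
    show "\<bar>\<rho> (upd i s x)\<bar> \<le> A" using \<rho>[OF upd_in_cube[OF x s], of i] a by linarith
    show "\<bar>S (upd i s x)\<bar> \<le> A"
      using \<rho>[OF upd_in_cube[OF x s], of i] \<sigma>[OF upd_in_cube[OF x s], of i] a by linarith
  qed auto
  have eq1: "primitive (u x) 1 = primitive (v x) 1" if "x \<in> cube" for x
    using pv[OF that] mass[OF that] by simp
  \<comment> \<open>The profiles depend on \<open>x\<close> only through its line, so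
    \<open>T\<close> acts on every line as one fixed one-dimensional rearrangement.\<close>
  have uu: "u (upd i s x) = u x" "v (upd i s x) = v x" for s x
    by (auto simp: u_def v_def)
  have Tu: "T (upd i s x) = upd i (rearrangement (u x) (v x) s) x" for s x
    by (simp add: T_def uu)
  show ?thesis
  proof (rule move_map[OF p w])
    show "finite_measure (dens \<rho>)"
      by (rule finite_measure_dens[of _ A]) (use \<rho> in auto)
    show "distr (dens \<rho>) borel T = dens (\<lambda>x. \<rho> x + S x)"
    proof (rule measure_eqI)
      fix B assume "B \<in> sets (distr (dens \<rho>) borel T)"
      then have [measurable]: "B \<in> sets borel" by simp
      have "emeasure (distr (dens \<rho>) borel T) B = (\<integral>\<^sup>+ y. indicator B y \<partial>distr (dens \<rho>) borel T)"
        by simp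
      also have "\<dots> = (\<integral>\<^sup>+ x. ennreal (\<rho> x) * indicator B (T x) \<partial>cubeM)"
        by (subst nn_integral_distr) (auto simp: dens_def nn_integral_density)
      also have "\<dots> = (\<integral>\<^sup>+ x. (\<integral>\<^sup>+ s. ennreal (u x s) * indicator B (upd i (rearrangement (u x) (v x) s) x) \<partial>unit_measure) \<partial>cubeM)"
        by (subst nn_integral_upd[of _ i]) (auto simp: Tu u_def)
      also have "\<dots> = (\<integral>\<^sup>+ x. (\<integral>\<^sup>+ s. ennreal (v x s) * indicator B (upd i s x) \<partial>unit_measure) \<partial>cubeM)"
      proof (rule nn_integral_cong_AE, rule AE_cubeI)
        fix x :: "real ^ 'n" assume x: "x \<in> cube"
        have "(\<integral>\<^sup>+ s. ennreal (u x s) * indicator B (upd i (rearrangement (u x) (v x) s) x) \<partial>unit_measure) =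
            (\<integral>\<^sup>+ s. indicator B (upd i s x) \<partial>distr (density unit_measure (\<lambda>s. ennreal (u x s))) borel (rearrangement (u x) (v x)))"
          by (subst nn_integral_distr) (auto simp: nn_integral_density)
        also have "\<dots> = (\<integral>\<^sup>+ s. indicator B (upd i s x) \<partial>density unit_measure (\<lambda>s. ennreal (v x s)))"
          using ub[OF x] a eq1[OF x] by (subst distr_rearrangement[of "u x" "v x" a A]) auto
        finally show "(\<integral>\<^sup>+ s. ennreal (u x s) * indicator B (upd i (rearrangement (u x) (v x) s) x) \<partial>unit_measure) =
            (\<integral>\<^sup>+ s. ennreal (v x s) * indicator B (upd i s x) \<partial>unit_measure)"
          by (simp add: nn_integral_density)
      qed
      also have "\<dots> = (\<integral>\<^sup>+ x. ennreal (\<rho> x + S x) * indicator B x \<partial>cubeM)"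
        by (subst (2) nn_integral_upd[of _ i]) (auto simp: v_def)
      also have "\<dots> = emeasure (dens (\<lambda>x. \<rho> x + S x)) B"
        by (simp add: dens_def emeasure_density)
      finally show "emeasure (distr (dens \<rho>) borel T) B = emeasure (dens (\<lambda>x. \<rho> x + S x)) B" .
    qed simp
    have "ennreal (a powr (p - 1)) * (\<integral>\<^sup>+ x. ennreal (\<rho> x) * ennreal (dist x (T x) powr p) \<partial>cubeM) =
        (\<integral>\<^sup>+ x. ennreal (a powr (p - 1)) * (\<integral>\<^sup>+ s. ennreal (u x s) * ennreal (\<bar>rearrangement (u x) (v x) s - s\<bar> powr p) \<partial>unit_measure) \<partial>cubeM)"
    proof -
      have "dist (upd i s x) (upd i t x) = \<bar>t - s\<bar>" for s t x
      proof -
        have "upd i s x - upd i t x = (s - t) *\<^sub>R axis i 1"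
          by (simp add: vec_eq_iff axis_def)
        then show ?thesis by (simp add: dist_norm norm_axis_1 abs_minus_commute)
      qed
      note d = this
      have "(\<integral>\<^sup>+ x. ennreal (\<rho> x) * ennreal (dist x (T x) powr p) \<partial>cubeM) =
          (\<integral>\<^sup>+ x. (\<integral>\<^sup>+ s. ennreal (u x s) * ennreal (\<bar>rearrangement (u x) (v x) s - s\<bar> powr p) \<partial>unit_measure) \<partial>cubeM)"
        by (subst nn_integral_upd[of _ i]) (auto simp: Tu u_def[symmetric] d)
      then show ?thesis
      proof (subst nn_integral_cmult)
        have [measurable]: "(\<lambda>z. rearrangement (u (fst z)) (v (fst z)) (snd z)) \<in> borel_measurable (borel \<Otimes>\<^sub>M borel)"
          by (rule rearrangement_measurable_param) (auto simp: u_def v_def)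
        have [measurable]: "(\<lambda>z. u (fst z) (snd z)) \<in> borel_measurable (borel \<Otimes>\<^sub>M borel)"
          by (auto simp: u_def)
        show "(\<lambda>x. \<integral>\<^sup>+ s. ennreal (u x s) * ennreal (\<bar>rearrangement (u x) (v x) s - s\<bar> powr p) \<partial>unit_measure) \<in> borel_measurable cubeM"
          by (rule unit.borel_measurable_nn_integral) (auto simp: split_def)
      qed auto
    qed
    also have "\<dots> \<le> (\<integral>\<^sup>+ x. (\<integral>\<^sup>+ s. ennreal (\<bar>line_primitive i S (upd i s x)\<bar> powr p) \<partial>unit_measure) \<partial>cubeM)"
    proof (rule nn_integral_mono_AE, rule AE_cubeI)
      fix x :: "real ^ 'n" assume x: "x \<in> cube"
      have "line_primitive i S (upd i s x) = primitive (v x) s - primitive (u x) s" for s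
        using pv[OF x] by (simp add: line_primitive_def)
      then show "ennreal (a powr (p - 1)) * (\<integral>\<^sup>+ s. ennreal (u x s) * ennreal (\<bar>rearrangement (u x) (v x) s - s\<bar> powr p) \<partial>unit_measure) \<le>
          (\<integral>\<^sup>+ s. ennreal (\<bar>line_primitive i S (upd i s x)\<bar> powr p) \<partial>unit_measure)"
        using rearrangement_cost[of "u x" "v x" a A p] ub[OF x] a eq1[OF x] p
        by (simp add: abs_minus_commute)
    qed
    also have "\<dots> = (\<integral>\<^sup>+ x. ennreal (\<bar>line_primitive i S x\<bar> powr p) \<partial>cubeM)"
      by (rule nn_integral_upd[symmetric]) measurable
    also have "\<dots> \<le> ennreal (a powr (p - 1)) * ennreal (w powr p)"
      using cost by (simp add: ennreal_mult)
    finally show "(\<integral>\<^sup>+ x. ennreal (\<rho> x) * ennreal (dist x (T x) powr p) \<partial>cubeM) \<le> ennreal (w powr p)"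
      using a by (subst (asm) ennreal_mult_le_mult_iff) auto
  qed auto
qed

section \<open>Transport in total variation\<close>

text \<open>For uniform \<open>b\<close> the test \<open>b * r \<le> s\<close> succeeds with
  probability \<open>min 1 (s / r)\<close>; the product form remains meaningful at
  \<open>r = 0\<close>.\<close>

lemma unit_keep_probability:
  fixes r s :: real
  assumes r: "0 \<le> r" and s: "0 \<le> s"
  shows "ennreal r * emeasure unit_measure {b. b * r \<le> s} = ennreal (min r s)"
    and "ennreal r * emeasure unit_measure {b. \<not> b * r \<le> s} = ennreal (max 0 (r - s))"
proof -
  have *: "ennreal r * emeasure unit_measure {b. b * r \<le> s} = ennreal (min r s) \<and>
    ennreal r * emeasure unit_measure {b. \<not> b * r \<le> s} = ennreal (max 0 (r - s))"
  proof (cases "r = 0")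
    case True
    then show ?thesis using s by simp
  next
    case False
    then have r: "0 < r" using r by simp
    define t where "t = min 1 (s / r)"
    have t: "0 \<le> t" "t \<le> 1" "r * t = min r s" "r * (1 - t) = max 0 (r - s)"
      using r s by (auto simp: t_def min_def max_def field_simps)
    have iff: "b * r \<le> s \<longleftrightarrow> b \<le> t" if "b \<in> {0..1}" for b
      using r that by (auto simp: t_def pos_le_divide_eq)
    have "emeasure unit_measure {b. b * r \<le> s} = emeasure unit_measure {0..t}"
      by (intro emeasure_eq_AE AE_unitI) (auto simp: iff)
    moreover have "emeasure unit_measure {b. \<not> b * r \<le> s} = emeasure unit_measure {t<..1}"
      by (intro emeasure_eq_AE AE_unitI) (auto simp: iff)
    ultimately show ?thesis
      using t r measure_unit_interval(1)[of 0 t] measure_unit_interval(2)[of t 1]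
      by (simp flip: ennreal_mult)
  qed
  show "ennreal r * emeasure unit_measure {b. b * r \<le> s} = ennreal (min r s)"
    and "ennreal r * emeasure unit_measure {b. \<not> b * r \<le> s} = ennreal (max 0 (r - s))"
    using * by auto
qed

text \<open>The kernel keeps \<open>x\<close> with probability \<open>min 1 (\<sigma> x / \<rho> x)\<close> and otherwise moves it to a
  point drawn from the normalised excess of \<open>\<sigma>\<close> over \<open>\<rho>\<close>.\<close>

lemma move_total_variation:
  fixes \<rho> \<sigma> :: "real ^ 'n \<Rightarrow> real"
  assumes p: "1 \<le> p" and w: "0 < w"
    and \<rho>m [measurable]: "\<rho> \<in> borel_measurable borel" and \<sigma>m [measurable]: "\<sigma> \<in> borel_measurable borel"
    and \<rho>: "\<And>x. x \<in> cube \<Longrightarrow> 0 \<le> \<rho> x \<and> \<rho> x \<le> A"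
    and \<sigma>: "\<And>x. x \<in> cube \<Longrightarrow> 0 \<le> \<sigma> x \<and> \<sigma> x \<le> A"
    and mass: "(\<integral>\<^sup>+ x. ennreal (\<rho> x) \<partial>cubeM) = (\<integral>\<^sup>+ x. ennreal (\<sigma> x) \<partial>cubeM)"
    and \<delta>: "(\<integral>\<^sup>+ x. ennreal \<bar>\<rho> x - \<sigma> x\<bar> \<partial>cubeM) \<le> ennreal \<delta>" "0 \<le> \<delta>"
    and D: "\<And>x y :: real ^ 'n. x \<in> cube \<Longrightarrow> y \<in> cube \<Longrightarrow> dist x y \<le> D"
    and cost: "D powr p * \<delta> \<le> w powr p"
  shows "move p w (dens \<rho>) (dens \<sigma>)"
proof -
  \<comment> \<open>Common part \<open>k\<close>, deficit \<open>d\<close> and excess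
    \<open>e\<close> of \<open>\<sigma>\<close> relative to \<open>\<rho>\<close>.\<close>
  define k where "k x = min (\<rho> x) (\<sigma> x)" for x
  define d where "d x = max 0 (\<rho> x - \<sigma> x)" for x
  define e where "e x = max 0 (\<sigma> x - \<rho> x)" for x
  define m where "m = (\<integral>\<^sup>+ x. ennreal (e x) \<partial>cubeM)"
  have [measurable]: "k \<in> borel_measurable borel" "d \<in> borel_measurable borel" "e \<in> borel_measurable borel"
    unfolding k_def[abs_def] d_def[abs_def] e_def[abs_def] by measurable
  have kd: "ennreal (\<rho> x) = ennreal (k x) + ennreal (d x)" "ennreal (\<sigma> x) = ennreal (k x) + ennreal (e x)"
    if "x \<in> cube" for x
  proof -
    have "ennreal y = ennreal (min y z) + ennreal (max 0 (y - z))" if "0 \<le> y" "0 \<le> z" for y z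
      using that by (subst ennreal_plus[symmetric]) (auto simp: min_def max_def simp del: ennreal_plus)
    from this[of "\<rho> x" "\<sigma> x"] this[of "\<sigma> x" "\<rho> x"]
    show "ennreal (\<rho> x) = ennreal (k x) + ennreal (d x)" "ennreal (\<sigma> x) = ennreal (k x) + ennreal (e x)"
      using \<rho>[OF that] \<sigma>[OF that] by (simp_all add: k_def d_def e_def min.commute)
  qed
  have fin: "(\<integral>\<^sup>+ x. ennreal (k x) \<partial>cubeM) \<noteq> \<infinity>"
  proof -
    have "(\<integral>\<^sup>+ x. ennreal (k x) \<partial>cubeM) \<le> (\<integral>\<^sup>+ x. ennreal A \<partial>(cubeM :: (real ^ 'n) measure))"
      using \<rho> by (intro nn_integral_mono_AE AE_cubeI ennreal_leI) (force simp: k_def)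
    also have "\<dots> < \<infinity>"
      by (simp add: ucube.emeasure_space_1[simplified])
    finally show ?thesis by simp
  qed
  have "(\<integral>\<^sup>+ x. ennreal (\<rho> x) \<partial>cubeM) = (\<integral>\<^sup>+ x. ennreal (k x) + ennreal (d x) \<partial>cubeM)"
    by (intro nn_integral_cong_AE AE_cubeI kd)
  also have "\<dots> = (\<integral>\<^sup>+ x. ennreal (k x) \<partial>cubeM) + (\<integral>\<^sup>+ x. ennreal (d x) \<partial>cubeM)"
    by (rule nn_integral_add) auto
  finally have I1: "(\<integral>\<^sup>+ x. ennreal (\<rho> x) \<partial>cubeM) = \<dots>" .
  have "(\<integral>\<^sup>+ x. ennreal (\<sigma> x) \<partial>cubeM) = (\<integral>\<^sup>+ x. ennreal (k x) + ennreal (e x) \<partial>cubeM)"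
    by (intro nn_integral_cong_AE AE_cubeI kd)
  also have "\<dots> = (\<integral>\<^sup>+ x. ennreal (k x) \<partial>cubeM) + m"
    unfolding m_def by (rule nn_integral_add) auto
  \<comment> \<open>The common part is finite and cancels, so equal total masses give deficit and
    excess the same mass \<open>m\<close>.\<close>
  finally have dm: "(\<integral>\<^sup>+ x. ennreal (d x) \<partial>cubeM) = m"
    using I1 fin mass by (simp add: ennreal_add_left_cancel)
  have mfin: "m \<noteq> \<infinity>" and d\<delta>: "m \<le> ennreal \<delta>"
  proof -
    have "m \<le> (\<integral>\<^sup>+ x. ennreal \<bar>\<rho> x - \<sigma> x\<bar> \<partial>cubeM)"
      unfolding m_def by (intro nn_integral_mono ennreal_leI) (auto simp: e_def)
    also have "\<dots> \<le> ennreal \<delta>" by (rule \<delta>)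
    finally show "m \<le> ennreal \<delta>" .
    then show "m \<noteq> \<infinity>" by (auto simp: top_unique)
  qed
  show ?thesis
  proof (cases "m = 0")
    \<comment> \<open>The excess cannot be normalised, but then the two densities agree almost
      everywhere.\<close>
    case True
    have null: "AE x in cubeM. h x \<le> 0"
      if [measurable]: "h \<in> borel_measurable borel" and "(\<integral>\<^sup>+ x. ennreal (h x) \<partial>cubeM) = 0"
      for h :: "real ^ 'n \<Rightarrow> real"
    proof -
      have "AE x in cubeM. ennreal (h x) = 0"
        using that by (subst (asm) nn_integral_0_iff_AE) auto
      then show ?thesis by eventually_elim (simp add: ennreal_eq_0_iff)
    qed
    have "AE x in cubeM. e x \<le> 0" "AE x in cubeM. d x \<le> 0"
      using null[of e] null[of d] dm True by (simp_all add: m_def)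
    then have "AE x in cubeM. ennreal (\<rho> x) = ennreal (\<sigma> x)"
      by eventually_elim (auto simp: e_def d_def)
    then have "dens \<rho> = dens \<sigma>"
      unfolding dens_def by (intro density_cong) auto
    then show ?thesis using w p by (simp add: move_refl)
  next
    case False
    define N where "N = density cubeM (\<lambda>x. ennreal (e x) / m)"
    define T where "T y z = (if fst z * \<rho> y \<le> \<sigma> y then y else snd z)" for y :: "real ^ 'n" and z
    have [measurable_cong]: "sets N = sets borel" by (simp add: N_def)
    have [simp]: "space N = UNIV" by (simp add: N_def)
    have NB: "m * emeasure N B = (\<integral>\<^sup>+ x. ennreal (e x) * indicator B x \<partial>cubeM)"
      if [measurable]: "B \<in> sets borel" for B
    proof -
      have "m * emeasure N B = (\<integral>\<^sup>+ x. m * (ennreal (e x) / m * indicator B x) \<partial>cubeM)"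
        by (simp add: N_def emeasure_density nn_integral_cmult)
      also have "\<dots> = (\<integral>\<^sup>+ x. ennreal (e x) * indicator B x \<partial>cubeM)"
        using False mfin
        by (intro nn_integral_cong)
          (simp add: ennreal_times_divide mult.commute[of m] ennreal_mult_divide_eq flip: mult.assoc)
      finally show ?thesis .
    qed
    have "emeasure N UNIV = 1"
    proof -
      have "m * emeasure N UNIV = m * 1" using NB[of UNIV] by (simp add: m_def)
      then show ?thesis using False mfin by (subst (asm) ennreal_mult_cancel_left) auto
    qed
    then interpret N: prob_space N by (intro prob_spaceI) simp
    interpret P: pair_prob_space unit_measure N ..
    have TM: "(\<lambda>z. T (fst z) (snd z)) \<in> borel_measurable (borel \<Otimes>\<^sub>M (borel \<Otimes>\<^sub>M borel))"
      unfolding T_def by measurable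
    then have T' [measurable]: "(\<lambda>z. T (fst z) (snd z)) \<in> dens \<rho> \<Otimes>\<^sub>M (unit_measure \<Otimes>\<^sub>M N) \<rightarrow>\<^sub>M borel"
      by (simp cong: measurable_cong_sets)
    have TM1 [measurable]: "T y \<in> borel_measurable (borel \<Otimes>\<^sub>M borel)" for y
      unfolding T_def[abs_def] by measurable
    interpret dr: finite_measure "dens \<rho>"
      by (rule finite_measure_dens[of _ A]) (use \<rho> in auto)
    \<comment> \<open>The joint law of a point and its image, tested against arbitrary
      \<open>h\<close>: an indicator of the image identifies the new marginal, and the distance
      power gives the cost, to which kept points contribute \<open>0\<close>.\<close>
    have key: "(\<integral>\<^sup>+ z. h (fst z, T (fst z) (snd z)) \<partial>(dens \<rho> \<Otimes>\<^sub>M (unit_measure \<Otimes>\<^sub>M N))) =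
        (\<integral>\<^sup>+ y. ennreal (k y) * h (y, y) + ennreal (d y) * (\<integral>\<^sup>+ z. h (y, z) \<partial>N) \<partial>cubeM)"
      if [measurable]: "h \<in> borel_measurable (borel \<Otimes>\<^sub>M borel)" for h
    proof -
      have inner: "ennreal (\<rho> y) * (\<integral>\<^sup>+ z. h (y, T y z) \<partial>(unit_measure \<Otimes>\<^sub>M N)) =
          ennreal (k y) * h (y, y) + ennreal (d y) * (\<integral>\<^sup>+ z. h (y, z) \<partial>N)" if y: "y \<in> cube" for y
      proof -
        have "(\<integral>\<^sup>+ z. h (y, T y z) \<partial>(unit_measure \<Otimes>\<^sub>M N)) = (\<integral>\<^sup>+ b. (\<integral>\<^sup>+ z. h (y, T y (b, z)) \<partial>N) \<partial>unit_measure)"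
          by (rule N.nn_integral_fst[symmetric]) measurable
        also have "\<dots> = (\<integral>\<^sup>+ b. h (y, y) * indicator {b. b * \<rho> y \<le> \<sigma> y} b +
            (\<integral>\<^sup>+ z. h (y, z) \<partial>N) * indicator {b. \<not> b * \<rho> y \<le> \<sigma> y} b \<partial>unit_measure)"
          by (intro nn_integral_cong) (auto simp: T_def indicator_def N.emeasure_space_1[simplified])
        also have "\<dots> = h (y, y) * emeasure unit_measure {b. b * \<rho> y \<le> \<sigma> y} +
            (\<integral>\<^sup>+ z. h (y, z) \<partial>N) * emeasure unit_measure {b. \<not> b * \<rho> y \<le> \<sigma> y}"
          by (subst nn_integral_add) (auto simp: nn_integral_cmult_indicator)
        finally show ?thesis
          using unit_keep_probability[of "\<rho> y" "\<sigma> y"] \<rho>[OF y] \<sigma>[OF y]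
          by (simp add: distrib_left mult.left_commute[of "ennreal (\<rho> y)"] k_def d_def mult.commute)
      qed
      have hT: "(\<lambda>z. h (fst z, T (fst z) (snd z))) \<in> borel_measurable (borel \<Otimes>\<^sub>M (unit_measure \<Otimes>\<^sub>M N))"
        using TM by (simp cong: measurable_cong_sets)
      then have [measurable]: "(\<lambda>y. \<integral>\<^sup>+ z. h (y, T y z) \<partial>(unit_measure \<Otimes>\<^sub>M N)) \<in> borel_measurable borel"
        by (intro P.borel_measurable_nn_integral) (simp add: split_def)
      have "(\<integral>\<^sup>+ z. h (fst z, T (fst z) (snd z)) \<partial>(dens \<rho> \<Otimes>\<^sub>M (unit_measure \<Otimes>\<^sub>M N))) =
          (\<integral>\<^sup>+ y. (\<integral>\<^sup>+ z. h (y, T y z) \<partial>(unit_measure \<Otimes>\<^sub>M N)) \<partial>dens \<rho>)"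
        using hT by (subst P.nn_integral_fst[symmetric]) (auto cong: measurable_cong_sets)
      also have "\<dots> = (\<integral>\<^sup>+ y. ennreal (\<rho> y) * (\<integral>\<^sup>+ z. h (y, T y z) \<partial>(unit_measure \<Otimes>\<^sub>M N)) \<partial>cubeM)"
        by (simp add: dens_def nn_integral_density)
      also have "\<dots> = (\<integral>\<^sup>+ y. ennreal (k y) * h (y, y) + ennreal (d y) * (\<integral>\<^sup>+ z. h (y, z) \<partial>N) \<partial>cubeM)"
        by (intro nn_integral_cong_AE AE_cubeI inner)
      finally show ?thesis .
    qed
    show ?thesis
    proof (rule move_kernel[OF p w P.prob_space_axioms dr.finite_measure_axioms])
      show "(\<lambda>z. T (fst z) (snd z)) \<in> dens \<rho> \<Otimes>\<^sub>M (unit_measure \<Otimes>\<^sub>M N) \<rightarrow>\<^sub>M dens \<sigma>"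
        using T' by (simp cong: measurable_cong_sets)
      show "distr (dens \<rho> \<Otimes>\<^sub>M (unit_measure \<Otimes>\<^sub>M N)) (dens \<sigma>) (\<lambda>z. T (fst z) (snd z)) = dens \<sigma>"
      proof (rule measure_eqI)
        let ?D = "distr (dens \<rho> \<Otimes>\<^sub>M (unit_measure \<Otimes>\<^sub>M N)) (dens \<sigma>) (\<lambda>z. T (fst z) (snd z))"
        fix B assume "B \<in> sets ?D"
        then have [measurable]: "B \<in> sets borel" by simp
        have "emeasure ?D B = (\<integral>\<^sup>+ z. indicator B z \<partial>?D)" by simp
        also have "\<dots> = (\<integral>\<^sup>+ z. indicator B (T (fst z) (snd z)) \<partial>(dens \<rho> \<Otimes>\<^sub>M (unit_measure \<Otimes>\<^sub>M N)))"
          by (rule nn_integral_distr) auto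
        also have "\<dots> = (\<integral>\<^sup>+ y. ennreal (k y) * indicator B y + ennreal (d y) * emeasure N B \<partial>cubeM)"
          using key[of "\<lambda>z. indicator B (snd z)"] by simp
        also have "\<dots> = (\<integral>\<^sup>+ y. ennreal (k y) * indicator B y \<partial>cubeM) + m * emeasure N B"
          by (subst nn_integral_add) (auto simp: nn_integral_multc dm)
        also have "\<dots> = (\<integral>\<^sup>+ y. (ennreal (k y) + ennreal (e y)) * indicator B y \<partial>cubeM)"
          by (simp add: NB distrib_right nn_integral_add)
        also have "\<dots> = (\<integral>\<^sup>+ y. ennreal (\<sigma> y) * indicator B y \<partial>cubeM)"
          by (intro nn_integral_cong_AE AE_cubeI) (simp add: kd)
        also have "\<dots> = emeasure (dens \<sigma>) B"
          by (simp add: dens_def emeasure_density)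
        finally show "emeasure ?D B = emeasure (dens \<sigma>) B" .
      qed simp
      have "(\<integral>\<^sup>+ z. ennreal (dist (fst z) (T (fst z) (snd z)) powr p) \<partial>(dens \<rho> \<Otimes>\<^sub>M (unit_measure \<Otimes>\<^sub>M N))) =
          (\<integral>\<^sup>+ y. ennreal (d y) * (\<integral>\<^sup>+ z. ennreal (dist y z powr p) \<partial>N) \<partial>cubeM)"
        using key[of "\<lambda>z. ennreal (dist (fst z) (snd z) powr p)"] by simp
      also have "\<dots> \<le> (\<integral>\<^sup>+ y. ennreal (d y) * ennreal (D powr p) \<partial>cubeM)"
      proof (intro nn_integral_mono_AE AE_cubeI mult_left_mono)
        fix y :: "real ^ 'n" assume y: "y \<in> cube"
        have "AE z in N. z \<in> cube"
        proof -
          have "AE z in cubeM. 0 < ennreal (e z) / m \<longrightarrow> z \<in> (cube :: (real ^ 'n) set)"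
            by (rule AE_cubeI) simp
          then show ?thesis unfolding N_def by (subst AE_density) auto
        qed
        then have "(\<integral>\<^sup>+ z. ennreal (dist y z powr p) \<partial>N) \<le> (\<integral>\<^sup>+ z. ennreal (D powr p) \<partial>N)"
          using D[OF y] p by (intro nn_integral_mono_AE) (auto elim!: eventually_mono intro!: ennreal_leI powr_mono2)
        then show "(\<integral>\<^sup>+ z. ennreal (dist y z powr p) \<partial>N) \<le> ennreal (D powr p)"
          by (simp add: N.emeasure_space_1[simplified])
      qed simp
      also have "\<dots> = m * ennreal (D powr p)"
        by (simp add: nn_integral_multc dm)
      also have "\<dots> \<le> ennreal \<delta> * ennreal (D powr p)"
        by (rule mult_right_mono[OF d\<delta>]) simp
      also have "\<dots> \<le> ennreal (w powr p)"
        using cost \<delta> by (simp flip: ennreal_mult add: mult.commute ennreal_leI)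
      finally show "(\<integral>\<^sup>+ z. ennreal (dist (fst z) (T (fst z) (snd z)) powr p) \<partial>(dens \<rho> \<Otimes>\<^sub>M (unit_measure \<Otimes>\<^sub>M N))) \<le> ennreal (w powr p)" .
    qed auto
  qed
qed

section \<open>Transport along the linear interpolation of two densities\<close>

lemma primitive_scale: "primitive (\<lambda>s. c * u s) t = c * primitive u t"
proof -
  have "primitive (\<lambda>s. c * u s) t = (\<integral>s. c * (if s \<le> t then u s else 0) \<partial>unit_measure)"
    unfolding primitive_def by (intro Bochner_Integration.integral_cong) auto
  then show ?thesis by (simp add: primitive_def)
qed

lemma line_primitive_scale: "line_primitive i (\<lambda>x. c * S x) x = c * line_primitive i S x"
  by (simp add: line_primitive_def primitive_scale)

text \<open>The pieces are slid one after another. The intermediate densities are partial sums in no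
  particular order, which is why \<open>bounds\<close> ranges over all subsets.\<close>

lemma move_pieces:
  fixes \<rho> :: "real ^ 'n \<Rightarrow> real" and S :: "'q \<Rightarrow> real ^ 'n \<Rightarrow> real"
  assumes p: "1 \<le> p" and b: "0 < b" and X: "finite X"
    and \<rho>m: "\<rho> \<in> borel_measurable borel"
    and Sm: "\<And>q. q \<in> X \<Longrightarrow> S q \<in> borel_measurable borel"
    and mass: "\<And>q x. q \<in> X \<Longrightarrow> x \<in> cube \<Longrightarrow> primitive (\<lambda>s. S q (upd (dir q) s x)) 1 = 0"
    and c: "\<And>q. q \<in> X \<Longrightarrow> 0 < c q"
    and cost: "\<And>q. q \<in> X \<Longrightarrow> (\<integral>\<^sup>+ x. ennreal (\<bar>line_primitive (dir q) (S q) x\<bar> powr p) \<partial>cubeM) \<le>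
      ennreal (b powr (p - 1) * c q powr p)"
    and bounds: "\<And>Y x. Y \<subseteq> X \<Longrightarrow> x \<in> cube \<Longrightarrow> b \<le> \<rho> x + (\<Sum>q\<in>Y. S q x) \<and> \<rho> x + (\<Sum>q\<in>Y. S q x) \<le> A"
  shows "move p (\<Sum>q\<in>X. c q) (dens \<rho>) (dens (\<lambda>x. \<rho> x + (\<Sum>q\<in>X. S q x)))"
  using X Sm mass c cost bounds
proof (induction X rule: finite_induct)
  case empty
  then show ?case using p by (simp add: move_refl)
next
  case (insert q X)
  have 1: "move p (\<Sum>q\<in>X. c q) (dens \<rho>) (dens (\<lambda>x. \<rho> x + (\<Sum>q\<in>X. S q x)))"
  proof (rule insert.IH)
    show "b \<le> \<rho> x + (\<Sum>q\<in>Y. S q x) \<and> \<rho> x + (\<Sum>q\<in>Y. S q x) \<le> A" if "Y \<subseteq> X" "x \<in> cube" for Y x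
      using insert.prems(5)[of Y x] that by auto
  qed (use insert.prems in auto)
  have "move p (c q) (dens (\<lambda>x. \<rho> x + (\<Sum>q\<in>X. S q x))) (dens (\<lambda>x. \<rho> x + (\<Sum>q\<in>X. S q x) + S q x))"
  proof (rule move_slide[OF p _ b])
    have [measurable]: "\<rho> \<in> borel_measurable borel" "\<And>q. q \<in> X \<Longrightarrow> S q \<in> borel_measurable borel"
      using \<rho>m insert.prems(1) by auto
    show "(\<lambda>x. \<rho> x + (\<Sum>q\<in>X. S q x)) \<in> borel_measurable borel" by measurable
    fix x :: "real ^ 'n" assume x: "x \<in> cube"
    show "b \<le> \<rho> x + (\<Sum>q\<in>X. S q x) \<and> \<rho> x + (\<Sum>q\<in>X. S q x) \<le> A"
      using insert.prems(5)[of X x] x by auto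
    show "b \<le> \<rho> x + (\<Sum>q\<in>X. S q x) + S q x \<and> \<rho> x + (\<Sum>q\<in>X. S q x) + S q x \<le> A"
      using insert.prems(5)[of "insert q X" x] x insert.hyps by (auto simp: algebra_simps)
  qed (use insert.prems in auto)
  with 1 have "move p ((\<Sum>q\<in>X. c q) + c q) (dens \<rho>) (dens (\<lambda>x. \<rho> x + (\<Sum>q\<in>X. S q x) + S q x))"
    by (rule move_trans) (use insert.prems(3) in \<open>force intro: sum_nonneg less_imp_le\<close>)
  then show ?case
    using insert.hyps by (simp add: algebra_simps)
qed

text \<open>Splitting the displacement into many rounds keeps all intermediate densities above \<open>a / 2\<close>.\<close>

lemma move_line_pieces:
  fixes \<rho> :: "real ^ 'n \<Rightarrow> real" and S :: "'q \<Rightarrow> real ^ 'n \<Rightarrow> real" and \<sigma> :: real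
  assumes p: "1 \<le> p" and a: "0 < a" and X: "finite X"
    and \<rho>m [measurable]: "\<rho> \<in> borel_measurable borel"
    and Sm [measurable]: "\<And>q. q \<in> X \<Longrightarrow> S q \<in> borel_measurable borel"
    and SB: "\<And>q x. q \<in> X \<Longrightarrow> x \<in> cube \<Longrightarrow> \<bar>S q x\<bar> \<le> B"
    and mass: "\<And>q x. q \<in> X \<Longrightarrow> x \<in> cube \<Longrightarrow> primitive (\<lambda>s. S q (upd (dir q) s x)) 1 = 0"
    and c: "\<And>q. q \<in> X \<Longrightarrow> 0 < c q"
    and cost: "\<And>q. q \<in> X \<Longrightarrow> (\<integral>\<^sup>+ x. ennreal (\<bar>line_primitive (dir q) (S q) x\<bar> powr p) \<partial>cubeM) \<le>
      ennreal (c q powr p)"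
    and start: "\<And>x. x \<in> cube \<Longrightarrow> a \<le> \<rho> x \<and> \<rho> x \<le> A"
    and final: "\<And>x. x \<in> cube \<Longrightarrow> a \<le> \<rho> x + \<sigma> * (\<Sum>q\<in>X. S q x) \<and> \<rho> x + \<sigma> * (\<Sum>q\<in>X. S q x) \<le> A"
  shows "move p ((a / 2) powr (-(1 - 1 / p)) * \<bar>\<sigma>\<bar> * (\<Sum>q\<in>X. c q)) (dens \<rho>)
    (dens (\<lambda>x. \<rho> x + \<sigma> * (\<Sum>q\<in>X. S q x)))"
proof (cases "\<sigma> = 0")
  case True
  then show ?thesis using p by (simp add: move_refl)
next
  case False
  define T where "T x = (\<Sum>q\<in>X. S q x)" for x
  have [measurable]: "T \<in> borel_measurable borel" unfolding T_def[abs_def] by measurable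
  define b where "b = a / 2"
  have b: "0 < b" using a by (simp add: b_def)
  \<comment> \<open>With at least \<open>E\<close> rounds, each round changes the density by at most
    \<open>b\<close>, whichever of its pieces have been applied. \<open>B\<close> may be negative
    when \<open>X\<close> is empty, hence \<open>\<bar>B\<bar>\<close>.\<close>
  define E where "E = \<bar>\<sigma>\<bar> * (real (card X) * \<bar>B\<bar>) / b"
  obtain N0 :: nat where N0: "E \<le> real N0" using real_arch_simple by blast
  define N where "N = Suc N0"
  have N: "0 < real N" "E \<le> real N" using N0 by (auto simp: N_def)
  define \<epsilon> where "\<epsilon> = \<sigma> / real N"
  have \<epsilon>: "\<epsilon> \<noteq> 0" "\<bar>\<epsilon>\<bar> = \<bar>\<sigma>\<bar> / real N" using False N by (auto simp: \<epsilon>_def)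
  have small: "\<bar>\<Sum>q\<in>Y. \<epsilon> * S q x\<bar> \<le> b" if "Y \<subseteq> X" "x \<in> cube" for Y x
  proof -
    have "\<bar>\<Sum>q\<in>Y. \<epsilon> * S q x\<bar> \<le> (\<Sum>q\<in>Y. \<bar>\<epsilon> * S q x\<bar>)" by (rule sum_abs)
    also have "\<dots> \<le> (\<Sum>q\<in>X. \<bar>\<epsilon> * S q x\<bar>)" using X that by (intro sum_mono2) auto
    also have "\<dots> \<le> (\<Sum>q\<in>X. \<bar>\<epsilon>\<bar> * \<bar>B\<bar>)"
      using SB that by (intro sum_mono) (force simp: abs_mult intro!: mult_left_mono)
    also have "\<dots> = E * b / real N" using b by (simp add: E_def \<epsilon>)
    also have "\<dots> \<le> b" using N b by (simp add: divide_le_eq mult.commute)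
    finally show ?thesis .
  qed
  define R where "R k x = \<rho> x + real k * \<epsilon> * T x" for k x
  have R: "a \<le> R k x \<and> R k x \<le> A" if "k \<le> N" "x \<in> cube" for k x
  proof -
    define t where "t = real k / real N"
    have t: "0 \<le> t" "t \<le> 1" using that N by (auto simp: t_def)
    have e: "R k x = (1 - t) * \<rho> x + t * (\<rho> x + \<sigma> * T x)"
      by (simp add: R_def \<epsilon>_def t_def algebra_simps)
    have "(1 - t) * a + t * a \<le> R k x" "R k x \<le> (1 - t) * A + t * A"
      unfolding e T_def using t start[OF that(2)] final[OF that(2)]
      by (auto intro!: add_mono mult_left_mono)
    then show ?thesis by (simp add: algebra_simps)
  qed
  \<comment> \<open>The exponent is chosen so that \<open>b powr (p - 1) * w q powr p\<close> is the
    bound \<open>(\<bar>\<epsilon>\<bar> * c q) powr p\<close> on the line cost of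
    \<open>\<epsilon> * S q\<close>.\<close>
  define w where "w q = b powr (-(1 - 1 / p)) * \<bar>\<epsilon>\<bar> * c q" for q
  have step: "move p (\<Sum>q\<in>X. w q) (dens (R k)) (dens (R (Suc k)))" if k: "k < N" for k
  proof -
    have "move p (\<Sum>q\<in>X. w q) (dens (R k)) (dens (\<lambda>x. R k x + (\<Sum>q\<in>X. \<epsilon> * S q x)))"
    proof (rule move_pieces[OF p b X, where A = "A + b" and dir = dir])
      show "R k \<in> borel_measurable borel" unfolding R_def[abs_def] by measurable
      show "0 < w q" if "q \<in> X" for q using c[OF that] b \<epsilon>(1) unfolding w_def by (intro mult_pos_pos) auto
      show "b \<le> R k x + (\<Sum>q\<in>Y. \<epsilon> * S q x) \<and> R k x + (\<Sum>q\<in>Y. \<epsilon> * S q x) \<le> A + b"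
        if "Y \<subseteq> X" "x \<in> cube" for Y x
        using small[OF that] R[of k x] k that by (auto simp: b_def)
      show "primitive (\<lambda>s. \<epsilon> * S q (upd (dir q) s x)) 1 = 0" if "q \<in> X" "x \<in> cube" for q x
        using mass[OF that] by (simp add: primitive_scale)
      show "(\<integral>\<^sup>+ x. ennreal (\<bar>line_primitive (dir q) (\<lambda>x. \<epsilon> * S q x) x\<bar> powr p) \<partial>cubeM) \<le>
          ennreal (b powr (p - 1) * w q powr p)" if q: "q \<in> X" for q
      proof -
        have "(\<integral>\<^sup>+ x. ennreal (\<bar>line_primitive (dir q) (\<lambda>x. \<epsilon> * S q x) x\<bar> powr p) \<partial>cubeM) =
            (\<integral>\<^sup>+ x. ennreal (\<bar>\<epsilon>\<bar> powr p) * ennreal (\<bar>line_primitive (dir q) (S q) x\<bar> powr p) \<partial>cubeM)"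
          by (simp add: line_primitive_scale abs_mult powr_mult ennreal_mult)
        also have "\<dots> = ennreal (\<bar>\<epsilon>\<bar> powr p) * (\<integral>\<^sup>+ x. ennreal (\<bar>line_primitive (dir q) (S q) x\<bar> powr p) \<partial>cubeM)"
          using q by (intro nn_integral_cmult) measurable
        also have "\<dots> \<le> ennreal (\<bar>\<epsilon>\<bar> powr p) * ennreal (c q powr p)"
          by (rule mult_left_mono[OF cost[OF q]]) simp
        also have "\<dots> = ennreal (b powr (p - 1) * w q powr p)"
        proof -
          have "(b powr (-(1 - 1 / p))) powr p = b powr (-(p - 1))"
            using p by (simp add: powr_powr algebra_simps)
          then have "b powr (p - 1) * w q powr p = (b powr (p - 1) * b powr (-(p - 1))) * (\<bar>\<epsilon>\<bar> powr p * c q powr p)"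
            using c[OF q] by (simp add: w_def powr_mult)
          also have "b powr (p - 1) * b powr (-(p - 1)) = 1"
            using b by (simp flip: powr_add)
          finally show ?thesis by (simp flip: ennreal_mult)
        qed
        finally show ?thesis .
      qed
    qed measurable
    moreover have "R k x + (\<Sum>q\<in>X. \<epsilon> * S q x) = R (Suc k) x" for x
    proof -
      have "(\<Sum>q\<in>X. \<epsilon> * S q x) = \<epsilon> * T x" by (simp add: T_def sum_distrib_left)
      then show ?thesis by (simp add: R_def algebra_simps)
    qed
    ultimately show ?thesis by simp
  qed
  have "move p (\<Sum>k<N. \<Sum>q\<in>X. w q) (dens (R 0)) (dens (R N))"
  proof (rule move_chain[where \<rho> = "\<lambda>k. dens (R k)" and w = "\<lambda>k. \<Sum>q\<in>X. w q"])
    show "0 \<le> (\<Sum>q\<in>X. w q)" using less_imp_le[OF c] b unfolding w_def by (intro sum_nonneg mult_nonneg_nonneg) auto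
  qed (use p step in auto)
  moreover have "R 0 = \<rho>" "R N = (\<lambda>x. \<rho> x + \<sigma> * T x)"
    using N by (auto simp: R_def \<epsilon>_def)
  \<comment> \<open>Costs are proportional to displacements, so the number of rounds cancels:
    \<open>real N * \<bar>\<epsilon>\<bar> = \<bar>\<sigma>\<bar>\<close>.\<close>
  moreover have "(\<Sum>k<N. \<Sum>q\<in>X. w q) = b powr (-(1 - 1 / p)) * \<bar>\<sigma>\<bar> * (\<Sum>q\<in>X. c q)"
  proof -
    have "(\<Sum>k<N. \<Sum>q\<in>X. w q) = real N * (b powr (-(1 - 1 / p)) * \<bar>\<epsilon>\<bar> * (\<Sum>q\<in>X. c q))"
      by (simp add: w_def sum_distrib_left)
    then show ?thesis using N by (simp add: \<epsilon>)
  qed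
  ultimately show ?thesis by (simp add: b_def T_def)
qed

lemma geometric_sum_le:
  fixes q :: real
  assumes "0 \<le> q" "q < 1"
  shows "(\<Sum>i<n. q ^ (i + 2)) \<le> 1 / (1 - q)"
proof -
  have "(\<Sum>i<n. q ^ (i + 2)) \<le> (\<Sum>i<n. q ^ i)"
    using assms by (intro sum_mono power_decreasing) auto
  also have "\<dots> \<le> (\<Sum>i. q ^ i)"
    using assms by (intro sum_le_suminf) auto
  also have "\<dots> = 1 / (1 - q)"
    using assms by (simp add: suminf_geometric)
  finally show ?thesis .
qed

text \<open>The density at time \<open>t\<close> of the linear interpolation is at least \<open>m * min t (1 - t)\<close>, so time is
  cut dyadically towards both ends.\<close>

lemma move_interpolation:
  fixes f :: "real ^ 'n \<Rightarrow> real" and S :: "'q \<Rightarrow> real ^ 'n \<Rightarrow> real"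
  assumes p: "1 \<le> p" and m: "0 < m" and X: "finite X"
    and fm [measurable]: "f \<in> borel_measurable borel"
    and Sm [measurable]: "\<And>q. q \<in> X \<Longrightarrow> S q \<in> borel_measurable borel"
    and SB: "\<And>q x. q \<in> X \<Longrightarrow> x \<in> cube \<Longrightarrow> \<bar>S q x\<bar> \<le> B"
    and mass: "\<And>q x. q \<in> X \<Longrightarrow> x \<in> cube \<Longrightarrow> primitive (\<lambda>s. S q (upd (dir q) s x)) 1 = 0"
    and c: "\<And>q. q \<in> X \<Longrightarrow> 0 < c q"
    and cost: "\<And>q. q \<in> X \<Longrightarrow> (\<integral>\<^sup>+ x. ennreal (\<bar>line_primitive (dir q) (S q) x\<bar> powr p) \<partial>cubeM) \<le>
      ennreal (c q powr p)"
    and T: "T = (\<lambda>x. \<Sum>q\<in>X. S q x)"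
    and nonneg: "\<And>x. x \<in> cube \<Longrightarrow> 0 \<le> f x \<and> f x \<le> A \<and> 0 \<le> f x + T x \<and> f x + T x \<le> A"
    and lower: "\<And>x. x \<in> cube \<Longrightarrow> m \<le> max (f x) (f x + T x)"
  shows "move p (2 / (1 - 2 powr (-1 / p)) * (m / 2) powr (-(1 - 1 / p)) * (\<Sum>q\<in>X. c q))
    (dens (\<lambda>x. f x + (1 / 2) ^ (Suc n) * T x)) (dens (\<lambda>x. f x + (1 - (1 / 2) ^ (Suc n)) * T x))"
proof -
  define C where "C = (\<Sum>q\<in>X. c q)"
  have C: "0 \<le> C" unfolding C_def by (rule sum_nonneg) (rule less_imp_le[OF c])
  define R where "R t x = f x + t * T x" for t x
  have Tm [measurable]: "T \<in> borel_measurable borel" unfolding T by measurable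
  \<comment> \<open>At each point one of the two endpoint densities is at least \<open>m\<close>,
    and its weight in the convex combination is at least \<open>\<theta>\<close>; which endpoint it
    is may change from point to point.\<close>
  have Rlow: "\<theta> * m \<le> R t x \<and> R t x \<le> A" if "0 \<le> \<theta>" "\<theta> \<le> t" "t \<le> 1 - \<theta>" "x \<in> cube" for \<theta> t x
  proof -
    have t: "0 \<le> t" "t \<le> 1" using that by auto
    have e: "R t x = (1 - t) * f x + t * (f x + T x)"
      by (simp add: R_def algebra_simps)
    note n = nonneg[OF that(4)]
    have "R t x \<le> (1 - t) * A + t * A"
      unfolding e using t n by (intro add_mono mult_left_mono) auto
    moreover have "\<theta> * m \<le> R t x"
    proof (cases "m \<le> f x")
      case True
      have "\<theta> * m \<le> (1 - t) * f x" using that True m by (intro mult_mono) auto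
      then show ?thesis unfolding e using t n by (simp add: add_increasing2)
    next
      case False
      then have "m \<le> f x + T x" using lower[OF that(4)] by auto
      then have "\<theta> * m \<le> t * (f x + T x)" using that m t by (intro mult_mono) auto
      then show ?thesis unfolding e using t n by (simp add: add_increasing)
    qed
    ultimately show ?thesis by (simp add: algebra_simps)
  qed
  \<comment> \<open>The density is at least \<open>\<theta> * m\<close> during a step of length
    \<open>\<theta>\<close>, and \<open>\<theta> powr (-(1 - 1 / p)) * \<theta>\<close> leaves the
    positive power \<open>\<theta> powr (1 / p)\<close>.\<close>
  have step: "move p ((m / 2) powr (-(1 - 1 / p)) * \<theta> powr (1 / p) * C) (dens (R s)) (dens (R t))"
    if \<theta>: "0 < \<theta>" "\<theta> \<le> s" "s \<le> 1 - \<theta>" "\<theta> \<le> t" "t \<le> 1 - \<theta>" "\<bar>t - s\<bar> = \<theta>" for \<theta> s t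
  proof -
    have eq: "R s x + (t - s) * (\<Sum>q\<in>X. S q x) = R t x" for x
      by (simp add: R_def T algebra_simps)
    have "move p ((\<theta> * m / 2) powr (-(1 - 1 / p)) * \<bar>t - s\<bar> * (\<Sum>q\<in>X. c q)) (dens (R s))
        (dens (\<lambda>x. R s x + (t - s) * (\<Sum>q\<in>X. S q x)))"
    proof (rule move_line_pieces[OF p _ X, where B = B and dir = dir and A = A])
      show "R s \<in> borel_measurable borel" unfolding R_def[abs_def] by measurable
    qed (use m \<theta> Rlow[of \<theta> s] Rlow[of \<theta> t] SB mass c cost in \<open>auto simp: eq\<close>)
    moreover have "(\<theta> * m / 2) powr (-(1 - 1 / p)) * \<bar>t - s\<bar> = (m / 2) powr (-(1 - 1 / p)) * \<theta> powr (1 / p)"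
    proof -
      have "(\<theta> * m / 2) powr (-(1 - 1 / p)) = \<theta> powr (-(1 - 1 / p)) * (m / 2) powr (-(1 - 1 / p))"
        using \<theta> m by (subst powr_mult[symmetric]) auto
      moreover have "\<theta> powr (-(1 - 1 / p)) * \<theta> = \<theta> powr (1 / p)"
        using \<theta> powr_add[of \<theta> "-(1 - 1 / p)" 1] by simp
      ultimately show ?thesis using \<theta>(6) by (simp add: mult.assoc mult.left_commute)
    qed
    ultimately show ?thesis by (simp add: eq C_def)
  qed
  \<comment> \<open>The ratio of the costs of consecutive dyadic steps, below \<open>1\<close> since
    \<open>p\<close> is finite; the constant \<open>2 / (1 - q)\<close> counts the geometric series
    at both ends.\<close>
  define q where "q = 2 powr (-1 / p)"
  have q: "0 \<le> q" "q < 1" using p by (auto simp: q_def intro: powr_less_one)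
  have qp: "((1 / 2) ^ k) powr (1 / p) = q ^ k" for k :: nat
  proof -
    have "((1 / 2 :: real) ^ k) powr (1 / p) = (2 powr (- real k)) powr (1 / p)"
      by (simp add: powr_minus powr_realpow power_one_over inverse_eq_divide)
    also have "\<dots> = q ^ k"
      by (simp add: q_def powr_powr mult.commute flip: powr_realpow)
    finally show ?thesis .
  qed
  define K where "K = (m / 2) powr (-(1 - 1 / p)) * C"
  have K: "0 \<le> K" using C by (simp add: K_def)
  have half: "(1 / 2 :: real) ^ (k + 1) \<le> 1 / 2" for k
    by (simp add: power_le_one)
  \<comment> \<open>A step leads from \<open>(1 / 2) ^ (j + 2)\<close> to
    \<open>(1 / 2) ^ (j + 1)\<close>, so its length equals its starting time. The index is reversed
    because the chain starts at the smallest time.\<close>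
  have up: "move p (\<Sum>k<n. K * q ^ (n - Suc k + 2)) (dens (R ((1 / 2) ^ (n - 0 + 1)))) (dens (R ((1 / 2) ^ (n - n + 1))))"
  proof (rule move_chain[where \<rho> = "\<lambda>k. dens (R ((1 / 2) ^ (n - k + 1)))"])
    fix k assume k: "k < n"
    define j where "j = n - Suc k"
    have j: "n - k + 1 = j + 2" "n - Suc k + 1 = j + 1" using k by (auto simp: j_def)
    have "move p ((m / 2) powr (-(1 - 1 / p)) * ((1 / 2) ^ (j + 2)) powr (1 / p) * C)
        (dens (R ((1 / 2) ^ (j + 2)))) (dens (R ((1 / 2) ^ (j + 1))))"
      using half[of j] by (intro step) auto
    then show "move p (K * q ^ (n - Suc k + 2)) (dens (R ((1 / 2) ^ (n - k + 1)))) (dens (R ((1 / 2) ^ (n - Suc k + 1))))"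
      unfolding j qp by (simp add: K_def j_def mult.commute mult.left_commute)
  qed (use K q p in auto)
  have down: "move p (\<Sum>k<n. K * q ^ (k + 2)) (dens (R (1 - (1 / 2) ^ (0 + 1)))) (dens (R (1 - (1 / 2) ^ (n + 1))))"
  proof (rule move_chain[where \<rho> = "\<lambda>k. dens (R (1 - (1 / 2) ^ (k + 1)))"])
    fix k assume k: "k < n"
    have "move p ((m / 2) powr (-(1 - 1 / p)) * ((1 / 2) ^ (k + 2)) powr (1 / p) * C)
        (dens (R (1 - (1 / 2) ^ (k + 1)))) (dens (R (1 - (1 / 2) ^ (Suc k + 1))))"
      using half[of k] by (intro step) auto
    then show "move p (K * q ^ (k + 2)) (dens (R (1 - (1 / 2) ^ (k + 1)))) (dens (R (1 - (1 / 2) ^ (Suc k + 1))))"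
      unfolding qp by (simp add: K_def mult.commute mult.left_commute)
  qed (use K q p in auto)
  have "move p ((\<Sum>k<n. K * q ^ (n - Suc k + 2)) + (\<Sum>k<n. K * q ^ (k + 2)))
      (dens (R ((1 / 2) ^ (n + 1)))) (dens (R (1 - (1 / 2) ^ (n + 1))))"
    using up down K q by (intro move_trans[of p _ _ "dens (R (1 / 2))"]) (auto intro!: sum_nonneg)
  moreover have "(\<Sum>k<n. K * q ^ (n - Suc k + 2)) = (\<Sum>k<n. K * q ^ (k + 2))"
    by (rule sum.nat_diff_reindex)
  moreover have "(\<Sum>k<n. K * q ^ (k + 2)) \<le> K * (1 / (1 - q))"
    unfolding sum_distrib_left[symmetric] using geometric_sum_le[OF q] K by (intro mult_left_mono) auto
  moreover have "0 \<le> (\<Sum>k<n. K * q ^ (k + 2))"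
    using K q by (auto intro!: sum_nonneg)
  ultimately have "move p (2 * (K * (1 / (1 - q)))) (dens (R ((1 / 2) ^ (n + 1)))) (dens (R (1 - (1 / 2) ^ (n + 1))))"
    using p by (elim move_mono) auto
  then show ?thesis
    by (simp add: R_def[abs_def] K_def C_def q_def mult.commute mult.left_commute)
qed

section \<open>Decomposition of functions supported in boxes\<close>

lemma upd_commute: "i \<noteq> j \<Longrightarrow> upd i s (upd j t x) = upd j t (upd i s x)"
  by (simp add: vec_eq_iff)

lemma primitive_at_1: "u \<in> borel_measurable borel \<Longrightarrow> primitive u 1 = (\<integral>s. u s \<partial>unit_measure)"
  unfolding primitive_def by (intro integral_cong_AE AE_unitI) auto

lemma integral_unit_interval_indicator:
  fixes c :: real
  assumes "0 \<le> a" "a \<le> b" "b \<le> 1"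
  shows "(\<integral>s. c * indicator {a..b} s \<partial>unit_measure) = c * (b - a)"
  using measure_unit_interval(1)[OF assms] assms by (simp add: measure_def)

lemma integral_unit_bound:
  fixes u :: "real \<Rightarrow> real"
  assumes [measurable]: "u \<in> borel_measurable borel" and ab: "0 \<le> a" "a \<le> b" "b \<le> 1"
    and u: "\<And>s. s \<in> {0..1} \<Longrightarrow> \<bar>u s\<bar> \<le> A * indicator {a..b} s"
  shows "\<bar>\<integral>s. u s \<partial>unit_measure\<bar> \<le> A * (b - a)"
proof -
  have "\<bar>\<integral>s. u s \<partial>unit_measure\<bar> \<le> (\<integral>s. A * indicator {a..b} s \<partial>unit_measure)"
  proof (rule order_trans[OF integral_abs_bound integral_mono_AE])
    have uA: "\<bar>u s\<bar> \<le> \<bar>A\<bar>" if "s \<in> {0..1}" for s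
      using u[OF that] by (cases "s \<in> {a..b}") auto
    show "integrable unit_measure (\<lambda>s. \<bar>u s\<bar>)"
      by (rule integrable_unit_measure[where B = "\<bar>A\<bar>"]) (use uA in auto)
    show "integrable unit_measure (\<lambda>s. A * indicator {a..b} s)"
      by (rule integrable_unit_measure[where B = "\<bar>A\<bar>"]) (auto simp: indicator_def)
    show "AE s in unit_measure. \<bar>u s\<bar> \<le> A * indicator {a..b} s"
      by (rule AE_unitI) (rule u)
  qed
  then show ?thesis by (simp only: integral_unit_interval_indicator[OF ab])
qed

context
  fixes l u :: "real ^ 'n"
  assumes lu: "\<And>k. 0 \<le> l $ k \<and> l $ k < u $ k \<and> u $ k \<le> 1"
begin

lemma upd_in_box_iff: "upd k s x \<in> cbox l u \<longleftrightarrow> (\<forall>j. j \<noteq> k \<longrightarrow> l $ j \<le> x $ j \<and> x $ j \<le> u $ j) \<and> s \<in> {l $ k..u $ k}"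
  by (auto simp: mem_box_cart)

text \<open>For \<open>G\<close> supported in the box this is the average over the segment of the
  line inside the box, cut off to the box again.\<close>

definition line_mean :: "'n \<Rightarrow> (real ^ 'n \<Rightarrow> real) \<Rightarrow> real ^ 'n \<Rightarrow> real" where
  "line_mean k G x = indicator (cbox l u) x * (\<integral>s. G (upd k s x) \<partial>unit_measure) / (u $ k - l $ k)"

lemma line_mean_measurable [measurable]:
  assumes [measurable]: "G \<in> borel_measurable borel"
  shows "line_mean k G \<in> borel_measurable borel"
proof -
  have [measurable]: "(\<lambda>x. \<integral>s. G (upd k s x) \<partial>unit_measure) \<in> borel_measurable borel"
    by (rule unit.borel_measurable_lebesgue_integral) measurable
  show ?thesis unfolding line_mean_def[abs_def] by measurable
qed

lemma line_mean_bound: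
  assumes [measurable]: "G \<in> borel_measurable borel"
    and G: "\<And>x. \<bar>G x\<bar> \<le> A" "\<And>x. x \<notin> cbox l u \<Longrightarrow> G x = 0"
  shows "\<bar>line_mean k G x\<bar> \<le> A"
proof -
  have A: "0 \<le> A" using G(1)[of 0] by linarith
  have "\<bar>G (upd k s x)\<bar> \<le> A * indicator {l $ k..u $ k} s" for s
  proof (cases "s \<in> {l $ k..u $ k}")
    case False
    then have "upd k s x \<notin> cbox l u" by (simp add: upd_in_box_iff)
    then show ?thesis using False G(2) by simp
  qed (simp add: G(1))
  then have "\<bar>\<integral>s. G (upd k s x) \<partial>unit_measure\<bar> \<le> A * (u $ k - l $ k)"
    using lu[of k] by (intro integral_unit_bound) auto
  then show ?thesis
    using lu[of k] A by (auto simp: line_mean_def indicator_def divide_le_eq abs_divide)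
qed

text \<open>On lines meeting the box the constant mean, spread over the side, restores the integral
  of \<open>G\<close>; on all other lines both functions vanish.\<close>

lemma line_mean_integral:
  assumes [measurable]: "G \<in> borel_measurable borel"
    and G: "\<And>x. \<bar>G x\<bar> \<le> A" "\<And>x. x \<notin> cbox l u \<Longrightarrow> G x = 0"
  shows "(\<integral>s. G (upd k s x) - line_mean k G (upd k s x) \<partial>unit_measure) = 0"
proof -
  define J where "J = (\<integral>s. G (upd k s x) \<partial>unit_measure)"
  define X where "X \<longleftrightarrow> (\<forall>j. j \<noteq> k \<longrightarrow> l $ j \<le> x $ j \<and> x $ j \<le> u $ j)"
  have iff: "upd k s x \<in> cbox l u \<longleftrightarrow> X \<and> s \<in> {l $ k..u $ k}" for s
    by (simp add: upd_in_box_iff X_def)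
  have mean: "line_mean k G (upd k s x) = (if X then J / (u $ k - l $ k) else 0) * indicator {l $ k..u $ k} s" for s
    by (simp add: line_mean_def J_def indicator_def iff)
  have "integrable unit_measure (\<lambda>s. G (upd k s x))"
    by (rule integrable_unit_measure[where B = A]) (auto simp: G)
  moreover have "integrable unit_measure (\<lambda>s. line_mean k G (upd k s x))"
    by (rule integrable_unit_measure[where B = A]) (auto intro: line_mean_bound G)
  ultimately have "(\<integral>s. G (upd k s x) - line_mean k G (upd k s x) \<partial>unit_measure) =
      J - (\<integral>s. line_mean k G (upd k s x) \<partial>unit_measure)"
    unfolding J_def by (rule Bochner_Integration.integral_diff)
  also have "(\<integral>s. line_mean k G (upd k s x) \<partial>unit_measure) = (if X then J else 0)"
    unfolding mean using lu[of k] by (subst integral_unit_interval_indicator) auto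
  also have "J - \<dots> = 0"
  proof (cases X)
    case False
    then have "J = 0" by (simp add: J_def G(2) iff)
    then show ?thesis by simp
  qed simp
  finally show ?thesis .
qed

lemma line_mean_total:
  assumes [measurable]: "G \<in> borel_measurable borel"
    and G: "\<And>x. \<bar>G x\<bar> \<le> A" "\<And>x. x \<notin> cbox l u \<Longrightarrow> G x = 0"
  shows "(\<integral>x. line_mean k G x \<partial>cubeM) = (\<integral>x. G x \<partial>cubeM)"
proof -
  have b: "\<bar>line_mean k G x\<bar> \<le> A" for x by (rule line_mean_bound) (use G in auto)
  have I: "integrable cubeM G" "integrable cubeM (line_mean k G)"
    by (rule ucube.integrable_const_bound[of _ A]; simp add: G b)+
  have "(\<integral>x. G x - line_mean k G x \<partial>cubeM) =
      (\<integral>x. (\<integral>s. G (upd k s x) - line_mean k G (upd k s x) \<partial>unit_measure) \<partial>cubeM)"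
  proof (rule integral_upd)
    fix x show "\<bar>G x - line_mean k G x\<bar> \<le> 2 * A"
      using G(1)[of x] b[of x] by linarith
  qed measurable
  then have "(\<integral>x. G x - line_mean k G x \<partial>cubeM) = 0"
    by (simp add: line_mean_integral[OF assms(1) G])
  then show ?thesis using I by simp
qed

text \<open>Averaging successively over the coordinates turns \<open>S\<close> into a function that is constant on the
  box, hence zero; the differences of consecutive averages have vanishing line integrals.\<close>

lemma box_decomposition_partial:
  fixes S :: "real ^ 'n \<Rightarrow> real"
  assumes Sm [measurable]: "S \<in> borel_measurable borel"
    and S: "\<And>x. \<bar>S x\<bar> \<le> A" "\<And>x. x \<notin> cbox l u \<Longrightarrow> S x = 0"
    and "finite D"
  shows "\<exists>G P. G \<in> borel_measurable borel \<and> (\<forall>x. \<bar>G x\<bar> \<le> A) \<and> (\<forall>x. x \<notin> cbox l u \<longrightarrow> G x = 0) \<and>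
    (\<integral>x. G x \<partial>cubeM) = (\<integral>x. S x \<partial>cubeM) \<and>
    (\<forall>k\<in>D. \<forall>x\<in>cbox l u. \<forall>s\<in>{l $ k..u $ k}. G (upd k s x) = G x) \<and>
    (\<forall>x. S x = G x + (\<Sum>i\<in>D. P i x)) \<and>
    (\<forall>i\<in>D. P i \<in> borel_measurable borel \<and> (\<forall>x. \<bar>P i x\<bar> \<le> 2 * A) \<and> (\<forall>x. x \<notin> cbox l u \<longrightarrow> P i x = 0) \<and>
       (\<forall>x. (\<integral>s. P i (upd i s x) \<partial>unit_measure) = 0))"
    (is "\<exists>G P. ?Q D G P")
  using \<open>finite D\<close>
proof (induction D rule: finite_induct)
  case empty
  show ?case by (rule exI[of _ S]) (use S in auto)
next
  case (insert k D)
  then obtain G P where GP: "?Q D G P" by (elim exE)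
  then have Gm [measurable]: "G \<in> borel_measurable borel"
    and G: "\<And>x. \<bar>G x\<bar> \<le> A" "\<And>x. x \<notin> cbox l u \<Longrightarrow> G x = 0"
    and GS: "(\<integral>x. G x \<partial>cubeM) = (\<integral>x. S x \<partial>cubeM)"
    and Ginv: "\<And>k x s. k \<in> D \<Longrightarrow> x \<in> cbox l u \<Longrightarrow> s \<in> {l $ k..u $ k} \<Longrightarrow> G (upd k s x) = G x"
    and SG: "\<And>x. S x = G x + (\<Sum>i\<in>D. P i x)"
    and P: "\<And>i. i \<in> D \<Longrightarrow> P i \<in> borel_measurable borel \<and> (\<forall>x. \<bar>P i x\<bar> \<le> 2 * A) \<and> (\<forall>x. x \<notin> cbox l u \<longrightarrow> P i x = 0) \<and>
       (\<forall>x. (\<integral>s. P i (upd i s x) \<partial>unit_measure) = 0)"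
    by (elim conjE; simp)+
  define H where "H = line_mean k G"
  \<comment> \<open>Replacing \<open>G\<close> by its mean in direction \<open>k\<close> produces
    the piece of that direction; two functions bounded by \<open>A\<close> account for
    \<open>2 * A\<close>.\<close>
  define Q where "Q = P(k := \<lambda>x. G x - H x)"
  have Hm [measurable]: "H \<in> borel_measurable borel" unfolding H_def by measurable
  have H: "\<bar>H x\<bar> \<le> A" "x \<notin> cbox l u \<Longrightarrow> H x = 0" for x
    unfolding H_def by (auto intro: line_mean_bound G) (simp add: line_mean_def)
  show ?case
  proof (intro exI[of _ H] exI[of _ Q] conjI ballI allI impI)
    show "(\<integral>x. H x \<partial>cubeM) = (\<integral>x. S x \<partial>cubeM)"
      unfolding H_def GS[symmetric] by (rule line_mean_total) (use G in auto)
    show "H (upd j s x) = H x" if j: "j \<in> insert k D" and x: "x \<in> cbox l u" and s: "s \<in> {l $ j..u $ j}" for j x s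
    proof -
      have x': "upd j s x \<in> cbox l u"
        using x s by (auto simp: mem_box_cart)
      \<comment> \<open>Averaging in direction \<open>k\<close> keeps the invariance already
        obtained in direction \<open>j\<close>, because updates of different coordinates
        commute.\<close>
      have "G (upd k t (upd j s x)) = G (upd k t x)" for t
      proof (cases "j = k")
        case False
        then have jD: "j \<in> D" using j by auto
        show ?thesis
        proof (cases "t \<in> {l $ k..u $ k}")
          case True
          then have "upd k t x \<in> cbox l u" using x by (auto simp: mem_box_cart)
          then show ?thesis using Ginv[OF jD _ s] False by (simp add: upd_commute)
        next
          case out: False
          then show ?thesis by (simp add: G(2) upd_in_box_iff)
        qed
      qed simp
      then show ?thesis using x x' by (simp add: H_def line_mean_def)
    qed
    show "S x = H x + (\<Sum>i\<in>insert k D. Q i x)" for x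
    proof -
      have "(\<Sum>i\<in>D. Q i x) = (\<Sum>i\<in>D. P i x)"
        using insert.hyps by (intro sum.cong) (auto simp: Q_def)
      then show ?thesis using insert.hyps SG[of x] by (simp add: Q_def)
    qed
    fix i assume i: "i \<in> insert k D"
    show "Q i \<in> borel_measurable borel" using P i by (auto simp: Q_def)
    show "(\<integral>s. Q i (upd i s x) \<partial>unit_measure) = 0" for x
      using P i line_mean_integral[OF Gm G] by (auto simp: Q_def H_def)
    show "Q i x = 0" if "x \<notin> cbox l u" for x
      using P i that G H by (auto simp: Q_def)
    show "\<bar>Q i x\<bar> \<le> 2 * A" for x
    proof (cases "i = k")
      case True
      then show ?thesis using G(1)[of x] H(1)[of x] by (simp add: Q_def)
    next
      case False
      then show ?thesis using P i by (auto simp: Q_def)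
    qed
  qed (auto simp: H)
qed

text \<open>The sup bound \<open>2 * A\<close> depends neither on the shape of the box nor on the
  number of averaging steps; the size of the box enters only through
  \<open>line_primitive_box\<close>.\<close>

lemma box_decomposition:
  fixes S :: "real ^ 'n \<Rightarrow> real"
  assumes Sm [measurable]: "S \<in> borel_measurable borel"
    and S: "\<And>x. \<bar>S x\<bar> \<le> A" "\<And>x. x \<notin> cbox l u \<Longrightarrow> S x = 0"
    and S0: "(\<integral>x. S x \<partial>cubeM) = 0"
  obtains P where "\<And>i. P i \<in> borel_measurable borel" "\<And>i x. \<bar>P i x\<bar> \<le> 2 * A"
    "\<And>i x. x \<notin> cbox l u \<Longrightarrow> P i x = 0" "\<And>i x. (\<integral>s. P i (upd i s x) \<partial>unit_measure) = 0"
    "\<And>x. S x = (\<Sum>i\<in>UNIV. P i x)"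
proof -
  have "\<exists>G P. G \<in> borel_measurable borel \<and> (\<forall>x. x \<notin> cbox l u \<longrightarrow> G x = 0) \<and>
    (\<integral>x. G x \<partial>cubeM) = 0 \<and>
    (\<forall>k. \<forall>x\<in>cbox l u. \<forall>s\<in>{l $ k..u $ k}. G (upd k s x) = G x) \<and>
    (\<forall>x. S x = G x + (\<Sum>i\<in>UNIV. P i x)) \<and>
    (\<forall>i. P i \<in> borel_measurable borel \<and> (\<forall>x. \<bar>P i x\<bar> \<le> 2 * A) \<and> (\<forall>x. x \<notin> cbox l u \<longrightarrow> P i x = 0) \<and>
       (\<forall>x. (\<integral>s. P i (upd i s x) \<partial>unit_measure) = 0))" (is "\<exists>G P. ?Q G P")
  proof -
    have "\<exists>G P. G \<in> borel_measurable borel \<and> (\<forall>x. \<bar>G x\<bar> \<le> A) \<and> (\<forall>x. x \<notin> cbox l u \<longrightarrow> G x = 0) \<and>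
      (\<integral>x. G x \<partial>cubeM) = (\<integral>x. S x \<partial>cubeM) \<and>
      (\<forall>k\<in>UNIV. \<forall>x\<in>cbox l u. \<forall>s\<in>{l $ k..u $ k}. G (upd k s x) = G x) \<and>
      (\<forall>x. S x = G x + (\<Sum>i\<in>UNIV. P i x)) \<and>
      (\<forall>i\<in>UNIV. P i \<in> borel_measurable borel \<and> (\<forall>x. \<bar>P i x\<bar> \<le> 2 * A) \<and> (\<forall>x. x \<notin> cbox l u \<longrightarrow> P i x = 0) \<and>
         (\<forall>x. (\<integral>s. P i (upd i s x) \<partial>unit_measure) = 0))"
      by (rule box_decomposition_partial[OF Sm S]) auto
    then show ?thesis unfolding ball_UNIV S0 by (elim exE conjE, intro exI conjI)
  qed
  then obtain G P where GP: "?Q G P" by (elim exE)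
  then have Gm [measurable]: "G \<in> borel_measurable borel"
    and G: "\<And>x. x \<notin> cbox l u \<Longrightarrow> G x = 0"
    and G0: "(\<integral>x. G x \<partial>cubeM) = 0"
    and Ginv: "\<And>k x s. x \<in> cbox l u \<Longrightarrow> s \<in> {l $ k..u $ k} \<Longrightarrow> G (upd k s x) = G x"
    and SG: "\<And>x. S x = G x + (\<Sum>i\<in>UNIV. P i x)"
    and P: "\<And>i. P i \<in> borel_measurable borel \<and> (\<forall>x. \<bar>P i x\<bar> \<le> 2 * A) \<and> (\<forall>x. x \<notin> cbox l u \<longrightarrow> P i x = 0) \<and>
       (\<forall>x. (\<integral>s. P i (upd i s x) \<partial>unit_measure) = 0)"
    by (elim conjE; simp)+
  have lI: "l \<in> cbox l u" using lu by (auto simp: mem_box_cart less_imp_le)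
  have const: "G x = G l" if x: "x \<in> cbox l u" for x
  proof -
    \<comment> \<open>A path of points from \<open>l\<close> to \<open>x\<close> that changes one
      coordinate at a time and stays in the box.\<close>
    define z where "z D = (\<chi> k. if k \<in> D then x $ k else l $ k)" for D
    have zI: "z D \<in> cbox l u" for D
      using x lI by (auto simp: z_def mem_box_cart)
    have "G (z D) = G l" if "finite D" for D
      using that
    proof (induction D rule: finite_induct)
      case empty
      have "z {} = l" by (simp add: z_def vec_eq_iff)
      then show ?case by simp
    next
      case (insert k D)
      have "z (insert k D) = upd k (x $ k) (z D)"
        by (simp add: z_def vec_eq_iff)
      then show ?case
        using insert Ginv[OF zI[of D], of "x $ k" k] x by (simp add: mem_box_cart)
    qed
    moreover have "z UNIV = x" by (simp add: z_def vec_eq_iff)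
    ultimately show ?thesis by (metis finite_UNIV finite)
  qed
  have "G l * measure cubeM (cbox l u) = (\<integral>x. G l * indicator (cbox l u) x \<partial>cubeM)"
    by simp
  also have "\<dots> = (\<integral>x. G x \<partial>cubeM)"
    by (intro Bochner_Integration.integral_cong) (auto simp: indicator_def G const)
  finally have "G l * measure cubeM (cbox l u) = 0"
    using G0 by simp
  moreover have "measure cubeM (cbox l u) \<noteq> 0"
  proof -
    have "cbox l u \<subseteq> cube"
      unfolding subset_iff mem_box_cart using lu by (simp, meson order_trans)
    then have "emeasure cubeM (cbox l u) = emeasure lborel (cbox l u)"
      by (simp add: emeasure_unit_cube Int_absorb2)
    also have "\<dots> = ennreal (\<Prod>b\<in>Basis. (u - l) \<bullet> b)"
      using lu by (subst emeasure_lborel_cbox_eq) (auto simp: Basis_vec_def inner_axis less_imp_le)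
    finally have "emeasure cubeM (cbox l u) = ennreal (\<Prod>b\<in>Basis. (u - l) \<bullet> b)" .
    moreover have "(\<Prod>b\<in>Basis. (u - l) \<bullet> b) > 0"
      using lu by (intro prod_pos) (auto simp: Basis_vec_def inner_axis)
    ultimately have "emeasure cubeM (cbox l u) > 0"
      by (simp only: ennreal_less_zero_iff)
    then show ?thesis
      by (simp add: ucube.emeasure_eq_measure)
  qed
  ultimately have "G l = 0" by simp
  then have "G x = 0" for x using G const by (cases "x \<in> cbox l u") auto
  then have "S x = (\<Sum>i\<in>UNIV. P i x)" for x using SG by simp
  with P that show ?thesis by blast
qed

text \<open>The line integral vanishes, so the primitive is zero beyond the box as well as before
  it; inside it is at most height times side. This one factor of the side length is the source of
  the smoothness exponent \<open>-1\<close>.\<close>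

lemma line_primitive_box:
  fixes P :: "real ^ 'n \<Rightarrow> real"
  assumes [measurable]: "P \<in> borel_measurable borel"
    and P: "\<And>x. \<bar>P x\<bar> \<le> A" "\<And>x. x \<notin> cbox l u \<Longrightarrow> P x = 0"
    and P0: "\<And>x. (\<integral>s. P (upd i s x) \<partial>unit_measure) = 0"
  shows "\<bar>line_primitive i P x\<bar> \<le> A * (u $ i - l $ i) * indicator (cbox l u) x"
proof (cases "x \<in> cbox l u")
  case True
  have A: "0 \<le> A" using P(1)[of 0] by linarith
  have "\<bar>if s \<le> x $ i then P (upd i s x) else 0\<bar> \<le> A * indicator {l $ i..u $ i} s" for s
  proof (cases "s \<in> {l $ i..u $ i}")
    case False
    then show ?thesis by (simp add: P(2) upd_in_box_iff)
  qed (use P(1) A in auto)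
  then show ?thesis
    unfolding line_primitive_def primitive_def using True lu[of i]
    by (simp, intro integral_unit_bound) auto
next
  case False
  have "line_primitive i P x = 0"
  proof (cases "\<forall>j. j \<noteq> i \<longrightarrow> l $ j \<le> x $ j \<and> x $ j \<le> u $ j")
    case X: True
    with False have "x $ i < l $ i \<or> u $ i < x $ i"
      by (auto simp: mem_box_cart not_le) 
    then show ?thesis
    proof
      assume "x $ i < l $ i"
      then have "(if s \<le> x $ i then P (upd i s x) else 0) = 0" for s
        by (auto simp: P(2) upd_in_box_iff)
      then show ?thesis by (simp add: line_primitive_def primitive_def)
    next
      assume "u $ i < x $ i"
      then have "(if s \<le> x $ i then P (upd i s x) else 0) = P (upd i s x)" for s
        by (auto simp: P(2) upd_in_box_iff)
      then show ?thesis by (simp add: line_primitive_def primitive_def P0)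
    qed
  next
    case False
    then have "P (upd i s x) = 0" for s by (intro P(2)) (auto simp: upd_in_box_iff)
    then show ?thesis by (simp add: line_primitive_def primitive_def)
  qed
  then show ?thesis using False by simp
qed

end

text \<open>Every term is at most the largest one. The power of the cardinality is crude, but it
  enters only through the overlap constant.\<close>

lemma sum_powr_le_card:
  fixes b :: "'b \<Rightarrow> real"
  assumes "finite Y" and b: "\<And>y. y \<in> Y \<Longrightarrow> 0 \<le> b y" and p: "1 \<le> p"
  shows "(\<Sum>y\<in>Y. b y) powr p \<le> real (card Y) powr p * (\<Sum>y\<in>Y. b y powr p)"
proof (cases "Y = {}")
  case False
  define M where "M = Max (b ` Y)"
  obtain z where z: "z \<in> Y" "M = b z"
  proof -
    have "Max (b ` Y) \<in> b ` Y" using \<open>finite Y\<close> False by (intro Max_in) auto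
    then show ?thesis using that by (auto simp: M_def)
  qed
  have "(\<Sum>y\<in>Y. b y) \<le> real (card Y) * M"
    using \<open>finite Y\<close> by (intro sum_bounded_above) (simp add: M_def)
  then have "(\<Sum>y\<in>Y. b y) powr p \<le> (real (card Y) * M) powr p"
    using b p by (intro powr_mono2) (auto intro: sum_nonneg)
  also have "\<dots> = real (card Y) powr p * b z powr p"
    using z b by (simp add: powr_mult)
  also have "\<dots> \<le> real (card Y) powr p * (\<Sum>y\<in>Y. b y powr p)"
    using z \<open>finite Y\<close> by (intro mult_left_mono member_le_sum) auto
  finally show ?thesis .
qed simp

lemma primitive_sum:
  assumes "finite Y" and m: "\<And>y. y \<in> Y \<Longrightarrow> u y \<in> borel_measurable borel"
    and b: "\<And>y s. y \<in> Y \<Longrightarrow> \<bar>u y s\<bar> \<le> B"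
  shows "primitive (\<lambda>s. \<Sum>y\<in>Y. u y s) t = (\<Sum>y\<in>Y. primitive (u y) t)"
proof -
  have "integrable unit_measure (\<lambda>s. if s \<le> t then u y s else 0)" if "y \<in> Y" for y
  proof (rule integrable_unit_measure[where B = "\<bar>B\<bar>"])
    have [measurable]: "u y \<in> borel_measurable borel" using m that .
    show "(\<lambda>s. if s \<le> t then u y s else 0) \<in> borel_measurable borel" by measurable
    show "\<bar>if s \<le> t then u y s else 0\<bar> \<le> \<bar>B\<bar>" for s
      using b[OF that, of s] by auto
  qed
  then have "(\<integral>s. (\<Sum>y\<in>Y. if s \<le> t then u y s else 0) \<partial>unit_measure) = (\<Sum>y\<in>Y. primitive (u y) t)"
    unfolding primitive_def by (rule Bochner_Integration.integral_sum)
  moreover have "primitive (\<lambda>s. \<Sum>y\<in>Y. u y s) t = (\<integral>s. (\<Sum>y\<in>Y. if s \<le> t then u y s else 0) \<partial>unit_measure)"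
    unfolding primitive_def by (intro Bochner_Integration.integral_cong) auto
  ultimately show ?thesis by simp
qed

text \<open>Each function is decomposed in its own box and pieces of equal direction are added. At
  most \<open>K\<close> boxes meet at a point, so the \<open>p\<close>-th power of the summed line
  primitive is bounded by a sum of \<open>p\<close>-th powers, whose integral is controlled by
  \<open>V\<close> and the coefficients.\<close>

lemma localized_sum_pieces:
  fixes \<psi> :: "'b \<Rightarrow> real ^ 'n \<Rightarrow> real" and l u :: "'b \<Rightarrow> real ^ 'n" and \<beta> :: "'b \<Rightarrow> real"
  assumes p: "1 \<le> p" and fin: "finite Y" and nn: "0 \<le> A" "0 \<le> h" "0 \<le> K" "0 \<le> V"
    and lu: "\<And>y k. y \<in> Y \<Longrightarrow> 0 \<le> l y $ k \<and> l y $ k < u y $ k \<and> u y $ k \<le> 1"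
    and \<psi>m: "\<And>y. y \<in> Y \<Longrightarrow> \<psi> y \<in> borel_measurable borel"
    and \<psi>A: "\<And>y x. y \<in> Y \<Longrightarrow> \<bar>\<psi> y x\<bar> \<le> A"
    and \<psi>0: "\<And>y x. y \<in> Y \<Longrightarrow> x \<notin> cbox (l y) (u y) \<Longrightarrow> \<psi> y x = 0"
    and mean: "\<And>y. y \<in> Y \<Longrightarrow> (\<integral>x. \<psi> y x \<partial>cubeM) = 0"
    and side: "\<And>y k. y \<in> Y \<Longrightarrow> u y $ k - l y $ k \<le> h"
    and overlap: "AE x in cubeM. real (card {y\<in>Y. x \<in> cbox (l y) (u y)}) \<le> K"
    and vol: "\<And>y. y \<in> Y \<Longrightarrow> emeasure cubeM (cbox (l y) (u y)) \<le> ennreal V"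
  obtains P C where "\<And>i. P i \<in> borel_measurable borel" "\<And>i x. \<bar>P i x\<bar> \<le> C"
    "\<And>i x. primitive (\<lambda>s. P i (upd i s x)) 1 = 0"
    "\<And>x. (\<Sum>y\<in>Y. \<beta> y * \<psi> y x) = (\<Sum>i\<in>UNIV. P i x)"
    "\<And>i. (\<integral>\<^sup>+ x. ennreal (\<bar>line_primitive i (P i) x\<bar> powr p) \<partial>cubeM) \<le>
       ennreal ((K * (2 * A * h)) powr p * V * (\<Sum>y\<in>Y. \<bar>\<beta> y\<bar> powr p))"
proof -
  have "\<exists>Q. (\<forall>i. Q i \<in> borel_measurable borel) \<and> (\<forall>i x. \<bar>Q i x\<bar> \<le> 2 * A) \<and>
      (\<forall>i x. x \<notin> cbox (l y) (u y) \<longrightarrow> Q i x = 0) \<and> (\<forall>i x. (\<integral>s. Q i (upd i s x) \<partial>unit_measure) = 0) \<and>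
      (\<forall>x. \<psi> y x = (\<Sum>i\<in>UNIV. Q i x))" if y: "y \<in> Y" for y
  proof -
    obtain Q where "\<And>i. Q i \<in> borel_measurable borel" "\<And>i x. \<bar>Q i x\<bar> \<le> 2 * A"
      "\<And>i x. x \<notin> cbox (l y) (u y) \<Longrightarrow> Q i x = 0" "\<And>i x. (\<integral>s. Q i (upd i s x) \<partial>unit_measure) = 0"
      "\<And>x. \<psi> y x = (\<Sum>i\<in>UNIV. Q i x)"
      by (rule box_decomposition[OF lu[OF y] \<psi>m[OF y] \<psi>A[OF y] \<psi>0[OF y] mean[OF y]]) (assumption, rule that)
    then show ?thesis by (intro exI[of _ Q] conjI allI impI)
  qed
  then have "\<forall>y\<in>Y. \<exists>Q. (\<forall>i. Q i \<in> borel_measurable borel) \<and> (\<forall>i x. \<bar>Q i x\<bar> \<le> 2 * A) \<and>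
      (\<forall>i x. x \<notin> cbox (l y) (u y) \<longrightarrow> Q i x = 0) \<and> (\<forall>i x. (\<integral>s. Q i (upd i s x) \<partial>unit_measure) = 0) \<and>
      (\<forall>x. \<psi> y x = (\<Sum>i\<in>UNIV. Q i x))"
    by (intro ballI)
  from bchoice[OF this] obtain Q where Q: "\<forall>y\<in>Y. (\<forall>i. Q y i \<in> borel_measurable borel) \<and> (\<forall>i x. \<bar>Q y i x\<bar> \<le> 2 * A) \<and>
      (\<forall>i x. x \<notin> cbox (l y) (u y) \<longrightarrow> Q y i x = 0) \<and> (\<forall>i x. (\<integral>s. Q y i (upd i s x) \<partial>unit_measure) = 0) \<and>
      (\<forall>x. \<psi> y x = (\<Sum>i\<in>UNIV. Q y i x))"
    by (elim exE)
  have Qm: "Q y i \<in> borel_measurable borel" and QA: "\<bar>Q y i x\<bar> \<le> 2 * A"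
    and Qo: "x \<notin> cbox (l y) (u y) \<Longrightarrow> Q y i x = 0"
    and Q0: "(\<integral>s. Q y i (upd i s x) \<partial>unit_measure) = 0" if "y \<in> Y" for y i x
    using bspec[OF Q that] by simp_all
  have Qs: "\<psi> y x = (\<Sum>i\<in>UNIV. Q y i x)" if "y \<in> Y" for y x
    using bspec[OF Q that] by (elim conjE) (rule spec)
  define P where "P i x = (\<Sum>y\<in>Y. \<beta> y * Q y i x)" for i x
  define L where "L y i x = line_primitive i (Q y i) x" for y i x
  have Lb: "\<bar>L y i x\<bar> \<le> 2 * A * h * indicator (cbox (l y) (u y)) x" if y: "y \<in> Y" for y i x
  proof -
    have "\<bar>L y i x\<bar> \<le> 2 * A * (u y $ i - l y $ i) * indicator (cbox (l y) (u y)) x"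
      unfolding L_def by (rule line_primitive_box[OF lu[OF y] Qm[OF y] QA[OF y] Qo[OF y] Q0[OF y]])
    also have "\<dots> \<le> 2 * A * h * indicator (cbox (l y) (u y)) x"
      using side[OF y] nn by (intro mult_right_mono mult_left_mono) auto
    finally show ?thesis .
  qed
  \<comment> \<open>Used for boundedness and integrability, not in the cost; the inserted
    \<open>0\<close> covers an empty \<open>Y\<close>.\<close>
  define BQ where "BQ = Max (insert 0 ((\<lambda>y. \<bar>\<beta> y\<bar> * (2 * A)) ` Y))"
  have BQ: "\<bar>\<beta> y * Q y i x\<bar> \<le> BQ" if "y \<in> Y" for y i x
  proof -
    have "\<bar>\<beta> y * Q y i x\<bar> \<le> \<bar>\<beta> y\<bar> * (2 * A)"
      using QA[OF that] by (simp add: abs_mult mult_left_mono)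
    also have "\<dots> \<le> BQ" unfolding BQ_def using that fin by (intro Max_ge) auto
    finally show ?thesis .
  qed
  have prim: "primitive (\<lambda>s. P i (upd i s x)) t = (\<Sum>y\<in>Y. \<beta> y * primitive (\<lambda>s. Q y i (upd i s x)) t)" for i x t
    unfolding P_def
    by (subst primitive_sum[OF fin, where B = BQ])
      (use Qm BQ in \<open>auto simp: primitive_scale intro!: borel_measurable_times measurable_compose[OF _ Qm] upd_measurable\<close>)
  have Pm: "P i \<in> borel_measurable borel" for i
    unfolding P_def[abs_def] by (intro borel_measurable_sum borel_measurable_times Qm) auto
  show thesis
  proof (rule that[of P "real (card Y) * BQ"])
    show "P i \<in> borel_measurable borel" for i by (rule Pm)
    show "\<bar>P i x\<bar> \<le> real (card Y) * BQ" for i x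
      unfolding P_def using BQ by (intro order_trans[OF sum_abs] sum_bounded_above) auto
    show "primitive (\<lambda>s. P i (upd i s x)) 1 = 0" for i x
      unfolding prim
    proof (intro sum.neutral ballI)
      fix y assume y: "y \<in> Y"
      have [measurable]: "Q y i \<in> borel_measurable borel" by (rule Qm[OF y])
      show "\<beta> y * primitive (\<lambda>s. Q y i (upd i s x)) 1 = 0"
        using Q0[OF y] by (subst primitive_at_1) auto
    qed
    show "(\<Sum>y\<in>Y. \<beta> y * \<psi> y x) = (\<Sum>i\<in>UNIV. P i x)" for x
    proof -
      have "(\<Sum>y\<in>Y. \<beta> y * \<psi> y x) = (\<Sum>y\<in>Y. \<Sum>i\<in>UNIV. \<beta> y * Q y i x)"
        by (intro sum.cong) (auto simp: Qs sum_distrib_left)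
      also have "\<dots> = (\<Sum>i\<in>UNIV. P i x)"
        unfolding P_def by (rule sum.swap)
      finally show ?thesis .
    qed
    fix i
    define c where "c = (K * (2 * A * h)) powr p"
    have pt: "AE x in cubeM. ennreal (\<bar>line_primitive i (P i) x\<bar> powr p) \<le>
        (\<Sum>y\<in>Y. ennreal (c * \<bar>\<beta> y\<bar> powr p) * indicator (cbox (l y) (u y)) x)"
      using overlap
    proof eventually_elim
      case (elim x)
      \<comment> \<open>Only the boxes containing \<open>x\<close> contribute to the line primitive
        at \<open>x\<close>.\<close>
      define Z where "Z = {y\<in>Y. x \<in> cbox (l y) (u y)}"
      have Z: "finite Z" "Z \<subseteq> Y" using fin by (auto simp: Z_def)
      have "line_primitive i (P i) x = (\<Sum>y\<in>Y. \<beta> y * L y i x)"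
        by (simp add: line_primitive_def prim L_def)
      then have "\<bar>line_primitive i (P i) x\<bar> \<le> (\<Sum>y\<in>Y. \<bar>\<beta> y * L y i x\<bar>)"
        by simp
      also have "\<dots> = (\<Sum>y\<in>Z. \<bar>\<beta> y * L y i x\<bar>)"
      proof (rule sum.mono_neutral_right[OF fin Z(2)], intro ballI)
        fix y assume "y \<in> Y - Z"
        then show "\<bar>\<beta> y * L y i x\<bar> = 0"
          using Lb[of y i x] by (auto simp: Z_def)
      qed
      also have "\<dots> \<le> (\<Sum>y\<in>Z. \<bar>\<beta> y\<bar> * (2 * A * h))"
      proof (rule sum_mono)
        fix y assume "y \<in> Z"
        then show "\<bar>\<beta> y * L y i x\<bar> \<le> \<bar>\<beta> y\<bar> * (2 * A * h)"
          using Lb[of y i x] by (auto simp: Z_def abs_mult intro!: mult_left_mono)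
      qed
      finally have "\<bar>line_primitive i (P i) x\<bar> powr p \<le> (\<Sum>y\<in>Z. \<bar>\<beta> y\<bar> * (2 * A * h)) powr p"
        using p by (intro powr_mono2) auto
      also have "\<dots> \<le> real (card Z) powr p * (\<Sum>y\<in>Z. (\<bar>\<beta> y\<bar> * (2 * A * h)) powr p)"
        using nn by (intro sum_powr_le_card Z p) auto
      also have "\<dots> \<le> K powr p * (\<Sum>y\<in>Z. (\<bar>\<beta> y\<bar> * (2 * A * h)) powr p)"
        using elim p by (intro mult_right_mono powr_mono2) (auto simp: Z_def intro: sum_nonneg)
      also have "\<dots> = (\<Sum>y\<in>Z. c * \<bar>\<beta> y\<bar> powr p)"
        using nn by (simp add: c_def powr_mult sum_distrib_left mult.commute mult.left_commute)
      also have "\<dots> = (\<Sum>y\<in>Y. c * \<bar>\<beta> y\<bar> powr p * indicator (cbox (l y) (u y)) x)"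
        unfolding Z_def by (subst sum.inter_filter[OF fin], rule sum.cong) (auto simp: indicator_def)
      finally have "ennreal (\<bar>line_primitive i (P i) x\<bar> powr p) \<le>
          ennreal (\<Sum>y\<in>Y. c * \<bar>\<beta> y\<bar> powr p * indicator (cbox (l y) (u y)) x)"
        by (rule ennreal_leI)
      also have "\<dots> = (\<Sum>y\<in>Y. ennreal (c * \<bar>\<beta> y\<bar> powr p) * indicator (cbox (l y) (u y)) x)"
      proof -
        have "0 \<le> c" by (simp add: c_def)
        then have "ennreal (\<Sum>y\<in>Y. c * \<bar>\<beta> y\<bar> powr p * indicator (cbox (l y) (u y)) x) =
            (\<Sum>y\<in>Y. ennreal (c * \<bar>\<beta> y\<bar> powr p * indicator (cbox (l y) (u y)) x))"
          by (intro sum_ennreal[symmetric]) simp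
        also have "\<dots> = (\<Sum>y\<in>Y. ennreal (c * \<bar>\<beta> y\<bar> powr p) * indicator (cbox (l y) (u y)) x)"
          by (intro sum.cong) (auto split: split_indicator)
        finally show ?thesis .
      qed
      finally show ?case .
    qed
    have "(\<integral>\<^sup>+ x. ennreal (\<bar>line_primitive i (P i) x\<bar> powr p) \<partial>cubeM) \<le>
        (\<integral>\<^sup>+ x. (\<Sum>y\<in>Y. ennreal (c * \<bar>\<beta> y\<bar> powr p) * indicator (cbox (l y) (u y)) x) \<partial>cubeM)"
      by (rule nn_integral_mono_AE[OF pt])
    also have "\<dots> = (\<Sum>y\<in>Y. ennreal (c * \<bar>\<beta> y\<bar> powr p) * emeasure cubeM (cbox (l y) (u y)))"
      by (subst nn_integral_sum) (auto simp: nn_integral_cmult_indicator)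
    also have "\<dots> \<le> (\<Sum>y\<in>Y. ennreal (c * \<bar>\<beta> y\<bar> powr p) * ennreal V)"
      by (intro sum_mono mult_left_mono vol) auto
    also have "\<dots> = ennreal (\<Sum>y\<in>Y. c * \<bar>\<beta> y\<bar> powr p * V)"
      using nn by (subst sum_ennreal[symmetric]) (auto simp: c_def ennreal_mult)
    also have "(\<Sum>y\<in>Y. c * \<bar>\<beta> y\<bar> powr p * V) = c * V * (\<Sum>y\<in>Y. \<bar>\<beta> y\<bar> powr p)"
      unfolding sum_distrib_left by (intro sum.cong) (simp_all add: ac_simps)
    finally show "(\<integral>\<^sup>+ x. ennreal (\<bar>line_primitive i (P i) x\<bar> powr p) \<partial>cubeM) \<le>
       ennreal ((K * (2 * A * h)) powr p * V * (\<Sum>y\<in>Y. \<bar>\<beta> y\<bar> powr p))"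
      by (simp add: c_def)
  qed
qed

section \<open>Elementary properties of wavelet systems\<close>

lemma open_AE_lborel_in:
  fixes U :: "'a::euclidean_space set"
  assumes U: "open U" and "closed N" and AE: "AE x in lborel. x \<in> U \<longrightarrow> x \<in> N"
  shows "U \<subseteq> N"
proof (rule ccontr)
  assume "\<not> U \<subseteq> N"
  then obtain x where "x \<in> U - N" by auto
  moreover have "open (U - N)" using assms by auto
  ultimately obtain e where e: "0 < e" "ball x e \<subseteq> U - N"
    by (meson openE)
  have "AE y in lborel. y \<notin> ball x e"
    using AE by eventually_elim (use e in auto)
  then have "emeasure lborel (ball x e) = 0"
    by (subst (asm) AE_iff_null_sets[symmetric]) (auto simp: null_sets_def)
  then have "measure lborel (ball x e) = 0" by (simp add: measure_def)
  then show False using content_ball_pos[OF e(1), of x] by simp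
qed

text \<open>Makes essential bounds pointwise for continuous functions: on the open box since
  nonempty open sets have positive measure, then on the cube by closure. The exponent
  \<open>\<infinity>\<close> cases of \<open>normalized\<close> and \<open>bernstein\<close> are
  used in this form.\<close>

lemma AE_cube_bound:
  fixes v :: "real ^ 'n \<Rightarrow> real"
  assumes v: "continuous_on cube v" and AE: "AE x in cube_measure. v x \<le> B"
  shows "\<forall>x\<in>cube. v x \<le> B"
proof -
  let ?N = "{x \<in> cube. v x \<le> B}"
  have "closed ?N"
    using continuous_closed_preimage[OF v closed_cbox, of "{..B}"] by (simp add: vimage_def Int_def)
  have "AE x in lborel. x \<in> cube \<longrightarrow> v x \<le> B"
    using AE by (simp add: AE_restrict_space_iff)
  then have "AE x in lborel. x \<in> box 0 1 \<longrightarrow> x \<in> ?N"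
    by eventually_elim (use box_subset_cbox in auto)
  then have "box 0 1 \<subseteq> ?N"
    using \<open>closed ?N\<close> by (intro open_AE_lborel_in) auto
  then have "closure (box 0 1) \<subseteq> ?N"
    using \<open>closed ?N\<close> by (rule closure_minimal)
  moreover have "closure (box 0 1) = (cube :: (real ^ 'n) set)"
    by (rule closure_box) (auto simp: box_ne_empty Basis_vec_def inner_axis)
  ultimately show ?thesis by auto
qed

lemma L_norm_infinity_le_imp:
  fixes v :: "real ^ 'n \<Rightarrow> 'b::real_normed_vector"
  assumes v: "continuous_on cube v" and le: "L_norm \<infinity> cube_measure v \<le> ennreal B" and B: "0 \<le> B"
  shows "\<forall>x\<in>cube. norm (v x) \<le> B"
proof (rule AE_cube_bound)
  show "continuous_on cube (\<lambda>x. norm (v x))" by (intro continuous_intros v)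
  have le': "esssup cube_measure (\<lambda>x. ennreal (norm (v x))) \<le> ennreal B"
    using le by (simp add: L_norm_def eL_norm_def)
  have "AE x in cube_measure. ennreal (norm (v x)) \<le> esssup cube_measure (\<lambda>x. ennreal (norm (v x)))"
    by (rule esssup_AE)
  then show "AE x in cube_measure. norm (v x) \<le> B"
  proof eventually_elim
    case (elim x)
    then have "ennreal (norm (v x)) \<le> ennreal B" using le' by (rule order_trans)
    then show ?case using B by simp
  qed
qed

lemma L_norm_infinity_le:
  assumes "v \<in> borel_measurable M" and "AE x in M. norm (v x) \<le> B"
  shows "L_norm \<infinity> M v \<le> ennreal B"
  using assms unfolding L_norm_def eL_norm_def
  by (auto intro!: esssup_I elim!: eventually_mono ennreal_leI)

lemma continuous_measurable_cube:
  assumes "continuous_on cube v"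
  shows "v \<in> borel_measurable cube_measure"
proof -
  have "v \<in> borel_measurable (restrict_space borel cube)"
    by (rule borel_measurable_continuous_on_restrict[OF assms])
  then show ?thesis by (simp cong: measurable_cong_sets add: sets_restrict_space)
qed

text \<open>One unfolding of \<open>holder_space\<close> with the Hoelder condition relaxed to
  continuity; this form is closed under linear combinations and gives a continuous gradient up to
  the boundary.\<close>

definition C1_on_cube :: "(real ^ 'n \<Rightarrow> real) \<Rightarrow> bool" where
  "C1_on_cube u \<longleftrightarrow> (\<exists>D. (\<forall>i. continuous_on cube (D i)) \<and>
     (\<forall>x\<in>cube. (u has_derivative (\<lambda>h. \<Sum>i\<in>UNIV. D i x * h $ i)) (at x within cube)))"

lemma C1_on_cube_continuous: "C1_on_cube u \<Longrightarrow> continuous_on cube u"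
  unfolding C1_on_cube_def continuous_on_eq_continuous_within
  using has_derivative_continuous by blast

lemma holder_space_continuous: "u \<in> holder_space k a \<Longrightarrow> continuous_on cube u"
  by (cases k)
    (auto simp: continuous_on_eq_continuous_within dest: bspec intro: has_derivative_continuous)

lemma C_space_C1:
  assumes "1 < r" "u \<in> C_space r"
  shows "C1_on_cube u"
proof -
  have "1 \<le> \<lfloor>r\<rfloor>" using assms(1) by linarith
  then obtain k where "nat \<lfloor>r\<rfloor> = Suc k" by (cases "nat \<lfloor>r\<rfloor>") auto
  then show ?thesis
    using assms(2) unfolding C_space_def C1_on_cube_def by (auto intro: holder_space_continuous)
qed

lemma C1_on_cube_fun_span:
  assumes B: "\<And>\<phi>. \<phi> \<in> B \<Longrightarrow> C1_on_cube \<phi>" and u: "u \<in> fun_span B"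
  shows "C1_on_cube u"
proof -
  obtain S c where S: "finite S" "S \<subseteq> B" "u = (\<lambda>x. \<Sum>\<phi>\<in>S. c \<phi> * \<phi> x)"
    using u unfolding fun_span_def by blast
  have "\<forall>\<phi>\<in>S. \<exists>D. (\<forall>i. continuous_on cube (D i)) \<and>
     (\<forall>x\<in>cube. (\<phi> has_derivative (\<lambda>h. \<Sum>i\<in>UNIV. D i x * h $ i)) (at x within cube))"
    using B S(2) unfolding C1_on_cube_def by blast
  from bchoice[OF this] obtain D where D: "\<forall>\<phi>\<in>S. (\<forall>i. continuous_on cube (D \<phi> i)) \<and>
     (\<forall>x\<in>cube. (\<phi> has_derivative (\<lambda>h. \<Sum>i\<in>UNIV. D \<phi> i x * h $ i)) (at x within cube))" ..
  show ?thesis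
    unfolding C1_on_cube_def
  proof (intro exI[of _ "\<lambda>i x. \<Sum>\<phi>\<in>S. c \<phi> * D \<phi> i x"] conjI allI ballI)
    show "continuous_on cube (\<lambda>x. \<Sum>\<phi>\<in>S. c \<phi> * D \<phi> i x)" for i
      using D by (intro continuous_intros) auto
    fix x :: "real ^ 'a" assume x: "x \<in> cube"
    have "(u has_derivative (\<lambda>h. \<Sum>\<phi>\<in>S. c \<phi> * (\<Sum>i\<in>UNIV. D \<phi> i x * h $ i))) (at x within cube)"
      unfolding S(3) using D x by (intro has_derivative_sum has_derivative_mult_right) auto
    moreover have "(\<Sum>\<phi>\<in>S. c \<phi> * (\<Sum>i\<in>UNIV. D \<phi> i x * h $ i)) = (\<Sum>i\<in>UNIV. (\<Sum>\<phi>\<in>S. c \<phi> * D \<phi> i x) * h $ i)" for h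
      by (simp add: sum_distrib_left sum_distrib_right mult.assoc) (rule sum.swap)
    ultimately show "(u has_derivative (\<lambda>h. \<Sum>i\<in>UNIV. (\<Sum>\<phi>\<in>S. c \<phi> * D \<phi> i x) * h $ i)) (at x within cube)"
      by simp
  qed
qed

text \<open>Derivatives within a closed box with interior are unique, so \<open>gradient u\<close>
  is the continuous field \<open>G\<close>; its essential bound then holds everywhere, and the mean
  value inequality applies on the convex cube.\<close>

lemma lipschitz_of_gradient_bound:
  fixes u :: "real ^ 'n \<Rightarrow> real"
  assumes u: "C1_on_cube u" and le: "L_norm \<infinity> cube_measure (gradient u) \<le> ennreal B" and B: "0 \<le> B"
    and xy: "x \<in> cube" "y \<in> cube"
  shows "\<bar>u x - u y\<bar> \<le> B * dist x y"
proof -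
  obtain D where Dc: "\<And>i. continuous_on cube (D i)"
    and D: "\<And>x. x \<in> cube \<Longrightarrow> (u has_derivative (\<lambda>h. \<Sum>i\<in>UNIV. D i x * h $ i)) (at x within cube)"
    using u unfolding C1_on_cube_def by blast
  define G where "G x = (\<chi> i. D i x)" for x
  have G: "gradient u x = G x" if x: "x \<in> cube" for x
  proof -
    have d: "u differentiable at x within cube" using D[OF x] by (auto simp: differentiable_def)
    have "frechet_derivative u (at x within cube) = (\<lambda>h. \<Sum>i\<in>UNIV. D i x * h $ i)"
      using d x D[OF x]
      by (intro frechet_derivative_unique_within_closed_interval[of 0 1 x])
        (auto simp: frechet_derivative_works Basis_vec_def inner_axis)
    then show ?thesis
      by (simp add: gradient_def G_def vec_eq_iff axis_def if_distrib[of "\<lambda>z. _ * z"] cong: if_cong)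
  qed
  have "continuous_on cube (gradient u)"
  proof (subst continuous_on_cong[OF refl G])
    show "continuous_on cube G" unfolding G_def using Dc by (intro continuous_on_vec_lambda) auto
  qed
  then have "\<forall>x\<in>cube. norm (gradient u x) \<le> B"
    by (rule L_norm_infinity_le_imp[OF _ le B])
  then have GB: "norm (G x) \<le> B" if "x \<in> cube" for x
    using G that by simp
  have "norm (u x - u y) \<le> B * norm (x - y)"
  proof (rule differentiable_bound[OF convex_box(1) D])
    fix z :: "real ^ 'n" assume z: "z \<in> cube"
    show "onorm (\<lambda>h. \<Sum>i\<in>UNIV. D i z * h $ i) \<le> B"
    proof (rule onorm_le)
      fix h :: "real ^ 'n"
      have "(\<Sum>i\<in>UNIV. D i z * h $ i) = G z \<bullet> h" by (simp add: inner_vec_def G_def)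
      then have "norm (\<Sum>i\<in>UNIV. D i z * h $ i) \<le> norm (G z) * norm h"
        by (simp add: Cauchy_Schwarz_ineq2)
      also have "\<dots> \<le> B * norm h" using GB[OF z] by (intro mult_right_mono) auto
      finally show "norm (\<Sum>i\<in>UNIV. D i z * h $ i) \<le> B * norm h" .
    qed
  qed (use xy in auto)
  then show ?thesis by (simp add: dist_norm)
qed

text \<open>Gaussian elimination: the pivot unknown \<open>z\<close> is solved for, leaving one
  equation and one unknown fewer. It serves to find a nonzero combination of functions that vanishes
  at prescribed points.\<close>

lemma homogeneous_system:
  fixes a :: "'b \<Rightarrow> 'c \<Rightarrow> real"
  assumes "finite X" "finite F" "card X < card F"
  shows "\<exists>c. (\<exists>y\<in>F. c y \<noteq> 0) \<and> (\<forall>x\<in>X. (\<Sum>y\<in>F. c y * a y x) = 0)"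
  using assms
proof (induction X arbitrary: F a rule: finite_induct)
  case empty
  then show ?case by (intro exI[of _ "\<lambda>_. 1"]) (auto simp: card_gt_0_iff)
next
  case (insert x X)
  show ?case
  proof (cases "\<forall>y\<in>F. a y x = 0")
    case True
    then show ?thesis using insert.IH[of F a] insert.prems insert.hyps by auto
  next
    case False
    then obtain z where z: "z \<in> F" "a z x \<noteq> 0" by auto
    define b where "b y t = a y t - a y x / a z x * a z t" for y t
    have "finite (F - {z})" "card X < card (F - {z})"
      using insert.prems insert.hyps z by auto
    from insert.IH[OF this, of b]
    obtain c where c: "\<exists>y\<in>F - {z}. c y \<noteq> 0" "\<forall>t\<in>X. (\<Sum>y\<in>F - {z}. c y * b y t) = 0"
      by (elim exE conjE)
    define c' where "c' = c(z := - (\<Sum>y\<in>F - {z}. c y * a y x / a z x))"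
    have eq: "(\<Sum>y\<in>F. c' y * a y t) = (\<Sum>y\<in>F - {z}. c y * b y t)" for t
    proof -
      have "(\<Sum>y\<in>F. c' y * a y t) = c' z * a z t + (\<Sum>y\<in>F - {z}. c' y * a y t)"
        using insert.prems z by (simp add: sum.remove)
      also have "(\<Sum>y\<in>F - {z}. c' y * a y t) = (\<Sum>y\<in>F - {z}. c y * a y t)"
        by (intro sum.cong) (auto simp: c'_def)
      also have "c' z * a z t = - (\<Sum>y\<in>F - {z}. c y * a y x / a z x * a z t)"
        by (simp add: c'_def sum_distrib_right)
      finally show ?thesis
        by (simp add: b_def right_diff_distrib sum_subtractf mult.assoc)
    qed
    show ?thesis
    proof (intro exI[of _ c'] conjI ballI)
      show "\<exists>y\<in>F. c' y \<noteq> 0" using c(1) by (auto simp: c'_def)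
      fix t assume "t \<in> insert x X"
      then show "(\<Sum>y\<in>F. c' y * a y t) = 0"
        using c(2) z unfolding eq by (auto simp: b_def)
    qed
  qed
qed

section \<open>Passing between the two presentations of Lebesgue measure on the cube\<close>

lemma integral_cube_measure:
  fixes g :: "real ^ 'n \<Rightarrow> real"
  assumes [measurable]: "g \<in> borel_measurable borel"
  shows "(\<integral>x. g x \<partial>cube_measure) = (\<integral>x. g x \<partial>cubeM)"
proof -
  have "(\<integral>x. g x \<partial>cubeM) = (\<integral>x. g x \<partial>density lborel (\<lambda>x. ennreal (indicator cube x)))"
    by (simp add: ennreal_indicator)
  also have "\<dots> = (\<integral>x. indicator cube x *\<^sub>R g x \<partial>lborel)"
    by (rule integral_density) auto
  also have "\<dots> = (\<integral>x. g x \<partial>cube_measure)"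
    by (rule integral_restrict_space[symmetric]) auto
  finally show ?thesis ..
qed

lemma nn_integral_cube_measure:
  fixes g :: "real ^ 'n \<Rightarrow> ennreal"
  assumes [measurable]: "g \<in> borel_measurable borel"
  shows "(\<integral>\<^sup>+ x. g x \<partial>cube_measure) = (\<integral>\<^sup>+ x. g x \<partial>cubeM)"
  by (simp add: nn_integral_restrict_space nn_integral_density mult.commute)

lemma AE_cube_measure_iff: "(AE x in cube_measure. P x) \<longleftrightarrow> (AE x in cubeM. P x)"
proof -
  have "(AE x in cubeM. P x) \<longleftrightarrow> (AE x in lborel. 0 < (indicator cube x :: ennreal) \<longrightarrow> P x)"
    by (rule AE_density) simp
  then show ?thesis by (simp add: AE_restrict_space_iff indicator_def)
qed

lemma space_cube_measure [simp]: "space cube_measure = cube"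
  by (simp add: space_restrict_space)

text \<open>Basis functions are constrained on the cube only; their extensions by zero are Borel and
  bounded on the whole space and vanish off the supporting rectangles.\<close>

definition ext :: "(real ^ 'n \<Rightarrow> real) \<Rightarrow> real ^ 'n \<Rightarrow> real" where
  "ext u x = (if x \<in> cube then u x else 0)"

lemma ext_in [simp]: "x \<in> cube \<Longrightarrow> ext u x = u x"
  by (simp add: ext_def)

lemma ext_measurable:
  assumes "u \<in> borel_measurable cube_measure"
  shows "ext u \<in> borel_measurable borel"
proof -
  have "(\<lambda>x. u x * indicator cube x) \<in> borel_measurable lborel"
    using assms by (subst (asm) borel_measurable_restrict_space_iff) (auto simp: mult.commute)
  moreover have "(\<lambda>x. u x * indicator cube x) = ext u"
    by (auto simp: ext_def)
  ultimately show ?thesis by simp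
qed

lemma integral_ext:
  assumes "u \<in> borel_measurable cube_measure"
  shows "(\<integral>x. u x \<partial>cube_measure) = (\<integral>x. ext u x \<partial>cubeM)"
proof -
  have "(\<integral>x. u x \<partial>cube_measure) = (\<integral>x. ext u x \<partial>cube_measure)"
    by (intro Bochner_Integration.integral_cong) auto
  then show ?thesis by (simp add: integral_cube_measure[OF ext_measurable[OF assms]])
qed

lemma ext_mult: "ext (\<lambda>x. u x * v x) x = ext u x * ext v x"
  by (simp add: ext_def)

lemma integrable_unit_cube:
  fixes u :: "real ^ 'n \<Rightarrow> real"
  assumes "u \<in> borel_measurable borel" "\<And>x. x \<in> cube \<Longrightarrow> \<bar>u x\<bar> \<le> B"
  shows "integrable cubeM u"
  by (rule ucube.integrable_const_bound[of _ B]) (use assms in \<open>auto intro!: AE_cubeI\<close>)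

context wavelet_system
begin

abbreviation "basis \<equiv> \<Phi> \<union> (\<Union>j. \<Psi> j)"

lemma basis_C1: "\<phi> \<in> basis \<Longrightarrow> C1_on_cube \<phi>"
  using smooth regularity C_space_C1 by blast

lemma basis_continuous: "\<phi> \<in> basis \<Longrightarrow> continuous_on cube \<phi>"
  by (rule C1_on_cube_continuous[OF basis_C1])

lemma basis_measurable: "\<phi> \<in> basis \<Longrightarrow> \<phi> \<in> borel_measurable cube_measure"
  by (rule continuous_measurable_cube[OF basis_continuous])

lemma ext_basis_measurable: "\<phi> \<in> basis \<Longrightarrow> ext \<phi> \<in> borel_measurable borel"
  by (rule ext_measurable[OF basis_measurable])

lemma basis_bounded:
  assumes "\<phi> \<in> basis"
  obtains B where "0 \<le> B" "\<And>x. \<bar>ext \<phi> x\<bar> \<le> B"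
proof -
  have "compact (\<phi> ` cube)"
    by (intro compact_continuous_image basis_continuous assms compact_cbox)
  then obtain B where B: "\<And>y. y \<in> \<phi> ` cube \<Longrightarrow> \<bar>y\<bar> \<le> B"
    using compact_imp_bounded bounded_real by metis
  show thesis
    by (rule that[of "\<bar>B\<bar>"]) (use B in \<open>force simp: ext_def\<close>)+
qed

lemma orthonormal:
  assumes "\<phi> \<in> basis" "\<psi> \<in> basis"
  shows "(\<integral>x. ext \<phi> x * ext \<psi> x \<partial>cubeM) = (if \<phi> = \<psi> then 1 else 0)"
proof -
  have "(\<integral>x. \<phi> x * \<psi> x \<partial>cube_measure) = (\<integral>x. ext (\<lambda>x. \<phi> x * \<psi> x) x \<partial>cubeM)"
    using assms by (intro integral_ext borel_measurable_times basis_measurable)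
  then show ?thesis
    using orthonormal_basis assms unfolding orthonormal_basis_L2_def by (simp add: ext_mult)
qed

text \<open>Bernstein's inequality at exponent \<open>\<infinity>\<close>. Since the maximum of
  \<open>u\<close> itself stands on the right, it applies to combinations with unknown coefficients,
  as in \<open>finite_\<Phi>\<close>.\<close>

lemma lipschitz_span:
  "\<exists>C>0. \<forall>j. \<forall>u\<in>fun_span (\<Phi> \<union> (\<Union>k<j. \<Psi> k)). \<forall>A. (\<forall>x\<in>cube. \<bar>u x\<bar> \<le> A) \<longrightarrow>
     (\<forall>x\<in>cube. \<forall>y\<in>cube. \<bar>u x - u y\<bar> \<le> C * 2 ^ j * A * dist x y)"
proof -
  obtain C where C: "0 < C" and bern: "\<And>j u. u \<in> fun_span (\<Phi> \<union> (\<Union>k<j. \<Psi> k)) \<Longrightarrow>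
      L_norm \<infinity> cube_measure (gradient u) \<le> ennreal (C * 2 ^ j) * L_norm \<infinity> cube_measure u"
    using bernstein by (metis infinity_ennreal_def top_greatest)
  show ?thesis
  proof (intro exI[of _ C] conjI C allI ballI impI)
    fix j u A and x y :: "real ^ 'n"
    assume u: "u \<in> fun_span (\<Phi> \<union> (\<Union>k<j. \<Psi> k))" and A: "\<forall>x\<in>cube. \<bar>u x\<bar> \<le> A"
      and xy: "x \<in> cube" "y \<in> cube"
    have A0: "0 \<le> A" using bspec[OF A xy(1)] by linarith
    have C1: "C1_on_cube u" by (rule C1_on_cube_fun_span[OF _ u]) (use basis_C1 in auto)
    have "L_norm \<infinity> cube_measure u \<le> ennreal A"
      using continuous_measurable_cube[OF C1_on_cube_continuous[OF C1]] A
      by (intro L_norm_infinity_le) (auto intro!: AE_I2)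
    then have "L_norm \<infinity> cube_measure (gradient u) \<le> ennreal (C * 2 ^ j) * ennreal A"
      by (intro order_trans[OF bern[OF u]] mult_left_mono) auto
    also have "\<dots> = ennreal (C * 2 ^ j * A)"
      using C A0 by (simp flip: ennreal_mult)
    finally show "\<bar>u x - u y\<bar> \<le> C * 2 ^ j * A * dist x y"
      using C A0 xy by (intro lipschitz_of_gradient_bound[OF C1]) auto
  qed
qed

lemma in_fun_span: "\<phi> \<in> B \<Longrightarrow> \<phi> \<in> fun_span B"
  unfolding fun_span_def by (intro CollectI exI[of _ "{\<phi>}"] exI[of _ "\<lambda>_. 1"]) auto

text \<open>Exponent \<open>\<infinity>\<close> in \<open>normalized\<close> gives the amplitude
  \<open>2 powr (d * j / 2)\<close>, as \<open>1 / \<infinity> = 0\<close>, with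
  \<open>d = CARD('n)\<close>; the Lipschitz constant costs a further \<open>2 ^ j\<close>.\<close>

lemma wavelet_bounds:
  "\<exists>A L. 0 < A \<and> 0 < L \<and>
    (\<forall>j. \<forall>\<psi>\<in>\<Psi> j. \<forall>x. \<bar>ext \<psi> x\<bar> \<le> A * 2 powr (real CARD('n) * real j / 2)) \<and>
    (\<forall>j. \<forall>\<psi>\<in>\<Psi> j. \<forall>x\<in>cube. \<forall>y\<in>cube.
       \<bar>\<psi> x - \<psi> y\<bar> \<le> L * 2 ^ j * 2 powr (real CARD('n) * real j / 2) * dist x y)"
proof -
  obtain A where A: "0 < A" and norm: "\<And>j \<psi>. \<psi> \<in> \<Psi> j \<Longrightarrow>
      L_norm \<infinity> cube_measure \<psi> \<le> ennreal (A * 2 powr (real CARD('n) * real j * (1 / 2 - enn2real (1 / \<infinity>))))"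
    using normalized unfolding Let_def by (metis infinity_ennreal_def top_greatest)
  have A': "\<bar>\<psi> x\<bar> \<le> A * 2 powr (real CARD('n) * real j / 2)" if "\<psi> \<in> \<Psi> j" "x \<in> cube" for j \<psi> x
    using L_norm_infinity_le_imp[OF basis_continuous[of \<psi>] norm[OF that(1)]] that A
    by (auto simp: real_norm_def)
  obtain C where C: "0 < C"
    and lip: "\<forall>j. \<forall>u\<in>fun_span (\<Phi> \<union> (\<Union>k<j. \<Psi> k)). \<forall>A. (\<forall>x\<in>cube. \<bar>u x\<bar> \<le> A) \<longrightarrow>
     (\<forall>x\<in>cube. \<forall>y\<in>cube. \<bar>u x - u y\<bar> \<le> C * 2 ^ j * A * dist x y)"
    using lipschitz_span by (elim exE conjE)
  show ?thesis
  proof (rule exI[of _ A], rule exI[of _ "2 * C * A"], intro conjI allI ballI)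
    show "0 < 2 * C * A" using A C by simp
    show "\<bar>ext \<psi> x\<bar> \<le> A * 2 powr (real CARD('n) * real j / 2)" if "\<psi> \<in> \<Psi> j" for j \<psi> x
      using A'[OF that] A by (auto simp: ext_def)
    fix j \<psi> and x y :: "real ^ 'n" assume \<psi>: "\<psi> \<in> \<Psi> j" and xy: "x \<in> cube" "y \<in> cube"
    \<comment> \<open>The spans in \<open>bernstein\<close> stop strictly below their index, so
      level \<open>j\<close> is treated at \<open>Suc j\<close>; hence the \<open>2\<close> in
      \<open>2 * C * A\<close>.\<close>
    have "\<psi> \<in> fun_span (\<Phi> \<union> (\<Union>k<Suc j. \<Psi> k))"
      using \<psi> by (intro in_fun_span) auto
    moreover have "\<forall>x\<in>cube. \<bar>\<psi> x\<bar> \<le> A * 2 powr (real CARD('n) * real j / 2)"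
      using A'[OF \<psi>] by blast
    ultimately have "\<bar>\<psi> x - \<psi> y\<bar> \<le> C * 2 ^ Suc j * (A * 2 powr (real CARD('n) * real j / 2)) * dist x y"
      using lip xy by blast
    then show "\<bar>\<psi> x - \<psi> y\<bar> \<le> 2 * C * A * 2 ^ j * 2 powr (real CARD('n) * real j / 2) * dist x y"
      by (simp add: mult.assoc mult.left_commute)
  qed (rule A)
qed

end

section \<open>Finiteness of the levels and geometry of the supports\<close>

context wavelet_system
begin

text \<open>Parseval's identity for finite combinations: it turns a vanishing combination into
  vanishing coefficients and evaluates the quadratic term in
  \<open>projection_distance\<close>.\<close>

lemma basis_subset_sum:
  assumes "finite F" "F \<subseteq> basis"
  shows "(\<integral>x. (\<Sum>\<phi>\<in>F. c \<phi> * ext \<phi> x) * (\<Sum>\<phi>\<in>F. c \<phi> * ext \<phi> x) \<partial>cubeM) = (\<Sum>\<phi>\<in>F. c \<phi> * c \<phi>)"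
proof -
  have I: "integrable cubeM (\<lambda>x. ext \<phi> x * ext \<psi> x)" if "\<phi> \<in> F" "\<psi> \<in> F" for \<phi> \<psi>
  proof -
    have \<phi>: "\<phi> \<in> basis" and \<psi>: "\<psi> \<in> basis" using assms that by auto
    obtain B where B: "0 \<le> B" "\<And>x. \<bar>ext \<phi> x\<bar> \<le> B" by (rule basis_bounded[OF \<phi>]) (rule that)
    obtain B' where B': "0 \<le> B'" "\<And>x. \<bar>ext \<psi> x\<bar> \<le> B'" by (rule basis_bounded[OF \<psi>]) (rule that)
    show ?thesis
      by (rule integrable_unit_cube[where B = "B * B'"])
        (auto simp: abs_mult simp del: ext_in intro!: mult_mono B B' borel_measurable_times ext_basis_measurable[OF \<phi>] ext_basis_measurable[OF \<psi>])
  qed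
  have "(\<integral>x. (\<Sum>\<phi>\<in>F. c \<phi> * ext \<phi> x) * (\<Sum>\<phi>\<in>F. c \<phi> * ext \<phi> x) \<partial>cubeM) =
      (\<integral>x. (\<Sum>\<phi>\<in>F. \<Sum>\<psi>\<in>F. c \<phi> * c \<psi> * (ext \<phi> x * ext \<psi> x)) \<partial>cubeM)"
    unfolding sum_product by (intro Bochner_Integration.integral_cong sum.cong) (simp_all only: mult.assoc mult.left_commute)
  also have "\<dots> = (\<Sum>\<phi>\<in>F. \<Sum>\<psi>\<in>F. c \<phi> * c \<psi> * (\<integral>x. ext \<phi> x * ext \<psi> x \<partial>cubeM))"
  proof (subst Bochner_Integration.integral_sum)
    show "(\<Sum>\<phi>\<in>F. \<integral>x. (\<Sum>\<psi>\<in>F. c \<phi> * c \<psi> * (ext \<phi> x * ext \<psi> x)) \<partial>cubeM) =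
        (\<Sum>\<phi>\<in>F. \<Sum>\<psi>\<in>F. c \<phi> * c \<psi> * (\<integral>x. ext \<phi> x * ext \<psi> x \<partial>cubeM))"
      by (intro sum.cong refl, subst Bochner_Integration.integral_sum)
        (auto intro!: I integrable_mult_right simp del: mult.assoc)
  qed (intro Bochner_Integration.integrable_sum integrable_mult_right I)
  also have "\<dots> = (\<Sum>\<phi>\<in>F. \<Sum>\<psi>\<in>F. c \<phi> * c \<psi> * (if \<phi> = \<psi> then 1 else 0))"
    using assms by (intro sum.cong) (auto simp: orthonormal subset_iff)
  also have "\<dots> = (\<Sum>\<phi>\<in>F. c \<phi> * c \<phi>)"
    using assms by (simp add: if_distrib[of "\<lambda>z. _ * z"] cong: if_cong)
  finally show ?thesis .
qed

text \<open>A function of \<open>span \<Phi>\<close> vanishing on a fine net of the cube vanishes, because its Lipschitz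
  constant is controlled by its maximum.\<close>

lemma finite_\<Phi>: "finite \<Phi>"
proof (rule ccontr)
  assume inf: "infinite \<Phi>"
  obtain C where C: "0 < C"
    and lip: "\<forall>j. \<forall>u\<in>fun_span (\<Phi> \<union> (\<Union>k<j. \<Psi> k)). \<forall>A. (\<forall>x\<in>cube. \<bar>u x\<bar> \<le> A) \<longrightarrow>
     (\<forall>x\<in>cube. \<forall>y\<in>cube. \<bar>u x - u y\<bar> \<le> C * 2 ^ j * A * dist x y)"
    using lipschitz_span by (elim exE conjE)
  have "\<forall>e>0. \<exists>X. finite X \<and> X \<subseteq> cube \<and> (cube :: (real ^ 'n) set) \<subseteq> (\<Union>x\<in>X. ball x e)"
    by (intro seq_compact_imp_totally_bounded compact_imp_seq_compact compact_cbox)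
  note net = this
  have "0 < 1 / (2 * C)" using C by simp
  from net[rule_format, OF this] obtain X :: "(real ^ 'n) set"
    where X: "finite X" "X \<subseteq> cube" "cube \<subseteq> (\<Union>x\<in>X. ball x (1 / (2 * C)))"
    by (elim exE conjE)
  \<comment> \<open>One function more than there are points in the net, so some nontrivial
    combination vanishes on the net.\<close>
  obtain F where F: "finite F" "card F = Suc (card X)" "F \<subseteq> \<Phi>"
    using infinite_arbitrarily_large[OF inf, of "Suc (card X)"] by blast
  obtain c where c: "\<exists>y\<in>F. c y \<noteq> 0" "\<forall>x\<in>X. (\<Sum>y\<in>F. c y * y x) = 0"
  proof -
    have "card X < card F" using F(2) by simp
    from homogeneous_system[OF X(1) F(1) this, of "\<lambda>y x. y x"] show ?thesis
      using that by (elim exE conjE)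
  qed
  define u where "u x = (\<Sum>y\<in>F. c y * y x)" for x
  have uspan: "u \<in> fun_span (\<Phi> \<union> (\<Union>k<0. \<Psi> k))"
    unfolding fun_span_def u_def[abs_def]
    by (intro CollectI exI[of _ F] exI[of _ c]) (use F in auto)
  have "C1_on_cube u" by (rule C1_on_cube_fun_span[OF _ uspan]) (use basis_C1 in auto)
  then have "continuous_on cube u" by (rule C1_on_cube_continuous)
  then have "continuous_on cube (\<lambda>x. \<bar>u x\<bar>)" by (intro continuous_intros)
  moreover have "0 \<in> (cube :: (real ^ 'n) set)" by (simp add: mem_box_cart)
  then have "cube \<noteq> ({} :: (real ^ 'n) set)" by blast
  ultimately obtain z where z: "z \<in> cube" "\<forall>x\<in>cube. \<bar>u x\<bar> \<le> \<bar>u z\<bar>"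
    using continuous_attains_sup[OF compact_cbox, of 0 1 "\<lambda>x. \<bar>u x\<bar>"] by blast
  obtain x where x: "x \<in> X" "dist x z < 1 / (2 * C)" using X(3) z(1) by auto
  \<comment> \<open>Between the maximum point \<open>z\<close> and a net point within
    \<open>1 / (2 * C)\<close> the function can change by at most half of its maximum, yet it drops
    to zero.\<close>
  have "\<bar>u z - u x\<bar> \<le> C * 2 ^ 0 * \<bar>u z\<bar> * dist z x"
    using mp[OF spec[OF bspec[OF spec[OF lip, of 0] uspan], of "\<bar>u z\<bar>"] z(2)] z(1) x(1) X(2) by (simp add: subset_iff)
  also have "\<dots> \<le> C * \<bar>u z\<bar> * (1 / (2 * C))"
    using x C by (simp only: power_0 mult_1_right, intro mult_left_mono) (auto simp: dist_commute)
  also have "\<dots> = \<bar>u z\<bar> / 2" using C by simp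
  finally have "\<bar>u z\<bar> \<le> \<bar>u z\<bar> / 2" using c(2) x(1) by (simp add: u_def)
  then have "u z = 0" by simp
  then have u0: "u x = 0" if "x \<in> cube" for x using z that by auto
  have "(\<Sum>\<phi>\<in>F. c \<phi> * ext \<phi> x) = 0" for x
    using u0[of x] by (cases "x \<in> cube") (simp_all add: ext_def u_def)
  then have "(\<Sum>\<phi>\<in>F. c \<phi> * c \<phi>) = 0"
    using basis_subset_sum[of F c] F by auto
  then show False using c(1) F(1) by (subst (asm) sum_nonneg_eq_0_iff) auto
qed

lemma measure_box_cart:
  fixes a b :: "real ^ 'm"
  assumes "\<forall>k. a $ k \<le> b $ k"
  shows "measure lborel (cbox a b) = (\<Prod>k\<in>UNIV. b $ k - a $ k)"
proof -
  have "a \<in> cbox a b" using assms by (simp add: mem_box_cart)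
  then have "cbox a b \<noteq> {}" by blast
  then show ?thesis by (rule content_cbox_cart)
qed

text \<open>A unit L2 norm together with the sup bound forces every rectangle to have a definite
  volume. This makes the sides nondegenerate, as averaging over them requires, and with bounded
  overlap it makes every level finite.\<close>

lemma wavelet_boxes:
  "\<exists>(a :: nat \<Rightarrow> (real ^ 'n \<Rightarrow> real) \<Rightarrow> real ^ 'n) b K. 0 < K \<and> (\<forall>j. finite (\<Psi> j) \<and>
     (\<forall>\<psi>\<in>\<Psi> j. (\<forall>k. 0 \<le> a j \<psi> $ k \<and> a j \<psi> $ k < b j \<psi> $ k \<and> b j \<psi> $ k \<le> 1 \<and>
          b j \<psi> $ k - a j \<psi> $ k \<le> K * 2 powr (- real j)) \<and>
        (\<forall>x. x \<notin> cbox (a j \<psi>) (b j \<psi>) \<longrightarrow> ext \<psi> x = 0) \<and>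
        emeasure cubeM (cbox (a j \<psi>) (b j \<psi>)) \<le> ennreal (K ^ CARD('n) * 2 powr (- real CARD('n) * real j))) \<and>
     (AE x in cubeM. real (card {\<psi>\<in>\<Psi> j. x \<in> cbox (a j \<psi>) (b j \<psi>)}) \<le> K))"
proof -
  obtain I :: "nat \<Rightarrow> (real ^ 'n \<Rightarrow> real) \<Rightarrow> (real ^ 'n) set" and K0 where
    I: "\<forall>j. (\<forall>\<psi>\<in>\<Psi> j. (\<exists>a b. I j \<psi> = cbox a b) \<and> I j \<psi> \<subseteq> cube \<and>
            closure {x \<in> cube. \<psi> x \<noteq> 0} \<subseteq> I j \<psi> \<and> diameter (I j \<psi>) \<le> K0 * 2 powr (- real j)) \<and>
         eL_norm \<infinity> cube_measure (\<lambda>x. \<integral>\<^sup>+ \<psi>. indicator (I j \<psi>) x \<partial>count_space (\<Psi> j)) \<le> ennreal K0"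
    using localized by (elim exE)
  have I1: "\<exists>a b. I j \<psi> = cbox a b" and I2: "I j \<psi> \<subseteq> cube"
    and I3: "closure {x \<in> cube. \<psi> x \<noteq> 0} \<subseteq> I j \<psi>" and I4: "diameter (I j \<psi>) \<le> K0 * 2 powr (- real j)"
    if "\<psi> \<in> \<Psi> j" for j \<psi>
    using bspec[OF conjunct1[OF spec[OF I, of j]] that] by simp_all
  have I5: "eL_norm \<infinity> cube_measure (\<lambda>x. \<integral>\<^sup>+ \<psi>. indicator (I j \<psi>) x \<partial>count_space (\<Psi> j)) \<le> ennreal K0" for j
    by (rule conjunct2[OF spec[OF I, of j]])
  \<comment> \<open>One positive constant for diameter and overlap.\<close>
  define K where "K = max K0 1"
  have K: "0 < K" "K0 \<le> K" by (auto simp: K_def)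
  define a where "a j \<psi> = (SOME a. \<exists>b. I j \<psi> = cbox a b)" for j \<psi>
  define b where "b j \<psi> = (SOME b. I j \<psi> = cbox (a j \<psi>) b)" for j \<psi>
  have Iab: "I j \<psi> = cbox (a j \<psi>) (b j \<psi>)" if "\<psi> \<in> \<Psi> j" for j \<psi>
  proof -
    have "\<exists>b. I j \<psi> = cbox (a j \<psi>) b" unfolding a_def by (rule someI_ex[OF I1[OF that]])
    then show ?thesis unfolding b_def by (rule someI_ex)
  qed
  obtain A where A: "0 < A"
    and \<psi>A': "\<forall>j. \<forall>\<psi>\<in>\<Psi> j. \<forall>x. \<bar>ext \<psi> x\<bar> \<le> A * 2 powr (real CARD('n) * real j / 2)"
    using wavelet_bounds by (elim exE conjE)
  have \<psi>A: "\<bar>ext \<psi> x\<bar> \<le> A * 2 powr (real CARD('n) * real j / 2)" if "\<psi> \<in> \<Psi> j" for j \<psi> x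
    using \<psi>A' that by simp
  have sub: "cbox (a j \<psi>) (b j \<psi>) \<subseteq> cube" if "\<psi> \<in> \<Psi> j" for j \<psi>
    using I2[OF that] Iab[OF that] by simp
  have out: "ext \<psi> x = 0" if "\<psi> \<in> \<Psi> j" "x \<notin> cbox (a j \<psi>) (b j \<psi>)" for j \<psi> x
  proof -
    have "{x \<in> cube. \<psi> x \<noteq> 0} \<subseteq> I j \<psi>" using I3[OF that(1)] closure_subset by (rule order_trans[rotated])
    then show ?thesis using that Iab[OF that(1)] by (auto simp: ext_def)
  qed
  define S where "S j = A * 2 powr (real CARD('n) * real j / 2)" for j
  have S: "0 < S j" for j using A by (simp add: S_def)
  \<comment> \<open>The volume is at least \<open>1 / (S j)\<^sup>2\<close>, since the square of a
    wavelet integrates to \<open>1\<close> and is at most \<open>(S j)\<^sup>2\<close>.\<close>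
  have vol: "1 \<le> (S j)\<^sup>2 * measure lborel (cbox (a j \<psi>) (b j \<psi>))" if \<psi>: "\<psi> \<in> \<Psi> j" for j \<psi>
  proof -
    let ?I = "cbox (a j \<psi>) (b j \<psi>)"
    have \<psi>b: "\<psi> \<in> basis" using \<psi> by auto
    have [measurable]: "ext \<psi> \<in> borel_measurable borel" by (rule ext_basis_measurable[OF \<psi>b])
    have "1 = (\<integral>x. ext \<psi> x * ext \<psi> x \<partial>cubeM)" using orthonormal[OF \<psi>b \<psi>b] by simp
    also have "\<dots> \<le> (\<integral>x. (S j)\<^sup>2 * indicator ?I x \<partial>cubeM)"
    proof (rule integral_mono)
      have sq: "ext \<psi> x * ext \<psi> x \<le> (S j)\<^sup>2" for x
        using power_mono[OF \<psi>A[OF \<psi>, of x], of 2] by (simp add: S_def power2_eq_square)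
      show "integrable cubeM (\<lambda>x. ext \<psi> x * ext \<psi> x)"
        by (rule integrable_unit_cube[where B = "(S j)\<^sup>2"]) (auto simp: sq simp del: ext_in)
      show "integrable cubeM (\<lambda>x. (S j)\<^sup>2 * indicator ?I x :: real)"
        by (rule integrable_unit_cube[where B = "(S j)\<^sup>2"]) (auto simp: indicator_def)
      show "ext \<psi> x * ext \<psi> x \<le> (S j)\<^sup>2 * indicator ?I x" for x
        using sq[of x] out[OF \<psi>, of x] by (auto simp: indicator_def)
    qed
    also have "\<dots> = (S j)\<^sup>2 * measure cubeM ?I" by simp
    also have "measure cubeM ?I = measure lborel ?I"
      using sub[OF \<psi>] by (simp add: measure_def emeasure_unit_cube Int_absorb2)
    finally show ?thesis .
  qed
  have ne: "a j \<psi> $ k < b j \<psi> $ k" if "\<psi> \<in> \<Psi> j" for j \<psi> k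
  proof -
    have pos: "measure lborel (cbox (a j \<psi>) (b j \<psi>)) \<noteq> 0" using vol[OF that] by auto
    have le: "\<forall>k. a j \<psi> $ k \<le> b j \<psi> $ k"
    proof (rule ccontr)
      assume "\<not> ?thesis"
      then have "cbox (a j \<psi>) (b j \<psi>) = {}"
        by (auto simp: mem_box_cart set_eq_iff not_le) (meson le_less_trans not_le order_trans)
      then show False using pos by simp
    qed
    then have "(\<Prod>k\<in>UNIV. b j \<psi> $ k - a j \<psi> $ k) \<noteq> 0" using pos by (simp add: measure_box_cart)
    then have "b j \<psi> $ k \<noteq> a j \<psi> $ k" by simp
    then show ?thesis using spec[OF le, of k] by linarith
  qed
  have ab: "a j \<psi> \<in> cbox (a j \<psi>) (b j \<psi>)" "b j \<psi> \<in> cbox (a j \<psi>) (b j \<psi>)" if "\<psi> \<in> \<Psi> j" for j \<psi>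
    using ne[OF that] by (auto simp: mem_box_cart less_imp_le)
  have side: "b j \<psi> $ k - a j \<psi> $ k \<le> K * 2 powr (- real j)" if "\<psi> \<in> \<Psi> j" for j \<psi> k
  proof -
    have "b j \<psi> $ k - a j \<psi> $ k \<le> dist (b j \<psi>) (a j \<psi>)"
      using component_le_norm_cart[of "b j \<psi> - a j \<psi>" k] by (simp add: dist_norm)
    also have "\<dots> \<le> diameter (I j \<psi>)"
      using ab[OF that] Iab[OF that] by (intro diameter_bounded_bound) auto
    also have "\<dots> \<le> K0 * 2 powr (- real j)" by (rule I4[OF that])
    also have "\<dots> \<le> K * 2 powr (- real j)" using K by (intro mult_right_mono) auto
    finally show ?thesis .
  qed
  \<comment> \<open>Stated for finite subsets because finiteness of \<open>\<Psi> j\<close> is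
    derived from it; for an infinite set \<open>card\<close> would be \<open>0\<close>.\<close>
  have cardY: "AE x in cubeM. real (card {\<psi>\<in>Y. x \<in> cbox (a j \<psi>) (b j \<psi>)}) \<le> K"
    if Y: "finite Y" "Y \<subseteq> \<Psi> j" for Y j
  proof -
    let ?g = "\<lambda>x. \<integral>\<^sup>+ \<psi>. indicator (I j \<psi>) x \<partial>count_space (\<Psi> j)"
    have le: "esssup cube_measure ?g \<le> ennreal K0"
      using I5[of j] by (simp add: eL_norm_def)
    have "AE x in cube_measure. ?g x \<le> esssup cube_measure ?g" by (rule esssup_AE)
    then have "AE x in cubeM. ?g x \<le> esssup cube_measure ?g"
      by (simp only: AE_cube_measure_iff)
    then show ?thesis
    proof eventually_elim
      case (elim x)
      have "ennreal (real (card {\<psi>\<in>Y. x \<in> cbox (a j \<psi>) (b j \<psi>)})) = (\<Sum>\<psi>\<in>Y. indicator (I j \<psi>) x)"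
      proof -
        have "(\<Sum>\<psi>\<in>Y. indicator (I j \<psi>) x) = (\<Sum>\<psi>\<in>Y. if x \<in> cbox (a j \<psi>) (b j \<psi>) then 1 else 0 :: ennreal)"
          using Y Iab by (intro sum.cong) (auto simp: indicator_def subset_iff)
        also have "\<dots> = of_nat (card {\<psi>\<in>Y. x \<in> cbox (a j \<psi>) (b j \<psi>)})"
          using Y by (simp flip: sum.inter_filter)
        finally show ?thesis by (simp add: ennreal_of_nat_eq_real_of_nat)
      qed
      also have "\<dots> = (\<integral>\<^sup>+ \<psi>. indicator (I j \<psi>) x * indicator Y \<psi> \<partial>count_space UNIV)"
        using Y by (subst nn_integral_count_space_indicator[symmetric]) (auto simp: nn_integral_count_space_finite)
      also have "\<dots> \<le> (\<integral>\<^sup>+ \<psi>. indicator (I j \<psi>) x * indicator (\<Psi> j) \<psi> \<partial>count_space UNIV)"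
        using Y by (intro nn_integral_mono) (auto simp: indicator_def)
      also have "\<dots> = ?g x" by (subst nn_integral_count_space_indicator) auto
      also have "\<dots> \<le> ennreal K0" using elim le by (rule order_trans)
      also have "\<dots> \<le> ennreal K" using K by (intro ennreal_leI)
      finally show ?case using K by simp
    qed
  qed
  \<comment> \<open>\<open>N\<close> wavelets occupy a total volume of at least
    \<open>N / (S j)\<^sup>2\<close>, while overlap at most \<open>K\<close> in a cube of volume
    \<open>1\<close> leaves room for at most \<open>K\<close>.\<close>
  have fin: "finite (\<Psi> j)" for j
  proof (rule ccontr)
    assume inf: "infinite (\<Psi> j)"
    obtain N :: nat where N: "K * (S j)\<^sup>2 < real N" using reals_Archimedean2 by blast
    obtain Y where Y: "finite Y" "card Y = N" "Y \<subseteq> \<Psi> j"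
      using infinite_arbitrarily_large[OF inf, of N] by blast
    have "real N = (\<Sum>\<psi>\<in>Y. 1)" using Y by simp
    also have "\<dots> \<le> (\<Sum>\<psi>\<in>Y. (S j)\<^sup>2 * measure lborel (cbox (a j \<psi>) (b j \<psi>)))"
      using vol Y by (intro sum_mono) auto
    also have "\<dots> = (\<Sum>\<psi>\<in>Y. (S j)\<^sup>2 * measure cubeM (cbox (a j \<psi>) (b j \<psi>)))"
      using sub Y by (intro sum.cong) (auto simp: measure_def emeasure_unit_cube Int_absorb2 subset_iff)
    also have "\<dots> = (S j)\<^sup>2 * (\<integral>x. (\<Sum>\<psi>\<in>Y. indicator (cbox (a j \<psi>) (b j \<psi>)) x) \<partial>cubeM)"
      by (subst Bochner_Integration.integral_sum) (auto simp: sum_distrib_left intro!: integrable_unit_cube[where B = 1])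
    also have "(\<integral>x. (\<Sum>\<psi>\<in>Y. indicator (cbox (a j \<psi>) (b j \<psi>)) x :: real) \<partial>cubeM) \<le> (\<integral>x. K \<partial>(cubeM :: (real ^ 'n) measure))"
    proof (rule integral_mono_AE)
      show "integrable cubeM (\<lambda>x. \<Sum>\<psi>\<in>Y. indicator (cbox (a j \<psi>) (b j \<psi>)) x :: real)"
        by (intro Bochner_Integration.integrable_sum integrable_unit_cube[where B = 1]) auto
      show "AE x in cubeM. (\<Sum>\<psi>\<in>Y. indicator (cbox (a j \<psi>) (b j \<psi>)) x) \<le> K"
        using cardY[OF Y(1,3)]
      proof eventually_elim
        case (elim x)
        have "(\<Sum>\<psi>\<in>Y. indicator (cbox (a j \<psi>) (b j \<psi>)) x) = (\<Sum>\<psi>\<in>Y. if x \<in> cbox (a j \<psi>) (b j \<psi>) then 1 else 0 :: real)"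
          by (intro sum.cong) (auto simp: indicator_def)
        also have "\<dots> = real (card {\<psi>\<in>Y. x \<in> cbox (a j \<psi>) (b j \<psi>)})"
          using Y by (simp flip: sum.inter_filter)
        finally show ?case using elim by simp
      qed
    qed simp
    also have "(\<integral>x. K \<partial>(cubeM :: (real ^ 'n) measure)) = K"
      by (simp add: ucube.prob_space[simplified])
    finally show False using N S[of j] by (simp add: mult.commute mult_left_mono)
  qed
  have Kj: "(K * 2 powr (- real j)) ^ CARD('n) = K ^ CARD('n) * 2 powr (- real CARD('n) * real j)" for j
    by (simp add: power_mult_distrib powr_powr mult.commute flip: powr_realpow)
  have volK: "emeasure cubeM (cbox (a j \<psi>) (b j \<psi>)) \<le> ennreal (K ^ CARD('n) * 2 powr (- real CARD('n) * real j))"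
    if \<psi>: "\<psi> \<in> \<Psi> j" for j \<psi>
  proof -
    have "measure lborel (cbox (a j \<psi>) (b j \<psi>)) = (\<Prod>k\<in>UNIV. b j \<psi> $ k - a j \<psi> $ k)"
      using ne[OF \<psi>] by (intro measure_box_cart) (auto simp: less_imp_le)
    also have "\<dots> \<le> (\<Prod>k\<in>(UNIV :: 'n set). K * 2 powr (- real j))"
      using side[OF \<psi>] ne[OF \<psi>] by (intro prod_mono) (auto simp: less_imp_le)
    also have "\<dots> = K ^ CARD('n) * 2 powr (- real CARD('n) * real j)" by (simp add: Kj)
    finally have "measure lborel (cbox (a j \<psi>) (b j \<psi>)) \<le> K ^ CARD('n) * 2 powr (- real CARD('n) * real j)" .
    moreover have "emeasure cubeM (cbox (a j \<psi>) (b j \<psi>)) = ennreal (measure lborel (cbox (a j \<psi>) (b j \<psi>)))"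
    proof -
      have "emeasure cubeM (cbox (a j \<psi>) (b j \<psi>)) = emeasure lborel (cbox (a j \<psi>) (b j \<psi>))"
        using sub[OF \<psi>] by (simp add: emeasure_unit_cube Int_absorb2)
      also have "\<dots> = ennreal (measure lborel (cbox (a j \<psi>) (b j \<psi>)))"
        using emeasure_lborel_cbox_finite[of "a j \<psi>" "b j \<psi>"] by (intro emeasure_eq_ennreal_measure) auto
      finally show ?thesis .
    qed
    ultimately show ?thesis by (simp add: ennreal_leI)
  qed
  have in01: "0 \<le> a j \<psi> $ k \<and> b j \<psi> $ k \<le> 1" if "\<psi> \<in> \<Psi> j" for j \<psi> k
    using subsetD[OF sub[OF that] ab(1)[OF that]] subsetD[OF sub[OF that] ab(2)[OF that]]
    by (simp add: mem_box_cart)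
  show ?thesis
  proof (rule exI[of _ a], rule exI[of _ b], rule exI[of _ K], intro conjI allI ballI impI)
    fix j
    show "AE x in cubeM. real (card {\<psi>\<in>\<Psi> j. x \<in> cbox (a j \<psi>) (b j \<psi>)}) \<le> K"
      by (rule cardY[OF fin subset_refl])
    fix \<psi> assume \<psi>: "\<psi> \<in> \<Psi> j"
    show "0 \<le> a j \<psi> $ k" "b j \<psi> $ k \<le> 1" for k using in01[OF \<psi>] by auto
    show "a j \<psi> $ k < b j \<psi> $ k" for k by (rule ne[OF \<psi>])
    show "b j \<psi> $ k - a j \<psi> $ k \<le> K * 2 powr (- real j)" for k by (rule side[OF \<psi>])
    show "ext \<psi> x = 0" if "x \<notin> cbox (a j \<psi>) (b j \<psi>)" for x by (rule out[OF \<psi> that])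
    show "emeasure cubeM (cbox (a j \<psi>) (b j \<psi>)) \<le> ennreal (K ^ CARD('n) * 2 powr (- real CARD('n) * real j))"
      by (rule volK[OF \<psi>])
  qed (rule K(1) fin)+
qed

end

section \<open>Wavelet expansions and their line pieces\<close>

definition lp_norm :: "real \<Rightarrow> 'b set \<Rightarrow> ('b \<Rightarrow> real) \<Rightarrow> real" where
  "lp_norm p F \<beta> = (\<Sum>y\<in>F. \<bar>\<beta> y\<bar> powr p) powr (1 / p)"

lemma lp_norm_nonneg [simp]: "0 \<le> lp_norm p F \<beta>"
  by (simp add: lp_norm_def)

lemma lp_norm_powr: "0 < p \<Longrightarrow> lp_norm p F \<beta> powr p = (\<Sum>y\<in>F. \<bar>\<beta> y\<bar> powr p)"
  by (simp add: lp_norm_def powr_powr sum_nonneg)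

lemma lp_norm_mono: "finite F \<Longrightarrow> G \<subseteq> F \<Longrightarrow> 0 < p \<Longrightarrow> lp_norm p G \<beta> \<le> lp_norm p F \<beta>"
  unfolding lp_norm_def by (intro powr_mono2 sum_mono2 sum_nonneg) auto

lemma abs_le_lp_norm:
  assumes "finite F" "y \<in> F" "0 < p"
  shows "\<bar>\<beta> y\<bar> \<le> lp_norm p F \<beta>"
proof -
  have "\<bar>\<beta> y\<bar> powr p \<le> (\<Sum>y\<in>F. \<bar>\<beta> y\<bar> powr p)"
    using assms by (intro member_le_sum) auto
  then have "(\<bar>\<beta> y\<bar> powr p) powr (1 / p) \<le> lp_norm p F \<beta>"
    unfolding lp_norm_def using assms by (intro powr_mono2) auto
  then show ?thesis using assms by (simp add: powr_powr)
qed

text \<open>A representation of \<open>S\<close> as a divergence: the functions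
  \<open>line_primitive i (P i)\<close> are the components of a field, each with p-norm at most
  \<open>w\<close>. The sup bound on \<open>P\<close> is qualitative.\<close>

definition line_pieces :: "real \<Rightarrow> (real ^ 'n \<Rightarrow> real) \<Rightarrow> ('n \<Rightarrow> real ^ 'n \<Rightarrow> real) \<Rightarrow> real \<Rightarrow> bool" where
  "line_pieces p S P w \<longleftrightarrow> (\<forall>i. P i \<in> borel_measurable borel) \<and> (\<exists>C. \<forall>i x. \<bar>P i x\<bar> \<le> C) \<and>
     (\<forall>i x. primitive (\<lambda>s. P i (upd i s x)) 1 = 0) \<and> (\<forall>x. S x = (\<Sum>i\<in>UNIV. P i x)) \<and>
     (\<forall>i. (\<integral>\<^sup>+ x. ennreal (\<bar>line_primitive i (P i) x\<bar> powr p) \<partial>cubeM) \<le> ennreal (w powr p))"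

lemma localized_line_pieces:
  fixes \<psi> :: "'b \<Rightarrow> real ^ 'n \<Rightarrow> real" and l u :: "'b \<Rightarrow> real ^ 'n" and \<beta> :: "'b \<Rightarrow> real"
  assumes p: "1 \<le> p" and fin: "finite Y" and nn: "0 \<le> A" "0 \<le> h" "0 \<le> K" "0 \<le> V"
    and lu: "\<And>y k. y \<in> Y \<Longrightarrow> 0 \<le> l y $ k \<and> l y $ k < u y $ k \<and> u y $ k \<le> 1"
    and \<psi>m: "\<And>y. y \<in> Y \<Longrightarrow> \<psi> y \<in> borel_measurable borel"
    and \<psi>A: "\<And>y x. y \<in> Y \<Longrightarrow> \<bar>\<psi> y x\<bar> \<le> A"
    and \<psi>0: "\<And>y x. y \<in> Y \<Longrightarrow> x \<notin> cbox (l y) (u y) \<Longrightarrow> \<psi> y x = 0"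
    and mean: "\<And>y. y \<in> Y \<Longrightarrow> (\<integral>x. \<psi> y x \<partial>cubeM) = 0"
    and side: "\<And>y k. y \<in> Y \<Longrightarrow> u y $ k - l y $ k \<le> h"
    and overlap: "AE x in cubeM. real (card {y\<in>Y. x \<in> cbox (l y) (u y)}) \<le> K"
    and vol: "\<And>y. y \<in> Y \<Longrightarrow> emeasure cubeM (cbox (l y) (u y)) \<le> ennreal V"
    and w: "(K * (2 * A * h)) powr p * V * (\<Sum>y\<in>Y. \<bar>\<beta> y\<bar> powr p) \<le> w powr p"
  shows "\<exists>P. line_pieces p (\<lambda>x. \<Sum>y\<in>Y. \<beta> y * \<psi> y x) P w"
proof (rule localized_sum_pieces[OF p fin nn lu \<psi>m \<psi>A \<psi>0 mean side overlap vol])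
  fix P C
  assume P: "\<And>i. P i \<in> borel_measurable borel" "\<And>i x. \<bar>P i x\<bar> \<le> C"
    "\<And>i x. primitive (\<lambda>s. P i (upd i s x)) 1 = 0"
    "\<And>x. (\<Sum>y\<in>Y. \<beta> y * \<psi> y x) = (\<Sum>i\<in>UNIV. P i x)"
    "\<And>i. (\<integral>\<^sup>+ x. ennreal (\<bar>line_primitive i (P i) x\<bar> powr p) \<partial>cubeM) \<le>
       ennreal ((K * (2 * A * h)) powr p * V * (\<Sum>y\<in>Y. \<bar>\<beta> y\<bar> powr p))"
  have "line_pieces p (\<lambda>x. \<Sum>y\<in>Y. \<beta> y * \<psi> y x) P w"
    unfolding line_pieces_def
  proof (intro conjI allI)
    show "\<exists>C. \<forall>i x. \<bar>P i x\<bar> \<le> C"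
      by (rule exI[of _ C]) (simp add: P(2))
    show "(\<integral>\<^sup>+ x. ennreal (\<bar>line_primitive i (P i) x\<bar> powr p) \<partial>cubeM) \<le> ennreal (w powr p)" for i
      by (rule order_trans[OF P(5) ennreal_leI[OF w]])
  qed (rule P)+
  then show ?thesis by blast
qed assumption+

context wavelet_system
begin

definition levels_below :: "nat \<Rightarrow> (real ^ 'n \<Rightarrow> real) set" where
  "levels_below J = \<Phi> \<union> (\<Union>j<J. \<Psi> j)"

text \<open>The sets of the system may share functions. A repeated function is assigned to the first
  set that contains it, \<open>\<Phi>\<close> coming first, so partial sums count every basis
  function once.\<close>

definition new_level :: "nat \<Rightarrow> (real ^ 'n \<Rightarrow> real) set" where
  "new_level j = \<Psi> j - levels_below j"

definition level_weight :: "real \<Rightarrow> nat \<Rightarrow> real" where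
  "level_weight p j = 2 powr (- real j) * 2 powr (real CARD('n) * real j * (1 / 2 - 1 / p))"

lemma finite_\<Psi>: "finite (\<Psi> j)"
  using wavelet_boxes by (elim exE conjE) simp

lemma finite_levels_below: "finite (levels_below J)"
  by (simp add: levels_below_def finite_\<Phi> finite_\<Psi>)

lemma levels_below_subset: "levels_below J \<subseteq> basis"
  by (auto simp: levels_below_def)

lemma sum_levels_below: "(\<Sum>\<phi>\<in>levels_below J. h \<phi>) = (\<Sum>\<phi>\<in>\<Phi>. h \<phi>) + (\<Sum>j<J. \<Sum>\<psi>\<in>new_level j. h \<psi>)"
  for h :: "(real ^ 'n \<Rightarrow> real) \<Rightarrow> real"
proof (induction J)
  case 0
  then show ?case by (simp add: levels_below_def)
next
  case (Suc J)
  have "levels_below (Suc J) = levels_below J \<union> new_level J"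
    by (auto simp: levels_below_def new_level_def less_Suc_eq)
  moreover have "levels_below J \<inter> new_level J = {}" by (auto simp: new_level_def)
  moreover have "finite (new_level J)" by (simp add: new_level_def finite_\<Psi>)
  ultimately have "(\<Sum>\<phi>\<in>levels_below (Suc J). h \<phi>) = (\<Sum>\<phi>\<in>levels_below J. h \<phi>) + (\<Sum>\<psi>\<in>new_level J. h \<psi>)"
    by (simp add: sum.union_disjoint finite_levels_below)
  then show ?case using Suc by (simp add: add.assoc)
qed

text \<open>The constant is a polynomial of degree \<open>0\<close>. Integrals over the cube are
  therefore determined by the coefficients on \<open>\<Phi>\<close>, which gives mean zero for all
  other basis functions and conservation of mass under projection.\<close>

lemma one_in_span:
  obtains c where "\<And>x. x \<in> cube \<Longrightarrow> (\<Sum>\<phi>\<in>\<Phi>. c \<phi> * \<phi> x) = 1"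
proof -
  have "(\<lambda>x :: real ^ 'n. 1) \<in> polys_deg_le r"
    unfolding polys_deg_le_def
    by (rule in_fun_span, rule CollectI, rule exI[of _ "\<lambda>_. 0"]) (use regularity in auto)
  from bspec[OF polynomials this] obtain u where u: "u \<in> fun_span \<Phi>" "\<forall>x\<in>cube. u x = 1"
    by (elim bexE)
  then obtain S c where S: "finite S" "S \<subseteq> \<Phi>" "u = (\<lambda>x. \<Sum>\<phi>\<in>S. c \<phi> * \<phi> x)"
    unfolding fun_span_def by blast
  show thesis
  proof (rule that[of "\<lambda>\<phi>. if \<phi> \<in> S then c \<phi> else 0"])
    fix x :: "real ^ 'n" assume x: "x \<in> cube"
    have "(\<Sum>\<phi>\<in>\<Phi>. (if \<phi> \<in> S then c \<phi> else 0) * \<phi> x) = (\<Sum>\<phi>\<in>S. (if \<phi> \<in> S then c \<phi> else 0) * \<phi> x)"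
      using S by (intro sum.mono_neutral_right finite_\<Phi>) auto
    also have "\<dots> = u x" using S(3) by simp
    finally show "(\<Sum>\<phi>\<in>\<Phi>. (if \<phi> \<in> S then c \<phi> else 0) * \<phi> x) = 1" using u(2) x by simp
  qed
qed

lemma integrable_bounded_times_basis:
  assumes [measurable]: "h \<in> borel_measurable borel" and h: "\<And>x. x \<in> cube \<Longrightarrow> \<bar>h x\<bar> \<le> B" and \<phi>: "\<phi> \<in> basis"
  shows "integrable cubeM (\<lambda>x. h x * ext \<phi> x)"
proof -
  obtain B' where B': "0 \<le> B'" "\<And>x. \<bar>ext \<phi> x\<bar> \<le> B'" by (rule basis_bounded[OF \<phi>]) (rule that)
  have [measurable]: "ext \<phi> \<in> borel_measurable borel" by (rule ext_basis_measurable[OF \<phi>])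
  show ?thesis
  proof (rule integrable_unit_cube[where B = "\<bar>B\<bar> * B'"])
    fix x :: "real ^ 'n" assume x: "x \<in> cube"
    have "\<bar>h x\<bar> \<le> \<bar>B\<bar>" using h[OF x] by linarith
    then show "\<bar>h x * ext \<phi> x\<bar> \<le> \<bar>B\<bar> * B'"
      unfolding abs_mult using B' by (intro mult_mono) auto
  qed measurable
qed

lemma integral_via_one:
  assumes [measurable]: "h \<in> borel_measurable borel" and h: "\<And>x. x \<in> cube \<Longrightarrow> \<bar>h x\<bar> \<le> B"
    and one: "\<And>x. x \<in> cube \<Longrightarrow> (\<Sum>\<phi>\<in>\<Phi>. c \<phi> * \<phi> x) = 1"
  shows "(\<integral>x. h x \<partial>cubeM) = (\<Sum>\<phi>\<in>\<Phi>. c \<phi> * (\<integral>x. h x * ext \<phi> x \<partial>cubeM))"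
proof -
  have I: "integrable cubeM (\<lambda>x. h x * ext \<phi> x)" if "\<phi> \<in> \<Phi>" for \<phi>
    by (rule integrable_bounded_times_basis[OF assms(1) h]) (use that in auto)
  have [measurable]: "ext \<phi> \<in> borel_measurable borel" if "\<phi> \<in> \<Phi>" for \<phi>
    using that by (intro ext_basis_measurable) auto
  have "(\<integral>x. h x \<partial>cubeM) = (\<integral>x. (\<Sum>\<phi>\<in>\<Phi>. c \<phi> * (h x * ext \<phi> x)) \<partial>cubeM)"
  proof (intro integral_cong_AE AE_cubeI)
    fix x :: "real ^ 'n" assume x: "x \<in> cube"
    have "(\<Sum>\<phi>\<in>\<Phi>. c \<phi> * (h x * ext \<phi> x)) = h x * (\<Sum>\<phi>\<in>\<Phi>. c \<phi> * \<phi> x)"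
      unfolding sum_distrib_left using x by (intro sum.cong) simp_all
    then show "h x = (\<Sum>\<phi>\<in>\<Phi>. c \<phi> * (h x * ext \<phi> x))" using one[OF x] by simp
  qed measurable
  also have "\<dots> = (\<Sum>\<phi>\<in>\<Phi>. c \<phi> * (\<integral>x. h x * ext \<phi> x \<partial>cubeM))"
    using I by (subst Bochner_Integration.integral_sum) (auto intro!: integrable_mult_right)
  finally show ?thesis .
qed

lemma basis_mean_zero:
  assumes \<psi>: "\<psi> \<in> basis" "\<psi> \<notin> \<Phi>"
  shows "(\<integral>x. ext \<psi> x \<partial>cubeM) = 0"
proof -
  obtain c where one: "\<And>x. x \<in> cube \<Longrightarrow> (\<Sum>\<phi>\<in>\<Phi>. c \<phi> * \<phi> x) = 1" by (rule one_in_span) (rule that)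
  obtain B where B: "0 \<le> B" "\<And>x. \<bar>ext \<psi> x\<bar> \<le> B" by (rule basis_bounded[OF \<psi>(1)]) (rule that)
  have "(\<integral>x. ext \<psi> x \<partial>cubeM) = (\<Sum>\<phi>\<in>\<Phi>. c \<phi> * (\<integral>x. ext \<psi> x * ext \<phi> x \<partial>cubeM))"
    by (rule integral_via_one[OF ext_basis_measurable[OF \<psi>(1)] B(2) one])
  also have "\<dots> = 0"
  proof (intro sum.neutral ballI)
    fix \<phi> assume "\<phi> \<in> \<Phi>"
    then show "c \<phi> * (\<integral>x. ext \<psi> x * ext \<phi> x \<partial>cubeM) = 0"
      using \<psi> by (subst orthonormal) auto
  qed
  finally show ?thesis .
qed

text \<open>Level \<open>0\<close> below is the span of \<open>\<Phi>\<close>, level \<open>Suc j\<close> consists of the new functions of \<open>\<Psi> j\<close>.\<close>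

definition level_sum :: "((real ^ 'n \<Rightarrow> real) \<Rightarrow> real) \<Rightarrow> nat \<Rightarrow> real ^ 'n \<Rightarrow> real" where
  "level_sum \<beta> k x = (case k of 0 \<Rightarrow> \<Sum>\<phi>\<in>\<Phi>. \<beta> \<phi> * ext \<phi> x | Suc j \<Rightarrow> \<Sum>\<psi>\<in>new_level j. \<beta> \<psi> * ext \<psi> x)"

definition level_norm :: "real \<Rightarrow> ((real ^ 'n \<Rightarrow> real) \<Rightarrow> real) \<Rightarrow> nat \<Rightarrow> real" where
  "level_norm p \<beta> k = (case k of 0 \<Rightarrow> lp_norm p \<Phi> \<beta> | Suc j \<Rightarrow> level_weight p j * lp_norm p (\<Psi> j) \<beta>)"

text \<open>With \<open>d = CARD('n)\<close>, the height \<open>2 powr (d * j / 2)\<close>, the side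
  \<open>2 powr (- j)\<close> and the \<open>p\<close>-th root of the volume
  \<open>2 powr (- d * j)\<close> multiply to \<open>level_weight p j\<close>.\<close>

lemma wavelet_level_pieces:
  assumes p: "1 \<le> p"
  shows "\<exists>C\<ge>0. \<forall>\<beta> j. \<exists>P. line_pieces p (level_sum \<beta> (Suc j)) P (C * level_norm p \<beta> (Suc j))"
proof -
  obtain a b K where K: "0 < K" and box: "\<forall>j. finite (\<Psi> j) \<and>
     (\<forall>\<psi>\<in>\<Psi> j. (\<forall>k. 0 \<le> a j \<psi> $ k \<and> a j \<psi> $ k < b j \<psi> $ k \<and> b j \<psi> $ k \<le> 1 \<and>
          b j \<psi> $ k - a j \<psi> $ k \<le> K * 2 powr (- real j)) \<and>
        (\<forall>x. x \<notin> cbox (a j \<psi>) (b j \<psi>) \<longrightarrow> ext \<psi> x = 0) \<and>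
        emeasure cubeM (cbox (a j \<psi>) (b j \<psi>)) \<le> ennreal (K ^ CARD('n) * 2 powr (- real CARD('n) * real j))) \<and>
     (AE x in cubeM. real (card {\<psi>\<in>\<Psi> j. x \<in> cbox (a j \<psi>) (b j \<psi>)}) \<le> K)"
    using wavelet_boxes by (elim exE conjE)
  have boxD: "\<forall>k. 0 \<le> a j \<psi> $ k \<and> a j \<psi> $ k < b j \<psi> $ k \<and> b j \<psi> $ k \<le> 1 \<and>
          b j \<psi> $ k - a j \<psi> $ k \<le> K * 2 powr (- real j)"
      "x \<notin> cbox (a j \<psi>) (b j \<psi>) \<Longrightarrow> ext \<psi> x = 0"
      "emeasure cubeM (cbox (a j \<psi>) (b j \<psi>)) \<le> ennreal (K ^ CARD('n) * 2 powr (- real CARD('n) * real j))"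
    if "\<psi> \<in> \<Psi> j" for j \<psi> x
    using bspec[OF conjunct1[OF conjunct2[OF spec[OF box, of j]]] that] by simp_all
  have boxAE: "AE x in cubeM. real (card {\<psi>\<in>\<Psi> j. x \<in> cbox (a j \<psi>) (b j \<psi>)}) \<le> K" for j
    by (rule conjunct2[OF conjunct2[OF spec[OF box, of j]]])
  obtain A where A: "0 < A"
    and \<psi>A': "\<forall>j. \<forall>\<psi>\<in>\<Psi> j. \<forall>x. \<bar>ext \<psi> x\<bar> \<le> A * 2 powr (real CARD('n) * real j / 2)"
    using wavelet_bounds by (elim exE conjE)
  have \<psi>A: "\<bar>ext \<psi> x\<bar> \<le> A * 2 powr (real CARD('n) * real j / 2)" if "\<psi> \<in> \<Psi> j" for j \<psi> x
    using \<psi>A' that by simp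
  define C where "C = 2 * K * A * K * (K ^ CARD('n)) powr (1 / p)"
  have C: "0 \<le> C" using A K by (simp add: C_def)
  show ?thesis
  proof (rule exI[of _ C], intro conjI C allI)
    fix \<beta> :: "(real ^ 'n \<Rightarrow> real) \<Rightarrow> real" and j
    define d where "d = real CARD('n)"
    have sub: "new_level j \<subseteq> \<Psi> j" by (auto simp: new_level_def)
    have fin: "finite (new_level j)" by (rule finite_subset[OF sub finite_\<Psi>])
    have inb: "\<psi> \<in> basis" "\<psi> \<notin> \<Phi>" if "\<psi> \<in> new_level j" for \<psi>
      using that by (auto simp: new_level_def levels_below_def)
    have "(K * (2 * (A * 2 powr (d * real j / 2)) * (K * 2 powr (- real j)))) powr p *
          (K ^ CARD('n) * 2 powr (- d * real j)) * (\<Sum>\<psi>\<in>new_level j. \<bar>\<beta> \<psi>\<bar> powr p) =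
        (C * (level_weight p j * lp_norm p (new_level j) \<beta>)) powr p"
    proof -
      have V: "K ^ CARD('n) * 2 powr (- d * real j) = ((K ^ CARD('n)) powr (1 / p) * 2 powr (- d * real j / p)) powr p"
        using p K by (simp add: powr_mult powr_powr)
      have "2 powr (d * real j / 2) * 2 powr (- d * real j / p) = 2 powr (d * real j * (1 / 2 - 1 / p))"
        by (simp flip: powr_add add: algebra_simps)
      then have e: "(K * (2 * (A * 2 powr (d * real j / 2)) * (K * 2 powr (- real j)))) *
          ((K ^ CARD('n)) powr (1 / p) * 2 powr (- d * real j / p)) * lp_norm p (new_level j) \<beta> =
          C * (level_weight p j * lp_norm p (new_level j) \<beta>)"
        by (simp add: C_def level_weight_def d_def algebra_simps)
      have N: "(\<Sum>\<psi>\<in>new_level j. \<bar>\<beta> \<psi>\<bar> powr p) = lp_norm p (new_level j) \<beta> powr p"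
        using p by (simp add: lp_norm_powr)
      show ?thesis
        unfolding N V e[symmetric] using A K by (simp add: powr_mult)
    qed
    also have "\<dots> \<le> (C * level_norm p \<beta> (Suc j)) powr p"
      using p C lp_norm_mono[OF finite_\<Psi> sub, of p \<beta>]
      by (intro powr_mono2 mult_left_mono mult_nonneg_nonneg) (auto simp: level_norm_def level_weight_def intro!: mult_left_mono)
    finally have cost: "(K * (2 * (A * 2 powr (d * real j / 2)) * (K * 2 powr (- real j)))) powr p *
          (K ^ CARD('n) * 2 powr (- d * real j)) * (\<Sum>\<psi>\<in>new_level j. \<bar>\<beta> \<psi>\<bar> powr p) \<le>
        (C * level_norm p \<beta> (Suc j)) powr p" .
    have "\<exists>P. line_pieces p (\<lambda>x. \<Sum>\<psi>\<in>new_level j. \<beta> \<psi> * ext \<psi> x) P (C * level_norm p \<beta> (Suc j))"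
    proof (rule localized_line_pieces[where l = "a j" and u = "b j" and A = "A * 2 powr (d * real j / 2)"
          and h = "K * 2 powr (- real j)" and K = K and V = "K ^ CARD('n) * 2 powr (- d * real j)"])
      show "AE x in cubeM. real (card {\<psi>\<in>new_level j. x \<in> cbox (a j \<psi>) (b j \<psi>)}) \<le> K"
        using boxAE[of j]
      proof eventually_elim
        case (elim x)
        have "card {\<psi>\<in>new_level j. x \<in> cbox (a j \<psi>) (b j \<psi>)} \<le> card {\<psi>\<in>\<Psi> j. x \<in> cbox (a j \<psi>) (b j \<psi>)}"
          using sub finite_\<Psi>[of j] by (intro card_mono) auto
        then show ?case using elim by linarith
      qed
      fix \<psi> assume \<psi>: "\<psi> \<in> new_level j"
      then have \<psi>j: "\<psi> \<in> \<Psi> j" using sub by auto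
      show "ext \<psi> \<in> borel_measurable borel" by (rule ext_basis_measurable[OF inb(1)[OF \<psi>]])
      show "(\<integral>x. ext \<psi> x \<partial>cubeM) = 0" by (rule basis_mean_zero[OF inb[OF \<psi>]])
      show "0 \<le> a j \<psi> $ k \<and> a j \<psi> $ k < b j \<psi> $ k \<and> b j \<psi> $ k \<le> 1" for k
        using boxD(1)[OF \<psi>j] by simp
      show "b j \<psi> $ k - a j \<psi> $ k \<le> K * 2 powr (- real j)" for k
        using boxD(1)[OF \<psi>j] by simp
      show "\<bar>ext \<psi> x\<bar> \<le> A * 2 powr (d * real j / 2)" for x
        using \<psi>A[OF \<psi>j] by (simp add: d_def)
      show "ext \<psi> x = 0" if "x \<notin> cbox (a j \<psi>) (b j \<psi>)" for x by (rule boxD(2)[OF \<psi>j that])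
      show "emeasure cubeM (cbox (a j \<psi>) (b j \<psi>)) \<le> ennreal (K ^ CARD('n) * 2 powr (- d * real j))"
        using boxD(3)[OF \<psi>j] by (simp add: d_def)
    qed (use p fin A K cost in simp_all)
    then show "\<exists>P. line_pieces p (level_sum \<beta> (Suc j)) P (C * level_norm p \<beta> (Suc j))"
      by (simp add: level_sum_def[abs_def])
  qed
qed

text \<open>The functions of \<open>\<Phi>\<close> need not have mean zero individually, only the
  combination does; so the whole sum is decomposed at once, with the cube as its box. The constant
  contains the sup norms of the finitely many functions.\<close>

lemma coarse_level_pieces:
  assumes p: "1 \<le> p"
  shows "\<exists>C\<ge>0. \<forall>\<beta>. (\<integral>x. level_sum \<beta> 0 x \<partial>cubeM) = 0 \<longrightarrow>
    (\<exists>P. line_pieces p (level_sum \<beta> 0) P (C * level_norm p \<beta> 0))"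
proof -
  have "\<forall>\<phi>\<in>\<Phi>. \<exists>B. 0 \<le> B \<and> (\<forall>x. \<bar>ext \<phi> x\<bar> \<le> B)"
  proof
    fix \<phi> assume "\<phi> \<in> \<Phi>"
    then have "\<phi> \<in> basis" by simp
    from basis_bounded[OF this] show "\<exists>B. 0 \<le> B \<and> (\<forall>x. \<bar>ext \<phi> x\<bar> \<le> B)" by metis
  qed
  from bchoice[OF this] obtain B where B: "\<forall>\<phi>\<in>\<Phi>. 0 \<le> B \<phi> \<and> (\<forall>x. \<bar>ext \<phi> x\<bar> \<le> B \<phi>)" ..
  define C where "C = 2 * (\<Sum>\<phi>\<in>\<Phi>. B \<phi>)"
  have C: "0 \<le> C" unfolding C_def using B by (simp add: sum_nonneg)
  show ?thesis
  proof (rule exI[of _ C], intro conjI C allI impI)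
    fix \<beta> assume mean: "(\<integral>x. level_sum \<beta> 0 x \<partial>cubeM) = 0"
    define A where "A = (\<Sum>\<phi>\<in>\<Phi>. B \<phi>) * lp_norm p \<Phi> \<beta>"
    have A: "0 \<le> A" unfolding A_def using B by (simp add: sum_nonneg)
    have m: "level_sum \<beta> 0 \<in> borel_measurable borel"
      unfolding level_sum_def[abs_def]
      by (simp, intro borel_measurable_sum borel_measurable_times ext_basis_measurable) auto
    have bound: "\<bar>level_sum \<beta> 0 x\<bar> \<le> A" for x
    proof -
      have "\<bar>level_sum \<beta> 0 x\<bar> \<le> (\<Sum>\<phi>\<in>\<Phi>. \<bar>\<beta> \<phi> * ext \<phi> x\<bar>)" by (simp add: level_sum_def)
      also have "\<dots> \<le> (\<Sum>\<phi>\<in>\<Phi>. lp_norm p \<Phi> \<beta> * B \<phi>)"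
        unfolding abs_mult using B p finite_\<Phi> by (intro sum_mono mult_mono abs_le_lp_norm) auto
      also have "\<dots> = A" by (simp add: A_def sum_distrib_right mult.commute)
      finally show ?thesis .
    qed
    have out: "level_sum \<beta> 0 x = 0" if "x \<notin> cbox 0 1" for x
      using that by (simp add: level_sum_def ext_def)
    \<comment> \<open>A one-point index set with coefficient \<open>1\<close> reuses the localized
      statement.\<close>
    have "\<exists>P. line_pieces p (\<lambda>x. \<Sum>y\<in>{()}. 1 * level_sum \<beta> 0 x) P (C * level_norm p \<beta> 0)"
    proof (rule localized_line_pieces[where l = "\<lambda>_. 0" and u = "\<lambda>_. 1" and A = A and h = 1 and K = 1 and V = 1])
      show "emeasure cubeM (cbox 0 1) \<le> ennreal 1"
        using ucube.emeasure_le_1 by simp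
      show "AE x in cubeM. real (card {y \<in> {()}. x \<in> cbox 0 1}) \<le> 1"
        by (intro AE_I2) (simp add: card_le_Suc0_iff_eq)
      show "(1 * (2 * A * 1)) powr p * 1 * (\<Sum>y\<in>{()}. \<bar>1\<bar> powr p) \<le> (C * level_norm p \<beta> 0) powr p"
        by (simp add: A_def C_def level_norm_def mult.assoc)
      show "level_sum \<beta> 0 x = 0" if "x \<notin> cbox 0 1" for x by (rule out[OF that])
      show "level_sum \<beta> 0 \<in> borel_measurable borel" by (rule m)
      show "\<bar>level_sum \<beta> 0 x\<bar> \<le> A" for x by (rule bound)
    qed (use p A mean in simp_all)
    then show "\<exists>P. line_pieces p (level_sum \<beta> 0) P (C * level_norm p \<beta> 0)" by simp
  qed
qed

end

section \<open>Orthogonal projection onto finitely many levels\<close>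

context wavelet_system
begin

definition coeff :: "(real ^ 'n \<Rightarrow> real) \<Rightarrow> (real ^ 'n \<Rightarrow> real) \<Rightarrow> real" where
  "coeff h \<phi> = (\<integral>x. h x * ext \<phi> x \<partial>cubeM)"

definition basis_sum :: "((real ^ 'n \<Rightarrow> real) \<Rightarrow> real) \<Rightarrow> (real ^ 'n \<Rightarrow> real) set \<Rightarrow> real ^ 'n \<Rightarrow> real" where
  "basis_sum c F x = (\<Sum>\<phi>\<in>F. c \<phi> * ext \<phi> x)"

lemma basis_sum_measurable:
  assumes "F \<subseteq> basis"
  shows "basis_sum c F \<in> borel_measurable borel"
  unfolding basis_sum_def[abs_def]
  using assms by (intro borel_measurable_sum borel_measurable_times ext_basis_measurable) auto

lemma basis_sum_bounded:
  assumes F: "finite F" "F \<subseteq> basis"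
  obtains B where "\<And>x. \<bar>basis_sum c F x\<bar> \<le> B"
proof -
  have "\<forall>\<phi>\<in>F. \<exists>B. 0 \<le> B \<and> (\<forall>x. \<bar>ext \<phi> x\<bar> \<le> B)"
  proof
    fix \<phi> assume "\<phi> \<in> F"
    then have "\<phi> \<in> basis" using F by auto
    from basis_bounded[OF this] show "\<exists>B. 0 \<le> B \<and> (\<forall>x. \<bar>ext \<phi> x\<bar> \<le> B)" by metis
  qed
  from bchoice[OF this] obtain B where B: "\<forall>\<phi>\<in>F. 0 \<le> B \<phi> \<and> (\<forall>x. \<bar>ext \<phi> x\<bar> \<le> B \<phi>)" ..
  have "\<bar>basis_sum c F x\<bar> \<le> (\<Sum>\<phi>\<in>F. \<bar>c \<phi>\<bar> * B \<phi>)" for x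
  proof -
    have "\<bar>basis_sum c F x\<bar> \<le> (\<Sum>\<phi>\<in>F. \<bar>c \<phi> * ext \<phi> x\<bar>)" by (simp add: basis_sum_def)
    also have "\<dots> \<le> (\<Sum>\<phi>\<in>F. \<bar>c \<phi>\<bar> * B \<phi>)"
      unfolding abs_mult using B by (intro sum_mono mult_left_mono) auto
    finally show ?thesis .
  qed
  then show thesis by (rule that)
qed

lemma integral_times_basis_sum:
  assumes h: "h \<in> borel_measurable borel" "\<And>x. x \<in> cube \<Longrightarrow> \<bar>h x\<bar> \<le> B" and F: "finite F" "F \<subseteq> basis"
  shows "(\<integral>x. h x * basis_sum c F x \<partial>cubeM) = (\<Sum>\<phi>\<in>F. c \<phi> * coeff h \<phi>)"
proof -
  have I: "integrable cubeM (\<lambda>x. h x * ext \<phi> x)" if "\<phi> \<in> F" for \<phi>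
    by (rule integrable_bounded_times_basis[OF h]) (use that F in auto)
  have "(\<integral>x. h x * basis_sum c F x \<partial>cubeM) = (\<integral>x. (\<Sum>\<phi>\<in>F. c \<phi> * (h x * ext \<phi> x)) \<partial>cubeM)"
    by (simp add: basis_sum_def sum_distrib_left mult.left_commute)
  also have "\<dots> = (\<Sum>\<phi>\<in>F. c \<phi> * coeff h \<phi>)"
    unfolding coeff_def using I by (subst Bochner_Integration.integral_sum) (auto intro!: integrable_mult_right)
  finally show ?thesis .
qed

lemma coeff_basis_sum:
  assumes F: "finite F" "F \<subseteq> basis" and \<phi>: "\<phi> \<in> F"
  shows "coeff (basis_sum c F) \<phi> = c \<phi>"
proof -
  have \<phi>b: "\<phi> \<in> basis" using \<phi> F by auto
  obtain B where B: "0 \<le> B" "\<And>x. \<bar>ext \<phi> x\<bar> \<le> B" by (rule basis_bounded[OF \<phi>b]) (rule that)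
  have "coeff (basis_sum c F) \<phi> = (\<integral>x. ext \<phi> x * basis_sum c F x \<partial>cubeM)"
    by (simp add: coeff_def mult.commute)
  also have "\<dots> = (\<Sum>\<psi>\<in>F. c \<psi> * coeff (ext \<phi>) \<psi>)"
    by (rule integral_times_basis_sum[OF ext_basis_measurable[OF \<phi>b] B(2) F])
  also have "\<dots> = (\<Sum>\<psi>\<in>F. c \<psi> * (if \<phi> = \<psi> then 1 else 0))"
  proof (intro sum.cong refl)
    fix \<psi> assume "\<psi> \<in> F"
    then have "\<psi> \<in> basis" using F by auto
    then show "c \<psi> * coeff (ext \<phi>) \<psi> = c \<psi> * (if \<phi> = \<psi> then 1 else 0)"
      using orthonormal[OF \<phi>b] by (simp add: coeff_def)
  qed
  also have "\<dots> = c \<phi>" using F \<phi> by (simp add: if_distrib[of "\<lambda>z. _ * z"] cong: if_cong)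
  finally show ?thesis .
qed

text \<open>Integration is testing against the constant, which lies in the span of
  \<open>\<Phi>\<close> and so sees only coefficients that the projection keeps.\<close>

lemma integral_projection:
  assumes h: "h \<in> borel_measurable borel" "\<And>x. x \<in> cube \<Longrightarrow> \<bar>h x\<bar> \<le> B"
    and F: "finite F" "\<Phi> \<subseteq> F" "F \<subseteq> basis"
  shows "(\<integral>x. basis_sum (coeff h) F x \<partial>cubeM) = (\<integral>x. h x \<partial>cubeM)"
proof -
  obtain c where one: "\<And>x. x \<in> cube \<Longrightarrow> (\<Sum>\<phi>\<in>\<Phi>. c \<phi> * \<phi> x) = 1" by (rule one_in_span) (rule that)
  obtain B' where B': "\<And>x. \<bar>basis_sum (coeff h) F x\<bar> \<le> B'" by (rule basis_sum_bounded[OF F(1,3)]) (rule that)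
  have "(\<integral>x. basis_sum (coeff h) F x \<partial>cubeM) = (\<Sum>\<phi>\<in>\<Phi>. c \<phi> * coeff (basis_sum (coeff h) F) \<phi>)"
    unfolding coeff_def[of "basis_sum (coeff h) F"] by (rule integral_via_one[OF basis_sum_measurable[OF F(3)] B' one])
  also have "\<dots> = (\<Sum>\<phi>\<in>\<Phi>. c \<phi> * coeff h \<phi>)"
    by (intro sum.cong refl) (use coeff_basis_sum[OF F(1,3)] F(2) in auto)
  also have "\<dots> = (\<integral>x. h x \<partial>cubeM)"
    unfolding coeff_def by (rule integral_via_one[OF h one, symmetric])
  finally show ?thesis .
qed

lemma projection_distance:
  assumes h: "h \<in> borel_measurable borel" "\<And>x. x \<in> cube \<Longrightarrow> \<bar>h x\<bar> \<le> B" and F: "finite F" "F \<subseteq> basis"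
  shows "(\<integral>x. (h x - basis_sum c F x)\<^sup>2 \<partial>cubeM) =
    (\<integral>x. (h x)\<^sup>2 \<partial>cubeM) - 2 * (\<Sum>\<phi>\<in>F. c \<phi> * coeff h \<phi>) + (\<Sum>\<phi>\<in>F. c \<phi> * c \<phi>)"
proof -
  have [measurable]: "h \<in> borel_measurable borel" "basis_sum c F \<in> borel_measurable borel"
    by (rule h, rule basis_sum_measurable[OF F(2)])
  obtain B' where B': "\<And>x. \<bar>basis_sum c F x\<bar> \<le> B'" by (rule basis_sum_bounded[OF F]) (rule that)
  have B0: "0 \<le> B'" using B'[of 0] by linarith
  have I: "integrable cubeM (\<lambda>x. (h x)\<^sup>2)" "integrable cubeM (\<lambda>x. h x * basis_sum c F x)"
    "integrable cubeM (\<lambda>x. basis_sum c F x * basis_sum c F x)"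
  proof -
    have hB: "\<bar>h x\<bar> \<le> \<bar>B\<bar>" if "x \<in> cube" for x using h(2)[OF that] by linarith
    show "integrable cubeM (\<lambda>x. (h x)\<^sup>2)"
    proof (rule integrable_unit_cube[where B = "\<bar>B\<bar> * \<bar>B\<bar>"])
      show "\<bar>(h x)\<^sup>2\<bar> \<le> \<bar>B\<bar> * \<bar>B\<bar>" if "x \<in> cube" for x
        unfolding power2_eq_square abs_mult using hB[OF that] by (intro mult_mono) auto
    qed measurable
    show "integrable cubeM (\<lambda>x. h x * basis_sum c F x)"
    proof (rule integrable_unit_cube[where B = "\<bar>B\<bar> * B'"])
      show "\<bar>h x * basis_sum c F x\<bar> \<le> \<bar>B\<bar> * B'" if "x \<in> cube" for x
        unfolding abs_mult using hB[OF that] B' by (intro mult_mono) auto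
    qed measurable
    show "integrable cubeM (\<lambda>x. basis_sum c F x * basis_sum c F x)"
    proof (rule integrable_unit_cube[where B = "B' * B'"])
      show "\<bar>basis_sum c F x * basis_sum c F x\<bar> \<le> B' * B'" for x
        unfolding abs_mult using B' B0 by (intro mult_mono) auto
    qed measurable
  qed
  have "(\<integral>x. (h x - basis_sum c F x)\<^sup>2 \<partial>cubeM) =
      (\<integral>x. (h x)\<^sup>2 - 2 * (h x * basis_sum c F x) + basis_sum c F x * basis_sum c F x \<partial>cubeM)"
    by (intro Bochner_Integration.integral_cong) (auto simp: power2_eq_square algebra_simps)
  also have "\<dots> = (\<integral>x. (h x)\<^sup>2 \<partial>cubeM) - 2 * (\<integral>x. h x * basis_sum c F x \<partial>cubeM) +
      (\<integral>x. basis_sum c F x * basis_sum c F x \<partial>cubeM)"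
    using I by simp
  also have "(\<integral>x. basis_sum c F x * basis_sum c F x \<partial>cubeM) = (\<Sum>\<phi>\<in>F. c \<phi> * c \<phi>)"
    unfolding basis_sum_def by (rule basis_subset_sum[OF F])
  finally show ?thesis by (simp only: integral_times_basis_sum[OF h F])
qed

lemma basis_levels: "finite T \<Longrightarrow> T \<subseteq> basis \<Longrightarrow> \<exists>J. T \<subseteq> levels_below J"
proof (induction T rule: finite_induct)
  case empty
  then show ?case by simp
next
  case (insert \<phi> T)
  then obtain J where J: "T \<subseteq> levels_below J" by auto
  have "\<exists>j. \<phi> \<in> levels_below j"
    using insert.prems by (auto simp: levels_below_def)
  then obtain j where "\<phi> \<in> levels_below j" ..
  then have "insert \<phi> T \<subseteq> levels_below (max j J)"
    using J by (auto simp: levels_below_def)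
  then show ?case ..
qed

text \<open>Density of the span yields some approximant from finitely many levels; the partial sum
  with the coefficients of \<open>h\<close> is at least as close.\<close>

lemma projection_approx:
  assumes h: "h \<in> borel_measurable borel" "\<And>x. x \<in> cube \<Longrightarrow> \<bar>h x\<bar> \<le> B" and \<eta>: "0 < \<eta>"
  shows "\<exists>J. (\<integral>x. (h x - basis_sum (coeff h) (levels_below J) x)\<^sup>2 \<partial>cubeM) \<le> \<eta>\<^sup>2"
proof -
  have [measurable]: "h \<in> borel_measurable borel" by (rule h)
  have L2: "L_norm 2 cube_measure v = (if (\<integral>\<^sup>+ x. ennreal ((v x)\<^sup>2) \<partial>cube_measure) = \<infinity> then \<infinity>
      else ennreal (enn2real (\<integral>\<^sup>+ x. ennreal ((v x)\<^sup>2) \<partial>cube_measure) powr (1 / 2)))" for v :: "real ^ 'n \<Rightarrow> real"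
  proof -
    have "epowr (ennreal \<bar>v x\<bar>) 2 = ennreal ((v x)\<^sup>2)" for x
      by (simp add: epowr_def powr_numeral)
    then show ?thesis by (simp add: L_norm_def eL_norm_def epowr_def)
  qed
  have "h \<in> L_space 2 cube_measure"
  proof -
    have "h \<in> borel_measurable cube_measure" by (simp add: measurable_restrict_space1)
    moreover have "(\<integral>\<^sup>+ x. ennreal ((h x)\<^sup>2) \<partial>cube_measure) < \<infinity>"
    proof -
      have "(\<integral>\<^sup>+ x. ennreal ((h x)\<^sup>2) \<partial>cube_measure) = (\<integral>\<^sup>+ x. ennreal ((h x)\<^sup>2) \<partial>cubeM)"
        by (rule nn_integral_cube_measure) measurable
      also have "\<dots> \<le> (\<integral>\<^sup>+ x. ennreal (B\<^sup>2) \<partial>(cubeM :: (real ^ 'n) measure))"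
      proof (intro nn_integral_mono_AE AE_cubeI ennreal_leI)
        fix x :: "real ^ 'n" assume "x \<in> cube"
        then show "(h x)\<^sup>2 \<le> B\<^sup>2" using power_mono[OF h(2), of x 2] by simp
      qed
      also have "\<dots> < \<infinity>" by (simp add: ucube.emeasure_space_1[simplified])
      finally show ?thesis .
    qed
    ultimately show ?thesis by (simp add: L_space_def L2)
  qed
  then obtain u where u: "u \<in> fun_span basis" "L_norm 2 cube_measure (\<lambda>x. h x - u x) < ennreal \<eta>"
    using orthonormal_basis \<eta> unfolding orthonormal_basis_L2_def by blast
  obtain T c where T: "finite T" "T \<subseteq> basis" "u = (\<lambda>x. \<Sum>\<phi>\<in>T. c \<phi> * \<phi> x)"
    using u(1) unfolding fun_span_def by blast
  obtain J where J: "T \<subseteq> levels_below J" using basis_levels[OF T(1,2)] ..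
  let ?F = "levels_below J"
  define c' where "c' \<phi> = (if \<phi> \<in> T then c \<phi> else 0)" for \<phi>
  have uc: "u x = basis_sum c' ?F x" if "x \<in> cube" for x
  proof -
    have "basis_sum c' ?F x = (\<Sum>\<phi>\<in>T. c' \<phi> * ext \<phi> x)"
      unfolding basis_sum_def using J by (intro sum.mono_neutral_right finite_levels_below) (auto simp: c'_def)
    also have "\<dots> = u x" using that by (simp add: T(3) c'_def)
    finally show ?thesis ..
  qed
  note F = finite_levels_below[of J] levels_below_subset[of J]
  have [measurable]: "basis_sum c' ?F \<in> borel_measurable borel" by (rule basis_sum_measurable[OF F(2)])
  let ?N = "\<integral>\<^sup>+ x. ennreal ((h x - u x)\<^sup>2) \<partial>cube_measure"
  have N: "?N = (\<integral>\<^sup>+ x. ennreal ((h x - basis_sum c' ?F x)\<^sup>2) \<partial>cubeM)"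
  proof -
    have "?N = (\<integral>\<^sup>+ x. ennreal ((h x - basis_sum c' ?F x)\<^sup>2) \<partial>cube_measure)"
      by (intro nn_integral_cong) (simp add: uc)
    then show ?thesis by (simp add: nn_integral_cube_measure)
  qed
  have fin: "?N \<noteq> \<infinity>" "ennreal (enn2real ?N powr (1 / 2)) < ennreal \<eta>"
    using u(2) by (auto simp: L2 split: if_splits)
  have "(enn2real ?N powr (1 / 2)) powr 2 \<le> \<eta> powr 2"
    using fin(2) \<eta> by (intro powr_mono2) (auto simp: ennreal_less_iff)
  then have "enn2real ?N \<le> \<eta>\<^sup>2"
    using \<eta> by (simp add: powr_powr powr_numeral)
  moreover have "enn2real ?N = (\<integral>x. (h x - basis_sum c' ?F x)\<^sup>2 \<partial>cubeM)"
    unfolding N by (subst integral_eq_nn_integral) auto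
  moreover have "(\<integral>x. (h x - basis_sum (coeff h) ?F x)\<^sup>2 \<partial>cubeM) \<le>
      (\<integral>x. (h x - basis_sum c' ?F x)\<^sup>2 \<partial>cubeM)"
  proof -
    \<comment> \<open>Completing the square: by \<open>projection_distance\<close> this sum is the
      difference of the two squared errors.\<close>
    have "0 \<le> (\<Sum>\<phi>\<in>?F. (c' \<phi> - coeff h \<phi>)\<^sup>2)" by (simp add: sum_nonneg)
    also have "\<dots> = (\<Sum>\<phi>\<in>?F. c' \<phi> * c' \<phi>) - 2 * (\<Sum>\<phi>\<in>?F. c' \<phi> * coeff h \<phi>) + (\<Sum>\<phi>\<in>?F. coeff h \<phi> * coeff h \<phi>)"
      unfolding sum_distrib_left sum_subtractf[symmetric] sum.distrib[symmetric]
      by (intro sum.cong) (simp_all add: power2_eq_square algebra_simps)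
    finally show ?thesis by (simp add: projection_distance[OF h F])
  qed
  ultimately have "(\<integral>x. (h x - basis_sum (coeff h) ?F x)\<^sup>2 \<partial>cubeM) \<le> \<eta>\<^sup>2" by linarith
  then show ?thesis ..
qed

lemma sum_level_sum: "(\<Sum>k<Suc J. level_sum \<beta> k x) = basis_sum \<beta> (levels_below J) x"
  unfolding basis_sum_def sum_levels_below sum.lessThan_Suc_shift by (simp add: level_sum_def)

lemma line_pieces_mono: "line_pieces p S P v \<Longrightarrow> 0 \<le> v \<Longrightarrow> v \<le> w \<Longrightarrow> 0 \<le> p \<Longrightarrow> line_pieces p S P w"
  unfolding line_pieces_def by (meson ennreal_leI order_trans powr_mono2)

text \<open>Pieces are indexed by level and direction, so \<open>snd q\<close> is the direction of
  \<open>q\<close>. Every direction is charged the full cost of its level, whence the factor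
  \<open>CARD('n)\<close>.\<close>

lemma assembled_pieces:
  assumes p: "1 \<le> p"
  shows "\<exists>C\<ge>0. \<forall>\<beta> J \<eta>. 0 < \<eta> \<longrightarrow> (\<integral>x. level_sum \<beta> 0 x \<partial>cubeM) = 0 \<longrightarrow>
    (\<exists>S B c. (\<forall>q\<in>{..<Suc J} \<times> UNIV. S q \<in> borel_measurable borel \<and> (\<forall>x. \<bar>S q x\<bar> \<le> B) \<and>
        (\<forall>x. primitive (\<lambda>s. S q (upd (snd q) s x)) 1 = 0) \<and> 0 < c q \<and>
        (\<integral>\<^sup>+ x. ennreal (\<bar>line_primitive (snd q) (S q) x\<bar> powr p) \<partial>cubeM) \<le> ennreal (c q powr p)) \<and>
      (\<forall>x. (\<Sum>q\<in>{..<Suc J} \<times> UNIV. S q x) = basis_sum \<beta> (levels_below J) x) \<and>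
      (\<Sum>q\<in>{..<Suc J} \<times> UNIV. c q) \<le> C * (\<Sum>k<Suc J. level_norm p \<beta> k) + \<eta>)"
proof -
  obtain C1 where C1: "0 \<le> C1" "\<forall>\<beta> j. \<exists>P. line_pieces p (level_sum \<beta> (Suc j)) P (C1 * level_norm p \<beta> (Suc j))"
    using wavelet_level_pieces[OF p] by blast
  obtain C0 where C0: "0 \<le> C0" "\<forall>\<beta>. (\<integral>x. level_sum \<beta> 0 x \<partial>cubeM) = 0 \<longrightarrow>
    (\<exists>P. line_pieces p (level_sum \<beta> 0) P (C0 * level_norm p \<beta> 0))"
    using coarse_level_pieces[OF p] by blast
  define C where "C = max C0 C1"
  have C: "0 \<le> C" "C0 \<le> C" "C1 \<le> C" using C0 C1 by (auto simp: C_def)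
  have ln: "0 \<le> level_norm p \<beta> k" for \<beta> k by (cases k) (simp_all add: level_norm_def level_weight_def)
  show ?thesis
  proof (rule exI[of _ "real CARD('n) * C"], intro conjI allI impI)
    show "0 \<le> real CARD('n) * C" using C by simp
    fix \<beta> J and \<eta> :: real
    assume \<eta>: "0 < \<eta>" and mean: "(\<integral>x. level_sum \<beta> 0 x \<partial>cubeM) = 0"
    have "\<exists>P. line_pieces p (level_sum \<beta> k) P (C * level_norm p \<beta> k)" for k
    proof (cases k)
      case 0
      obtain P where "line_pieces p (level_sum \<beta> 0) P (C0 * level_norm p \<beta> 0)"
        using C0(2) mean by blast
      then show ?thesis
        unfolding 0 using p C C0(1) ln by (intro exI[of _ P]) (auto elim!: line_pieces_mono intro!: mult_right_mono)
    next
      case (Suc j)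
      obtain P where "line_pieces p (level_sum \<beta> (Suc j)) P (C1 * level_norm p \<beta> (Suc j))"
        using C1(2) by blast
      then show ?thesis
        unfolding Suc using p C C1(1) ln by (intro exI[of _ P]) (auto elim!: line_pieces_mono intro!: mult_right_mono)
    qed
    from choice[OF allI[OF this]] obtain P where P: "\<forall>k. line_pieces p (level_sum \<beta> k) (P k) (C * level_norm p \<beta> k)" ..
    have Pm: "P k i \<in> borel_measurable borel" and Pb: "\<exists>C. \<forall>i x. \<bar>P k i x\<bar> \<le> C"
      and P0: "primitive (\<lambda>s. P k i (upd i s x)) 1 = 0" and Ps: "level_sum \<beta> k x = (\<Sum>i\<in>UNIV. P k i x)"
      and Pc: "(\<integral>\<^sup>+ x. ennreal (\<bar>line_primitive i (P k i) x\<bar> powr p) \<partial>cubeM) \<le> ennreal ((C * level_norm p \<beta> k) powr p)"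
      for k i x
      using spec[OF P, of k] unfolding line_pieces_def by simp_all
    from choice[OF allI[OF Pb]] obtain Bk where Bk: "\<forall>k. \<forall>i x. \<bar>P k i x\<bar> \<le> Bk k" ..
    define B where "B = Max (Bk ` {..<Suc J})"
    define X where "X = {..<Suc J} \<times> (UNIV :: 'n set)"
    have X: "finite X" "X \<noteq> {}" "card X = Suc J * CARD('n)" by (auto simp: X_def card_cartesian_product)
    \<comment> \<open>The slack \<open>\<eta>\<close> is shared equally so that costs stay positive
      on levels whose coefficients vanish.\<close>
    define c where "c q = C * level_norm p \<beta> (fst q) + \<eta> / real (card X)" for q :: "nat \<times> 'n"
    have "0 < card X" using X(1,2) by (simp add: card_gt_0_iff)
    note cX = this
    then have e0: "0 < \<eta> / real (card X)" using \<eta> by simp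
    show "\<exists>S B c. (\<forall>q\<in>{..<Suc J} \<times> UNIV. S q \<in> borel_measurable borel \<and> (\<forall>x. \<bar>S q x\<bar> \<le> B) \<and>
        (\<forall>x. primitive (\<lambda>s. S q (upd (snd q) s x)) 1 = 0) \<and> 0 < c q \<and>
        (\<integral>\<^sup>+ x. ennreal (\<bar>line_primitive (snd q) (S q) x\<bar> powr p) \<partial>cubeM) \<le> ennreal (c q powr p)) \<and>
      (\<forall>x. (\<Sum>q\<in>{..<Suc J} \<times> UNIV. S q x) = basis_sum \<beta> (levels_below J) x) \<and>
      (\<Sum>q\<in>{..<Suc J} \<times> UNIV. c q) \<le> real CARD('n) * C * (\<Sum>k<Suc J. level_norm p \<beta> k) + \<eta>"
    proof (rule exI[of _ "\<lambda>q. P (fst q) (snd q)"], rule exI[of _ B], rule exI[of _ c], intro conjI ballI allI)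
      fix q :: "nat \<times> 'n" assume q: "q \<in> {..<Suc J} \<times> UNIV"
      show "P (fst q) (snd q) \<in> borel_measurable borel" by (rule Pm)
      show "primitive (\<lambda>s. P (fst q) (snd q) (upd (snd q) s x)) 1 = 0" for x by (rule P0)
      have c0: "0 \<le> C * level_norm p \<beta> (fst q)" using C ln by simp
      show "0 < c q" unfolding c_def using c0 e0 by linarith
      show "\<bar>P (fst q) (snd q) x\<bar> \<le> B" for x
      proof -
        have "\<bar>P (fst q) (snd q) x\<bar> \<le> Bk (fst q)" using Bk by blast
        also have "\<dots> \<le> B" unfolding B_def using q by (intro Max_ge) auto
        finally show ?thesis .
      qed
      show "(\<integral>\<^sup>+ x. ennreal (\<bar>line_primitive (snd q) (P (fst q) (snd q)) x\<bar> powr p) \<partial>cubeM) \<le> ennreal (c q powr p)"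
      proof (rule order_trans[OF Pc ennreal_leI])
        show "(C * level_norm p \<beta> (fst q)) powr p \<le> c q powr p"
          unfolding c_def using p c0 e0 by (intro powr_mono2) auto
      qed
    next
      show "(\<Sum>q\<in>{..<Suc J} \<times> UNIV. P (fst q) (snd q) x) = basis_sum \<beta> (levels_below J) x" for x
      proof -
        have "(\<Sum>q\<in>{..<Suc J} \<times> UNIV. P (fst q) (snd q) x) = (\<Sum>k<Suc J. \<Sum>i\<in>UNIV. P k i x)"
          unfolding sum.cartesian_product by (simp only: split_def)
        then show ?thesis by (simp only: Ps[symmetric] sum_level_sum)
      qed
      have "(\<Sum>q\<in>X. c q) = (\<Sum>q\<in>X. C * level_norm p \<beta> (fst q)) + \<eta>"
        using cX by (simp add: c_def sum.distrib)
      also have "(\<Sum>q\<in>X. C * level_norm p \<beta> (fst q)) = (\<Sum>k<Suc J. \<Sum>i\<in>(UNIV :: 'n set). C * level_norm p \<beta> k)"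
        unfolding X_def sum.cartesian_product by (simp only: split_def)
      also have "\<dots> = real CARD('n) * C * (\<Sum>k<Suc J. level_norm p \<beta> k)"
        unfolding sum_distrib_left by (intro sum.cong) simp_all
      finally show "(\<Sum>q\<in>{..<Suc J} \<times> UNIV. c q) \<le> real CARD('n) * C * (\<Sum>k<Suc J. level_norm p \<beta> k) + \<eta>"
        by (simp add: X_def)
    qed
  qed
qed

end

section \<open>The upper bound\<close>

lemma nn_integral_unit_cube_eq:
  fixes h :: "real ^ 'n \<Rightarrow> real"
  assumes [measurable]: "h \<in> borel_measurable borel" and h: "\<And>x. x \<in> cube \<Longrightarrow> 0 \<le> h x \<and> h x \<le> A"
  shows "(\<integral>\<^sup>+ x. ennreal (h x) \<partial>cubeM) = ennreal (\<integral>x. h x \<partial>cubeM)"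
proof (rule nn_integral_eq_integral)
  show "integrable cubeM h"
  proof (rule integrable_unit_cube[where B = A])
    show "\<bar>h x\<bar> \<le> A" if "x \<in> cube" for x using h[OF that] by simp
  qed measurable
  show "AE x in cubeM. 0 \<le> h x"
    by (rule AE_cubeI) (use h in blast)
qed

text \<open>Integrating \<open>2 * \<eta> * \<bar>R\<bar> \<le> \<eta>\<^sup>2 + R\<^sup>2\<close>
  over a probability space stands in for Cauchy-Schwarz.\<close>

lemma integral_abs_le_of_square:
  fixes R :: "real ^ 'n \<Rightarrow> real"
  assumes [measurable]: "R \<in> borel_measurable borel" and R: "\<And>x. x \<in> cube \<Longrightarrow> \<bar>R x\<bar> \<le> B" and \<eta>: "0 < \<eta>"
    and sq: "(\<integral>x. (R x)\<^sup>2 \<partial>cubeM) \<le> \<eta>\<^sup>2"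
  shows "(\<integral>x. \<bar>R x\<bar> \<partial>cubeM) \<le> \<eta>"
proof -
  have I2: "integrable cubeM (\<lambda>x. (R x)\<^sup>2)"
  proof (rule integrable_unit_cube[where B = "B\<^sup>2"])
    show "\<bar>(R x)\<^sup>2\<bar> \<le> B\<^sup>2" if "x \<in> cube" for x
      using power_mono[OF R[OF that], of 2] by simp
  qed measurable
  have "(\<integral>x. \<bar>R x\<bar> \<partial>cubeM) \<le> (\<integral>x. \<eta> / 2 + (R x)\<^sup>2 / (2 * \<eta>) \<partial>cubeM)"
  proof (rule integral_mono)
    show "integrable cubeM (\<lambda>x. \<bar>R x\<bar>)"
      by (rule integrable_unit_cube[where B = B]) (use R in auto)
    show "integrable cubeM (\<lambda>x. \<eta> / 2 + (R x)\<^sup>2 / (2 * \<eta>))"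
      using I2 by simp
    show "\<bar>R x\<bar> \<le> \<eta> / 2 + (R x)\<^sup>2 / (2 * \<eta>)" for x
    proof -
      have "(\<bar>R x\<bar> - \<eta>)\<^sup>2 = (R x)\<^sup>2 + \<eta> * \<eta> - 2 * \<eta> * \<bar>R x\<bar>"
        by (simp add: power2_eq_square algebra_simps)
      then have "2 * \<eta> * \<bar>R x\<bar> \<le> \<eta> * \<eta> + (R x)\<^sup>2"
        using zero_le_power2[of "\<bar>R x\<bar> - \<eta>"] by linarith
      then show ?thesis using \<eta> by (simp add: field_simps power2_eq_square)
    qed
  qed
  also have "\<dots> = \<eta> / 2 + (\<integral>x. (R x)\<^sup>2 \<partial>cubeM) / (2 * \<eta>)"
    using I2 by (simp add: ucube.prob_space[simplified])
  also have "\<dots> \<le> \<eta> / 2 + \<eta>\<^sup>2 / (2 * \<eta>)"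
    using sq \<eta> by (intro add_left_mono divide_right_mono) auto
  also have "\<dots> = \<eta>" using \<eta> by (simp add: power2_eq_square)
  finally show ?thesis .
qed

lemma transport_refl:
  fixes \<mu> :: "'a::{metric_space,second_countable_topology} measure"
  assumes "0 < p" "0 \<le> w" "sets \<mu> = sets borel"
  shows "transport p w \<mu> \<mu>"
  unfolding transport_def
proof (rule bexI)
  note [measurable_cong] = assms(3)
  let ?\<pi> = "distr \<mu> (\<mu> \<Otimes>\<^sub>M \<mu>) (\<lambda>x. (x, x))"
  show "?\<pi> \<in> couplings \<mu> \<mu>"
    by (auto simp: couplings_def distr_distr o_def distr_id)
  have "(\<integral>\<^sup>+ z. ennreal (dist (fst z) (snd z) powr p) \<partial>?\<pi>) = (\<integral>\<^sup>+ x. 0 \<partial>\<mu>)"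
    using assms by (subst nn_integral_distr) auto
  then show "(\<integral>\<^sup>+ z. ennreal (dist (fst z) (snd z) powr p) \<partial>?\<pi>) \<le> ennreal (w powr p)"
    by simp
qed

lemma cube_dist_bound:
  obtains D where "0 < D" "\<And>x y :: real ^ 'n. x \<in> cube \<Longrightarrow> y \<in> cube \<Longrightarrow> dist x y \<le> D"
proof -
  have "bounded (cube :: (real ^ 'n) set)" by (rule bounded_cbox)
  then have "dist x y \<le> diameter (cube :: (real ^ 'n) set) + 1" if "x \<in> cube" "y \<in> cube" for x y :: "real ^ 'n"
    using diameter_bounded_bound[of cube x y] that by simp
  moreover have "0 < diameter (cube :: (real ^ 'n) set) + 1"
    using diameter_ge_0[OF bounded_cbox, of 0 "1 :: real ^ 'n"] by linarith
  ultimately show thesis using that by blast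
qed

text \<open>Adding the positive, respectively negative, part of the remainder \<open>R\<close> to \<open>f\<close>, respectively \<open>g\<close>,
  and renormalising, makes the difference of the two densities a multiple of the finite sum \<open>g - f - R\<close>.\<close>

lemma transport_through_pieces:
  fixes f g :: "real ^ 'n \<Rightarrow> real" and S :: "'q \<Rightarrow> real ^ 'n \<Rightarrow> real"
  assumes p: "1 \<le> p" and m: "0 < m" and X: "finite X"
    and fm [measurable]: "f \<in> borel_measurable borel" and gm [measurable]: "g \<in> borel_measurable borel"
    and fg: "\<And>x. x \<in> cube \<Longrightarrow> 0 \<le> f x \<and> f x \<le> M \<and> 0 \<le> g x \<and> g x \<le> M \<and> m \<le> max (f x) (g x)"
    and f1: "(\<integral>x. f x \<partial>cubeM) = 1" and g1: "(\<integral>x. g x \<partial>cubeM) = 1"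
    and Sm [measurable]: "\<And>q. q \<in> X \<Longrightarrow> S q \<in> borel_measurable borel"
    and SB: "\<And>q x. q \<in> X \<Longrightarrow> \<bar>S q x\<bar> \<le> B"
    and mass: "\<And>q x. q \<in> X \<Longrightarrow> primitive (\<lambda>s. S q (upd (dir q) s x)) 1 = 0"
    and c: "\<And>q. q \<in> X \<Longrightarrow> 0 < c q"
    and cost: "\<And>q. q \<in> X \<Longrightarrow> (\<integral>\<^sup>+ x. ennreal (\<bar>line_primitive (dir q) (S q) x\<bar> powr p) \<partial>cubeM) \<le>
      ennreal (c q powr p)"
    and R: "R = (\<lambda>x. g x - f x - (\<Sum>q\<in>X. S q x))"
    and R0: "(\<integral>x. R x \<partial>cubeM) = 0"
    and R1: "(\<integral>x. \<bar>R x\<bar> \<partial>cubeM) \<le> \<eta>" "\<eta> \<le> 1" "0 < \<eta>"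
    and w: "0 < w" and D: "0 < D" "\<And>x y :: real ^ 'n. x \<in> cube \<Longrightarrow> y \<in> cube \<Longrightarrow> dist x y \<le> D"
    and \<eta>w: "D powr p * (4 * \<eta>) \<le> w powr p"
  shows "transport p (w + w + 2 / (1 - 2 powr (-1 / p)) * (m / 4) powr (-(1 - 1 / p)) * (\<Sum>q\<in>X. c q) + w) (dens f) (dens g)"
proof -
  define T where "T x = (\<Sum>q\<in>X. S q x)" for x
  define BT where "BT = real (card X) * B"
  have TB: "\<bar>T x\<bar> \<le> BT" for x
    unfolding T_def BT_def using SB by (intro order_trans[OF sum_abs] sum_bounded_above) auto
  have Tm [measurable]: "T \<in> borel_measurable borel" unfolding T_def[abs_def] by measurable
  have Rm [measurable]: "R \<in> borel_measurable borel" unfolding R by measurable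
  have M: "0 \<le> M" using fg[of 0] by (auto simp: mem_box_cart)
  define BR where "BR = M + BT"
  have RB: "\<bar>R x\<bar> \<le> BR" if "x \<in> cube" for x
  proof -
    have "\<bar>g x - f x\<bar> \<le> M" using fg[OF that] by linarith
    then show ?thesis using TB[of x] by (simp add: R BR_def flip: T_def)
  qed
  have BR: "0 \<le> BR" using RB[of 0] by (simp add: mem_box_cart)
  define P where "P x = max 0 (R x)" for x
  define N where "N x = max 0 (- R x)" for x
  have PN: "P x - N x = R x" "0 \<le> P x" "0 \<le> N x" "P x \<le> \<bar>R x\<bar>" for x
    by (auto simp: P_def N_def)
  have [measurable]: "P \<in> borel_measurable borel" "N \<in> borel_measurable borel"
    unfolding P_def[abs_def] N_def[abs_def] by measurable
  have PB: "\<bar>P x\<bar> \<le> BR" "\<bar>N x\<bar> \<le> BR" if "x \<in> cube" for x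
    using RB[OF that] BR by (auto simp: P_def N_def)
  have I: "integrable cubeM f" "integrable cubeM g" "integrable cubeM P"
    "integrable cubeM N" "integrable cubeM (\<lambda>x. \<bar>R x\<bar>)"
  proof -
    show "integrable cubeM f" by (rule integrable_unit_cube[where B = M]) (use fg in auto)
    show "integrable cubeM g" by (rule integrable_unit_cube[where B = M]) (use fg in auto)
    show "integrable cubeM P" by (rule integrable_unit_cube[where B = BR]) (use PB in auto)
    show "integrable cubeM N" by (rule integrable_unit_cube[where B = BR]) (use PB in auto)
    show "integrable cubeM (\<lambda>x. \<bar>R x\<bar>)" by (rule integrable_unit_cube[where B = BR]) (use RB in auto)
  qed
  \<comment> \<open>\<open>R\<close> has mean zero, so its positive and negative parts have the same
    mass, and one normalising factor serves both densities.\<close>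
  define \<rho> where "\<rho> = (\<integral>x. P x \<partial>cubeM)"
  have \<rho>N: "(\<integral>x. N x \<partial>cubeM) = \<rho>"
  proof -
    have "(\<integral>x. P x - N x \<partial>cubeM) = 0" by (simp only: PN(1) R0)
    then show ?thesis using I by (simp add: \<rho>_def)
  qed
  have \<rho>: "0 \<le> \<rho>" "\<rho> \<le> \<eta>"
  proof -
    show "0 \<le> \<rho>" unfolding \<rho>_def using PN by (intro Bochner_Integration.integral_nonneg) auto
    have "\<rho> \<le> (\<integral>x. \<bar>R x\<bar> \<partial>cubeM)" unfolding \<rho>_def using I PN by (intro integral_mono) auto
    then show "\<rho> \<le> \<eta>" using R1 by linarith
  qed
  \<comment> \<open>From \<open>\<rho> \<le> \<eta> \<le> 1\<close> follows
    \<open>k \<ge> 1 / 2\<close>, which halves the lower bound of the maximum; a second halving in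
    \<open>move_line_pieces\<close> leads to \<open>m / 4\<close>.\<close>
  define k where "k = 1 / (1 + \<rho>)"
  have k: "0 < k" "k \<le> 1" "1 / 2 \<le> k" "k * (1 + \<rho>) = 1" "1 - k \<le> \<rho>"
  proof -
    show "0 < k" "k \<le> 1" "1 / 2 \<le> k" "k * (1 + \<rho>) = 1" using \<rho> R1 by (auto simp: k_def field_simps)
    then have "1 - k = k * \<rho>" by (simp add: algebra_simps)
    also have "\<dots> \<le> \<rho>" using \<rho> \<open>k \<le> 1\<close> by (simp add: mult_left_le_one_le \<open>0 < k\<close> less_imp_le)
    finally show "1 - k \<le> \<rho>" .
  qed
  define F where "F x = k * (f x + P x)" for x
  define G where "G x = k * (g x + N x)" for x
  have FT: "F x + k * T x = G x" for x
  proof -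
    have "T x = g x - f x - R x" by (simp add: R T_def)
    then have "f x + P x + T x = g x + N x" using PN(1)[of x] by linarith
    then show ?thesis unfolding F_def G_def by (simp flip: distrib_left)
  qed
  have [measurable]: "F \<in> borel_measurable borel" "G \<in> borel_measurable borel"
    unfolding F_def[abs_def] G_def[abs_def] by measurable
  define A where "A = M + BR"
  have FG: "0 \<le> F x \<and> F x \<le> A \<and> 0 \<le> G x \<and> G x \<le> A \<and> m / 2 \<le> max (F x) (G x)" if x: "x \<in> cube" for x
  proof -
    note b = fg[OF x] PB[OF x] PN(2,3)[of x]
    have F: "0 \<le> F x" "F x \<le> 1 * (f x + P x)"
      unfolding F_def using b k mult_right_mono[OF k(2), of "f x + P x"] by auto
    have G: "0 \<le> G x" "G x \<le> 1 * (g x + N x)"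
      unfolding G_def using b k mult_right_mono[OF k(2), of "g x + N x"] by auto
    have "1 / 2 * f x \<le> F x" unfolding F_def using b k by (intro mult_mono) auto
    moreover have "1 / 2 * g x \<le> G x" unfolding G_def using b k by (intro mult_mono) auto
    ultimately have "m / 2 \<le> max (F x) (G x)" using b by (auto simp: max_def split: if_splits)
    then show ?thesis using F G b by (auto simp: A_def)
  qed
  have IF: "integrable cubeM F" "integrable cubeM G"
    unfolding F_def[abs_def] G_def[abs_def] using I by auto
  have F1: "(\<integral>x. F x \<partial>cubeM) = 1" "(\<integral>x. G x \<partial>cubeM) = 1"
    unfolding F_def G_def using I f1 g1 \<rho>N k(4) by (simp_all add: \<rho>_def)
  have "\<exists>n. (1 / 2 :: real) ^ n < \<eta>" by (rule real_arch_pow_inv) (use R1 in auto)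
  then obtain n where "(1 / 2 :: real) ^ n < \<eta>" ..
  then have n: "(1 / 2 :: real) ^ Suc n \<le> \<eta>" "(1 / 2 :: real) ^ Suc n \<le> 1"
    using R1 by (auto simp: power_le_one)
  \<comment> \<open>The time at which the interpolation is cut at both ends; what remains there
    moves mass of order \<open>\<delta>\<close> and is left to total variation.\<close>
  define \<delta> where "\<delta> = (1 / 2 :: real) ^ Suc n"
  have \<delta>: "0 \<le> \<delta>" "\<delta> \<le> \<eta>" "\<delta> \<le> 1" using n by (auto simp: \<delta>_def)
  \<comment> \<open>Generic in \<open>a\<close>, \<open>b\<close>, \<open>e\<close> to cover both
    ends: \<open>f\<close> with \<open>P\<close> and \<open>e = \<delta>\<close>, then
    \<open>g\<close> with \<open>N\<close> and \<open>e = - \<delta>\<close>.\<close>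
  have tv: "\<bar>a x - (k * (a x + b x) + e * (k * T x))\<bar> \<le> (1 - k) * a x + k * b x + \<delta> * (F x + G x)"
    if "0 \<le> a x" "0 \<le> b x" "\<bar>e\<bar> = \<delta>" "x \<in> cube" for a b e x
  proof -
    have "\<bar>k * T x\<bar> \<le> F x + G x" using FT[of x] FG[OF that(4)] by linarith
    then have "\<bar>e * (k * T x)\<bar> \<le> \<delta> * (F x + G x)"
      unfolding abs_mult[of e] that(3) by (rule mult_left_mono[OF _ \<delta>(1)])
    moreover have "a x - (k * (a x + b x) + e * (k * T x)) = (1 - k) * a x - k * b x - e * (k * T x)"
      by (simp add: algebra_simps)
    moreover have "0 \<le> (1 - k) * a x" "0 \<le> k * b x" using k that by auto
    ultimately show ?thesis by linarith
  qed
  \<comment> \<open>The four shares of \<open>\<eta>\<close> are \<open>1 - k \<le> \<eta>\<close>,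
    \<open>k * \<rho> \<le> \<eta>\<close> and \<open>\<delta> * 2 \<le> 2 * \<eta>\<close>.\<close>
  have tvi: "(\<integral>x. (1 - k) * a x + k * b x + \<delta> * (F x + G x) \<partial>cubeM) \<le> 4 * \<eta>"
    if "integrable cubeM a" "integrable cubeM b" "(\<integral>x. a x \<partial>cubeM) = 1"
      "(\<integral>x. b x \<partial>cubeM) = \<rho>" for a b :: "real ^ 'n \<Rightarrow> real"
  proof -
    have "(\<integral>x. (1 - k) * a x + k * b x + \<delta> * (F x + G x) \<partial>cubeM) = (1 - k) + k * \<rho> + \<delta> * 2"
      using that IF F1 by simp
    moreover have "k * \<rho> \<le> \<rho>" using k \<rho> by (simp add: mult_left_le_one_le)
    ultimately show ?thesis using \<rho> \<delta> k(5) by linarith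
  qed
  define F' where "F' x = F x + \<delta> * (k * T x)" for x
  define G' where "G' x = F x + (1 - \<delta>) * (k * T x)" for x
  have [measurable]: "F' \<in> borel_measurable borel" "G' \<in> borel_measurable borel"
    unfolding F'_def[abs_def] G'_def[abs_def] by measurable
  have conv: "F' x = (1 - \<delta>) * F x + \<delta> * G x" "G' x = \<delta> * F x + (1 - \<delta>) * G x" for x
    unfolding F'_def G'_def FT[symmetric] by (simp_all add: algebra_simps)
  have conv_bound: "0 \<le> (1 - \<delta>) * a + \<delta> * b \<and> (1 - \<delta>) * a + \<delta> * b \<le> A" if "0 \<le> a" "a \<le> A" "0 \<le> b" "b \<le> A" for a b
  proof -
    have "(1 - \<delta>) * a + \<delta> * b \<le> (1 - \<delta>) * A + \<delta> * A" using that \<delta> by (intro add_mono mult_left_mono) auto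
    also have "(1 - \<delta>) * A + \<delta> * A = A" by (simp add: algebra_simps)
    finally have "(1 - \<delta>) * a + \<delta> * b \<le> A" .
    moreover have "0 \<le> (1 - \<delta>) * a" "0 \<le> \<delta> * b" using that \<delta> by auto
    ultimately show ?thesis by linarith
  qed
  have F'G': "0 \<le> F' x \<and> F' x \<le> A" "0 \<le> G' x \<and> G' x \<le> A" if "x \<in> cube" for x
    using conv_bound[of "F x" "G x"] conv_bound[of "G x" "F x"] FG[OF that] unfolding conv by (auto simp: add.commute)
  have F'1: "(\<integral>x. F' x \<partial>cubeM) = 1" "(\<integral>x. G' x \<partial>cubeM) = 1"
    unfolding conv using IF F1 by simp_all
  have nn1: "(\<integral>\<^sup>+ x. ennreal (h x) \<partial>cubeM) = 1"
    if "h \<in> borel_measurable borel" "\<And>x. x \<in> cube \<Longrightarrow> 0 \<le> h x \<and> h x \<le> A" "(\<integral>x. h x \<partial>cubeM) = 1" for h :: "real ^ 'n \<Rightarrow> real"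
    using nn_integral_unit_cube_eq[OF that(1,2)] that(3) by simp
  have fA: "0 \<le> f x \<and> f x \<le> A" "0 \<le> g x \<and> g x \<le> A" if "x \<in> cube" for x
    using fg[OF that] BR by (auto simp: A_def)
  have nns: "(\<integral>\<^sup>+ x. ennreal (f x) \<partial>cubeM) = 1" "(\<integral>\<^sup>+ x. ennreal (g x) \<partial>cubeM) = 1"
    "(\<integral>\<^sup>+ x. ennreal (F' x) \<partial>cubeM) = 1" "(\<integral>\<^sup>+ x. ennreal (G' x) \<partial>cubeM) = 1"
    by (rule nn1; use fA F'G' f1 g1 F'1 in simp)+
  have tvn: "(\<integral>\<^sup>+ x. ennreal \<bar>a x - (k * (a x + b x) + e * (k * T x))\<bar> \<partial>cubeM) \<le> ennreal (4 * \<eta>)"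
    if a: "a \<in> borel_measurable borel" "\<And>x. x \<in> cube \<Longrightarrow> 0 \<le> a x" and b: "b \<in> borel_measurable borel" "\<And>x. 0 \<le> b x" and e: "\<bar>e\<bar> = \<delta>"
      and ia: "integrable cubeM a" "integrable cubeM b" "(\<integral>x. a x \<partial>cubeM) = 1"
      "(\<integral>x. b x \<partial>cubeM) = \<rho>" for a b :: "real ^ 'n \<Rightarrow> real" and e
  proof -
    have "(\<integral>\<^sup>+ x. ennreal \<bar>a x - (k * (a x + b x) + e * (k * T x))\<bar> \<partial>cubeM) \<le>
        (\<integral>\<^sup>+ x. ennreal ((1 - k) * a x + k * b x + \<delta> * (F x + G x)) \<partial>cubeM)"
      by (intro nn_integral_mono_AE AE_cubeI ennreal_leI tv a b e)
    also have "\<dots> = ennreal (\<integral>x. (1 - k) * a x + k * b x + \<delta> * (F x + G x) \<partial>cubeM)"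
    proof (rule nn_integral_eq_integral)
      show "integrable cubeM (\<lambda>x. (1 - k) * a x + k * b x + \<delta> * (F x + G x))"
        using ia IF by simp
      show "AE x in cubeM. 0 \<le> (1 - k) * a x + k * b x + \<delta> * (F x + G x)"
      proof (rule AE_cubeI)
        fix x :: "real ^ 'n" assume x: "x \<in> cube"
        show "0 \<le> (1 - k) * a x + k * b x + \<delta> * (F x + G x)"
          using tv[of a x b e] a(2)[OF x] b(2)[of x] e x by (meson abs_ge_zero order_trans)
      qed
    qed
    also have "\<dots> \<le> ennreal (4 * \<eta>)" by (intro ennreal_leI tvi ia)
    finally show ?thesis .
  qed
  have mv1: "move p w (dens f) (dens F')"
  proof (rule move_total_variation[OF p w fm, where A = A and \<delta> = "4 * \<eta>" and D = D])
    show "(\<integral>\<^sup>+ x. ennreal \<bar>f x - F' x\<bar> \<partial>cubeM) \<le> ennreal (4 * \<eta>)"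
      unfolding F'_def F_def
      by (rule tvn) (use fA PN \<delta> I f1 \<rho>_def in simp_all)
  qed (use fA F'G' nns R1 D \<eta>w in simp_all)
  have mv3: "move p w (dens G') (dens g)"
  proof (rule move_total_variation[OF p w _ gm, where A = A and \<delta> = "4 * \<eta>" and D = D])
    have "\<bar>G' x - g x\<bar> = \<bar>g x - (k * (g x + N x) + (- \<delta>) * (k * T x))\<bar>" for x
    proof -
      have "G' x = G x + (- \<delta>) * (k * T x)"
        unfolding G'_def FT[symmetric] by (simp add: algebra_simps)
      then show ?thesis by (simp add: G_def abs_minus_commute)
    qed
    then show "(\<integral>\<^sup>+ x. ennreal \<bar>G' x - g x\<bar> \<partial>cubeM) \<le> ennreal (4 * \<eta>)"
      by (simp only:) (rule tvn; use fA PN \<delta> I g1 \<rho>N in simp)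
  qed (use fA F'G' nns R1 D \<eta>w in simp_all)
  have mv2: "move p (2 / (1 - 2 powr (-1 / p)) * ((m / 2) / 2) powr (-(1 - 1 / p)) * (\<Sum>q\<in>X. c q)) (dens F') (dens G')"
    unfolding F'_def[abs_def] G'_def[abs_def] \<delta>_def
  proof (rule move_interpolation[OF p _ X, where S = "\<lambda>q x. k * S q x" and dir = dir and A = A and B = "\<bar>B\<bar>" and c = c])
    show "0 < m / 2" using m by simp
    show "(\<lambda>x. k * T x) = (\<lambda>x. \<Sum>q\<in>X. k * S q x)" by (simp add: T_def sum_distrib_left)
    fix x :: "real ^ 'n" assume x: "x \<in> cube"
    show "0 \<le> F x \<and> F x \<le> A \<and> 0 \<le> F x + k * T x \<and> F x + k * T x \<le> A"
      "m / 2 \<le> max (F x) (F x + k * T x)"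
      unfolding FT using FG[OF x] by auto
  next
    fix q assume q: "q \<in> X"
    show "(\<lambda>x. k * S q x) \<in> borel_measurable borel" using q by measurable
    show "0 < c q" by (rule c[OF q])
    show "primitive (\<lambda>s. k * S q (upd (dir q) s x)) 1 = 0" for x
      using mass[OF q] by (simp add: primitive_scale)
    show "\<bar>k * S q x\<bar> \<le> \<bar>B\<bar>" for x
    proof -
      have "\<bar>k * S q x\<bar> \<le> 1 * \<bar>S q x\<bar>" unfolding abs_mult using k by (intro mult_right_mono) auto
      then show ?thesis using SB[OF q, of x] by linarith
    qed
    have "(\<integral>\<^sup>+ x. ennreal (\<bar>line_primitive (dir q) (\<lambda>x. k * S q x) x\<bar> powr p) \<partial>cubeM) \<le>
        (\<integral>\<^sup>+ x. ennreal (\<bar>line_primitive (dir q) (S q) x\<bar> powr p) \<partial>cubeM)"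
    proof (intro nn_integral_mono ennreal_leI powr_mono2)
      fix x
      have "\<bar>line_primitive (dir q) (\<lambda>x. k * S q x) x\<bar> \<le> 1 * \<bar>line_primitive (dir q) (S q) x\<bar>"
        unfolding line_primitive_scale abs_mult using k by (intro mult_right_mono) auto
      then show "\<bar>line_primitive (dir q) (\<lambda>x. k * S q x) x\<bar> \<le> \<bar>line_primitive (dir q) (S q) x\<bar>" by simp
    qed (use p in auto)
    then show "(\<integral>\<^sup>+ x. ennreal (\<bar>line_primitive (dir q) (\<lambda>x. k * S q x) x\<bar> powr p) \<partial>cubeM) \<le> ennreal (c q powr p)"
      using cost[OF q] by (rule order_trans)
  qed measurable
  \<comment> \<open>The chain starts from the diagonal coupling, entered with the positive cost that
    \<open>move\<close> demands; this is the first of the three summands \<open>w\<close>.\<close>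
  have t0: "transport p w (dens f) (dens f)"
    using p w by (intro transport_refl) auto
  have "prob_space (dens f)"
    by (rule prob_spaceI) (use nns in \<open>simp add: dens_def emeasure_density\<close>)
  moreover have "(\<lambda>x. x) \<in> borel_measurable (dens f)" by (simp cong: measurable_cong_sets)
  moreover have "2 / (1 - 2 powr (-1 / p)) * ((m / 2) / 2) powr (-(1 - 1 / p)) * (\<Sum>q\<in>X. c q) \<ge> 0"
    using p by (intro mult_nonneg_nonneg divide_nonneg_nonneg sum_nonneg less_imp_le[OF c])
      (auto intro!: less_imp_le powr_less_one)
  ultimately have "transport p (w + w + 2 / (1 - 2 powr (-1 / p)) * ((m / 2) / 2) powr (-(1 - 1 / p)) * (\<Sum>q\<in>X. c q) + w) (dens f) (dens g)"
    using mv1 mv2 mv3 t0 w unfolding move_def by (smt (verit, ccfv_threshold))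
  then show ?thesis by simp
qed

context wavelet_system
begin

lemma level_sum_0: "level_sum \<beta> 0 = basis_sum \<beta> \<Phi>"
  by (simp add: level_sum_def[abs_def] basis_sum_def[abs_def])

lemma upper_transport:
  assumes p: "1 \<le> p"
  shows "\<exists>C>0. \<forall>f g M m N \<epsilon>. f \<in> borel_measurable borel \<longrightarrow> g \<in> borel_measurable borel \<longrightarrow> 0 < m \<longrightarrow> 0 < \<epsilon> \<longrightarrow>
    (\<forall>x\<in>cube. 0 \<le> f x \<and> f x \<le> M \<and> 0 \<le> g x \<and> g x \<le> M \<and> m \<le> max (f x) (g x)) \<longrightarrow>
    (\<integral>x. f x \<partial>cubeM) = 1 \<longrightarrow> (\<integral>x. g x \<partial>cubeM) = 1 \<longrightarrow>
    (\<forall>J. (\<Sum>k<Suc J. level_norm p (coeff (\<lambda>x. g x - f x)) k) \<le> N) \<longrightarrow>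
    transport p (C * m powr (-(1 - 1 / p)) * N + \<epsilon>) (dens f) (dens g)"
proof -
  obtain CA where CA: "0 \<le> CA" and pieces: "\<forall>\<beta> J \<eta>. 0 < \<eta> \<longrightarrow> (\<integral>x. level_sum \<beta> 0 x \<partial>cubeM) = 0 \<longrightarrow>
    (\<exists>S B c. (\<forall>q\<in>{..<Suc J} \<times> UNIV. S q \<in> borel_measurable borel \<and> (\<forall>x. \<bar>S q x\<bar> \<le> B) \<and>
        (\<forall>x. primitive (\<lambda>s. S q (upd (snd q) s x)) 1 = 0) \<and> 0 < c q \<and>
        (\<integral>\<^sup>+ x. ennreal (\<bar>line_primitive (snd q) (S q) x\<bar> powr p) \<partial>cubeM) \<le> ennreal (c q powr p)) \<and>
      (\<forall>x. (\<Sum>q\<in>{..<Suc J} \<times> UNIV. S q x) = basis_sum \<beta> (levels_below J) x) \<and>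
      (\<Sum>q\<in>{..<Suc J} \<times> UNIV. c q) \<le> CA * (\<Sum>k<Suc J. level_norm p \<beta> k) + \<eta>)"
    using assembled_pieces[OF p] by (elim exE conjE)
  obtain D where D: "0 < D" "\<And>x y :: real ^ 'n. x \<in> cube \<Longrightarrow> y \<in> cube \<Longrightarrow> dist x y \<le> D"
    by (rule cube_dist_bound) (rule that)
  define G where "G = 2 / (1 - 2 powr (-1 / p))"
  have G: "0 < G" unfolding G_def using p by (auto intro!: divide_pos_pos powr_less_one)
  define C where "C = G * (1 / 4) powr (-(1 - 1 / p)) * (CA + 1)"
  have C: "0 < C" unfolding C_def using G CA by (intro mult_pos_pos) auto
  show ?thesis
  proof (rule exI[of _ C], intro conjI C allI impI)
    fix f g :: "real ^ 'n \<Rightarrow> real" and M m N \<epsilon> :: real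
    assume fm: "f \<in> borel_measurable borel" and gm: "g \<in> borel_measurable borel" and m: "0 < m" and \<epsilon>: "0 < \<epsilon>"
      and fg: "\<forall>x\<in>cube. 0 \<le> f x \<and> f x \<le> M \<and> 0 \<le> g x \<and> g x \<le> M \<and> m \<le> max (f x) (g x)"
      and f1: "(\<integral>x. f x \<partial>cubeM) = 1" and g1: "(\<integral>x. g x \<partial>cubeM) = 1"
      and N: "\<forall>J. (\<Sum>k<Suc J. level_norm p (coeff (\<lambda>x. g x - f x)) k) \<le> N"
    define h where "h x = g x - f x" for x
    define \<beta> where "\<beta> = coeff h"
    have hm [measurable]: "h \<in> borel_measurable borel" unfolding h_def[abs_def] using fm gm by measurable
    have hM: "\<bar>h x\<bar> \<le> M" if "x \<in> cube" for x using bspec[OF fg that] unfolding h_def by linarith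
    have If: "integrable cubeM f" by (rule integrable_unit_cube[where B = M]) (use fm fg in auto)
    have Ig: "integrable cubeM g" by (rule integrable_unit_cube[where B = M]) (use gm fg in auto)
    have h0: "(\<integral>x. h x \<partial>cubeM) = 0" unfolding h_def using If Ig f1 g1 by simp
    \<comment> \<open>Four equal shares of \<open>\<epsilon>\<close>: the start, the two ends, and
      the slack \<open>w / Q\<close> in the costs of the pieces after multiplication by
      \<open>Q\<close>.\<close>
    define w where "w = \<epsilon> / 4"
    have w: "0 < w" using \<epsilon> by (simp add: w_def)
    \<comment> \<open>Chosen so that a total variation of \<open>4 * \<eta>\<close>, moved over the
      distance \<open>D\<close>, costs at most \<open>w\<close>.\<close>
    define \<eta> where "\<eta> = min 1 (w powr p / (4 * D powr p))"
    have \<eta>: "0 < \<eta>" "\<eta> \<le> 1" using w D by (auto simp: \<eta>_def)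
    have \<eta>w: "D powr p * (4 * \<eta>) \<le> w powr p"
    proof -
      have "\<eta> \<le> w powr p / (4 * D powr p)" by (simp add: \<eta>_def)
      then show ?thesis using D(1) by (simp add: pos_le_divide_eq mult.commute mult.left_commute)
    qed
    define Q where "Q = G * (m / 4) powr (-(1 - 1 / p))"
    have Q: "0 < Q" using G m by (simp add: Q_def)
    have "\<exists>J. (\<integral>x. (h x - basis_sum \<beta> (levels_below J) x)\<^sup>2 \<partial>cubeM) \<le> \<eta>\<^sup>2"
      unfolding \<beta>_def by (rule projection_approx[OF hm _ \<eta>(1)]) (rule hM)
    then obtain J where J: "(\<integral>x. (h x - basis_sum \<beta> (levels_below J) x)\<^sup>2 \<partial>cubeM) \<le> \<eta>\<^sup>2" ..
    \<comment> \<open>Projection onto \<open>\<Phi>\<close> alone already preserves the integral of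
      \<open>h\<close>, which is zero.\<close>
    have "(\<integral>x. level_sum \<beta> 0 x \<partial>cubeM) = 0"
      unfolding level_sum_0 \<beta>_def using integral_projection[OF hm hM finite_\<Phi>] h0 by simp
    then have "\<exists>S B c. (\<forall>q\<in>{..<Suc J} \<times> UNIV. S q \<in> borel_measurable borel \<and> (\<forall>x. \<bar>S q x\<bar> \<le> B) \<and>
        (\<forall>x. primitive (\<lambda>s. S q (upd (snd q) s x)) 1 = 0) \<and> 0 < c q \<and>
        (\<integral>\<^sup>+ x. ennreal (\<bar>line_primitive (snd q) (S q) x\<bar> powr p) \<partial>cubeM) \<le> ennreal (c q powr p)) \<and>
      (\<forall>x. (\<Sum>q\<in>{..<Suc J} \<times> UNIV. S q x) = basis_sum \<beta> (levels_below J) x) \<and>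
      (\<Sum>q\<in>{..<Suc J} \<times> UNIV. c q) \<le> CA * (\<Sum>k<Suc J. level_norm p \<beta> k) + w / Q"
      using pieces w Q by simp
    then obtain S B c where S: "\<forall>q\<in>{..<Suc J} \<times> UNIV. S q \<in> borel_measurable borel \<and> (\<forall>x. \<bar>S q x\<bar> \<le> B) \<and>
        (\<forall>x. primitive (\<lambda>s. S q (upd (snd q) s x)) 1 = 0) \<and> 0 < c q \<and>
        (\<integral>\<^sup>+ x. ennreal (\<bar>line_primitive (snd q) (S q) x\<bar> powr p) \<partial>cubeM) \<le> ennreal (c q powr p)"
      and SS: "\<forall>x. (\<Sum>q\<in>{..<Suc J} \<times> UNIV. S q x) = basis_sum \<beta> (levels_below J) x"
      and Sc: "(\<Sum>q\<in>{..<Suc J} \<times> UNIV. c q) \<le> CA * (\<Sum>k<Suc J. level_norm p \<beta> k) + w / Q"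
      by (elim exE conjE)
    define X where "X = {..<Suc J} \<times> (UNIV :: 'n set)"
    have X: "finite X" by (simp add: X_def)
    have SX: "S q \<in> borel_measurable borel" "\<bar>S q x\<bar> \<le> B" "primitive (\<lambda>s. S q (upd (snd q) s x)) 1 = 0" "0 < c q"
      "(\<integral>\<^sup>+ x. ennreal (\<bar>line_primitive (snd q) (S q) x\<bar> powr p) \<partial>cubeM) \<le> ennreal (c q powr p)"
      if "q \<in> X" for q x
      using bspec[OF S that[unfolded X_def]] by simp_all
    note F = finite_levels_below[of J] levels_below_subset[of J]
    obtain BS where BS: "\<And>x. \<bar>basis_sum \<beta> (levels_below J) x\<bar> \<le> BS" by (rule basis_sum_bounded[OF F]) (rule that)
    have bm [measurable]: "basis_sum \<beta> (levels_below J) \<in> borel_measurable borel" by (rule basis_sum_measurable[OF F(2)])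
    define R where "R x = g x - f x - (\<Sum>q\<in>X. S q x)" for x
    have R: "R x = h x - basis_sum \<beta> (levels_below J) x" for x
      using SS by (simp add: R_def X_def h_def)
    have RB: "\<bar>R x\<bar> \<le> M + BS" if "x \<in> cube" for x
      unfolding R using hM[OF that] BS[of x] by linarith
    have R0: "(\<integral>x. R x \<partial>cubeM) = 0"
    proof -
      have "integrable cubeM h" by (rule integrable_unit_cube[OF hm hM])
      moreover have "integrable cubeM (basis_sum \<beta> (levels_below J))" by (rule integrable_unit_cube[OF bm BS])
      moreover have "(\<integral>x. basis_sum \<beta> (levels_below J) x \<partial>cubeM) = 0"
        unfolding \<beta>_def using integral_projection[OF hm hM F(1) _ F(2)] h0 by (auto simp: levels_below_def)
      ultimately show ?thesis unfolding R using h0 by simp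
    qed
    have R1: "(\<integral>x. \<bar>R x\<bar> \<partial>cubeM) \<le> \<eta>"
    proof (rule integral_abs_le_of_square[OF _ RB \<eta>(1)])
      show "R \<in> borel_measurable borel" unfolding R[abs_def] by measurable
      show "(\<integral>x. (R x)\<^sup>2 \<partial>cubeM) \<le> \<eta>\<^sup>2" unfolding R by (rule J)
    qed
    have tr: "transport p (w + w + G * (m / 4) powr (-(1 - 1 / p)) * (\<Sum>q\<in>X. c q) + w) (dens f) (dens g)"
      unfolding G_def
    proof (rule transport_through_pieces[OF p m X fm gm, where M = M and S = S and B = B and dir = snd and R = R and \<eta> = \<eta> and D = D])
      show "R = (\<lambda>x. g x - f x - (\<Sum>q\<in>X. S q x))" by (rule ext) (rule R_def)
      show "0 \<le> f x \<and> f x \<le> M \<and> 0 \<le> g x \<and> g x \<le> M \<and> m \<le> max (f x) (g x)" if "x \<in> cube" for x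
        by (rule bspec[OF fg that])
    qed (fact f1 g1 R0 R1 \<eta> w D \<eta>w | (erule SX))+
    have cn: "0 \<le> (\<Sum>q\<in>X. c q)" by (rule sum_nonneg) (rule less_imp_le[OF SX(4)])
    have Nn: "(\<Sum>k<Suc J. level_norm p \<beta> k) \<le> N"
      using N by (simp add: \<beta>_def h_def[abs_def])
    have ln: "0 \<le> level_norm p \<beta> k" for k by (cases k) (simp_all add: level_norm_def level_weight_def)
    have N0: "0 \<le> N" using Nn by (rule order_trans[rotated]) (rule sum_nonneg, rule ln)
    have "(\<Sum>q\<in>X. c q) \<le> CA * N + w / Q"
      using Sc mult_left_mono[OF Nn CA] by (simp add: X_def)
    then have "Q * (\<Sum>q\<in>X. c q) \<le> Q * (CA * N + w / Q)"
      using Q by (intro mult_left_mono) auto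
    also have "\<dots> = Q * CA * N + w" using Q by (simp add: field_simps)
    also have "Q * CA * N \<le> Q * (CA + 1) * N" using Q CA N0 by (intro mult_right_mono mult_left_mono) auto
    also have "Q * (CA + 1) * N = C * m powr (-(1 - 1 / p)) * N"
    proof -
      have "(m / 4) powr (-(1 - 1 / p)) = (1 / 4) powr (-(1 - 1 / p)) * m powr (-(1 - 1 / p))"
        using m by (subst powr_mult[symmetric]) auto
      then show ?thesis by (simp add: Q_def C_def)
    qed
    finally have le: "w + w + Q * (\<Sum>q\<in>X. c q) + w \<le> C * m powr (-(1 - 1 / p)) * N + \<epsilon>"
      by (simp add: w_def)
    show "transport p (C * m powr (-(1 - 1 / p)) * N + \<epsilon>) (dens f) (dens g)"
    proof (rule transport_mono[OF tr[folded Q_def] _ le])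
      show "0 \<le> w + w + Q * (\<Sum>q\<in>X. c q) + w" using w Q cn by simp
    qed (use p in simp)
  qed
qed

end

section \<open>The lower bound\<close>

text \<open>Whichever of \<open>t\<close> and \<open>b\<close> is larger absorbs the whole product.
  No conjugate exponent appears, so \<open>p = 1\<close> is included.\<close>

lemma young_powr:
  fixes b t p :: real
  assumes "1 \<le> p" "0 \<le> b" "0 \<le> t"
  shows "b powr (p - 1) * t \<le> t powr p + b powr p"
proof (cases "t \<le> b")
  case True
  have "b powr (p - 1) * t \<le> b powr (p - 1) * b" using True by (intro mult_left_mono) auto
  also have "\<dots> = b powr p" using powr_add[of b "p - 1" 1] assms by (cases "b = 0") auto
  finally show ?thesis by (simp add: add_increasing)
next
  case False
  have "b powr (p - 1) * t \<le> t powr (p - 1) * t" using False assms by (intro mult_right_mono powr_mono2) auto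
  also have "\<dots> = t powr p" using powr_add[of t "p - 1" 1] assms by (cases "t = 0") auto
  finally show ?thesis by (simp add: add_increasing2)
qed

text \<open>Duality: each coefficient \<open>b y\<close> is tested against \<open>sgn (b y) * \<bar>b y\<bar> powr (p - 1)\<close>; Young's inequality
  with weight \<open>4 * A\<close> makes the second term absorbable, since the sets have measure at most \<open>A\<close>.\<close>

lemma (in prob_space) sum_coefficients_bound:
  fixes \<Delta> :: "'b \<Rightarrow> 'a \<Rightarrow> real" and s :: "'a \<Rightarrow> real"
  assumes p: "1 \<le> p" and fin: "finite Y" and A: "0 < A" and L: "0 \<le> L" and K: "0 \<le> K"
    and sm [measurable]: "s \<in> borel_measurable M" and s0: "\<And>z. 0 \<le> s z"
    and e: "(\<integral>\<^sup>+ z. ennreal (s z powr p) \<partial>M) \<le> ennreal e" "0 \<le> e"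
    and \<Delta>m [measurable]: "\<And>y. y \<in> Y \<Longrightarrow> \<Delta> y \<in> borel_measurable M"
    and Um [measurable]: "\<And>y. y \<in> Y \<Longrightarrow> U y \<in> sets M" and Vm [measurable]: "\<And>y. y \<in> Y \<Longrightarrow> V y \<in> sets M"
    and \<Delta>: "\<And>y z. y \<in> Y \<Longrightarrow> z \<in> space M \<Longrightarrow> \<bar>\<Delta> y z\<bar> \<le> L * s z * (indicator (U y) z + indicator (V y) z)"
    and UA: "\<And>y. y \<in> Y \<Longrightarrow> prob (U y) \<le> A" and VA: "\<And>y. y \<in> Y \<Longrightarrow> prob (V y) \<le> A"
    and UK: "AE z in M. real (card {y\<in>Y. z \<in> U y}) \<le> K" and VK: "AE z in M. real (card {y\<in>Y. z \<in> V y}) \<le> K"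
  shows "(\<Sum>y\<in>Y. \<bar>expectation (\<Delta> y)\<bar> powr p) \<le> 4 * K * (4 * A) powr (p - 1) * L powr p * e"
proof -
  define b where "b y = \<bar>expectation (\<Delta> y)\<bar>" for y
  define I where "I y z = (indicator (U y) z + indicator (V y) z :: real)" for y z
  define \<theta> where "\<theta> = 4 * A"
  have \<theta>: "0 < \<theta>" using A by (simp add: \<theta>_def)
  have Im [measurable]: "I y \<in> borel_measurable M" if "y \<in> Y" for y
    unfolding I_def[abs_def] using that by measurable
  have I01: "0 \<le> I y z" "I y z \<le> 2" for y z by (auto simp: I_def indicator_def)
  have spI: "integrable M (\<lambda>z. s z powr p)"
    by (rule integrableI_nonneg) (use e in \<open>auto simp: less_top[symmetric] top_unique intro: le_less_trans\<close>)
  have sI: "integrable M s"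
  proof (rule Bochner_Integration.integrable_bound)
    show "integrable M (\<lambda>z. 1 + s z powr p)" using spI by simp
    show "AE z in M. norm (s z) \<le> norm (1 + s z powr p)"
    proof (rule AE_I2)
      fix z
      have "s z \<le> 1 + s z powr p"
      proof (cases "s z \<le> 1")
        case True
        then show ?thesis by (simp add: add_increasing2)
      next
        case False
        then have "s z powr 1 \<le> s z powr p" using p by (intro powr_mono) auto
        then show ?thesis using False by simp
      qed
      then show "norm (s z) \<le> norm (1 + s z powr p)" using s0[of z] by simp
    qed
  qed simp
  have times_I: "integrable M (\<lambda>z. h z * I y z)" if h: "integrable M h" and y: "y \<in> Y" for h :: "'a \<Rightarrow> real" and y
  proof (rule Bochner_Integration.integrable_bound)
    show "integrable M (\<lambda>z. 2 * \<bar>h z\<bar>)" using h by simp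
    show "(\<lambda>z. h z * I y z) \<in> borel_measurable M" using h y by measurable
    show "AE z in M. norm (h z * I y z) \<le> norm (2 * \<bar>h z\<bar>)"
    proof (rule AE_I2)
      fix z
      have "\<bar>h z\<bar> * \<bar>I y z\<bar> \<le> \<bar>h z\<bar> * 2" using I01[of y z] by (intro mult_left_mono) auto
      then show "norm (h z * I y z) \<le> norm (2 * \<bar>h z\<bar>)" by (simp add: abs_mult)
    qed
  qed
  \<comment> \<open>Young's inequality with \<open>t = \<theta> * L * s z\<close> puts
    \<open>\<theta> * b y powr p\<close> on the left. As \<open>\<theta> = 4 * A\<close> and the
    indicators integrate to at most \<open>2 * A\<close>, half of it survives the
    absorption.\<close>
  have per: "2 * A * b y powr p \<le> (\<integral>z. (\<theta> * L * s z) powr p * I y z \<partial>M)" if y: "y \<in> Y" for y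
  proof -
    have "b y \<le> (\<integral>z. L * s z * I y z \<partial>M)"
      unfolding b_def
    proof (rule order_trans[OF integral_abs_bound integral_mono])
      show I: "integrable M (\<lambda>z. L * s z * I y z)" using times_I[of "\<lambda>z. L * s z" y] sI y by simp
      have le: "\<bar>\<Delta> y z\<bar> \<le> L * s z * I y z" if "z \<in> space M" for z
        using \<Delta>[OF y that] by (simp add: I_def)
      then show "\<bar>\<Delta> y z\<bar> \<le> L * s z * I y z" if "z \<in> space M" for z using that .
      show "integrable M (\<lambda>z. \<bar>\<Delta> y z\<bar>)"
      proof (rule Bochner_Integration.integrable_bound[OF I])
        have [measurable]: "\<Delta> y \<in> borel_measurable M" by (rule \<Delta>m[OF y])
        show "(\<lambda>z. \<bar>\<Delta> y z\<bar>) \<in> borel_measurable M" by measurable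
        show "AE z in M. norm \<bar>\<Delta> y z\<bar> \<le> norm (L * s z * I y z)"
          using le by (intro AE_I2) (force simp: abs_of_nonneg)
      qed
    qed
    then have "\<theta> * b y powr (p - 1) * b y \<le> \<theta> * b y powr (p - 1) * (\<integral>z. L * s z * I y z \<partial>M)"
      using \<theta> by (intro mult_left_mono) auto
    also have "\<dots> = (\<integral>z. \<theta> * b y powr (p - 1) * (L * s z * I y z) \<partial>M)" by simp
    also have "\<dots> \<le> (\<integral>z. (\<theta> * L * s z) powr p * I y z + b y powr p * I y z \<partial>M)"
    proof (rule integral_mono)
      show "integrable M (\<lambda>z. \<theta> * b y powr (p - 1) * (L * s z * I y z))"
        using times_I[of "\<lambda>z. L * s z" y] sI y by simp
      have "integrable M (\<lambda>z. (\<theta> * L * s z) powr p)"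
        using spI s0 L \<theta> by (simp add: powr_mult)
      then have "integrable M (\<lambda>z. (\<theta> * L * s z) powr p * I y z)" by (rule times_I) (rule y)
      moreover have "integrable M (\<lambda>z. b y powr p * I y z)" by (rule times_I) (use y in auto)
      ultimately show "integrable M (\<lambda>z. (\<theta> * L * s z) powr p * I y z + b y powr p * I y z)" by simp
      show "\<theta> * b y powr (p - 1) * (L * s z * I y z) \<le> (\<theta> * L * s z) powr p * I y z + b y powr p * I y z" for z
        using mult_right_mono[OF young_powr[OF p, of "b y" "\<theta> * L * s z"] I01(1)[of y z]] \<theta> L s0[of z]
        by (simp add: b_def algebra_simps)
    qed
    also have "\<dots> = (\<integral>z. (\<theta> * L * s z) powr p * I y z \<partial>M) + b y powr p * (prob (U y) + prob (V y))"
    proof -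
      have "integrable M (\<lambda>z. (\<theta> * L * s z) powr p)"
        using spI s0 L \<theta> by (simp add: powr_mult)
      then have 1: "integrable M (\<lambda>z. (\<theta> * L * s z) powr p * I y z)" by (rule times_I) (rule y)
      have 2: "integrable M (\<lambda>z. b y powr p * I y z)" by (rule times_I) (use y in auto)
      have 3: "(\<integral>z. I y z \<partial>M) = prob (U y) + prob (V y)"
        unfolding I_def using y
        by (subst Bochner_Integration.integral_add) (auto simp: emeasure_finite less_top[symmetric])
      show ?thesis using 1 2 3 by simp
    qed
    also have "b y powr p * (prob (U y) + prob (V y)) \<le> b y powr p * (2 * A)"
      using UA[OF y] VA[OF y] by (intro mult_left_mono) auto
    finally have "\<theta> * (b y powr (p - 1) * b y) \<le> (\<integral>z. (\<theta> * L * s z) powr p * I y z \<partial>M) + b y powr p * (2 * A)"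
      by (simp add: mult.assoc)
    moreover have "b y powr (p - 1) * b y = b y powr p"
      using powr_add[of "b y" "p - 1" 1] by (cases "b y = 0") (auto simp: b_def)
    ultimately have "\<theta> * b y powr p \<le> (\<integral>z. (\<theta> * L * s z) powr p * I y z \<partial>M) + b y powr p * (2 * A)"
      by (simp only:)
    moreover have "\<theta> * b y powr p = 2 * A * b y powr p + b y powr p * (2 * A)"
      by (simp add: \<theta>_def)
    ultimately show ?thesis by linarith
  qed
  have IK: "AE z in M. (\<Sum>y\<in>Y. I y z) \<le> 2 * K"
    using UK VK
  proof eventually_elim
    case (elim z)
    have "(\<Sum>y\<in>Y. indicator (W y) z) = real (card {y\<in>Y. z \<in> W y})" for W :: "'b \<Rightarrow> 'a set"
    proof -
      have "(\<Sum>y\<in>Y. indicator (W y) z) = (\<Sum>y\<in>Y. if z \<in> W y then 1 else 0 :: real)"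
        by (intro sum.cong) (auto simp: indicator_def)
      then show ?thesis using fin by (simp flip: sum.inter_filter)
    qed
    then show ?case using elim by (simp add: I_def sum.distrib)
  qed
  have spI': "integrable M (\<lambda>z. (\<theta> * L * s z) powr p)"
    using spI s0 L \<theta> by (simp add: powr_mult)
  have "2 * A * (\<Sum>y\<in>Y. b y powr p) \<le> (\<Sum>y\<in>Y. \<integral>z. (\<theta> * L * s z) powr p * I y z \<partial>M)"
    unfolding sum_distrib_left by (intro sum_mono per)
  also have "\<dots> = (\<integral>z. (\<theta> * L * s z) powr p * (\<Sum>y\<in>Y. I y z) \<partial>M)"
    unfolding sum_distrib_left by (rule Bochner_Integration.integral_sum[symmetric]) (rule times_I[OF spI'])
  \<comment> \<open>Bounded overlap replaces the sum over \<open>y\<close> by \<open>2 * K\<close>,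
    so the bound does not grow with the cardinality of \<open>Y\<close>.\<close>
  also have "\<dots> \<le> (\<integral>z. (\<theta> * L * s z) powr p * (2 * K) \<partial>M)"
  proof (rule integral_mono_AE)
    show "integrable M (\<lambda>z. (\<theta> * L * s z) powr p * (\<Sum>y\<in>Y. I y z))"
      unfolding sum_distrib_left by (intro Bochner_Integration.integrable_sum times_I[OF spI'])
    show "integrable M (\<lambda>z. (\<theta> * L * s z) powr p * (2 * K))" using spI' by simp
    show "AE z in M. (\<theta> * L * s z) powr p * (\<Sum>y\<in>Y. I y z) \<le> (\<theta> * L * s z) powr p * (2 * K)"
      using IK by eventually_elim (intro mult_left_mono, auto)
  qed
  also have "\<dots> = (\<theta> * L) powr p * (\<integral>z. s z powr p \<partial>M) * (2 * K)"
    using s0 L \<theta> by (simp add: powr_mult)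
  also have "\<dots> \<le> (\<theta> * L) powr p * e * (2 * K)"
  proof -
    have "ennreal (\<integral>z. s z powr p \<partial>M) \<le> ennreal e"
      using e by (subst nn_integral_eq_integral[symmetric, OF spI]) auto
    then show ?thesis using e K by (intro mult_right_mono mult_left_mono) auto
  qed
  also have "\<dots> = 2 * A * (4 * K * (4 * A) powr (p - 1) * L powr p * e)"
  proof -
    have "\<theta> powr p = \<theta> powr (p - 1) * \<theta>" using powr_add[of \<theta> "p - 1" 1] \<theta> by simp
    then show ?thesis using \<theta> L by (simp add: powr_mult \<theta>_def)
  qed
  finally have "(\<Sum>y\<in>Y. b y powr p) \<le> 4 * K * (4 * A) powr (p - 1) * L powr p * e"
    by (rule mult_left_le_imp_le) (use A in simp)
  then show ?thesis by (simp only: b_def)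
qed

context wavelet_system
begin

text \<open>Applies \<open>sum_coefficients_bound\<close> on the probability space of the coupling:
  the increment of \<open>ext y\<close> has the coefficient of \<open>f - g\<close> as its
  expectation. The sets \<open>I y\<close> are abstract because they are rectangles for a wavelet
  level and the whole space for \<open>\<Phi>\<close>.\<close>

lemma coupling_level_bound:
  fixes f g :: "real ^ 'n \<Rightarrow> real"
  assumes p: "1 \<le> p" and M: "0 < M"
    and fm [measurable]: "f \<in> borel_measurable borel" and gm [measurable]: "g \<in> borel_measurable borel"
    and fg: "\<And>x. x \<in> cube \<Longrightarrow> 0 \<le> f x \<and> f x \<le> M \<and> 0 \<le> g x \<and> g x \<le> M"
    and f1: "(\<integral>\<^sup>+ x. ennreal (f x) \<partial>cubeM) = 1"
    and \<pi>: "\<pi> \<in> couplings (density cube_measure (\<lambda>x. ennreal (f x))) (density cube_measure (\<lambda>x. ennreal (g x)))"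
    and e: "(\<integral>\<^sup>+ z. ennreal (dist (fst z) (snd z) powr p) \<partial>\<pi>) \<le> ennreal e" "0 \<le> e"
    and Y: "finite Y" "Y \<subseteq> basis" and V: "0 < V" and L: "0 \<le> L" and K: "0 \<le> K"
    and Im [measurable]: "\<And>y. y \<in> Y \<Longrightarrow> I y \<in> sets borel"
    and IV: "\<And>y. y \<in> Y \<Longrightarrow> emeasure cubeM (I y) \<le> ennreal V"
    and I0: "\<And>y x. y \<in> Y \<Longrightarrow> x \<notin> I y \<Longrightarrow> ext y x = 0"
    and lip: "\<And>y x x'. y \<in> Y \<Longrightarrow> x \<in> cube \<Longrightarrow> x' \<in> cube \<Longrightarrow> \<bar>y x - y x'\<bar> \<le> L * dist x x'"
    and overlap: "AE x in cubeM. real (card {y\<in>Y. x \<in> I y}) \<le> K"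
  shows "(\<Sum>y\<in>Y. \<bar>coeff (\<lambda>x. f x - g x) y\<bar> powr p) \<le> 4 * K * (4 * (M * V)) powr (p - 1) * L powr p * e"
proof -
  let ?\<mu> = "density cube_measure (\<lambda>x. ennreal (f x))" and ?\<nu> = "density cube_measure (\<lambda>x. ennreal (g x))"
  have cm: "h \<in> borel_measurable borel \<Longrightarrow> h \<in> borel_measurable cube_measure" for h :: "real ^ 'n \<Rightarrow> 'c::topological_space"
    by (simp add: measurable_restrict_space1)
  have cmd: "h \<in> borel_measurable borel \<Longrightarrow> h \<in> borel_measurable (density cube_measure k)"
    for h :: "real ^ 'n \<Rightarrow> 'c::topological_space" and k
    unfolding measurable_cong_sets[OF sets_density refl] by (rule cm)
  have cs: "B \<inter> cube \<in> sets cube_measure" if "B \<in> sets borel" for B :: "(real ^ 'n) set"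
    using that by (subst sets_restrict_space_iff) auto
  have sp: "sets \<pi> = sets (?\<mu> \<Otimes>\<^sub>M ?\<nu>)" and d1: "distr \<pi> ?\<mu> fst = ?\<mu>" and d2: "distr \<pi> ?\<nu> snd = ?\<nu>"
    using \<pi> by (auto simp: couplings_def)
  have fst_m: "fst \<in> \<pi> \<rightarrow>\<^sub>M ?\<mu>" and snd_m: "snd \<in> \<pi> \<rightarrow>\<^sub>M ?\<nu>"
    by (auto simp: measurable_cong_sets[OF sp refl])
  have fe: "(\<lambda>x. ennreal (f x)) \<in> borel_measurable borel" by measurable
  have "prob_space ?\<mu>"
  proof (rule prob_spaceI)
    have "emeasure ?\<mu> cube = (\<integral>\<^sup>+ x. ennreal (f x) * indicator cube x \<partial>cube_measure)"
    proof (rule emeasure_density[OF cm[OF fe]])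
      show "cube \<in> sets (cube_measure :: (real ^ 'n) measure)"
        using sets.top[of "cube_measure :: (real ^ 'n) measure"] by (simp only: space_cube_measure)
    qed
    also have "\<dots> = (\<integral>\<^sup>+ x. ennreal (f x) \<partial>cube_measure)"
      by (rule nn_integral_cong) (simp only: space_cube_measure indicator_simps mult_1_right)
    also have "\<dots> = 1" by (simp only: nn_integral_cube_measure[OF fe] f1)
    finally show "emeasure ?\<mu> (space ?\<mu>) = 1" by (simp only: space_density space_cube_measure)
  qed
  then have "prob_space (distr \<pi> ?\<mu> fst)" unfolding d1 .
  then interpret \<pi>: prob_space \<pi> by (rule prob_space_distrD[OF fst_m])
  have spc: "z \<in> space \<pi> \<Longrightarrow> fst z \<in> cube \<and> snd z \<in> cube" for z
    unfolding sets_eq_imp_space_eq[OF sp] space_pair_measure space_density space_cube_measure by (rule mem_Times_iff[THEN iffD1])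
  have fstb: "fst \<in> borel_measurable \<pi>" and sndb: "snd \<in> borel_measurable \<pi>"
  proof -
    have id: "(\<lambda>x. x) \<in> borel_measurable ?\<mu>" "(\<lambda>x. x) \<in> borel_measurable ?\<nu>"
      unfolding measurable_cong_sets[OF sets_density refl] by (rule cm, rule measurable_ident_sets[OF refl])+
    show "fst \<in> borel_measurable \<pi>" "snd \<in> borel_measurable \<pi>"
      by (rule measurable_compose[OF fst_m id(1)], rule measurable_compose[OF snd_m id(2)])
  qed
  note [measurable] = fstb sndb
  have marg: "integrable \<pi> (\<lambda>z. ext y (fst z)) \<and> (\<integral>z. ext y (fst z) \<partial>\<pi>) = (\<integral>x. f x * ext y x \<partial>cubeM)"
      "integrable \<pi> (\<lambda>z. ext y (snd z)) \<and> (\<integral>z. ext y (snd z) \<partial>\<pi>) = (\<integral>x. g x * ext y x \<partial>cubeM)" if y: "y \<in> basis" for y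
  proof -
    have [measurable]: "ext y \<in> borel_measurable borel" by (rule ext_basis_measurable[OF y])
    obtain B where B: "0 \<le> B" "\<And>x. \<bar>ext y x\<bar> \<le> B" by (rule basis_bounded[OF y]) (rule that)
    have *: "(\<integral>x. ext y x \<partial>density cube_measure (\<lambda>x. ennreal (k x))) = (\<integral>x. k x * ext y x \<partial>cubeM)"
      if k [measurable]: "k \<in> borel_measurable borel" "\<And>x. x \<in> cube \<Longrightarrow> 0 \<le> k x" for k
    proof -
      have "(\<integral>x. ext y x \<partial>density cube_measure (\<lambda>x. ennreal (k x))) = (\<integral>x. k x *\<^sub>R ext y x \<partial>cube_measure)"
      proof (rule integral_density)
        show "ext y \<in> borel_measurable cube_measure" by (rule cm[OF ext_basis_measurable[OF y]])
        show "k \<in> borel_measurable cube_measure" by (rule cm[OF k(1)])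
        show "AE x in cube_measure. 0 \<le> k x" by (rule AE_I2) (simp add: k(2))
      qed
      then show ?thesis by (simp add: integral_cube_measure)
    qed
    have "(\<integral>x. ext y x \<partial>distr \<pi> ?\<mu> fst) = (\<integral>z. ext y (fst z) \<partial>\<pi>)"
      by (rule integral_distr[OF fst_m cmd[OF ext_basis_measurable[OF y]]])
    moreover have "(\<integral>x. ext y x \<partial>?\<mu>) = (\<integral>x. f x * ext y x \<partial>cubeM)"
      by (rule *[OF fm]) (use fg in blast)
    moreover have "integrable \<pi> (\<lambda>z. ext y (fst z))"
    proof (rule \<pi>.integrable_const_bound[of _ B])
      show "AE z in \<pi>. norm (ext y (fst z)) \<le> B" using B(2) by (intro AE_I2) simp
    qed measurable
    ultimately show "integrable \<pi> (\<lambda>z. ext y (fst z)) \<and> (\<integral>z. ext y (fst z) \<partial>\<pi>) = (\<integral>x. f x * ext y x \<partial>cubeM)"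
      by (simp only: d1)
    have "(\<integral>x. ext y x \<partial>distr \<pi> ?\<nu> snd) = (\<integral>z. ext y (snd z) \<partial>\<pi>)"
      by (rule integral_distr[OF snd_m cmd[OF ext_basis_measurable[OF y]]])
    moreover have "(\<integral>x. ext y x \<partial>?\<nu>) = (\<integral>x. g x * ext y x \<partial>cubeM)"
      by (rule *[OF gm]) (use fg in blast)
    moreover have "integrable \<pi> (\<lambda>z. ext y (snd z))"
    proof (rule \<pi>.integrable_const_bound[of _ B])
      show "AE z in \<pi>. norm (ext y (snd z)) \<le> B" using B(2) by (intro AE_I2) simp
    qed measurable
    ultimately show "integrable \<pi> (\<lambda>z. ext y (snd z)) \<and> (\<integral>z. ext y (snd z) \<partial>\<pi>) = (\<integral>x. g x * ext y x \<partial>cubeM)"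
      by (simp only: d2)
  qed
  \<comment> \<open>The density bound \<open>M\<close> turns volume into probability, for either
    marginal; this is how the power of \<open>M\<close> arises.\<close>
  have small: "emeasure (density cube_measure (\<lambda>x. ennreal (k x))) (I y \<inter> cube) \<le> ennreal (M * V)"
    if y: "y \<in> Y" and k [measurable]: "k \<in> borel_measurable borel" and kM: "\<And>x. x \<in> cube \<Longrightarrow> k x \<le> M" for y k
  proof -
    have [measurable]: "I y \<in> sets borel" by (rule Im[OF y])
    have "emeasure (density cube_measure (\<lambda>x. ennreal (k x))) (I y \<inter> cube) =
        (\<integral>\<^sup>+ x. ennreal (k x) * indicator (I y \<inter> cube) x \<partial>cube_measure)"
    proof (rule emeasure_density)
      show "(\<lambda>x. ennreal (k x)) \<in> borel_measurable cube_measure" by (rule cm) measurable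
      show "I y \<inter> cube \<in> sets cube_measure" by (rule cs[OF Im[OF y]])
    qed
    also have "\<dots> = (\<integral>\<^sup>+ x. ennreal (k x) * indicator (I y \<inter> cube) x \<partial>cubeM)"
      by (rule nn_integral_cube_measure) measurable
    also have "\<dots> \<le> (\<integral>\<^sup>+ x. ennreal M * indicator (I y) x \<partial>cubeM)"
      by (intro nn_integral_mono_AE AE_cubeI) (auto simp: indicator_def intro!: ennreal_leI kM)
    also have "\<dots> = ennreal M * emeasure cubeM (I y)"
      by (rule nn_integral_cmult_indicator) measurable
    also have "\<dots> \<le> ennreal M * ennreal V" by (rule mult_left_mono[OF IV[OF y]]) simp
    also have "\<dots> = ennreal (M * V)" using M V by (simp flip: ennreal_mult)
    finally show ?thesis .
  qed
  define U where "U y = {z \<in> space \<pi>. fst z \<in> I y}" for y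
  define W where "W y = {z \<in> space \<pi>. snd z \<in> I y}" for y
  have UM: "U y \<in> sets \<pi>" "W y \<in> sets \<pi>" if "y \<in> Y" for y
    using Im[OF that] unfolding U_def W_def by measurable
  have UP: "\<pi>.prob (U y) \<le> M * V" "\<pi>.prob (W y) \<le> M * V" if y: "y \<in> Y" for y
  proof -
    have Is: "I y \<inter> cube \<in> sets ?\<mu>" "I y \<inter> cube \<in> sets ?\<nu>" unfolding sets_density by (rule cs[OF Im[OF y]])+
    have "emeasure \<pi> (U y) = emeasure (distr \<pi> ?\<mu> fst) (I y \<inter> cube)"
    proof (subst emeasure_distr[OF fst_m Is(1)])
      show "emeasure \<pi> (U y) = emeasure \<pi> (fst -` (I y \<inter> cube) \<inter> space \<pi>)"
        using spc by (intro arg_cong[where f = "emeasure \<pi>"]) (auto simp: U_def)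
    qed
    also have "\<dots> \<le> ennreal (M * V)" unfolding d1 by (rule small[OF y fm]) (use fg in blast)
    finally show "\<pi>.prob (U y) \<le> M * V" using M V by (simp add: \<pi>.emeasure_eq_measure)
    have "emeasure \<pi> (W y) = emeasure (distr \<pi> ?\<nu> snd) (I y \<inter> cube)"
    proof (subst emeasure_distr[OF snd_m Is(2)])
      show "emeasure \<pi> (W y) = emeasure \<pi> (snd -` (I y \<inter> cube) \<inter> space \<pi>)"
        using spc by (intro arg_cong[where f = "emeasure \<pi>"]) (auto simp: W_def)
    qed
    also have "\<dots> \<le> ennreal (M * V)" unfolding d2 by (rule small[OF y gm]) (use fg in blast)
    finally show "\<pi>.prob (W y) \<le> M * V" using M V by (simp add: \<pi>.emeasure_eq_measure)
  qed
  have ovd: "AE x in density cube_measure (\<lambda>x. ennreal (k x)). real (card {y\<in>Y. x \<in> I y}) \<le> K"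
    if "k \<in> borel_measurable borel" for k
  proof -
    have "AE x in cube_measure. real (card {y\<in>Y. x \<in> I y}) \<le> K" using overlap by (simp only: AE_cube_measure_iff)
    then have "AE x in cube_measure. 0 < ennreal (k x) \<longrightarrow> real (card {y\<in>Y. x \<in> I y}) \<le> K"
      by (rule eventually_mono) simp
    moreover have "(\<lambda>x. ennreal (k x)) \<in> borel_measurable cube_measure"
      using that by (intro cm) measurable
    ultimately show ?thesis by (simp only: AE_density)
  qed
  have ov1: "AE z in \<pi>. real (card {y\<in>Y. fst z \<in> I y}) \<le> K"
    by (rule AE_distrD[OF fst_m]) (unfold d1, rule ovd[OF fm])
  have ov2: "AE z in \<pi>. real (card {y\<in>Y. snd z \<in> I y}) \<le> K"
    by (rule AE_distrD[OF snd_m]) (unfold d2, rule ovd[OF gm])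
  have "(\<Sum>y\<in>Y. \<bar>\<pi>.expectation (\<lambda>z. ext y (fst z) - ext y (snd z))\<bar> powr p) \<le>
      4 * K * (4 * (M * V)) powr (p - 1) * L powr p * e"
  proof (rule \<pi>.sum_coefficients_bound[OF p Y(1) _ L K, where s = "\<lambda>z. dist (fst z) (snd z)" and U = U and V = W])
    show "0 < M * V" using M V by simp
    show "AE z in \<pi>. real (card {y\<in>Y. z \<in> U y}) \<le> K"
      using ov1 AE_space by eventually_elim (simp add: U_def)
    show "AE z in \<pi>. real (card {y\<in>Y. z \<in> W y}) \<le> K"
      using ov2 AE_space by eventually_elim (simp add: W_def)
    fix y assume y: "y \<in> Y"
    have [measurable]: "ext y \<in> borel_measurable borel" using y Y by (intro ext_basis_measurable) auto
    show "(\<lambda>z. ext y (fst z) - ext y (snd z)) \<in> borel_measurable \<pi>" by measurable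
    show "U y \<in> sets \<pi>" "W y \<in> sets \<pi>" by (rule UM[OF y])+
    show "\<pi>.prob (U y) \<le> M * V" "\<pi>.prob (W y) \<le> M * V" by (rule UP[OF y])+
    fix z assume z: "z \<in> space \<pi>"
    show "\<bar>ext y (fst z) - ext y (snd z)\<bar> \<le> L * dist (fst z) (snd z) * (indicator (U y) z + indicator (W y) z)"
    proof (cases "fst z \<in> I y \<or> snd z \<in> I y")
      case True
      then have "1 \<le> (indicator (U y) z + indicator (W y) z :: real)"
        using z by (auto simp: U_def W_def indicator_def)
      then have "L * dist (fst z) (snd z) * 1 \<le> L * dist (fst z) (snd z) * (indicator (U y) z + indicator (W y) z)"
        using L by (intro mult_left_mono) auto
      moreover have "\<bar>ext y (fst z) - ext y (snd z)\<bar> \<le> L * dist (fst z) (snd z)"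
        using lip[OF y, of "fst z" "snd z"] spc[OF z] by simp
      ultimately show ?thesis by linarith
    next
      case False
      then show ?thesis using I0[OF y] L by (simp add: indicator_def)
    qed
  qed (use e in auto)
  moreover have "\<pi>.expectation (\<lambda>z. ext y (fst z) - ext y (snd z)) = coeff (\<lambda>x. f x - g x) y" if y: "y \<in> Y" for y
  proof -
    have yb: "y \<in> basis" using y Y by auto
    have If: "integrable cubeM (\<lambda>x. f x * ext y x)" "integrable cubeM (\<lambda>x. g x * ext y x)"
      by (rule integrable_bounded_times_basis[OF _ _ yb, where B = M]; use fg in auto)+
    have "\<pi>.expectation (\<lambda>z. ext y (fst z) - ext y (snd z)) = (\<integral>x. f x * ext y x \<partial>cubeM) - (\<integral>x. g x * ext y x \<partial>cubeM)"
      using marg[OF yb] by simp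
    also have "\<dots> = coeff (\<lambda>x. f x - g x) y"
      unfolding coeff_def using If by (simp add: left_diff_distrib)
    finally show ?thesis .
  qed
  ultimately show ?thesis by simp
qed

end

lemma le_root_of_powr_le:
  fixes x C M e p :: real
  assumes p: "1 \<le> p" and x: "0 \<le> x" and C: "0 \<le> C" "0 < M" "0 \<le> e"
    and le: "x powr p \<le> C * M powr (p - 1) * e"
  shows "x \<le> C powr (1 / p) * M powr (1 - 1 / p) * e powr (1 / p)"
proof -
  have "x = (x powr p) powr (1 / p)" using p x by (simp add: powr_powr)
  also have "\<dots> \<le> (C * M powr (p - 1) * e) powr (1 / p)"
    using p le by (intro powr_mono2) auto
  also have "\<dots> = C powr (1 / p) * M powr ((p - 1) * (1 / p)) * e powr (1 / p)"
    using C by (simp add: powr_mult powr_powr)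
  also have "(p - 1) * (1 / p) = 1 - 1 / p" using p by (simp add: field_simps)
  finally show ?thesis .
qed

context wavelet_system
begin

text \<open>The powers of \<open>2\<close> in the Besov weight, in the mass of the supports and in
  the Lipschitz constant cancel exactly. The resulting bound is uniform in \<open>j\<close>, as a
  supremum over levels requires.\<close>

lemma level_weight_cancel:
  assumes p: "1 \<le> p" and K: "0 < K" and M: "0 < M" and L: "0 \<le> L"
  shows "level_weight p j powr p * ((4 * (M * (K ^ CARD('n) * 2 powr (- real CARD('n) * real j)))) powr (p - 1) *
      (L * 2 ^ j * 2 powr (real CARD('n) * real j / 2)) powr p) =
    (4 * K ^ CARD('n)) powr (p - 1) * L powr p * M powr (p - 1)"
proof -
  define d where "d = real CARD('n)"
  define x where "x = - real j + d * real j * (1 / 2 - 1 / p)"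
  define y where "y = - d * real j"
  define z where "z = real j + d * real j / 2"
  have W: "level_weight p j powr p = 2 powr (x * p)"
    unfolding level_weight_def d_def[symmetric] powr_add[symmetric] powr_powr x_def ..
  have V: "(4 * (M * (K ^ CARD('n) * 2 powr y))) powr (p - 1) =
      (4 * K ^ CARD('n)) powr (p - 1) * M powr (p - 1) * 2 powr (y * (p - 1))"
  proof -
    have "4 * (M * (K ^ CARD('n) * 2 powr y)) = 4 * K ^ CARD('n) * M * 2 powr y" by simp
    then show ?thesis using K M by (simp only: powr_mult powr_powr)
  qed
  have E: "(L * 2 ^ j * 2 powr (d * real j / 2)) powr p = L powr p * 2 powr (z * p)"
  proof -
    have "L * 2 ^ j * 2 powr (d * real j / 2) = L * 2 powr z"
      by (simp add: z_def powr_add powr_realpow)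
    then show ?thesis using L by (simp only: powr_mult powr_powr)
  qed
  have "x * p + y * (p - 1) + z * p = 0"
  proof -
    have "x * p = - real j * p + d * real j * (p / 2 - 1)"
      using p by (simp add: x_def field_simps)
    then show ?thesis by (simp add: y_def z_def algebra_simps)
  qed
  then have "2 powr (x * p) * 2 powr (y * (p - 1)) * 2 powr (z * p) = (1 :: real)"
    by (simp only: powr_add[symmetric]) simp
  note one = this
  have rearr: "w * (a * m * v * (l * u)) = a * l * m * (w * v * u)" for w a m v l u :: real
    by (simp add: ac_simps)
  show ?thesis
    unfolding d_def[symmetric] y_def[symmetric] W V E rearr one by simp
qed

lemma lower_wavelet_level:
  assumes p: "1 \<le> p"
  shows "\<exists>C\<ge>0. \<forall>f g M e \<pi> j. 0 < M \<longrightarrow> f \<in> borel_measurable borel \<longrightarrow> g \<in> borel_measurable borel \<longrightarrow>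
    (\<forall>x\<in>cube. 0 \<le> f x \<and> f x \<le> M \<and> 0 \<le> g x \<and> g x \<le> M) \<longrightarrow> (\<integral>\<^sup>+ x. ennreal (f x) \<partial>cubeM) = 1 \<longrightarrow>
    \<pi> \<in> couplings (density cube_measure (\<lambda>x. ennreal (f x))) (density cube_measure (\<lambda>x. ennreal (g x))) \<longrightarrow>
    (\<integral>\<^sup>+ z. ennreal (dist (fst z) (snd z) powr p) \<partial>\<pi>) \<le> ennreal e \<longrightarrow> 0 \<le> e \<longrightarrow>
    level_norm p (coeff (\<lambda>x. f x - g x)) (Suc j) \<le> C * M powr (1 - 1 / p) * e powr (1 / p)"
proof -
  obtain a b K where K: "0 < K" and box: "\<forall>j. finite (\<Psi> j) \<and>
     (\<forall>\<psi>\<in>\<Psi> j. (\<forall>k. 0 \<le> a j \<psi> $ k \<and> a j \<psi> $ k < b j \<psi> $ k \<and> b j \<psi> $ k \<le> 1 \<and>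
          b j \<psi> $ k - a j \<psi> $ k \<le> K * 2 powr (- real j)) \<and>
        (\<forall>x. x \<notin> cbox (a j \<psi>) (b j \<psi>) \<longrightarrow> ext \<psi> x = 0) \<and>
        emeasure cubeM (cbox (a j \<psi>) (b j \<psi>)) \<le> ennreal (K ^ CARD('n) * 2 powr (- real CARD('n) * real j))) \<and>
     (AE x in cubeM. real (card {\<psi>\<in>\<Psi> j. x \<in> cbox (a j \<psi>) (b j \<psi>)}) \<le> K)"
    using wavelet_boxes by (elim exE conjE)
  have boxD: "x \<notin> cbox (a j \<psi>) (b j \<psi>) \<Longrightarrow> ext \<psi> x = 0"
      "emeasure cubeM (cbox (a j \<psi>) (b j \<psi>)) \<le> ennreal (K ^ CARD('n) * 2 powr (- real CARD('n) * real j))"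
    if "\<psi> \<in> \<Psi> j" for j \<psi> x
    using bspec[OF conjunct1[OF conjunct2[OF spec[OF box, of j]]] that] by simp_all
  have boxAE: "AE x in cubeM. real (card {\<psi>\<in>\<Psi> j. x \<in> cbox (a j \<psi>) (b j \<psi>)}) \<le> K" for j
    by (rule conjunct2[OF conjunct2[OF spec[OF box, of j]]])
  obtain L where L: "0 < L" and lip': "\<forall>j. \<forall>\<psi>\<in>\<Psi> j. \<forall>x\<in>cube. \<forall>y\<in>cube.
       \<bar>\<psi> x - \<psi> y\<bar> \<le> L * 2 ^ j * 2 powr (real CARD('n) * real j / 2) * dist x y"
    using wavelet_bounds by (elim exE conjE)
  define C where "C = 4 * K * ((4 * K ^ CARD('n)) powr (p - 1) * L powr p)"
  have C: "0 \<le> C" using K by (simp add: C_def)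
  show ?thesis
  proof (rule exI[of _ "C powr (1 / p)"], intro conjI allI impI)
    show "0 \<le> C powr (1 / p)" by simp
    fix f g :: "real ^ 'n \<Rightarrow> real" and M e \<pi> j
    assume M: "0 < M" and fm: "f \<in> borel_measurable borel" and gm: "g \<in> borel_measurable borel"
      and fg: "\<forall>x\<in>cube. 0 \<le> f x \<and> f x \<le> M \<and> 0 \<le> g x \<and> g x \<le> M"
      and f1: "(\<integral>\<^sup>+ x. ennreal (f x) \<partial>cubeM) = 1"
      and \<pi>: "\<pi> \<in> couplings (density cube_measure (\<lambda>x. ennreal (f x))) (density cube_measure (\<lambda>x. ennreal (g x)))"
      and e: "(\<integral>\<^sup>+ z. ennreal (dist (fst z) (snd z) powr p) \<partial>\<pi>) \<le> ennreal e" "0 \<le> e"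
    define c where "c = coeff (\<lambda>x. f x - g x)"
    let ?V = "K ^ CARD('n) * 2 powr (- real CARD('n) * real j)" and ?L = "L * 2 ^ j * 2 powr (real CARD('n) * real j / 2)"
    have S: "(\<Sum>\<psi>\<in>\<Psi> j. \<bar>c \<psi>\<bar> powr p) \<le> 4 * K * (4 * (M * ?V)) powr (p - 1) * ?L powr p * e"
      unfolding c_def
    proof (rule coupling_level_bound[OF p M fm gm bspec[OF fg] f1 \<pi> e finite_\<Psi>, where I = "\<lambda>\<psi>. cbox (a j \<psi>) (b j \<psi>)"])
      show "\<Psi> j \<subseteq> basis" by auto
      show "0 < ?V" "0 \<le> ?L" "0 \<le> K" using K L by simp_all
      show "AE x in cubeM. real (card {\<psi>\<in>\<Psi> j. x \<in> cbox (a j \<psi>) (b j \<psi>)}) \<le> K" by (rule boxAE)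
      fix \<psi> assume \<psi>: "\<psi> \<in> \<Psi> j"
      show "cbox (a j \<psi>) (b j \<psi>) \<in> sets borel" by simp
      show "emeasure cubeM (cbox (a j \<psi>) (b j \<psi>)) \<le> ennreal ?V" by (rule boxD(2)[OF \<psi>])
      show "ext \<psi> x = 0" if "x \<notin> cbox (a j \<psi>) (b j \<psi>)" for x by (rule boxD(1)[OF \<psi> that])
      show "\<bar>\<psi> x - \<psi> x'\<bar> \<le> ?L * dist x x'" if "x \<in> cube" "x' \<in> cube" for x x'
        by (rule bspec[OF bspec[OF bspec[OF spec[OF lip'] \<psi>] that(1)] that(2)])
    qed
    have "level_norm p c (Suc j) powr p = level_weight p j powr p * (\<Sum>\<psi>\<in>\<Psi> j. \<bar>c \<psi>\<bar> powr p)"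
      using p by (simp add: level_norm_def powr_mult lp_norm_powr level_weight_def)
    also have "\<dots> \<le> level_weight p j powr p * (4 * K * (4 * (M * ?V)) powr (p - 1) * ?L powr p * e)"
      by (rule mult_left_mono[OF S]) simp
    also have "\<dots> = 4 * K * (level_weight p j powr p * ((4 * (M * ?V)) powr (p - 1) * ?L powr p)) * e"
      by (simp only: ac_simps)
    also have "\<dots> = C * M powr (p - 1) * e"
      unfolding level_weight_cancel[OF p K M less_imp_le[OF L]] C_def by (simp only: ac_simps)
    finally show "level_norm p (coeff (\<lambda>x. f x - g x)) (Suc j) \<le> C powr (1 / p) * M powr (1 - 1 / p) * e powr (1 / p)"
      unfolding c_def by (rule le_root_of_powr_le[OF p _ C M e(2), rotated]) (simp add: level_norm_def level_weight_def)
  qed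
qed

text \<open>At a single scale the whole space serves as support, with volume \<open>1\<close> and
  overlap \<open>card \<Phi>\<close>; since \<open>\<Phi>\<close> is finite, one Lipschitz constant
  covers all its functions.\<close>

lemma lower_coarse_level:
  assumes p: "1 \<le> p"
  shows "\<exists>C\<ge>0. \<forall>f g M e \<pi>. 0 < M \<longrightarrow> f \<in> borel_measurable borel \<longrightarrow> g \<in> borel_measurable borel \<longrightarrow>
    (\<forall>x\<in>cube. 0 \<le> f x \<and> f x \<le> M \<and> 0 \<le> g x \<and> g x \<le> M) \<longrightarrow> (\<integral>\<^sup>+ x. ennreal (f x) \<partial>cubeM) = 1 \<longrightarrow>
    \<pi> \<in> couplings (density cube_measure (\<lambda>x. ennreal (f x))) (density cube_measure (\<lambda>x. ennreal (g x))) \<longrightarrow>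
    (\<integral>\<^sup>+ z. ennreal (dist (fst z) (snd z) powr p) \<partial>\<pi>) \<le> ennreal e \<longrightarrow> 0 \<le> e \<longrightarrow>
    level_norm p (coeff (\<lambda>x. f x - g x)) 0 \<le> C * M powr (1 - 1 / p) * e powr (1 / p)"
proof -
  obtain CL where CL: "0 < CL"
    and lip: "\<forall>j. \<forall>u\<in>fun_span (\<Phi> \<union> (\<Union>k<j. \<Psi> k)). \<forall>A. (\<forall>x\<in>cube. \<bar>u x\<bar> \<le> A) \<longrightarrow>
     (\<forall>x\<in>cube. \<forall>y\<in>cube. \<bar>u x - u y\<bar> \<le> CL * 2 ^ j * A * dist x y)"
    using lipschitz_span by (elim exE conjE)
  have "\<forall>\<phi>\<in>\<Phi>. \<exists>L. 0 \<le> L \<and> (\<forall>x\<in>cube. \<forall>y\<in>cube. \<bar>\<phi> x - \<phi> y\<bar> \<le> L * dist x y)"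
  proof
    fix \<phi> assume \<phi>: "\<phi> \<in> \<Phi>"
    then have "\<phi> \<in> basis" by simp
    then obtain B where B: "0 \<le> B" "\<And>x. \<bar>ext \<phi> x\<bar> \<le> B" by (rule basis_bounded) (rule that)
    have "\<phi> \<in> fun_span (\<Phi> \<union> (\<Union>k<0. \<Psi> k))" by (rule in_fun_span) (simp add: \<phi>)
    note s = spec[OF bspec[OF spec[OF lip, of 0] this], of B]
    have "\<forall>x\<in>cube. \<bar>\<phi> x\<bar> \<le> B"
    proof
      fix x :: "real ^ 'n" assume "x \<in> cube"
      then show "\<bar>\<phi> x\<bar> \<le> B" using B(2)[of x] by simp
    qed
    from mp[OF s this] show "\<exists>L. 0 \<le> L \<and> (\<forall>x\<in>cube. \<forall>y\<in>cube. \<bar>\<phi> x - \<phi> y\<bar> \<le> L * dist x y)"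
      using CL B(1) by (intro exI[of _ "CL * 2 ^ 0 * B"]) simp
  qed
  from bchoice[OF this] obtain l where l: "\<forall>\<phi>\<in>\<Phi>. 0 \<le> l \<phi> \<and> (\<forall>x\<in>cube. \<forall>y\<in>cube. \<bar>\<phi> x - \<phi> y\<bar> \<le> l \<phi> * dist x y)" ..
  define L where "L = (\<Sum>\<phi>\<in>\<Phi>. l \<phi>)"
  have L: "0 \<le> L" unfolding L_def using l by (simp add: sum_nonneg)
  have lL: "\<bar>\<phi> x - \<phi> y\<bar> \<le> L * dist x y" if "\<phi> \<in> \<Phi>" "x \<in> cube" "y \<in> cube" for \<phi> x y
  proof -
    have "\<bar>\<phi> x - \<phi> y\<bar> \<le> l \<phi> * dist x y" using bspec[OF l that(1)] that by simp
    also have "\<dots> \<le> L * dist x y"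
      unfolding L_def using that(1) l by (intro mult_right_mono member_le_sum finite_\<Phi>) auto
    finally show ?thesis .
  qed
  define K where "K = real (card \<Phi>)"
  define C where "C = 4 * K * (4 powr (p - 1) * L powr p)"
  have C: "0 \<le> C" by (simp add: C_def K_def)
  show ?thesis
  proof (rule exI[of _ "C powr (1 / p)"], intro conjI allI impI)
    show "0 \<le> C powr (1 / p)" by simp
    fix f g :: "real ^ 'n \<Rightarrow> real" and M e \<pi>
    assume M: "0 < M" and fm: "f \<in> borel_measurable borel" and gm: "g \<in> borel_measurable borel"
      and fg: "\<forall>x\<in>cube. 0 \<le> f x \<and> f x \<le> M \<and> 0 \<le> g x \<and> g x \<le> M"
      and f1: "(\<integral>\<^sup>+ x. ennreal (f x) \<partial>cubeM) = 1"
      and \<pi>: "\<pi> \<in> couplings (density cube_measure (\<lambda>x. ennreal (f x))) (density cube_measure (\<lambda>x. ennreal (g x)))"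
      and e: "(\<integral>\<^sup>+ z. ennreal (dist (fst z) (snd z) powr p) \<partial>\<pi>) \<le> ennreal e" "0 \<le> e"
    define c where "c = coeff (\<lambda>x. f x - g x)"
    have S: "(\<Sum>\<phi>\<in>\<Phi>. \<bar>c \<phi>\<bar> powr p) \<le> 4 * K * (4 * (M * 1)) powr (p - 1) * L powr p * e"
      unfolding c_def
    proof (rule coupling_level_bound[OF p M fm gm bspec[OF fg] f1 \<pi> e finite_\<Phi>, where I = "\<lambda>_. UNIV"])
      show "AE x in cubeM. real (card {\<phi>\<in>\<Phi>. x \<in> UNIV}) \<le> K" by (simp add: K_def)
      show "emeasure cubeM (UNIV :: (real ^ 'n) set) \<le> ennreal 1" using ucube.emeasure_le_1 by simp
      show "\<bar>\<phi> x - \<phi> x'\<bar> \<le> L * dist x x'" if "\<phi> \<in> \<Phi>" "x \<in> cube" "x' \<in> cube" for \<phi> x x' by (rule lL[OF that])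
    qed (simp_all add: L K_def)
    have "level_norm p c 0 powr p = (\<Sum>\<phi>\<in>\<Phi>. \<bar>c \<phi>\<bar> powr p)"
      using p by (simp add: level_norm_def lp_norm_powr)
    also have "\<dots> \<le> C * M powr (p - 1) * e"
      using S M by (simp add: C_def powr_mult ac_simps)
    finally show "level_norm p (coeff (\<lambda>x. f x - g x)) 0 \<le> C powr (1 / p) * M powr (1 - 1 / p) * e powr (1 / p)"
      unfolding c_def by (rule le_root_of_powr_le[OF p _ C M e(2), rotated]) (simp add: level_norm_def)
  qed
qed

end

section \<open>The theorem\<close>

lemma epowr_ennreal: "0 \<le> x \<Longrightarrow> epowr (ennreal x) a = ennreal (x powr a)"
  by (simp add: epowr_def)

lemma epowr_mono:
  assumes "x \<le> y" "0 < a"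
  shows "epowr x a \<le> epowr y a"
proof (cases "y = \<infinity>")
  case True
  then show ?thesis by (simp add: epowr_def)
next
  case False
  then have "x \<noteq> \<infinity>" using assms by (auto simp: top_unique)
  then show ?thesis
    using False assms by (auto simp: epowr_def less_top intro!: ennreal_leI powr_mono2 enn2real_mono)
qed

lemma epowr_epowr:
  assumes "a * b = 1" "0 < a"
  shows "epowr (epowr x a) b = x"
proof (cases "x = \<infinity>")
  case True
  then show ?thesis by (simp add: epowr_def)
next
  case False
  have "(enn2real x powr a) powr b = enn2real x" using assms by (simp add: powr_powr)
  then show ?thesis using False by (simp add: epowr_def less_top)
qed

lemma L_norm_count_space:
  fixes c :: "'b \<Rightarrow> real"
  assumes p: "1 \<le> p" and F: "finite F"
  shows "L_norm (ennreal p) (count_space F) c = ennreal (lp_norm p F c)"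
proof -
  have "(\<integral>\<^sup>+ y. epowr (ennreal (norm (c y))) p \<partial>count_space F) = ennreal (\<Sum>y\<in>F. \<bar>c y\<bar> powr p)"
    using F by (simp add: nn_integral_count_space_finite epowr_ennreal)
  then show ?thesis
    using p by (simp add: L_norm_def eL_norm_def lp_norm_def epowr_ennreal sum_nonneg)
qed

lemma eL_norm_1_nat: "eL_norm 1 (count_space UNIV) F = (\<Sum>j. F j)" for F :: "nat \<Rightarrow> ennreal"
proof -
  have "epowr x 1 = x" for x by (rule ennreal_cases[of x]) (auto simp: epowr_def)
  then show ?thesis by (simp add: eL_norm_def nn_integral_count_space_nat)
qed

text \<open>Here \<open>dens f\<close> is a measure on the whole space, whereas \<open>density_wasserstein\<close> couples measures on
  the subspace \<open>cube\<close>; couplings of the former are retracted onto the cube.\<close>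

lemma wasserstein_le_transport:
  fixes f g :: "real ^ 'n \<Rightarrow> real"
  assumes p: "1 \<le> p" and w: "0 \<le> w"
    and fm: "f \<in> borel_measurable borel" and gm: "g \<in> borel_measurable borel"
    and tr: "transport p w (dens f) (dens g)"
  shows "density_wasserstein p f g \<le> ennreal w"
proof -
  let ?\<mu> = "density cube_measure (\<lambda>x. ennreal (f x))" and ?\<nu> = "density cube_measure (\<lambda>x. ennreal (g x))"
  \<comment> \<open>Off the cube the value is an arbitrary point of it; neither marginal charges
    that region, so marginals and cost are unaffected.\<close>
  define clip where "clip x = (if x \<in> cube then x else 0)" for x :: "real ^ 'n"
  have clipm: "clip \<in> borel \<rightarrow>\<^sub>M cube_measure"
  proof (rule measurable_restrict_space2)
    show "clip \<in> space borel \<rightarrow> cube" by (auto simp: clip_def mem_box_cart)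
    have "clip \<in> borel_measurable borel" unfolding clip_def[abs_def] by measurable
    then show "clip \<in> borel \<rightarrow>\<^sub>M lborel" by (simp only: measurable_cong_sets[OF refl sets_lborel])
  qed
  have clip_dens: "distr (dens k) (density cube_measure (\<lambda>x. ennreal (k x))) clip = density cube_measure (\<lambda>x. ennreal (k x))"
    if k: "k \<in> borel_measurable borel" for k :: "real ^ 'n \<Rightarrow> real"
  proof (rule measure_eqI)
    let ?k = "density cube_measure (\<lambda>x. ennreal (k x))"
    have ke: "(\<lambda>x. ennreal (k x)) \<in> borel_measurable borel" using k by measurable
    have kec: "(\<lambda>x. ennreal (k x)) \<in> borel_measurable cube_measure"
      using ke by (simp add: measurable_restrict_space1)
    have cm: "clip \<in> dens k \<rightarrow>\<^sub>M ?k"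
      using clipm by (simp add: measurable_cong_sets[OF sets_dens sets_density])
    fix B assume "B \<in> sets (distr (dens k) ?k clip)"
    then have B: "B \<in> sets cube_measure" "B \<in> sets ?k" by simp_all
    then have Bb: "B \<in> sets borel" "B \<subseteq> cube" by (auto simp: sets_restrict_space)
    have pre: "clip -` B \<in> sets borel" using measurable_sets[OF clipm B(1)] by simp
    have "emeasure (distr (dens k) ?k clip) B = emeasure (dens k) (clip -` B \<inter> space (dens k))"
      by (rule emeasure_distr[OF cm B(2)])
    also have "\<dots> = (\<integral>\<^sup>+ x. ennreal (k x) * indicator (clip -` B) x \<partial>cubeM)"
      unfolding dens_def using ke pre by (subst emeasure_density) auto
    also have "\<dots> = (\<integral>\<^sup>+ x. ennreal (k x) * indicator B x \<partial>cubeM)"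
      by (intro nn_integral_cong_AE AE_cubeI) (simp add: clip_def indicator_def)
    also have "\<dots> = (\<integral>\<^sup>+ x. ennreal (k x) * indicator B x \<partial>cube_measure)"
      by (intro nn_integral_cube_measure[symmetric] borel_measurable_times_ennreal ke borel_measurable_indicator Bb(1))
    also have "\<dots> = emeasure ?k B" by (rule emeasure_density[OF kec B(1), symmetric])
    finally show "emeasure (distr (dens k) ?k clip) B = emeasure ?k B" .
  qed simp
  obtain \<pi> where \<pi>: "\<pi> \<in> couplings (dens f) (dens g)"
    and cost: "(\<integral>\<^sup>+ z. ennreal (dist (fst z) (snd z) powr p) \<partial>\<pi>) \<le> ennreal (w powr p)"
    using tr unfolding transport_def by (elim bexE)
  have sp: "sets \<pi> = sets (dens f \<Otimes>\<^sub>M dens g)" and d1: "distr \<pi> (dens f) fst = dens f" and d2: "distr \<pi> (dens g) snd = dens g"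
    using \<pi> unfolding couplings_def by blast+
  have fstm: "fst \<in> \<pi> \<rightarrow>\<^sub>M dens f" and sndm: "snd \<in> \<pi> \<rightarrow>\<^sub>M dens g"
    unfolding measurable_cong_sets[OF sp refl] by (rule measurable_fst, rule measurable_snd)
  have cf: "clip \<in> dens f \<rightarrow>\<^sub>M ?\<mu>" and cg: "clip \<in> dens g \<rightarrow>\<^sub>M ?\<nu>"
    unfolding measurable_cong_sets[OF sets_dens sets_density] by (rule clipm)+
  let ?T = "\<lambda>z. (clip (fst z), clip (snd z))"
  have Tm: "?T \<in> \<pi> \<rightarrow>\<^sub>M ?\<mu> \<Otimes>\<^sub>M ?\<nu>"
    by (rule measurable_Pair[OF measurable_compose[OF fstm cf] measurable_compose[OF sndm cg]])
  let ?\<pi> = "distr \<pi> (?\<mu> \<Otimes>\<^sub>M ?\<nu>) ?T"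
  have "distr ?\<pi> ?\<mu> fst = distr \<pi> ?\<mu> (fst \<circ> ?T)" by (rule distr_distr[OF measurable_fst Tm])
  also have "\<dots> = distr (distr \<pi> (dens f) fst) ?\<mu> clip" unfolding distr_distr[OF cf fstm] by (simp add: o_def)
  finally have m1: "distr ?\<pi> ?\<mu> fst = ?\<mu>" unfolding d1 clip_dens[OF fm] .
  have "distr ?\<pi> ?\<nu> snd = distr \<pi> ?\<nu> (snd \<circ> ?T)" by (rule distr_distr[OF measurable_snd Tm])
  also have "\<dots> = distr (distr \<pi> (dens g) snd) ?\<nu> clip" unfolding distr_distr[OF cg sndm] by (simp add: o_def)
  finally have m2: "distr ?\<pi> ?\<nu> snd = ?\<nu>" unfolding d2 clip_dens[OF gm] .
  have \<pi>c: "?\<pi> \<in> couplings ?\<mu> ?\<nu>"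
    unfolding couplings_def using m1 m2 by simp
  have inc: "AE x in dens k. x \<in> cube" if "k \<in> borel_measurable borel" for k :: "real ^ 'n \<Rightarrow> real"
  proof -
    have "AE x in cubeM. 0 < ennreal (k x) \<longrightarrow> x \<in> cube" by (rule AE_cubeI) simp
    moreover have "(\<lambda>x. ennreal (k x)) \<in> borel_measurable cubeM" using that by measurable
    ultimately show ?thesis unfolding dens_def by (simp only: AE_density)
  qed
  have a1: "AE z in \<pi>. fst z \<in> cube" by (rule AE_distrD[OF fstm]) (unfold d1, rule inc[OF fm])
  have a2: "AE z in \<pi>. snd z \<in> cube" by (rule AE_distrD[OF sndm]) (unfold d2, rule inc[OF gm])
  have dm: "(\<lambda>z. ennreal (dist (fst z) (snd z) powr p)) \<in> borel_measurable (?\<mu> \<Otimes>\<^sub>M ?\<nu>)"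
  proof -
    have i: "(\<lambda>x. x) \<in> borel_measurable (density cube_measure (\<lambda>x. ennreal (k x)))" for k :: "real ^ 'n \<Rightarrow> real"
      unfolding measurable_cong_sets[OF sets_density refl] by (rule measurable_restrict_space1) simp
    have [measurable]: "fst \<in> borel_measurable (?\<mu> \<Otimes>\<^sub>M ?\<nu>)" "snd \<in> borel_measurable (?\<mu> \<Otimes>\<^sub>M ?\<nu>)"
      by (rule measurable_compose[OF measurable_fst i], rule measurable_compose[OF measurable_snd i])
    show ?thesis by measurable
  qed
  have "(\<integral>\<^sup>+ z. ennreal (dist (fst z) (snd z) powr p) \<partial>?\<pi>) =
      (\<integral>\<^sup>+ z. ennreal (dist (clip (fst z)) (clip (snd z)) powr p) \<partial>\<pi>)"
    using dm by (subst nn_integral_distr[OF Tm]) simp_all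
  also have "\<dots> = (\<integral>\<^sup>+ z. ennreal (dist (fst z) (snd z) powr p) \<partial>\<pi>)"
  proof (rule nn_integral_cong_AE)
    show "AE z in \<pi>. ennreal (dist (clip (fst z)) (clip (snd z)) powr p) = ennreal (dist (fst z) (snd z) powr p)"
      using a1 a2 by eventually_elim (simp add: clip_def)
  qed
  finally have "(\<integral>\<^sup>+ z. ennreal (dist (fst z) (snd z) powr p) \<partial>?\<pi>) \<le> ennreal (w powr p)" using cost by simp
  then have "(INF \<pi>\<in>couplings ?\<mu> ?\<nu>. \<integral>\<^sup>+ z. ennreal (dist (fst z) (snd z) powr p) \<partial>\<pi>) \<le> ennreal (w powr p)"
    by (rule INF_lower2[OF \<pi>c])
  then have "density_wasserstein p f g \<le> epowr (ennreal (w powr p)) (1 / p)"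
    unfolding density_wasserstein_def wasserstein_def using p by (intro epowr_mono) auto
  also have "\<dots> = ennreal w" using p w by (simp add: epowr_ennreal powr_powr)
  finally show ?thesis .
qed

lemma density_wasserstein_cong:
  assumes "f \<in> borel_measurable cube_measure" "g \<in> borel_measurable cube_measure"
    "f' \<in> borel_measurable cube_measure" "g' \<in> borel_measurable cube_measure"
    "AE x in cube_measure. f x = f' x" "AE x in cube_measure. g x = g' x"
  shows "density_wasserstein p f g = density_wasserstein p f' g'"
proof -
  have "density cube_measure (\<lambda>x. ennreal (f x)) = density cube_measure (\<lambda>x. ennreal (f' x))"
    using assms by (intro density_cong) (auto elim: eventually_mono)
  moreover have "density cube_measure (\<lambda>x. ennreal (g x)) = density cube_measure (\<lambda>x. ennreal (g' x))"
    using assms by (intro density_cong) (auto elim: eventually_mono)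
  ultimately show ?thesis by (simp only: density_wasserstein_def)
qed

text \<open>Read in \<open>ennreal\<close>, the equation forces \<open>1 / p' = 0\<close> when
  \<open>p = 1\<close>, so \<open>p' = \<infinity>\<close> is covered by the same formula.\<close>

lemma conjugate_exponent:
  assumes p: "1 \<le> p" and p': "1 / ennreal p + 1 / p' = 1"
  shows "enn2real (1 / p') = 1 - 1 / p"
proof -
  have e: "1 / ennreal p = ennreal (1 / p)" using p by (simp add: divide_ennreal flip: ennreal_1)
  have "1 / p' \<le> 1" using p' by (metis add_increasing le_add_same_cancel2 order_refl zero_le)
  then have "1 / p' < \<infinity>" by (rule le_less_trans) simp
  then obtain y where y: "1 / p' = ennreal y" "0 \<le> y" by (cases "1 / p'") auto
  have "ennreal (1 / p + y) = ennreal 1" using p' p y by (simp add: e)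
  then have "1 / p + y = 1" using p y by (subst (asm) ennreal_inj) auto
  then show ?thesis using y by simp
qed

section \<open>Besov norms in terms of level norms\<close>

context wavelet_system
begin

lemma wavelet_coeff_eq:
  assumes h: "h \<in> borel_measurable cube_measure" and k: "k \<in> borel_measurable borel"
    and eq: "AE x in cube_measure. h x = k x" and \<phi>: "\<phi> \<in> basis"
  shows "wavelet_coeff h \<phi> = coeff k \<phi>"
proof -
  have kc: "k \<in> borel_measurable cube_measure" using k by (simp add: measurable_restrict_space1)
  have km: "(\<lambda>x. k x * ext \<phi> x) \<in> borel_measurable borel" by (rule borel_measurable_times[OF k ext_basis_measurable[OF \<phi>]])
  have "wavelet_coeff h \<phi> = (\<integral>x. k x * \<phi> x \<partial>cube_measure)"
    unfolding wavelet_coeff_def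
  proof (rule integral_cong_AE)
    show "AE x in cube_measure. h x * \<phi> x = k x * \<phi> x" using eq by eventually_elim simp
  qed (rule borel_measurable_times[OF h basis_measurable[OF \<phi>]], rule borel_measurable_times[OF kc basis_measurable[OF \<phi>]])
  also have "\<dots> = (\<integral>x. k x * ext \<phi> x \<partial>cube_measure)"
    by (rule Bochner_Integration.integral_cong) simp_all
  also have "\<dots> = coeff k \<phi>" unfolding coeff_def by (rule integral_cube_measure[OF km])
  finally show ?thesis .
qed

lemma besov_terms:
  assumes p: "1 \<le> p" and eq: "\<And>\<phi>. \<phi> \<in> basis \<Longrightarrow> wavelet_coeff h \<phi> = c \<phi>"
  shows "besov_norm \<Phi> \<Psi> (- 1) (ennreal p) q h =
    ennreal (level_norm p c 0) + eL_norm q (count_space UNIV) (\<lambda>j. ennreal (level_norm p c (Suc j)))"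
proof -
  have lc: "lp_norm p F (wavelet_coeff h) = lp_norm p F c" if "F \<subseteq> basis" for F
  proof -
    have "(\<Sum>y\<in>F. \<bar>wavelet_coeff h y\<bar> powr p) = (\<Sum>y\<in>F. \<bar>c y\<bar> powr p)"
    proof (intro sum.cong refl)
      fix y assume "y \<in> F"
      then have "y \<in> basis" using that by blast
      then show "\<bar>wavelet_coeff h y\<bar> powr p = \<bar>c y\<bar> powr p" by (simp only: eq)
    qed
    then show ?thesis by (simp add: lp_norm_def)
  qed
  have p1: "enn2real (1 / ennreal p) = 1 / p"
  proof -
    have "1 / ennreal p = ennreal (1 / p)" using p by (simp add: divide_ennreal flip: ennreal_1)
    then show ?thesis using p by simp
  qed
  have j: "ennreal (2 powr (real j * - 1) * 2 powr (real CARD('n) * real j * (1 / 2 - enn2real (1 / ennreal p)))) *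
      L_norm (ennreal p) (count_space (\<Psi> j)) (wavelet_coeff h) = ennreal (level_norm p c (Suc j))" for j
  proof -
    have "\<Psi> j \<subseteq> basis" by auto
    then show ?thesis
      unfolding L_norm_count_space[OF p finite_\<Psi>] p1 lc[OF \<open>\<Psi> j \<subseteq> basis\<close>]
      by (subst ennreal_mult[symmetric]) (simp_all add: level_norm_def level_weight_def)
  qed
  have "\<Phi> \<subseteq> basis" by auto
  from lc[OF this] show ?thesis
    unfolding besov_norm_def j L_norm_count_space[OF p finite_\<Phi>] by (simp add: level_norm_def)
qed

lemma level_norm_nonneg: "0 \<le> level_norm p c k"
  by (cases k) (simp_all add: level_norm_def level_weight_def)

text \<open>The factor \<open>2\<close> adds the coarse norm to the supremum over the wavelet
  levels.\<close>

lemma besov_norm_infinity_le: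
  assumes p: "1 \<le> p" and eq: "\<And>\<phi>. \<phi> \<in> basis \<Longrightarrow> wavelet_coeff h \<phi> = c \<phi>" and b: "\<And>k. level_norm p c k \<le> b"
  shows "besov_norm \<Phi> \<Psi> (- 1) (ennreal p) \<infinity> h \<le> ennreal (2 * b)"
proof -
  have "esssup (count_space UNIV) (\<lambda>j. ennreal (level_norm p c (Suc j))) \<le> ennreal b"
    by (rule esssup_I) (auto intro!: AE_I2 ennreal_leI b)
  moreover have "besov_norm \<Phi> \<Psi> (- 1) (ennreal p) \<infinity> h =
      ennreal (level_norm p c 0) + eL_norm \<infinity> (count_space UNIV) (\<lambda>j. ennreal (level_norm p c (Suc j)))"
    by (rule besov_terms[OF p]) (rule eq)
  ultimately have "besov_norm \<Phi> \<Psi> (- 1) (ennreal p) \<infinity> h \<le> ennreal b + ennreal b"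
    using b by (simp add: eL_norm_def add_mono ennreal_leI)
  also have "\<dots> = ennreal (2 * b)"
    using order_trans[OF level_norm_nonneg b] by (simp flip: ennreal_plus)
  finally show ?thesis .
qed

lemma sum_level_norm_le_besov:
  assumes p: "1 \<le> p" and eq: "\<And>\<phi>. \<phi> \<in> basis \<Longrightarrow> wavelet_coeff h \<phi> = c \<phi>"
    and fin: "besov_norm \<Phi> \<Psi> (- 1) (ennreal p) 1 h = ennreal N" "0 \<le> N"
  shows "(\<Sum>k<Suc J. level_norm p c k) \<le> N"
proof -
  have "ennreal (\<Sum>k<Suc J. level_norm p c k) = ennreal (level_norm p c 0) + (\<Sum>j<J. ennreal (level_norm p c (Suc j)))"
    unfolding sum.lessThan_Suc_shift
    by (subst ennreal_plus) (simp_all add: level_norm_nonneg sum_nonneg sum_ennreal)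
  also have "\<dots> \<le> ennreal (level_norm p c 0) + (\<Sum>j. ennreal (level_norm p c (Suc j)))"
    by (intro add_left_mono sum_le_suminf summableI) auto
  also have "\<dots> = besov_norm \<Phi> \<Psi> (- 1) (ennreal p) 1 h"
    unfolding eL_norm_1_nat[symmetric] by (rule besov_terms[OF p, symmetric]) (rule eq)
  also have "\<dots> = ennreal N" by (rule fin(1))
  finally show ?thesis using fin(2) by simp
qed

end

text \<open>The bounds are given almost everywhere, while the constructions use them at every point
  of the cube. On the exceptional null set both functions are set to \<open>m\<close>, which meets
  all the bounds because \<open>m \<le> M\<close>.\<close>

lemma good_representatives:
  fixes f g :: "real ^ 'n \<Rightarrow> real"
  assumes f: "prob_density f" and g: "prob_density g" and m: "0 < m"
    and mM: "AE x in cube_measure. max (f x) (g x) \<le> M \<and> m \<le> max (f x) (g x)"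
  obtains f' g' where "f' \<in> borel_measurable borel" "g' \<in> borel_measurable borel"
    "AE x in cube_measure. f x = f' x" "AE x in cube_measure. g x = g' x"
    "\<forall>x\<in>cube. 0 \<le> f' x \<and> f' x \<le> M \<and> 0 \<le> g' x \<and> g' x \<le> M \<and> m \<le> max (f' x) (g' x)"
    "(\<integral>\<^sup>+ x. ennreal (f' x) \<partial>cubeM) = 1" "(\<integral>x. f' x \<partial>cubeM) = 1"
    "(\<integral>x. g' x \<partial>cubeM) = 1"
proof -
  have fm: "f \<in> borel_measurable cube_measure" and gm: "g \<in> borel_measurable cube_measure"
    using f g by (auto simp: prob_density_def)
  have [measurable]: "ext f \<in> borel_measurable borel" "ext g \<in> borel_measurable borel"
    by (rule ext_measurable[OF fm], rule ext_measurable[OF gm])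
  define ok where "ok x \<longleftrightarrow> 0 \<le> ext f x \<and> 0 \<le> ext g x \<and> max (ext f x) (ext g x) \<le> M \<and> m \<le> max (ext f x) (ext g x)" for x
  have [measurable]: "Measurable.pred borel ok" unfolding ok_def[abs_def] by measurable
  have AEok: "AE x in cube_measure. ok x"
  proof -
    have "AE x in cube_measure. 0 \<le> f x" "AE x in cube_measure. 0 \<le> g x" using f g by (auto simp: prob_density_def)
    moreover have "AE x in cube_measure. x \<in> cube" by (rule AE_I2) simp
    ultimately show ?thesis using mM by eventually_elim (simp add: ok_def)
  qed
  \<comment> \<open>A constant inequality holding almost everywhere is true because the measure is
    not zero.\<close>
  have mM': "m \<le> M"
  proof -
    have "AE x in cubeM. ok x" using AEok by (simp only: AE_cube_measure_iff)
    then have "AE x in (cubeM :: (real ^ 'n) measure). m \<le> M" by eventually_elim (auto simp: ok_def)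
    then show ?thesis by (simp add: ucube.AE_const)
  qed
  define f' where "f' x = (if ok x then ext f x else m)" for x
  define g' where "g' x = (if ok x then ext g x else m)" for x
  have m1 [measurable]: "f' \<in> borel_measurable borel" "g' \<in> borel_measurable borel"
    unfolding f'_def[abs_def] g'_def[abs_def] by measurable
  have ae: "AE x in cube_measure. f x = f' x \<and> g x = g' x"
  proof -
    have "AE x in cube_measure. x \<in> cube" by (rule AE_I2) simp
    with AEok show ?thesis by eventually_elim (simp add: f'_def g'_def)
  qed
  have bd: "\<forall>x\<in>cube. 0 \<le> f' x \<and> f' x \<le> M \<and> 0 \<le> g' x \<and> g' x \<le> M \<and> m \<le> max (f' x) (g' x)"
    using m mM' by (auto simp: f'_def g'_def ok_def)
  have aef: "AE x in cube_measure. f x = f' x" and aeg: "AE x in cube_measure. g x = g' x"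
    using ae by (auto elim: eventually_mono)
  have int1: "(\<integral>\<^sup>+ x. ennreal (k' x) \<partial>cubeM) = 1"
    if "prob_density k" "AE x in cube_measure. k x = k' x" "k' \<in> borel_measurable borel" for k k' :: "real ^ 'n \<Rightarrow> real"
  proof -
    have "(\<integral>\<^sup>+ x. ennreal (k' x) \<partial>cube_measure) = (\<integral>\<^sup>+ x. ennreal (k x) \<partial>cube_measure)"
      by (rule nn_integral_cong_AE) (use that(2) in \<open>auto elim: eventually_mono\<close>)
    also have "\<dots> = 1" using that(1) by (simp add: prob_density_def)
    finally have "(\<integral>\<^sup>+ x. ennreal (k' x) \<partial>cube_measure) = 1" .
    moreover have "(\<lambda>x. ennreal (k' x)) \<in> borel_measurable borel" using that(3) by measurable
    ultimately show ?thesis by (simp only: nn_integral_cube_measure)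
  qed
  have n1: "(\<integral>\<^sup>+ x. ennreal (f' x) \<partial>cubeM) = 1" "(\<integral>\<^sup>+ x. ennreal (g' x) \<partial>cubeM) = 1"
    by (rule int1[OF f aef m1(1)], rule int1[OF g aeg m1(2)])
  have "ennreal (\<integral>x. f' x \<partial>cubeM) = 1"
    using nn_integral_unit_cube_eq[OF m1(1), of M] bd n1(1) by simp
  then have i1: "(\<integral>x. f' x \<partial>cubeM) = 1" by (simp only: ennreal_eq_1)
  have "ennreal (\<integral>x. g' x \<partial>cubeM) = 1"
    using nn_integral_unit_cube_eq[OF m1(2), of M] bd n1(2) by simp
  then have i2: "(\<integral>x. g' x \<partial>cubeM) = 1" by (simp only: ennreal_eq_1)
  show thesis by (rule that[OF m1 aef aeg bd n1(1) i1 i2])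
qed

text \<open>Origin of the lower constant: \<open>1 / (2 * C)\<close> undoes the level constant and
  the factor \<open>2\<close> of \<open>besov_norm_infinity_le\<close>.\<close>

lemma ennreal_rescale_le:
  fixes C M E :: real
  assumes C: "0 < C" and M: "0 < M" and E: "0 \<le> E" and B: "B \<le> ennreal (2 * (C * M powr a * E))"
  shows "ennreal (1 / (2 * C) * M powr (- a)) * B \<le> ennreal E"
proof -
  define k where "k = 1 / (2 * C) * M powr (- a)"
  have k: "0 \<le> k" using C by (simp add: k_def)
  have "M powr (- a) * M powr a = 1" using M by (simp flip: powr_add)
  then have e: "k * (2 * (C * M powr a * E)) = E" using C by (simp add: k_def)
  have "ennreal k * B \<le> ennreal k * ennreal (2 * (C * M powr a * E))" by (rule mult_left_mono[OF B]) simp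
  also have "\<dots> = ennreal (k * (2 * (C * M powr a * E)))" using k C E by (intro ennreal_mult[symmetric]) auto
  finally show ?thesis by (simp only: e k_def[symmetric])
qed

theorem theorem4:
  fixes p :: real and p' :: ennreal
    and r :: real
    and \<Phi> :: "(real ^ 'n \<Rightarrow> real) set"
    and \<Psi> :: "nat \<Rightarrow> (real ^ 'n \<Rightarrow> real) set"
  assumes "1 \<le> p" and "1 / ennreal p + 1 / p' = 1"
    and "wavelet_system r \<Phi> \<Psi>"
  shows "\<exists>c>0. \<exists>C>0. \<forall>(f :: real ^ 'n \<Rightarrow> real) g (m :: real) (M :: real).
    prob_density f \<longrightarrow> prob_density g \<longrightarrow>
    f \<in> L_space (ennreal p) cube_measure \<longrightarrow> g \<in> L_space (ennreal p) cube_measure \<longrightarrow>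
    0 < m \<longrightarrow>
    (AE x in cube_measure. max (f x) (g x) \<le> M \<and> m \<le> max (f x) (g x)) \<longrightarrow>
      ennreal (c * M powr (- enn2real (1 / p'))) *
        besov_norm \<Phi> \<Psi> (- 1) (ennreal p) \<infinity> (\<lambda>x. f x - g x)
          \<le> density_wasserstein p f g \<and>
      density_wasserstein p f g
          \<le> ennreal (C * m powr (- enn2real (1 / p'))) *
             besov_norm \<Phi> \<Psi> (- 1) (ennreal p) 1 (\<lambda>x. f x - g x)"
proof -
  interpret wavelet_system r \<Phi> \<Psi> by (rule assms(3))
  have p: "1 \<le> p" by (rule assms(1))
  have \<gamma>: "enn2real (1 / p') = 1 - 1 / p" by (rule conjugate_exponent[OF assms(1,2)])
  obtain C1 where C1: "0 \<le> C1" and L1: "\<forall>f g M e \<pi> j. 0 < M \<longrightarrow> f \<in> borel_measurable borel \<longrightarrow> g \<in> borel_measurable borel \<longrightarrow>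
    (\<forall>x\<in>cube. 0 \<le> f x \<and> f x \<le> M \<and> 0 \<le> g x \<and> g x \<le> M) \<longrightarrow> (\<integral>\<^sup>+ x. ennreal (f x) \<partial>cubeM) = 1 \<longrightarrow>
    \<pi> \<in> couplings (density cube_measure (\<lambda>x. ennreal (f x))) (density cube_measure (\<lambda>x. ennreal (g x))) \<longrightarrow>
    (\<integral>\<^sup>+ z. ennreal (dist (fst z) (snd z) powr p) \<partial>\<pi>) \<le> ennreal e \<longrightarrow> 0 \<le> e \<longrightarrow>
    level_norm p (coeff (\<lambda>x. f x - g x)) (Suc j) \<le> C1 * M powr (1 - 1 / p) * e powr (1 / p)"
    using lower_wavelet_level[OF p] by (elim exE conjE)
  obtain C0 where C0: "0 \<le> C0" and L0: "\<forall>f g M e \<pi>. 0 < M \<longrightarrow> f \<in> borel_measurable borel \<longrightarrow> g \<in> borel_measurable borel \<longrightarrow>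
    (\<forall>x\<in>cube. 0 \<le> f x \<and> f x \<le> M \<and> 0 \<le> g x \<and> g x \<le> M) \<longrightarrow> (\<integral>\<^sup>+ x. ennreal (f x) \<partial>cubeM) = 1 \<longrightarrow>
    \<pi> \<in> couplings (density cube_measure (\<lambda>x. ennreal (f x))) (density cube_measure (\<lambda>x. ennreal (g x))) \<longrightarrow>
    (\<integral>\<^sup>+ z. ennreal (dist (fst z) (snd z) powr p) \<partial>\<pi>) \<le> ennreal e \<longrightarrow> 0 \<le> e \<longrightarrow>
    level_norm p (coeff (\<lambda>x. f x - g x)) 0 \<le> C0 * M powr (1 - 1 / p) * e powr (1 / p)"
    using lower_coarse_level[OF p] by (elim exE conjE)
  \<comment> \<open>The added \<open>1\<close> makes the constant positive, and the maximum lets it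
    serve the coarse and the wavelet levels alike.\<close>
  define CL where "CL = max C0 C1 + 1"
  have CL: "0 < CL" "C0 \<le> CL" "C1 \<le> CL" using C0 C1 by (auto simp: CL_def)
  obtain CU where CU: "0 < CU" and up: "\<forall>f g M m N \<epsilon>. f \<in> borel_measurable borel \<longrightarrow> g \<in> borel_measurable borel \<longrightarrow> 0 < m \<longrightarrow> 0 < \<epsilon> \<longrightarrow>
    (\<forall>x\<in>cube. 0 \<le> f x \<and> f x \<le> M \<and> 0 \<le> g x \<and> g x \<le> M \<and> m \<le> max (f x) (g x)) \<longrightarrow>
    (\<integral>x. f x \<partial>cubeM) = 1 \<longrightarrow> (\<integral>x. g x \<partial>cubeM) = 1 \<longrightarrow>
    (\<forall>J. (\<Sum>k<Suc J. level_norm p (coeff (\<lambda>x. g x - f x)) k) \<le> N) \<longrightarrow>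
    transport p (CU * m powr (-(1 - 1 / p)) * N + \<epsilon>) (dens f) (dens g)"
    using upper_transport[OF p] by (elim exE conjE)
  show ?thesis
  proof (rule exI[of _ "1 / (2 * CL)"], rule conjI[OF _ exI[of _ CU]], goal_cases)
    case 1
    show ?case using CL by simp
  next
    case 2
    show ?case
    proof (rule conjI[OF CU], intro allI impI, goal_cases)
      case (1 f g m M)
      note H = 1
      obtain f' g' where f'm: "f' \<in> borel_measurable borel" and g'm: "g' \<in> borel_measurable borel"
        and aef: "AE x in cube_measure. f x = f' x" and aeg: "AE x in cube_measure. g x = g' x"
        and bd: "\<forall>x\<in>cube. 0 \<le> f' x \<and> f' x \<le> M \<and> 0 \<le> g' x \<and> g' x \<le> M \<and> m \<le> max (f' x) (g' x)"
        and n1: "(\<integral>\<^sup>+ x. ennreal (f' x) \<partial>cubeM) = 1"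
        and i1: "(\<integral>x. f' x \<partial>cubeM) = 1" "(\<integral>x. g' x \<partial>cubeM) = 1"
        by (rule good_representatives[OF H(1,2,5,6)]) (rule that)
      have fm: "f \<in> borel_measurable cube_measure" and gm: "g \<in> borel_measurable cube_measure"
        using H(1,2) unfolding prob_density_def by blast+
      have f'c: "f' \<in> borel_measurable cube_measure" and g'c: "g' \<in> borel_measurable cube_measure"
        using f'm g'm by (simp_all add: measurable_restrict_space1)
      have W: "density_wasserstein p f g = density_wasserstein p f' g'"
        by (rule density_wasserstein_cong[OF fm gm f'c g'c aef aeg])
      have bdM: "\<forall>x\<in>cube. 0 \<le> f' x \<and> f' x \<le> M \<and> 0 \<le> g' x \<and> g' x \<le> M" using bd by simp
      have M: "0 < M"
      proof -
        have "(0 :: real ^ 'n) \<in> cube" by (simp add: mem_box_cart)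
        from bspec[OF bd this] show ?thesis using H(5) by (auto simp: max_def split: if_splits)
      qed
      define c where "c = coeff (\<lambda>x. f' x - g' x)"
      have wc: "wavelet_coeff (\<lambda>x. f x - g x) \<phi> = c \<phi>" if \<phi>: "\<phi> \<in> basis" for \<phi>
        unfolding c_def
      proof (rule wavelet_coeff_eq[OF borel_measurable_diff[OF fm gm] borel_measurable_diff[OF f'm g'm] _ \<phi>])
        show "AE x in cube_measure. f x - g x = f' x - g' x" using aef aeg by eventually_elim simp
      qed
      show ?case
      proof (rule conjI)
        define B where "B = besov_norm \<Phi> \<Psi> (- 1) (ennreal p) \<infinity> (\<lambda>x. f x - g x)"
        let ?\<mu> = "density cube_measure (\<lambda>x. ennreal (f' x))" and ?\<nu> = "density cube_measure (\<lambda>x. ennreal (g' x))"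
        let ?E = "\<lambda>\<pi>. \<integral>\<^sup>+ z. ennreal (dist (fst z) (snd z) powr p) \<partial>\<pi>"
        define X where "X = ennreal (1 / (2 * CL) * M powr (- (1 - 1 / p))) * B"
        \<comment> \<open>Powers are compared with the cost of each single coupling, and the infimum
          is taken afterwards; a coupling of infinite cost is trivial.\<close>
        have "epowr X p \<le> ?E \<pi>" if \<pi>: "\<pi> \<in> couplings ?\<mu> ?\<nu>" for \<pi>
        proof (cases "?E \<pi> = \<infinity>")
          case True
          then show ?thesis by (simp only: infinity_ennreal_def top_greatest)
        next
          case False
          define e where "e = enn2real (?E \<pi>)"
          have e: "?E \<pi> = ennreal e" "0 \<le> e" using False by (simp_all add: e_def less_top)
          have eb: "level_norm p c k \<le> CL * M powr (1 - 1 / p) * e powr (1 / p)" for k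
          proof (cases k)
            case 0
            have "level_norm p c 0 \<le> C0 * M powr (1 - 1 / p) * e powr (1 / p)"
              unfolding c_def
              by (rule L0[rule_format, OF M f'm g'm bspec[OF bdM] n1 \<pi> _ e(2)]) (simp_all only: e(1) order_refl)
            also have "\<dots> \<le> CL * M powr (1 - 1 / p) * e powr (1 / p)" using CL by (intro mult_right_mono) auto
            finally show ?thesis by (simp only: 0)
          next
            case (Suc j)
            have "level_norm p c (Suc j) \<le> C1 * M powr (1 - 1 / p) * e powr (1 / p)"
              unfolding c_def
              by (rule L1[rule_format, OF M f'm g'm bspec[OF bdM] n1 \<pi> _ e(2)]) (simp_all only: e(1) order_refl)
            also have "\<dots> \<le> CL * M powr (1 - 1 / p) * e powr (1 / p)" using CL by (intro mult_right_mono) auto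
            finally show ?thesis by (simp only: Suc)
          qed
          have "B \<le> ennreal (2 * (CL * M powr (1 - 1 / p) * e powr (1 / p)))"
            unfolding B_def by (rule besov_norm_infinity_le[OF p _ eb]) (rule wc)
          from ennreal_rescale_le[OF CL(1) M powr_ge_zero this]
          have "X \<le> ennreal (e powr (1 / p))" unfolding X_def .
          then have "epowr X p \<le> epowr (ennreal (e powr (1 / p))) p" using p by (intro epowr_mono) auto
          also have "\<dots> = ennreal e" using p e(2) by (simp add: epowr_ennreal powr_powr)
          finally show ?thesis by (simp only: e(1))
        qed
        then have "epowr X p \<le> (INF \<pi>\<in>couplings ?\<mu> ?\<nu>. ?E \<pi>)" by (rule INF_greatest)
        then have "epowr (epowr X p) (1 / p) \<le> density_wasserstein p f' g'"
          unfolding density_wasserstein_def wasserstein_def using p by (intro epowr_mono) auto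
        then have "X \<le> density_wasserstein p f' g'" using p by (subst (asm) epowr_epowr) auto
        then show "ennreal (1 / (2 * CL) * M powr - enn2real (1 / p')) *
            besov_norm \<Phi> \<Psi> (- 1) (ennreal p) \<infinity> (\<lambda>x. f x - g x) \<le> density_wasserstein p f g"
          unfolding X_def B_def W \<gamma> .
      next
        define B where "B = besov_norm \<Phi> \<Psi> (- 1) (ennreal p) 1 (\<lambda>x. f x - g x)"
        define K where "K = CU * m powr (- (1 - 1 / p))"
        have K: "0 < K" using CU H(5) by (simp add: K_def)
        have "density_wasserstein p f' g' \<le> ennreal K * B"
        proof (cases "B = \<infinity>")
          case True
          have "ennreal K * B = top" unfolding True using K by (simp add: ennreal_mult_top)
          then show ?thesis by (simp only: top_greatest)
        next
          case False
          define N where "N = enn2real B"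
          have N: "B = ennreal N" "0 \<le> N" using False by (simp_all add: N_def less_top)
          \<comment> \<open>The transport from \<open>f'\<close> to \<open>g'\<close> is driven by
            \<open>g' - f'\<close>; the change of sign leaves all level norms as they are.\<close>
          have c': "level_norm p (coeff (\<lambda>x. g' x - f' x)) k = level_norm p c k" for k
          proof -
            have "coeff (\<lambda>x. g' x - f' x) \<phi> = - c \<phi>" for \<phi>
            proof -
              have "coeff (\<lambda>x. g' x - f' x) \<phi> = (\<integral>x. - ((f' x - g' x) * ext \<phi> x) \<partial>cubeM)"
                unfolding coeff_def by (intro Bochner_Integration.integral_cong) (simp_all add: algebra_simps)
              then show ?thesis by (simp add: c_def coeff_def)
            qed
            then have "coeff (\<lambda>x. g' x - f' x) = (\<lambda>\<phi>. - c \<phi>)" by (rule ext)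
            then show ?thesis by (cases k) (simp_all add: level_norm_def lp_norm_def)
          qed
          have sumN: "\<forall>J. (\<Sum>k<Suc J. level_norm p (coeff (\<lambda>x. g' x - f' x)) k) \<le> N"
            unfolding c' by (rule allI, rule sum_level_norm_le_besov[OF p _ N[unfolded B_def]]) (rule wc)
          have tr: "transport p (K * N + \<epsilon>) (dens f') (dens g')" if "0 < \<epsilon>" for \<epsilon>
            unfolding K_def
            by (rule up[rule_format, OF f'm g'm H(5) that bspec[OF bd] i1 spec[OF sumN]])
          \<comment> \<open>The slack \<open>\<epsilon>\<close> of the constructed transports is
            arbitrary and disappears in the limit.\<close>
          have "density_wasserstein p f' g' \<le> ennreal (K * N)"
          proof (rule ennreal_le_epsilon)
            fix \<epsilon> :: real assume \<epsilon>: "0 < \<epsilon>"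
            have "density_wasserstein p f' g' \<le> ennreal (K * N + \<epsilon>)"
              using K N(2) \<epsilon> by (intro wasserstein_le_transport[OF p _ f'm g'm tr]) auto
            then show "density_wasserstein p f' g' \<le> ennreal (K * N) + ennreal \<epsilon>"
              using K N(2) \<epsilon> by simp
          qed
          then show ?thesis unfolding N(1) using K N(2) by (simp add: ennreal_mult)
        qed
        then show "density_wasserstein p f g \<le> ennreal (CU * m powr - enn2real (1 / p')) *
            besov_norm \<Phi> \<Psi> (- 1) (ennreal p) 1 (\<lambda>x. f x - g x)"
          unfolding K_def B_def W \<gamma> .
      qed
    qed
  qed
qed

end
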